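(* There exists a constant $c>0$ such that for every nuclear charge $Z>0$ and every field strength $B>0$ the following holds: if for some integer $N\ge 1$ the operator $h(N,Z,B^{-1/2})$ has a bound state, then $$N < 2Z+1+c\sqrt{B}.$$ Equivalently, the maximum number $N_{\max}$ of electrons for which $h(N,Z,B^{-1/2})$ has a bound state satisfies $N_{\max} < 2Z+1+c\sqrt{B}$.
   Context: Let $V_0:\mathbb{R}\to(0,\infty)$ be the regularized Coulomb potential $$V_0(x)=\int_0^\infty \frac{e^{-u}}{\sqrt{x^2+u}}\,du = 2e^{x^2}\int_{|x|}^\infty e^{-t^2}\,dt .$$ For an integer $N\ge1$, $Z>0$ and a "mass" $M>0$, let $h(N,Z,M)$ be the self-adjoint operator on $L^2(\mathbb{R}^N)$ (no permutational symmetry imposed) $$h(N,Z,M)=\sum_{j=1}^N\Big[-\frac{1}{M}\frac{d^2}{dx_j^2}-Z\,V_0(x_j)\Big]+\sum_{1\le j<k\le N}\frac{1}{\sqrt2}\,V_0\Big(\frac{|x_j-x_k|}{\sqrt2}\Big).$$ With $M=B^{-1/2}$ the kinetic term is $-\sqrt{B}\sum_j d^2/dx_j^2$. Let $E_0(N,Z,M)=\inf\operatorname{spec} h(N,Z,M)$, with the convention $E_0(0,Z,M)=0$. The operator $h(N,Z,M)$ is said to have a bound state if it has an eigenvalue $E$ (with a normalizable eigenfunction) satisfying $E<E_0(N-1,Z,M)$, the latter being the bottom of the continuous spectrum. The constant $c$ is independent of $N$, $Z$ and $B$. *)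

theory Defs
  imports "HOL-Analysis.Analysis"
begin

definition V0 :: "real \<Rightarrow> real" where
  "V0 x = (LBINT u:{0<..}. exp (- u) / sqrt (x\<^sup>2 + u))"

definition configM :: "nat \<Rightarrow> (nat \<Rightarrow> real) measure" where
  "configM N = PiM {..<N} (\<lambda>_. lborel)"

definition Wpot :: "nat \<Rightarrow> real \<Rightarrow> (nat \<Rightarrow> real) \<Rightarrow> real" where
  "Wpot N Z x =
     (\<Sum>j<N. - Z * V0 (x j))
   + (\<Sum>j<N. \<Sum>k\<in>{j<..<N}. (1 / sqrt 2) * V0 (\<bar>x j - x k\<bar> / sqrt 2))"

definition pd :: "nat \<Rightarrow> ((nat \<Rightarrow> real) \<Rightarrow> real) \<Rightarrow> (nat \<Rightarrow> real) \<Rightarrow> real" where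
  "pd j \<phi> x = deriv (\<lambda>t. \<phi> (x(j := t))) (x j)"

definition iter_pd :: "nat list \<Rightarrow> ((nat \<Rightarrow> real) \<Rightarrow> real) \<Rightarrow> (nat \<Rightarrow> real) \<Rightarrow> real" where
  "iter_pd js \<phi> = foldr pd js \<phi>"

definition test_fun :: "nat \<Rightarrow> ((nat \<Rightarrow> real) \<Rightarrow> real) \<Rightarrow> bool" where
  "test_fun N \<phi> \<longleftrightarrow>
     (\<forall>x. \<phi> x = \<phi> (restrict x {..<N}))
   \<and> (\<exists>R. \<forall>x. (\<exists>j<N. \<bar>x j\<bar> > R) \<longrightarrow> \<phi> x = 0)
   \<and> (\<forall>js. set js \<subseteq> {..<N} \<longrightarrow>
         continuous_on (PiE {..<N} (\<lambda>_. UNIV)) (iter_pd js \<phi>)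
       \<and> (\<forall>j<N. \<forall>x. (\<lambda>t. iter_pd js \<phi> (x(j := t))) differentiable (at (x j))))"

definition L2 :: "nat \<Rightarrow> ((nat \<Rightarrow> real) \<Rightarrow> complex) set" where
  "L2 N = {f. f \<in> borel_measurable (configM N) \<and> integrable (configM N) (\<lambda>x. (cmod (f x))\<^sup>2)}"

text \<open>h(N,Z,M) psi = f, with psi in the (self-adjoint) domain H^2(R^N): since the
  potential is bounded, h is -(1/M) Laplacian + W on H^2, i.e. the maximal
  operator defined distributionally: psi, f in L^2 and
  int psi ( -(1/M) Laplace phi + W phi ) = int f phi for all test functions phi.\<close>

definition h_op :: "nat \<Rightarrow> real \<Rightarrow> real \<Rightarrow> ((nat \<Rightarrow> real) \<Rightarrow> complex) \<Rightarrow> ((nat \<Rightarrow> real) \<Rightarrow> complex) \<Rightarrow> bool" where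
  "h_op N Z M \<psi> f \<longleftrightarrow> \<psi> \<in> L2 N \<and> f \<in> L2 N \<and>
     (\<forall>\<phi>. test_fun N \<phi> \<longrightarrow>
        (\<integral>x. \<psi> x * complex_of_real (- (1 / M) * (\<Sum>j<N. iter_pd [j, j] \<phi> x) + Wpot N Z x * \<phi> x)
           \<partial>configM N)
        = (\<integral>x. f x * complex_of_real (\<phi> x) \<partial>configM N))"

definition ae_zero :: "nat \<Rightarrow> ((nat \<Rightarrow> real) \<Rightarrow> complex) \<Rightarrow> bool" where
  "ae_zero N \<psi> \<longleftrightarrow> (AE x in configM N. \<psi> x = 0)"

definition is_eigenvalue :: "nat \<Rightarrow> real \<Rightarrow> real \<Rightarrow> real \<Rightarrow> bool" where
  "is_eigenvalue N Z M E \<longleftrightarrow>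
     (\<exists>\<psi>. \<not> ae_zero N \<psi> \<and> h_op N Z M \<psi> (\<lambda>x. complex_of_real E * \<psi> x))"

text \<open>Spectrum: E is in the spectrum iff h - E : dom h -> L^2 is not bijective
  (for the closed operator h this is the usual definition; bounded inverse is automatic).\<close>

definition spectrum_h :: "nat \<Rightarrow> real \<Rightarrow> real \<Rightarrow> complex set" where
  "spectrum_h N Z M = {z. \<not> (
      (\<forall>f\<in>L2 N. \<exists>\<psi>. h_op N Z M \<psi> (\<lambda>x. f x + z * \<psi> x))
    \<and> (\<forall>\<psi>. h_op N Z M \<psi> (\<lambda>x. z * \<psi> x) \<longrightarrow> ae_zero N \<psi>))}"

text \<open>E_0(N,Z,M) = inf spec h(N,Z,M) (spectrum is real: h is self-adjoint),
  with the convention E_0(0,Z,M) = 0.\<close>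

definition E0 :: "nat \<Rightarrow> real \<Rightarrow> real \<Rightarrow> real" where
  "E0 N Z M = (if N = 0 then 0 else Inf (Re ` spectrum_h N Z M))"

definition has_bound_state :: "nat \<Rightarrow> real \<Rightarrow> real \<Rightarrow> bool" where
  "has_bound_state N Z M \<longleftrightarrow> (\<exists>E. is_eigenvalue N Z M E \<and> E < E0 (N - 1) Z M)"

end

theory Submission
  imports Defs "HOL-Probability.Distributions" "HOL-Computational_Algebra.Polynomial" "HOL-Real_Asymp.Real_Asymp"
begin

text \<open>
  Multiply the eigenvalue equation by \<open>g(x\<^sub>j) \<psi>\<close>, where \<open>g > 0\<close> satisfies \<open>g V\<^sub>0 \<le> 1\<close> and
  \<open>(g(x) + g(y)) V\<^sub>0(|x - y|/\<surd>2)/\<surd>2 \<ge> 1\<close>, and sum over \<open>j\<close>. The electrons other than \<open>j\<close>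
  contribute at least \<open>E\<^sub>0(N-1) > E\<close>; the potentials acting on electron \<open>j\<close> contribute at least
  \<open>N(N-1)/2 - Z N\<close> in total; and by the IMS identity the price for the weight is
  \<open>N/M\<close> times \<open>sup ((\<surd>g)')\<^sup>2\<close>, a constant. Dividing by \<open>N/2\<close> gives the bound.

  Weak solutions are approximated by mollification followed by a cutoff, along which the energy form
  converges. The form bound of \<open>h(N-1)\<close> is shown to be a lower bound of the spectrum (least squares
  on the range of \<open>h - z\<close>) and to belong to it (otherwise \<open>h - z\<close> would be onto, which a gliding
  hump argument excludes), so that it dominates \<open>E\<^sub>0(N-1)\<close>.
\<close>

subsection \<open>Square-integrable functions\<close>

text \<open>The two demands on the weight pull in opposite directions; for an even convex weight the
  second reduces to \<open>y = -x\<close>. \<open>V0\<close> is traded for algebraic bounds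
  \<open>2 / (|x| + sqrt (x^2 + b))\<close>, with \<open>b = 2\<close> from below and
  \<open>b = 5/4\<close> from above, and the gap between them leaves room to round off the kink at
  0. The obstacle is the spectrum, which is given only as failure of bijectivity of a distributional
  operator. All that is wanted of it is that \<open>E0\<close> is at most the best form bound; as
  \<open>E0\<close> is an \<open>Inf\<close> of reals, this takes both membership of that bound in
  the set of real parts and a lower bound for the set, nonreal points of the spectrum included. No
  regularity of eigenfunctions is established: a mollified solution satisfies a classical equation
  whose right-hand side converges in L2, because the potential is bounded. Strictness comes from
  \<open>E < E0\<close> together with a weight bounded away from 0. The constant is
  \<open>c = 2\<close>: the squared derivative of \<open>sqrt_weight\<close> is at most 1/2, this is
  doubled when the cutoff is separated from the weight, and doubled again on division by
  \<open>N/2\<close>.\<close>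

definition sq_int :: "'a measure \<Rightarrow> ('a \<Rightarrow> 'b::euclidean_space) \<Rightarrow> bool" where
  "sq_int M f \<longleftrightarrow> f \<in> borel_measurable M \<and> integrable M (\<lambda>x. (norm (f x))\<^sup>2)"

text \<open>For complex values the euclidean inner product is \<open>Re (f * cnj g)\<close>. The
  pairing is thus real and symmetric, and one theory serves real functions as well as pairs of real
  and imaginary parts.\<close>

definition l2_inner :: "'a measure \<Rightarrow> ('a \<Rightarrow> 'b::euclidean_space) \<Rightarrow> ('a \<Rightarrow> 'b) \<Rightarrow> real" where
  "l2_inner M f g = (\<integral>x. f x \<bullet> g x \<partial>M)"

definition l2_norm :: "'a measure \<Rightarrow> ('a \<Rightarrow> 'b::euclidean_space) \<Rightarrow> real" where
  "l2_norm M f = sqrt (l2_inner M f f)"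

definition l2_conv :: "'a measure \<Rightarrow> (nat \<Rightarrow> 'a \<Rightarrow> 'b::euclidean_space) \<Rightarrow> ('a \<Rightarrow> 'b) \<Rightarrow> bool" where
  "l2_conv M F f \<longleftrightarrow> (\<lambda>k. l2_norm M (\<lambda>x. F k x - f x)) \<longlonglongrightarrow> 0"

lemma sq_int_measurable[measurable_dest]: "sq_int M f \<Longrightarrow> f \<in> borel_measurable M"
  by (simp add: sq_int_def)

lemma sq_int_inner_integrable:
  assumes "sq_int M f" "sq_int M g"
  shows "integrable M (\<lambda>x. f x \<bullet> g x)"
proof (rule Bochner_Integration.integrable_bound)
  show "integrable M (\<lambda>x. (norm (f x))\<^sup>2 + (norm (g x))\<^sup>2)"
    using assms by (auto simp: sq_int_def)
  show "(\<lambda>x. f x \<bullet> g x) \<in> borel_measurable M"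
    using assms by (auto simp: sq_int_def)
  have "norm (f x \<bullet> g x) \<le> norm ((norm (f x))\<^sup>2 + (norm (g x))\<^sup>2)" for x
  proof -
    have "norm (f x \<bullet> g x) \<le> norm (f x) * norm (g x)"
      by (simp add: Cauchy_Schwarz_ineq2)
    also have "\<dots> \<le> (norm (f x))\<^sup>2 + (norm (g x))\<^sup>2"
      using sum_squares_bound[of "norm (f x)" "norm (g x)"]
        mult_nonneg_nonneg[OF norm_ge_zero norm_ge_zero, of "f x" "g x"] by linarith
    finally show ?thesis by simp
  qed
  then show "AE x in M. norm (f x \<bullet> g x) \<le> norm ((norm (f x))\<^sup>2 + (norm (g x))\<^sup>2)" by simp
qed

lemma sq_int_real_mult_integrable:
  fixes f g :: "'a \<Rightarrow> real"
  assumes "sq_int M f" "sq_int M g"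
  shows "integrable M (\<lambda>x. f x * g x)"
  using sq_int_inner_integrable[OF assms] by simp

lemma sq_int_bound:
  assumes "sq_int M f" "g \<in> borel_measurable M" "\<And>x. x \<in> space M \<Longrightarrow> norm (g x) \<le> C * norm (f x)"
  shows "sq_int M g"
  unfolding sq_int_def
proof
  show "integrable M (\<lambda>x. (norm (g x))\<^sup>2)"
  proof (rule Bochner_Integration.integrable_bound)
    show "integrable M (\<lambda>x. C\<^sup>2 * (norm (f x))\<^sup>2)"
      using assms(1) by (auto simp: sq_int_def)
    show "(\<lambda>x. (norm (g x))\<^sup>2) \<in> borel_measurable M"
      using assms(2) by simp
    show "AE x in M. norm ((norm (g x))\<^sup>2) \<le> norm (C\<^sup>2 * (norm (f x))\<^sup>2)"
    proof (rule AE_I2)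
      fix x assume "x \<in> space M"
      then have "(norm (g x))\<^sup>2 \<le> (C * norm (f x))\<^sup>2" by (intro power_mono assms(3)) auto
      then show "norm ((norm (g x))\<^sup>2) \<le> norm (C\<^sup>2 * (norm (f x))\<^sup>2)"
        by (simp add: power_mult_distrib)
    qed
  qed
qed (fact assms(2))

lemma sq_int_add:
  assumes "sq_int M f" "sq_int M g"
  shows "sq_int M (\<lambda>x. f x + g x)"
  unfolding sq_int_def
proof
  have "(\<lambda>x. (norm (f x + g x))\<^sup>2) = (\<lambda>x. (norm (f x))\<^sup>2 + (2 * (f x \<bullet> g x) + (norm (g x))\<^sup>2))"
    by (auto simp: power2_norm_eq_inner inner_simps inner_commute fun_eq_iff)
  then show "integrable M (\<lambda>x. (norm (f x + g x))\<^sup>2)"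
    using assms sq_int_inner_integrable[OF assms] by (auto simp: sq_int_def)
qed (use assms in \<open>auto simp: sq_int_def\<close>)

lemma sq_int_scaleR:
  assumes "sq_int M f"
  shows "sq_int M (\<lambda>x. c *\<^sub>R f x)"
  by (rule sq_int_bound[OF assms, where C = "\<bar>c\<bar>"]) (use assms in \<open>auto simp: sq_int_def\<close>)

lemma sq_int_cmult:
  fixes f :: "'a \<Rightarrow> real"
  assumes "sq_int M f"
  shows "sq_int M (\<lambda>x. c * f x)"
  using sq_int_scaleR[OF assms, of c] by simp

lemma sq_int_uminus: "sq_int M f \<Longrightarrow> sq_int M (\<lambda>x. - f x)"
  using sq_int_scaleR[of M f "-1"] by simp

lemma sq_int_diff:
  assumes "sq_int M f" "sq_int M g"
  shows "sq_int M (\<lambda>x. f x - g x)"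
  using sq_int_add[OF assms(1) sq_int_uminus[OF assms(2)]] by simp

lemma sq_int_zero: "sq_int M (\<lambda>x. 0)"
  by (simp add: sq_int_def)

lemma sq_int_mult_bounded:
  fixes f :: "'a \<Rightarrow> real"
  assumes "sq_int M f" "a \<in> borel_measurable M" "\<And>x. x \<in> space M \<Longrightarrow> \<bar>a x\<bar> \<le> C"
  shows "sq_int M (\<lambda>x. a x * f x)"
  by (rule sq_int_bound[OF assms(1), where C = C])
    (use assms in \<open>auto simp: sq_int_def abs_mult mult_right_mono\<close>)

lemmas sq_int_intros = sq_int_add sq_int_diff sq_int_scaleR sq_int_cmult sq_int_uminus sq_int_zero

lemma l2_inner_commute: "l2_inner M f g = l2_inner M g f"
  by (simp add: l2_inner_def inner_commute)

lemma l2_inner_add_left: "sq_int M f \<Longrightarrow> sq_int M g \<Longrightarrow> sq_int M h \<Longrightarrow>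
    l2_inner M (\<lambda>x. f x + g x) h = l2_inner M f h + l2_inner M g h"
  by (simp add: l2_inner_def inner_simps sq_int_inner_integrable)

lemma l2_inner_diff_left: "sq_int M f \<Longrightarrow> sq_int M g \<Longrightarrow> sq_int M h \<Longrightarrow>
    l2_inner M (\<lambda>x. f x - g x) h = l2_inner M f h - l2_inner M g h"
  by (simp add: l2_inner_def inner_simps sq_int_inner_integrable)

lemma l2_inner_scale_left: "l2_inner M (\<lambda>x. c *\<^sub>R f x) h = c * l2_inner M f h"
  by (simp add: l2_inner_def inner_simps)

lemma l2_inner_add_right: "sq_int M f \<Longrightarrow> sq_int M g \<Longrightarrow> sq_int M h \<Longrightarrow>
    l2_inner M h (\<lambda>x. f x + g x) = l2_inner M h f + l2_inner M h g"
  by (simp add: l2_inner_def inner_simps sq_int_inner_integrable)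

lemma l2_inner_diff_right: "sq_int M f \<Longrightarrow> sq_int M g \<Longrightarrow> sq_int M h \<Longrightarrow>
    l2_inner M h (\<lambda>x. f x - g x) = l2_inner M h f - l2_inner M h g"
  by (simp add: l2_inner_def inner_simps sq_int_inner_integrable)

lemma l2_inner_scale_right: "l2_inner M h (\<lambda>x. c *\<^sub>R f x) = c * l2_inner M h f"
  by (simp add: l2_inner_def inner_simps)

lemmas l2_inner_simps = l2_inner_add_left l2_inner_diff_left l2_inner_scale_left
  l2_inner_add_right l2_inner_diff_right l2_inner_scale_right

lemma l2_inner_ge0: "0 \<le> l2_inner M f f"
  by (simp add: l2_inner_def)

lemma l2_norm_ge0: "0 \<le> l2_norm M f"
  by (simp add: l2_norm_def l2_inner_ge0)

lemma l2_norm_sq: "(l2_norm M f)\<^sup>2 = l2_inner M f f"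
  by (simp add: l2_norm_def l2_inner_ge0)

text \<open>A nonnegative affine function is constant, which settles \<open>c = 0\<close>; a
  negative \<open>c\<close> is refuted at a large \<open>t\<close>, and a positive \<open>c\<close>
  is tested at the vertex of the parabola.\<close>

lemma quadratic_nonneg_imp_discr:
  fixes a b c :: real
  assumes "\<And>t. 0 \<le> a + 2 * b * t + c * t\<^sup>2"
  shows "b\<^sup>2 \<le> a * c"
proof (cases "c = 0")
  case True
  have "b = 0"
  proof (rule ccontr)
    assume b: "b \<noteq> 0"
    have "0 \<le> a + 2 * b * (- (a + 1) / (2 * b)) + c * (- (a + 1) / (2 * b))\<^sup>2"
      by (rule assms)
    then show False using True b by (simp add: field_simps)
  qed
  then show ?thesis using True by simp
next
  case False
  have "c > 0"
  proof (rule ccontr)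
    assume "\<not> 0 < c"
    with False have c: "c < 0" by simp
    \<comment> \<open>Chosen so that \<open>- c * t\<close> exceeds \<open>|a| + 2 |b|\<close> by
      exactly \<open>- c\<close>; as \<open>t >= 1\<close>, the quadratic is then at most
      \<open>t * c\<close>, which is negative.\<close>
    define t where "t = 1 + (\<bar>a\<bar> + 2 * \<bar>b\<bar>) / (- c)"
    have t1: "t \<ge> 1" using c by (simp add: t_def divide_nonneg_neg)
    have ct: "- c * t = - c + \<bar>a\<bar> + 2 * \<bar>b\<bar>" using c by (simp add: t_def field_simps)
    have "a + 2 * b * t + c * t\<^sup>2 \<le> \<bar>a\<bar> * t + 2 * \<bar>b\<bar> * t + c * t\<^sup>2"
    proof -
      have "a \<le> \<bar>a\<bar> * t" using mult_left_mono[OF t1, of "\<bar>a\<bar>"] by simp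
      moreover have "b * t \<le> \<bar>b\<bar> * t" using t1 by (intro mult_right_mono) auto
      ultimately show ?thesis by simp
    qed
    also have "\<dots> = t * (\<bar>a\<bar> + 2 * \<bar>b\<bar> - (- c * t))" by (simp add: power2_eq_square algebra_simps)
    also have "\<dots> = t * c" by (simp only: ct) simp
    also have "\<dots> < 0" using t1 c by (simp add: mult_pos_neg)
    finally show False using assms[of t] by simp
  qed
  have "0 \<le> a + 2 * b * (- b / c) + c * (- b / c)\<^sup>2" by (rule assms)
  also have "\<dots> = a - b\<^sup>2 / c" using \<open>c > 0\<close> by (simp add: power2_eq_square field_simps)
  finally show ?thesis using \<open>c > 0\<close> by (simp add: field_simps)
qed

lemma l2_inner_square_add:
  assumes "sq_int M f" "sq_int M g"
  shows "l2_inner M (\<lambda>x. f x + t *\<^sub>R g x) (\<lambda>x. f x + t *\<^sub>R g x)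
    = l2_inner M f f + 2 * l2_inner M f g * t + l2_inner M g g * t\<^sup>2"
  using assms by (simp add: l2_inner_simps sq_int_intros l2_inner_commute[of M g f] power2_eq_square algebra_simps)

lemma l2_inner_CS_sq:
  assumes "sq_int M f" "sq_int M g"
  shows "(l2_inner M f g)\<^sup>2 \<le> l2_inner M f f * l2_inner M g g"
proof (rule quadratic_nonneg_imp_discr)
  fix t
  show "0 \<le> l2_inner M f f + 2 * l2_inner M f g * t + l2_inner M g g * t\<^sup>2"
    unfolding l2_inner_square_add[OF assms, symmetric] by (rule l2_inner_ge0)
qed

lemma l2_inner_CS:
  assumes "sq_int M f" "sq_int M g"
  shows "\<bar>l2_inner M f g\<bar> \<le> l2_norm M f * l2_norm M g"
proof (rule power2_le_imp_le)
  show "\<bar>l2_inner M f g\<bar>\<^sup>2 \<le> (l2_norm M f * l2_norm M g)\<^sup>2"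
    using l2_inner_CS_sq[OF assms] by (simp only: power_mult_distrib l2_norm_sq power2_abs)
qed (simp add: l2_norm_ge0)

lemma l2_norm_triangle:
  assumes "sq_int M f" "sq_int M g"
  shows "l2_norm M (\<lambda>x. f x + g x) \<le> l2_norm M f + l2_norm M g"
proof (rule power2_le_imp_le)
  have "(l2_norm M (\<lambda>x. f x + g x))\<^sup>2 = (l2_norm M f)\<^sup>2 + 2 * l2_inner M f g + (l2_norm M g)\<^sup>2"
    using l2_inner_square_add[OF assms, of 1] by (simp add: l2_norm_sq)
  also have "\<dots> \<le> (l2_norm M f + l2_norm M g)\<^sup>2"
    using l2_inner_CS[OF assms] by (simp add: power2_sum)
  finally show "(l2_norm M (\<lambda>x. f x + g x))\<^sup>2 \<le> (l2_norm M f + l2_norm M g)\<^sup>2" .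
qed (simp add: l2_norm_ge0)

lemma l2_norm_scale: "l2_norm M (\<lambda>x. c *\<^sub>R f x) = \<bar>c\<bar> * l2_norm M f"
proof -
  have "l2_norm M (\<lambda>x. c *\<^sub>R f x) = sqrt (c * c * l2_inner M f f)"
    by (simp add: l2_norm_def l2_inner_simps mult.assoc)
  then show ?thesis by (simp add: l2_norm_def real_sqrt_mult)
qed

lemma l2_norm_minus_commute: "l2_norm M (\<lambda>x. f x - g x) = l2_norm M (\<lambda>x. g x - f x)"
  using l2_norm_scale[of M "-1" "\<lambda>x. f x - g x"] by simp

lemma l2_norm_triangle_diff:
  assumes "sq_int M f" "sq_int M g" "sq_int M h"
  shows "l2_norm M (\<lambda>x. f x - h x) \<le> l2_norm M (\<lambda>x. f x - g x) + l2_norm M (\<lambda>x. g x - h x)"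
  using l2_norm_triangle[OF sq_int_diff[OF assms(1,2)] sq_int_diff[OF assms(2,3)]] by simp

lemma l2_norm_mono:
  assumes "sq_int M f" "sq_int M g" "\<And>x. x \<in> space M \<Longrightarrow> norm (g x) \<le> C * norm (f x)" "C \<ge> 0"
  shows "l2_norm M g \<le> C * l2_norm M f"
proof -
  have "l2_inner M g g \<le> (\<integral>x. C\<^sup>2 * (f x \<bullet> f x) \<partial>M)"
    unfolding l2_inner_def
  proof (rule integral_mono)
    fix x assume "x \<in> space M"
    then have "(norm (g x))\<^sup>2 \<le> (C * norm (f x))\<^sup>2"
      by (intro power_mono assms) auto
    then show "g x \<bullet> g x \<le> C\<^sup>2 * (f x \<bullet> f x)"
      by (simp add: power2_norm_eq_inner power_mult_distrib)
  qed (use assms sq_int_inner_integrable in auto)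
  also have "\<dots> = C\<^sup>2 * l2_inner M f f" by (simp add: l2_inner_def)
  finally have "l2_norm M g \<le> sqrt (C\<^sup>2 * l2_inner M f f)" by (simp add: l2_norm_def)
  also have "\<dots> = C * l2_norm M f" using \<open>C \<ge> 0\<close> by (simp add: l2_norm_def real_sqrt_mult)
  finally show ?thesis .
qed

lemma l2_conv_ip:
  assumes "l2_conv M F f" "\<And>k. sq_int M (F k)" "sq_int M f" "sq_int M g"
  shows "(\<lambda>k. l2_inner M (F k) g) \<longlonglongrightarrow> l2_inner M f g"
proof -
  have "(\<lambda>k. l2_inner M (F k) g - l2_inner M f g) \<longlonglongrightarrow> 0"
  proof (rule Lim_null_comparison)
    show "\<forall>\<^sub>F k in sequentially. norm (l2_inner M (F k) g - l2_inner M f g) \<le> l2_norm M (\<lambda>x. F k x - f x) * l2_norm M g"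
      using l2_inner_CS[OF sq_int_diff[OF assms(2) assms(3)] assms(4)] assms
      by (simp add: l2_inner_simps)
    show "(\<lambda>k. l2_norm M (\<lambda>x. F k x - f x) * l2_norm M g) \<longlonglongrightarrow> 0"
      using assms(1) unfolding l2_conv_def by (rule tendsto_mult_left_zero)
  qed
  then show ?thesis by (rule LIM_zero_cancel)
qed

lemma l2_conv_ip2:
  assumes "l2_conv M F f" "\<And>k. sq_int M (F k)" "sq_int M f"
    and "l2_conv M G g" "\<And>k. sq_int M (G k)" "sq_int M g"
  shows "(\<lambda>k. l2_inner M (F k) (G k)) \<longlonglongrightarrow> l2_inner M f g"
proof -
  have *: "(\<lambda>k. l2_norm M (\<lambda>x. F k x - f x) * l2_norm M (\<lambda>x. G k x - g x)) \<longlonglongrightarrow> 0"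
    using tendsto_mult[OF assms(1)[unfolded l2_conv_def] assms(4)[unfolded l2_conv_def]] by simp
  have **: "(\<lambda>k. l2_inner M (\<lambda>x. F k x - f x) (\<lambda>x. G k x - g x)) \<longlonglongrightarrow> 0"
    by (rule Lim_null_comparison[OF _ *])
      (use l2_inner_CS[OF sq_int_diff[OF assms(2,3)] sq_int_diff[OF assms(5,6)]] in simp)
  have "(\<lambda>k. l2_inner M (\<lambda>x. F k x - f x) (\<lambda>x. G k x - g x) + l2_inner M (F k) g + l2_inner M (G k) f - l2_inner M f g)
     \<longlonglongrightarrow> 0 + l2_inner M f g + l2_inner M g f - l2_inner M f g"
    by (intro tendsto_intros ** l2_conv_ip assms)
  moreover have "l2_inner M (\<lambda>x. F k x - f x) (\<lambda>x. G k x - g x) + l2_inner M (F k) g + l2_inner M (G k) f - l2_inner M f g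
     = l2_inner M (F k) (G k)" for k
    using assms by (simp add: l2_inner_simps sq_int_intros l2_inner_commute[of M f])
  ultimately show ?thesis by (simp add: l2_inner_commute[of M g f])
qed

lemma l2_conv_mult_bounded:
  fixes f :: "'a \<Rightarrow> real"
  assumes "l2_conv M F f" "\<And>k. sq_int M (F k)" "sq_int M f"
    and "a \<in> borel_measurable M" "\<And>x. x \<in> space M \<Longrightarrow> \<bar>a x\<bar> \<le> C" "C \<ge> 0"
  shows "l2_conv M (\<lambda>k x. a x * F k x) (\<lambda>x. a x * f x)"
  unfolding l2_conv_def
proof (rule Lim_null_comparison)
  show "(\<lambda>k. C * l2_norm M (\<lambda>x. F k x - f x)) \<longlonglongrightarrow> 0"
    using assms(1)[unfolded l2_conv_def] by (rule tendsto_mult_right_zero)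
  have "l2_norm M (\<lambda>x. a x * F k x - a x * f x) \<le> C * l2_norm M (\<lambda>x. F k x - f x)" for k
    using assms
    by (intro l2_norm_mono) (auto intro!: sq_int_diff sq_int_mult_bounded[where C = C]
        simp: abs_mult mult_right_mono simp flip: right_diff_distrib)
  then show "\<forall>\<^sub>F k in sequentially. norm (l2_norm M (\<lambda>x. a x * F k x - a x * f x)) \<le> C * l2_norm M (\<lambda>x. F k x - f x)"
    by (simp add: l2_norm_ge0)
qed

section \<open>Completeness and orthogonal projection\<close>

lemma sq_int_nn_integral:
  assumes "f \<in> borel_measurable M"
  shows "sq_int M f \<longleftrightarrow> (\<integral>\<^sup>+x. ennreal ((norm (f x))\<^sup>2) \<partial>M) < \<infinity>"
  using assms by (auto simp: sq_int_def integrable_iff_bounded)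

lemma l2_norm_nn_integral:
  assumes "sq_int M f"
  shows "ennreal ((l2_norm M f)\<^sup>2) = (\<integral>\<^sup>+x. ennreal ((norm (f x))\<^sup>2) \<partial>M)"
  unfolding l2_norm_sq l2_inner_def
  using assms by (subst nn_integral_eq_integral) (auto simp: sq_int_def power2_norm_eq_inner)

text \<open>Riesz-Fischer: along a subsequence whose increments have norm below \<open>4^-k\<close>
  the functions converge almost everywhere, and Fatou's lemma turns the Cauchy bound into a bound on
  the distance to the pointwise limit.\<close>

lemma l2_complete:
  fixes F :: "nat \<Rightarrow> 'a \<Rightarrow> 'b::euclidean_space"
  assumes F: "\<And>k. sq_int M (F k)"
    and Cauchy: "\<And>e. e > 0 \<Longrightarrow> \<exists>n0. \<forall>m\<ge>n0. \<forall>n\<ge>n0. l2_norm M (\<lambda>x. F m x - F n x) < e"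
  shows "\<exists>f. sq_int M f \<and> l2_conv M F f"
proof -
  have [measurable]: "F k \<in> borel_measurable M" for k using F by (simp add: sq_int_def)
  have "\<exists>n0. \<forall>m\<ge>n0. \<forall>n\<ge>n0. l2_norm M (\<lambda>x. F m x - F n x) < (1/2)^(2*k)" for k
    by (rule Cauchy) simp
  then obtain n0 where n0: "\<And>k m n. m \<ge> n0 k \<Longrightarrow> n \<ge> n0 k \<Longrightarrow> l2_norm M (\<lambda>x. F m x - F n x) < (1/2)^(2*k)"
    by metis
  \<comment> \<open>The partial sums make \<open>r\<close> monotone and at least \<open>n0 k\<close>
    at once; the summand \<open>k\<close> makes it tend to infinity.\<close>
  define r where "r k = (\<Sum>i\<le>k. n0 i) + k" for k
  have r_ge: "r k \<ge> n0 k" for k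
    by (auto simp: r_def intro: trans_le_add1 member_le_sum)
  have r_mono: "r k \<le> r (Suc k)" for k by (simp add: r_def)
  have r_k: "r k \<ge> k" for k by (simp add: r_def)
  define a where "a k x = norm (F (r (Suc k)) x - F (r k) x)" for k x
  have [measurable]: "a k \<in> borel_measurable M" for k unfolding a_def by measurable
  \<comment> \<open>Increments have squared norm at most \<open>16^-k\<close>, so the integrals stay
    summable under the factor \<open>2^k\<close>. Where the weighted series is finite,
    \<open>a k x\<close> is then bounded by a geometric sequence of ratio
    \<open>1 / sqrt 2\<close>.\<close>
  have a_int: "(\<integral>\<^sup>+x. ennreal (2^k * (a k x)\<^sup>2) \<partial>M) \<le> ennreal ((1/2)^k)" for k
  proof -
    have "(\<integral>\<^sup>+x. ennreal (2^k * (a k x)\<^sup>2) \<partial>M) = ennreal (2^k) * (\<integral>\<^sup>+x. ennreal ((a k x)\<^sup>2) \<partial>M)"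
      by (simp add: ennreal_mult nn_integral_cmult)
    also have "(\<integral>\<^sup>+x. ennreal ((a k x)\<^sup>2) \<partial>M) = ennreal ((l2_norm M (\<lambda>x. F (r (Suc k)) x - F (r k) x))\<^sup>2)"
      unfolding a_def by (rule l2_norm_nn_integral[symmetric]) (intro sq_int_diff F)
    also have "\<dots> \<le> ennreal (((1/2)^(2*k))\<^sup>2)"
      using n0[of k "r (Suc k)" "r k"] r_ge[of k] r_mono[of k]
      by (intro ennreal_leI power_mono) (auto simp: l2_norm_ge0 less_imp_le)
    also have "ennreal (2^k) * \<dots> = ennreal (2^k * ((1/2)^(2*k))\<^sup>2)"
      by (simp add: ennreal_mult)
    also have "\<dots> \<le> ennreal ((1/2)^k)"
    proof (rule ennreal_leI)
      have "(2::real)^k * ((1/2)^(2*k))\<^sup>2 = (1/2)^k * ((1/2)^k)\<^sup>2"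
      proof -
        have q: "(1/2::real)^(2*k) = (1/2)^k * (1/2)^k" by (simp add: mult_2 power_add)
        have "(2::real)^k * (1/2)^k = 1" by (simp add: power_one_over)
        then have "(2::real)^k * (((1/2)^k * (1/2)^k) * ((1/2)^k * (1/2)^k)) = (1/2)^k * ((1/2)^k * (1/2)^k)"
          by (metis mult.assoc mult.left_neutral)
        then show ?thesis by (simp only: q power2_eq_square)
      qed
      also have "\<dots> \<le> (1/2)^k * 1"
        by (intro mult_left_mono) (auto simp: power_le_one)
      finally show "(2::real)^k * ((1/2)^(2*k))\<^sup>2 \<le> (1/2)^k" by simp
    qed
    finally show ?thesis by (simp add: mult_left_mono)
  qed
  have "(\<integral>\<^sup>+x. (\<Sum>k. ennreal (2^k * (a k x)\<^sup>2)) \<partial>M) = (\<Sum>k. \<integral>\<^sup>+x. ennreal (2^k * (a k x)\<^sup>2) \<partial>M)"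
    by (rule nn_integral_suminf) auto
  also have "\<dots> \<le> (\<Sum>k. ennreal ((1/2)^k))" by (intro suminf_le a_int) auto
  also have "\<dots> = ennreal (\<Sum>k. (1/2)^k)" by (intro suminf_ennreal2) (auto simp: summable_geometric)
  also have "\<dots> < \<infinity>" by simp
  finally have "AE x in M. (\<Sum>k. ennreal (2^k * (a k x)\<^sup>2)) \<noteq> \<infinity>"
    by (intro nn_integral_PInf_AE) auto
  then have conv: "AE x in M. (\<lambda>k. F (r k) x) \<longlonglongrightarrow> lim (\<lambda>k. F (r k) x)"
  proof eventually_elim
    case (elim x)
    define C where "C = enn2real (\<Sum>k. ennreal (2^k * (a k x)\<^sup>2))"
    have C0: "C \<ge> 0" by (simp add: C_def)
    have ak: "2^k * (a k x)\<^sup>2 \<le> C" for k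
    proof -
      have "sum (\<lambda>k. ennreal (2^k * (a k x)\<^sup>2)) {k} \<le> (\<Sum>k. ennreal (2^k * (a k x)\<^sup>2))"
        by (intro sum_le_suminf) auto
      then have "ennreal (2^k * (a k x)\<^sup>2) \<le> (\<Sum>k. ennreal (2^k * (a k x)\<^sup>2))"
        by (simp only: sum.insert finite.emptyI empty_iff sum.empty not_False_eq_True add_0_right)
      also have "\<dots> = ennreal C" using elim by (simp add: C_def less_top)
      finally show ?thesis using C0 by simp
    qed
    have "a k x \<le> sqrt C * (1 / sqrt 2)^k" for k
    proof (rule power2_le_imp_le)
      have "(sqrt C * (1 / sqrt 2)^k)\<^sup>2 = C / 2^k"
      proof -
        have "(sqrt 2 ^ k)\<^sup>2 = (2::real) ^ k"
          by (metis power_mult mult.commute real_sqrt_pow2 zero_le_numeral)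
        then show ?thesis using C0 by (simp add: power_mult_distrib power_divide)
      qed
      then show "(a k x)\<^sup>2 \<le> (sqrt C * (1 / sqrt 2)^k)\<^sup>2"
        using ak[of k] by (simp only:) (simp add: field_simps)
    qed (use C0 in simp)
    then have le: "norm (F (r (Suc k)) x - F (r k) x) \<le> sqrt C * (1 / sqrt 2)^k" for k
      unfolding a_def .
    have "summable (\<lambda>k. sqrt C * (1 / sqrt 2)^k)"
      by (intro summable_mult summable_geometric) simp
    then have "summable (\<lambda>k. F (r (Suc k)) x - F (r k) x)"
      by (rule summable_comparison_test'[where N = 0]) (rule le)
    then have "convergent (\<lambda>k. F (r k) x)"
    proof -
      assume "summable (\<lambda>k. F (r (Suc k)) x - F (r k) x)"
      then obtain l where "(\<lambda>n. \<Sum>k<n. F (r (Suc k)) x - F (r k) x) \<longlonglongrightarrow> l"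
        by (auto simp: summable_def sums_def)
      then have "(\<lambda>n. (F (r n) x - F (r 0) x) + F (r 0) x) \<longlonglongrightarrow> l + F (r 0) x"
        by (intro tendsto_intros) (simp add: sum_lessThan_telescope[of "\<lambda>k. F (r k) x"])
      then show ?thesis by (auto simp: convergent_def)
    qed
    then show ?case by (simp add: convergent_LIMSEQ_iff)
  qed
  \<comment> \<open>\<open>lim\<close> is total, so \<open>f\<close> is measurable on the whole
    space; the exceptional null set does not affect the integrals below.\<close>
  define f where "f x = lim (\<lambda>k. F (r k) x)" for x
  have [measurable]: "f \<in> borel_measurable M" unfolding f_def by measurable
  have close: "(\<integral>\<^sup>+x. ennreal ((norm (F n x - f x))\<^sup>2) \<partial>M) \<le> ennreal (e\<^sup>2)"
    if e: "\<And>m. m \<ge> n \<Longrightarrow> l2_norm M (\<lambda>x. F n x - F m x) \<le> e" for n e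
  proof -
    have "(\<integral>\<^sup>+x. ennreal ((norm (F n x - f x))\<^sup>2) \<partial>M)
       = (\<integral>\<^sup>+x. liminf (\<lambda>k. ennreal ((norm (F n x - F (r k) x))\<^sup>2)) \<partial>M)"
    proof (rule nn_integral_cong_AE)
      show "AE x in M. ennreal ((norm (F n x - f x))\<^sup>2) = liminf (\<lambda>k. ennreal ((norm (F n x - F (r k) x))\<^sup>2))"
        using conv
      proof eventually_elim
        case (elim x)
        then have "(\<lambda>k. ennreal ((norm (F n x - F (r k) x))\<^sup>2)) \<longlonglongrightarrow> ennreal ((norm (F n x - f x))\<^sup>2)"
          unfolding f_def by (intro tendsto_intros)
        then show ?case by (rule lim_imp_Liminf[OF sequentially_bot, symmetric])
      qed
    qed
    also have "\<dots> \<le> liminf (\<lambda>k. \<integral>\<^sup>+x. ennreal ((norm (F n x - F (r k) x))\<^sup>2) \<partial>M)"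
      by (rule nn_integral_liminf) measurable
    also have "\<dots> \<le> ennreal (e\<^sup>2)"
    proof (rule Liminf_le)
      show "\<forall>\<^sub>F k in sequentially. (\<integral>\<^sup>+x. ennreal ((norm (F n x - F (r k) x))\<^sup>2) \<partial>M) \<le> ennreal (e\<^sup>2)"
        using eventually_ge_at_top[of n]
      proof eventually_elim
        case (elim k)
        then have "l2_norm M (\<lambda>x. F n x - F (r k) x) \<le> e" using e r_k[of k] by simp
        then show ?case
          unfolding l2_norm_nn_integral[OF sq_int_diff[OF F F], symmetric]
          by (intro ennreal_leI power_mono) (auto simp: l2_norm_ge0)
      qed
    qed simp
    finally show ?thesis .
  qed
  obtain n1 where n1: "\<forall>m\<ge>n1. \<forall>n\<ge>n1. l2_norm M (\<lambda>x. F m x - F n x) < 1" using Cauchy[of 1] by auto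
  have "(\<integral>\<^sup>+x. ennreal ((norm (F n1 x - f x))\<^sup>2) \<partial>M) \<le> ennreal (1\<^sup>2)"
    by (rule close) (use n1 in \<open>auto intro: less_imp_le\<close>)
  then have "sq_int M (\<lambda>x. F n1 x - f x)"
    by (subst sq_int_nn_integral) (auto intro: le_less_trans)
  from sq_int_diff[OF F[of n1] this] have f: "sq_int M f" by simp
  have "l2_conv M F f"
    unfolding l2_conv_def
  proof (rule LIMSEQ_I)
    fix e :: real assume "e > 0"
    then obtain n2 where n2: "\<forall>m\<ge>n2. \<forall>n\<ge>n2. l2_norm M (\<lambda>x. F m x - F n x) < e / 2" using Cauchy[of "e/2"] by auto
    show "\<exists>no. \<forall>n\<ge>no. norm (l2_norm M (\<lambda>x. F n x - f x) - 0) < e"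
    proof (intro exI allI impI)
      fix n assume "n2 \<le> n"
      then have "ennreal ((l2_norm M (\<lambda>x. F n x - f x))\<^sup>2) \<le> ennreal ((e/2)\<^sup>2)"
        unfolding l2_norm_nn_integral[OF sq_int_diff[OF F f]]
        using n2 by (intro close) (auto intro: less_imp_le)
      then have "(l2_norm M (\<lambda>x. F n x - f x))\<^sup>2 \<le> (e/2)\<^sup>2"
        by (simp only: ennreal_le_iff zero_le_power2)
      then have "l2_norm M (\<lambda>x. F n x - f x) \<le> e / 2"
        by (rule power2_le_imp_le) (use \<open>e > 0\<close> in simp)
      then show "norm (l2_norm M (\<lambda>x. F n x - f x) - 0) < e" using \<open>e > 0\<close> by (simp add: l2_norm_ge0)
    qed
  qed
  with f show ?thesis by blast
qed

text \<open>As \<open>V\<close> is not assumed closed, the nearest point \<open>f'\<close> is found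
  in its closure, as the limit of a minimizing sequence that the parallelogram identity makes
  Cauchy. Orthogonality to \<open>V\<close> is the first-order condition at the minimum. The
  approximants \<open>F\<close> are returned because later arguments work with elements of
  \<open>V\<close> itself.\<close>

lemma l2_projection:
  fixes f :: "'a \<Rightarrow> 'b::euclidean_space"
  assumes V: "\<And>v. v \<in> V \<Longrightarrow> sq_int M v" "V \<noteq> {}"
    and add: "\<And>u v. u \<in> V \<Longrightarrow> v \<in> V \<Longrightarrow> (\<lambda>x. u x + v x) \<in> V"
    and scale: "\<And>c v. v \<in> V \<Longrightarrow> (\<lambda>x. c *\<^sub>R v x) \<in> V"
    and f: "sq_int M f"
  shows "\<exists>f' F. sq_int M f' \<and> (\<forall>k::nat. F k \<in> V) \<and> l2_conv M F f' \<and> (\<forall>v\<in>V. l2_inner M (\<lambda>x. f x - f' x) v = 0)"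
proof -
  define D where "D v = l2_inner M (\<lambda>x. f x - v x) (\<lambda>x. f x - v x)" for v
  define d where "d = Inf (D ` V)"
  have D0: "0 \<le> D v" for v by (simp add: D_def l2_inner_ge0)
  have bdd: "bdd_below (D ` V)" by (rule bdd_belowI[of _ 0]) (auto simp: D0)
  have dle: "d \<le> D v" if "v \<in> V" for v unfolding d_def using bdd that by (intro cInf_lower) auto
  have "\<exists>v\<in>V. D v < d + 1 / real (Suc k)" for k
    using cInf_lessD[of "D ` V" "d + 1 / real (Suc k)"] V(2) by (auto simp: d_def)
  then obtain F where F: "\<And>k. F k \<in> V" "\<And>k. D (F k) < d + 1 / real (Suc k)" by metis
  have Fs: "sq_int M (F k)" for k using F V by auto
  \<comment> \<open>Parallelogram identity for \<open>f - F m\<close> and \<open>f - F n\<close>: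
    the midpoint of \<open>F m\<close> and \<open>F n\<close> lies in \<open>V\<close>, so its
    squared distance from \<open>f\<close> is at least \<open>d\<close>.\<close>
  have par: "(l2_norm M (\<lambda>x. F m x - F n x))\<^sup>2 \<le> 2 / real (Suc m) + 2 / real (Suc n)" for m n
  proof -
    have "(\<lambda>x. (1/2) *\<^sub>R (F m x + F n x)) \<in> V" by (intro scale add F)
    then have "d \<le> D (\<lambda>x. (1/2) *\<^sub>R (F m x + F n x))" by (rule dle)
    moreover have "(l2_norm M (\<lambda>x. F m x - F n x))\<^sup>2
        = 2 * D (F m) + 2 * D (F n) - 4 * D (\<lambda>x. (1/2) *\<^sub>R (F m x + F n x))"
    proof -
      define a where "a x = f x - F m x" for x
      define b where "b x = f x - F n x" for x
      have ab: "sq_int M a" "sq_int M b" unfolding a_def b_def by (intro sq_int_diff f Fs)+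
      have 1: "(\<lambda>x. F m x - F n x) = (\<lambda>x. b x + (-1) *\<^sub>R a x)" by (simp add: a_def b_def fun_eq_iff)
      have 2: "(\<lambda>x. f x - (1/2) *\<^sub>R (F m x + F n x)) = (\<lambda>x. (1/2) *\<^sub>R (b x + 1 *\<^sub>R a x))"
      proof
        fix x
        have "f x = (1/2) *\<^sub>R f x + (1/2) *\<^sub>R f x" by (simp flip: scaleR_add_left)
        then show "f x - (1/2) *\<^sub>R (F m x + F n x) = (1/2) *\<^sub>R (b x + 1 *\<^sub>R a x)"
          unfolding a_def b_def by (simp add: scaleR_right_distrib scaleR_right_diff_distrib)
      qed
      have "4 * D (\<lambda>x. (1/2) *\<^sub>R (F m x + F n x)) = l2_inner M (\<lambda>x. b x + 1 *\<^sub>R a x) (\<lambda>x. b x + 1 *\<^sub>R a x)"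
        unfolding D_def 2 by (simp add: l2_inner_scale_left l2_inner_scale_right del: scaleR_one)
      moreover have "D (F m) = l2_inner M a a" "D (F n) = l2_inner M b b" by (simp_all add: D_def a_def[abs_def] b_def[abs_def])
      moreover have "(l2_norm M (\<lambda>x. F m x - F n x))\<^sup>2 = l2_inner M (\<lambda>x. b x + (-1) *\<^sub>R a x) (\<lambda>x. b x + (-1) *\<^sub>R a x)"
        unfolding l2_norm_sq 1 ..
      ultimately show ?thesis
        unfolding l2_inner_square_add[OF ab(2,1)] by simp
    qed
    moreover have "D (F m) < d + 1 / real (Suc m)" "D (F n) < d + 1 / real (Suc n)" by (rule F)+
    ultimately show ?thesis by linarith
  qed
  have "\<exists>f'. sq_int M f' \<and> l2_conv M F f'"
  proof (rule l2_complete[OF Fs])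
    fix e :: real assume e: "e > 0"
    obtain n0 where n0: "real n0 > 4 / e\<^sup>2" using reals_Archimedean2 by blast
    show "\<exists>n0. \<forall>m\<ge>n0. \<forall>n\<ge>n0. l2_norm M (\<lambda>x. F m x - F n x) < e"
    proof (intro exI allI impI)
      fix m n assume mn: "n0 \<le> m" "n0 \<le> n"
      have n00: "0 < real n0" using n0 e by (smt (verit) divide_nonneg_nonneg zero_le_power2)
      have "(l2_norm M (\<lambda>x. F m x - F n x))\<^sup>2 \<le> 2 / real (Suc m) + 2 / real (Suc n)" by (rule par)
      also have "\<dots> \<le> 2 / real n0 + 2 / real n0" using mn n00 by (intro add_mono divide_left_mono) auto
      also have "\<dots> < e\<^sup>2" using n0 n00 e by (simp add: field_simps)
      finally show "l2_norm M (\<lambda>x. F m x - F n x) < e" using e by (auto intro: power2_less_imp_less)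
    qed
  qed
  then obtain f' where f': "sq_int M f'" "l2_conv M F f'" by blast
  have "l2_inner M (\<lambda>x. f x - f' x) v = 0" if v: "v \<in> V" for v
  proof -
    have vs: "sq_int M v" using v V by auto
    \<comment> \<open>Minimality of \<open>d\<close> is tested at \<open>F k - t v\<close> and
      passed to the limit. A quadratic in \<open>t\<close> without constant term can be nonnegative
      only if its linear coefficient vanishes.\<close>
    have nonneg: "0 \<le> 0 + 2 * l2_inner M (\<lambda>x. f x - f' x) v * t + l2_inner M v v * t\<^sup>2" for t
    proof -
      have ineq: "- (1 / real (Suc k)) \<le> 2 * (l2_inner M f v - l2_inner M (F k) v) * t + l2_inner M v v * t\<^sup>2" for k
      proof -
        have "(\<lambda>x. F k x + (-t) *\<^sub>R v x) \<in> V" by (intro add scale F v)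
        then have "d \<le> D (\<lambda>x. F k x + (-t) *\<^sub>R v x)" by (rule dle)
        also have "\<dots> = D (F k) + 2 * (l2_inner M f v - l2_inner M (F k) v) * t + l2_inner M v v * t\<^sup>2"
          using l2_inner_square_add[OF sq_int_diff[OF f Fs[of k]] vs, of t] f Fs[of k] vs
          by (simp add: D_def algebra_simps l2_inner_diff_left)
        finally show ?thesis using F(2)[of k] by simp
      qed
      have 1: "(\<lambda>k. - (1 / real (Suc k))) \<longlonglongrightarrow> 0"
        using tendsto_minus[OF LIMSEQ_inverse_real_of_nat] by (simp add: inverse_eq_divide)
      have 2: "(\<lambda>k. 2 * (l2_inner M f v - l2_inner M (F k) v) * t + l2_inner M v v * t\<^sup>2) \<longlonglongrightarrow>
          2 * (l2_inner M f v - l2_inner M f' v) * t + l2_inner M v v * t\<^sup>2"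
        by (intro tendsto_intros l2_conv_ip f' Fs vs)
      have "0 \<le> 2 * (l2_inner M f v - l2_inner M f' v) * t + l2_inner M v v * t\<^sup>2"
        by (rule LIMSEQ_le[OF 1 2]) (use ineq in auto)
      then show ?thesis using f f' vs by (simp add: l2_inner_diff_left)
    qed
    show ?thesis using quadratic_nonneg_imp_discr[OF nonneg] by simp
  qed
  with f' F show ?thesis by blast
qed

subsection \<open>Smooth functions of one variable\<close>

text \<open>The derivative is asked for as a witness rather than as \<open>deriv f\<close>, so each
  closure rule is proved by exhibiting a derivative and invoking the induction hypothesis.\<close>

primrec Dk :: "nat \<Rightarrow> (real \<Rightarrow> real) \<Rightarrow> bool" where
  "Dk 0 f \<longleftrightarrow> continuous_on UNIV f"
| "Dk (Suc k) f \<longleftrightarrow> (\<exists>f'. (\<forall>x. (f has_real_derivative f' x) (at x)) \<and> Dk k f')"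

definition smooth1 :: "(real \<Rightarrow> real) \<Rightarrow> bool" where
  "smooth1 f \<longleftrightarrow> (\<forall>k. Dk k f)"

lemma Dk_Suc_deriv: "Dk (Suc k) f \<longleftrightarrow> (\<forall>x. (f has_real_derivative deriv f x) (at x)) \<and> Dk k (deriv f)"
proof
  assume "Dk (Suc k) f"
  then obtain f' where f': "\<forall>x. (f has_real_derivative f' x) (at x)" "Dk k f'" by auto
  then have "deriv f = f'" by (auto simp: fun_eq_iff intro: DERIV_imp_deriv)
  with f' show "(\<forall>x. (f has_real_derivative deriv f x) (at x)) \<and> Dk k (deriv f)" by simp
qed auto

lemma Dk_cont: "Dk k f \<Longrightarrow> continuous_on UNIV f"
  by (cases k) (auto intro: DERIV_continuous_on)

lemma Dk_weaken: "Dk (Suc k) f \<Longrightarrow> Dk k f"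
proof (induction k arbitrary: f)
  case 0
  then show ?case using Dk_cont[OF 0] by simp
next
  case (Suc k)
  then show ?case using Dk.simps(2) by metis
qed

lemma Dk_const: "Dk k (\<lambda>_. c)"
proof (induction k arbitrary: c)
  case (Suc k)
  show ?case by (auto intro!: exI[of _ "\<lambda>_. 0"] Suc)
qed auto

lemma Dk_ident: "Dk k (\<lambda>x. x)"
  by (cases k) (auto intro!: exI[of _ "\<lambda>_. 1"] Dk_const)

lemma Dk_add: "Dk k f \<Longrightarrow> Dk k g \<Longrightarrow> Dk k (\<lambda>x. f x + g x)"
proof (induction k arbitrary: f g)
  case (Suc k)
  then obtain f' g' where "\<forall>x. (f has_real_derivative f' x) (at x)" "Dk k f'"
    "\<forall>x. (g has_real_derivative g' x) (at x)" "Dk k g'" by auto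
  with Suc.IH[of f' g'] show ?case
    by (auto intro!: exI[of _ "\<lambda>x. f' x + g' x"] derivative_eq_intros)
qed (auto intro: continuous_intros)

lemma Dk_mult: "Dk k f \<Longrightarrow> Dk k g \<Longrightarrow> Dk k (\<lambda>x. f x * g x)"
proof (induction k arbitrary: f g)
  case (Suc k)
  then obtain f' g' where *: "\<forall>x. (f has_real_derivative f' x) (at x)" "Dk k f'"
    "\<forall>x. (g has_real_derivative g' x) (at x)" "Dk k g'" by auto
  have "Dk k f" "Dk k g" using Suc.prems by (auto simp del: Dk.simps intro: Dk_weaken)
  with * Suc.IH have "Dk k (\<lambda>x. f' x * g x + f x * g' x)" by (intro Dk_add) auto
  moreover have "\<forall>x. ((\<lambda>x. f x * g x) has_real_derivative f' x * g x + f x * g' x) (at x)"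
    using * by (auto intro!: derivative_eq_intros)
  ultimately show ?case by auto
qed (auto intro: continuous_intros)

lemma Dk_compose: "Dk k f \<Longrightarrow> Dk k g \<Longrightarrow> Dk k (\<lambda>x. f (g x))"
proof (induction k arbitrary: f)
  case 0
  then show ?case by (auto intro: continuous_on_compose2)
next
  case (Suc k)
  then obtain f' g' where *: "\<forall>x. (f has_real_derivative f' x) (at x)" "Dk k f'"
    "\<forall>x. (g has_real_derivative g' x) (at x)" "Dk k g'" by auto
  have "Dk k g" using Suc.prems by (auto simp del: Dk.simps intro: Dk_weaken)
  with * Suc.IH have "Dk k (\<lambda>x. f' (g x) * g' x)" by (intro Dk_mult) auto
  moreover have "\<forall>x. ((\<lambda>x. f (g x)) has_real_derivative f' (g x) * g' x) (at x)"
    using * by (blast intro: DERIV_chain2)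
  ultimately show ?case by auto
qed

lemma Dk_powr: "Dk k f \<Longrightarrow> (\<And>x. f x > 0) \<Longrightarrow> Dk k (\<lambda>x. f x powr a)"
proof (induction k arbitrary: a)
  case 0
  then show ?case by (auto intro!: continuous_intros simp: less_imp_neq[symmetric])
next
  case (Suc k)
  then obtain f' where *: "\<forall>x. (f has_real_derivative f' x) (at x)" "Dk k f'" by auto
  have "Dk k f" using Suc.prems by (auto simp del: Dk.simps intro: Dk_weaken)
  with * Suc have "Dk k (\<lambda>x. (a * f x powr (a - 1)) * f' x)"
    by (intro Dk_mult Dk_const) auto
  moreover have "\<forall>x. ((\<lambda>x. f x powr a) has_real_derivative (a * f x powr (a - 1)) * f' x) (at x)"
  proof
    fix x
    show "((\<lambda>x. f x powr a) has_real_derivative (a * f x powr (a - 1)) * f' x) (at x)"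
      using DERIV_chain2[OF has_real_derivative_powr[OF Suc.prems(2)] *(1)[rule_format]] by simp
  qed
  ultimately show ?case by auto
qed

lemma smooth1_const: "smooth1 (\<lambda>_. c)" by (simp add: smooth1_def Dk_const)
lemma smooth1_ident: "smooth1 (\<lambda>x. x)" by (simp add: smooth1_def Dk_ident)
lemma smooth1_add: "smooth1 f \<Longrightarrow> smooth1 g \<Longrightarrow> smooth1 (\<lambda>x. f x + g x)" by (simp add: smooth1_def Dk_add)
lemma smooth1_mult: "smooth1 f \<Longrightarrow> smooth1 g \<Longrightarrow> smooth1 (\<lambda>x. f x * g x)" by (simp add: smooth1_def Dk_mult)
lemma smooth1_compose: "smooth1 f \<Longrightarrow> smooth1 g \<Longrightarrow> smooth1 (\<lambda>x. f (g x))" by (simp add: smooth1_def Dk_compose)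
lemma smooth1_powr: "smooth1 f \<Longrightarrow> (\<And>x. f x > 0) \<Longrightarrow> smooth1 (\<lambda>x. f x powr a)" by (simp add: smooth1_def Dk_powr)
lemma smooth1_cmult: "smooth1 f \<Longrightarrow> smooth1 (\<lambda>x. c * f x)" by (intro smooth1_mult smooth1_const)
lemma smooth1_diff: "smooth1 f \<Longrightarrow> smooth1 g \<Longrightarrow> smooth1 (\<lambda>x. f x - g x)"
  using smooth1_add[of f "\<lambda>x. -1 * g x"] smooth1_cmult[of g "-1"] by simp
lemma smooth1_power: "smooth1 f \<Longrightarrow> smooth1 (\<lambda>x. f x ^ n)"
  by (induction n) (auto intro: smooth1_const smooth1_mult)

lemmas smooth1_intros = smooth1_const smooth1_ident smooth1_add smooth1_mult smooth1_diff smooth1_power smooth1_cmult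

lemma smooth1_deriv: "smooth1 f \<Longrightarrow> (f has_real_derivative deriv f x) (at x)" "smooth1 f \<Longrightarrow> smooth1 (deriv f)"
  unfolding smooth1_def using Dk_Suc_deriv by blast+

lemma smooth1_cont: "smooth1 f \<Longrightarrow> continuous_on UNIV f"
  unfolding smooth1_def using Dk_cont by blast

subsection \<open>Bump functions\<close>

text \<open>The functions \<open>p (1/x) * exp (- 1/x)\<close>, extended by 0 to the left, form a
  family closed under differentiation. Smoothness of the case \<open>p = 1\<close> therefore follows
  by an induction over all polynomials at once.\<close>

definition flat_exp :: "real poly \<Rightarrow> real \<Rightarrow> real" where
  "flat_exp p x = (if x > 0 then poly p (1 / x) * exp (- (1 / x)) else 0)"

lemma poly_exp_tendsto_0: "((\<lambda>y. poly p y * exp (- y)) \<longlongrightarrow> 0) at_top" for p :: "real poly"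
proof -
  have "((\<lambda>y. \<Sum>i\<le>degree p. coeff p i * (y ^ i / exp y)) \<longlongrightarrow> (\<Sum>i\<le>degree p. coeff p i * 0)) at_top"
    by (intro tendsto_sum tendsto_mult tendsto_const tendsto_power_div_exp_0)
  moreover have "(\<lambda>y. \<Sum>i\<le>degree p. coeff p i * (y ^ i / exp y)) = (\<lambda>y. poly p y * exp (- y))"
    by (auto simp: fun_eq_iff poly_altdef exp_minus sum_distrib_right divide_simps)
  ultimately show ?thesis by simp
qed

text \<open>With \<open>y = 1/x\<close> one has \<open>dy/dx = - y^2\<close>, hence the factor
  \<open>[:0, 0, 1:]\<close> on \<open>p - pderiv p\<close>. At 0 the right difference quotient is
  \<open>y * p y * exp (- y)\<close> as \<open>y\<close> tends to infinity, that is, the polynomial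
  \<open>pCons 0 p\<close> against the exponential.\<close>

lemma flat_exp_deriv: "(flat_exp p has_real_derivative flat_exp ([:0, 0, 1:] * (p - pderiv p)) x) (at x)"
proof -
  consider "x > 0" | "x < 0" | "x = 0" by linarith
  then show ?thesis
  proof cases
    case 1
    have "((\<lambda>x. poly p (1 / x) * exp (- (1 / x))) has_real_derivative
        poly (pderiv p) (1 / x) * (- (1 / x\<^sup>2)) * exp (- (1 / x)) + poly p (1 / x) * (exp (- (1 / x)) * (1 / x\<^sup>2))) (at x)"
      using 1 by (auto intro!: derivative_eq_intros DERIV_chain2[OF poly_DERIV] simp: power2_eq_square)
    moreover have "poly (pderiv p) (1 / x) * (- (1 / x\<^sup>2)) * exp (- (1 / x)) + poly p (1 / x) * (exp (- (1 / x)) * (1 / x\<^sup>2))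
       = flat_exp ([:0, 0, 1:] * (p - pderiv p)) x"
      using 1 by (simp add: flat_exp_def field_simps power2_eq_square)
    ultimately have "((\<lambda>x. poly p (1 / x) * exp (- (1 / x))) has_real_derivative flat_exp ([:0, 0, 1:] * (p - pderiv p)) x) (at x)"
      by simp
    then show ?thesis
    proof (rule has_field_derivative_transform_within_open[where S = "{0<..}"])
    qed (use 1 in \<open>auto simp: flat_exp_def\<close>)
  next
    case 2
    have "((\<lambda>_. 0) has_real_derivative 0) (at x)" by simp
    then have "(flat_exp p has_real_derivative 0) (at x)"
      by (rule has_field_derivative_transform_within_open[where S = "{..<0}"])
        (use 2 in \<open>auto simp: flat_exp_def\<close>)
    then show ?thesis using 2 by (simp add: flat_exp_def)
  next
    case 3
    have r: "((\<lambda>h. flat_exp p h / h) \<longlongrightarrow> 0) (at_right 0)"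
    proof -
      have "((\<lambda>h. poly (pCons 0 p) (inverse h) * exp (- inverse h)) \<longlongrightarrow> 0) (at_right 0)"
        by (rule filterlim_compose[OF poly_exp_tendsto_0 filterlim_inverse_at_top_right])
      moreover have "\<forall>\<^sub>F h in at_right 0. poly (pCons 0 p) (inverse h) * exp (- inverse h) = flat_exp p h / h"
        unfolding eventually_at_right_field
        by (auto intro!: exI[of _ 1] simp: flat_exp_def divide_inverse)
      ultimately show ?thesis by (rule Lim_transform_eventually)
    qed
    have l: "((\<lambda>h. flat_exp p h / h) \<longlongrightarrow> 0) (at_left 0)"
    proof (rule Lim_transform_eventually[OF tendsto_const])
      show "\<forall>\<^sub>F h in at_left 0. 0 = flat_exp p h / h"
        unfolding eventually_at_left_field by (auto intro!: exI[of _ "-1"] simp: flat_exp_def)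
    qed
    have "((\<lambda>h. flat_exp p h / h) \<longlongrightarrow> 0) (at 0)" using l r by (rule filterlim_split_at)
    then have "(flat_exp p has_real_derivative 0) (at 0)"
      by (simp add: DERIV_def flat_exp_def)
    then show ?thesis using 3 by (simp add: flat_exp_def)
  qed
qed

lemma smooth1_flat_exp: "smooth1 (flat_exp p)"
proof -
  have "Dk k (flat_exp p)" for k
  proof (induction k arbitrary: p)
    case 0
    show ?case using flat_exp_deriv by (auto intro: DERIV_continuous_on)
  next
    case (Suc k)
    show ?case using flat_exp_deriv[of p] Suc by auto
  qed
  then show ?thesis by (simp add: smooth1_def)
qed

lemma flat_exp_1: "flat_exp 1 x = (if x > 0 then exp (- (1 / x)) else 0)"
  by (simp add: flat_exp_def)

text \<open>The factor \<open>exp 1\<close> normalizes the value at 0 to 1, which lets dilated bumps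
  serve as cutoffs tending to 1.\<close>

definition bump :: "real \<Rightarrow> real" where
  "bump x = exp 1 * flat_exp 1 (1 - x\<^sup>2)"

lemma smooth1_bump: "smooth1 bump"
  unfolding bump_def[abs_def]
  by (intro smooth1_intros smooth1_compose[OF smooth1_flat_exp])

lemma bump_0: "bump 0 = 1"
  by (simp add: bump_def flat_exp_1 flip: exp_add)

lemma bump_nonneg: "0 \<le> bump x"
  by (simp add: bump_def flat_exp_1)

lemma bump_le_1: "bump x \<le> 1"
proof (cases "x\<^sup>2 < 1")
  case True
  then have "1 \<le> 1 / (1 - x\<^sup>2)" by (simp add: field_simps)
  then have "exp (1 + - (1 / (1 - x\<^sup>2))) \<le> exp 0" by (intro exp_mono) simp
  then show ?thesis using True by (simp add: bump_def flat_exp_1 exp_add[symmetric] del: exp_le_one_iff)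
qed (simp add: bump_def flat_exp_1)

lemma bump_eq_0: "\<bar>x\<bar> \<ge> 1 \<Longrightarrow> bump x = 0"
  by (simp add: bump_def flat_exp_1 abs_square_less_1 not_less[symmetric])

lemma bump_even: "bump (- x) = bump x"
  by (simp add: bump_def)

lemma bump_deriv_bound: "\<exists>C\<ge>0. \<forall>x. \<bar>deriv bump x\<bar> \<le> C"
proof -
  have "continuous_on {-1..1} (deriv bump)"
    using smooth1_cont[OF smooth1_deriv(2)[OF smooth1_bump]] by (rule continuous_on_subset) simp
  then have "compact (deriv bump ` {-1..1})" by (intro compact_continuous_image) auto
  then obtain C where C: "\<forall>y\<in>deriv bump ` {-1..1}. norm y \<le> C"
    using compact_imp_bounded bounded_iff by metis
  have "deriv bump x = 0" if "x \<notin> {-1..1}" for x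
  proof -
    have "((\<lambda>_. 0) has_real_derivative 0) (at x)" by simp
    then have "(bump has_real_derivative 0) (at x)"
      by (rule has_field_derivative_transform_within_open[where S = "- {-1..1}"])
        (use that bump_eq_0 in \<open>auto simp: abs_if\<close>)
    then show ?thesis by (rule DERIV_imp_deriv)
  qed
  with C show ?thesis
    by (intro exI[of _ "\<bar>C\<bar>"]) (metis abs_ge_self abs_ge_zero abs_zero imageI order_trans real_norm_def)
qed

text \<open>Each factor tends to 1 on the inner side of its endpoint as \<open>k\<close> grows and
  vanishes on the other side, so the indicator of the open interval is approximated from
  below.\<close>

definition interval_bump :: "real \<Rightarrow> real \<Rightarrow> nat \<Rightarrow> real \<Rightarrow> real" where
  "interval_bump a b k x = flat_exp 1 (real k * (x - a)) * flat_exp 1 (real k * (b - x))"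

lemma smooth1_interval_bump: "smooth1 (interval_bump a b k)"
  unfolding interval_bump_def[abs_def]
  by (intro smooth1_intros smooth1_compose[OF smooth1_flat_exp])

lemma flat_exp1_bounds: "0 \<le> flat_exp 1 x" "flat_exp 1 x \<le> 1"
  by (auto simp: flat_exp_1)

lemma interval_bump_bounds: "0 \<le> interval_bump a b k x" "interval_bump a b k x \<le> 1"
  using flat_exp1_bounds by (auto simp: interval_bump_def mult_le_one)

lemma interval_bump_eq_0: "x \<notin> {a<..<b} \<Longrightarrow> interval_bump a b k x = 0"
  by (auto simp: interval_bump_def flat_exp_1 zero_less_mult_iff)

lemma flat_exp1_tendsto: "t > 0 \<Longrightarrow> (\<lambda>k. flat_exp 1 (real k * t)) \<longlonglongrightarrow> 1"
proof -
  assume t: "t > 0"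
  have "filterlim (\<lambda>k. t * real k) at_top sequentially"
    by (intro filterlim_tendsto_pos_mult_at_top[OF tendsto_const t] filterlim_real_sequentially)
  then have "(\<lambda>k. inverse (t * real k)) \<longlonglongrightarrow> 0"
    by (rule tendsto_inverse_0_at_top)
  then have "(\<lambda>k. exp (- inverse (t * real k))) \<longlonglongrightarrow> exp (- 0)" by (intro tendsto_intros)
  moreover have "\<forall>\<^sub>F k in sequentially. exp (- inverse (t * real k)) = flat_exp 1 (real k * t)"
    using eventually_gt_at_top[of 0] by eventually_elim (use t in \<open>auto simp: flat_exp_1 divide_inverse mult.commute\<close>)
  ultimately show ?thesis by (auto intro: Lim_transform_eventually)
qed

lemma interval_bump_tendsto: "(\<lambda>k. interval_bump a b k x) \<longlonglongrightarrow> indicator {a<..<b} x"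
proof (cases "x \<in> {a<..<b}")
  case True
  then have "(\<lambda>k. interval_bump a b k x) \<longlonglongrightarrow> 1 * 1"
    unfolding interval_bump_def by (intro tendsto_intros flat_exp1_tendsto) auto
  then show ?thesis using True by simp
qed (simp add: interval_bump_eq_0)

subsection \<open>Smooth functions of several variables\<close>

definition depends_on :: "nat \<Rightarrow> ((nat \<Rightarrow> real) \<Rightarrow> real) \<Rightarrow> bool" where
  "depends_on N \<phi> \<longleftrightarrow> (\<forall>x. \<phi> x = \<phi> (restrict x {..<N}))"

text \<open>Recursion on the order replaces the lists of indices of \<open>iter_pd\<close>, so that
  closure under sums and products is an induction on \<open>k\<close>. Continuity refers to the
  product topology of the whole sequence space.\<close>

primrec Ck :: "nat \<Rightarrow> nat \<Rightarrow> ((nat \<Rightarrow> real) \<Rightarrow> real) \<Rightarrow> bool" where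
  "Ck N 0 \<phi> \<longleftrightarrow> continuous_on UNIV \<phi>"
| "Ck N (Suc k) \<phi> \<longleftrightarrow> continuous_on UNIV \<phi> \<and>
     (\<forall>j<N. (\<forall>x. (\<lambda>t. \<phi> (x(j := t))) differentiable (at (x j))) \<and> Ck N k (pd j \<phi>))"

definition smooth :: "nat \<Rightarrow> ((nat \<Rightarrow> real) \<Rightarrow> real) \<Rightarrow> bool" where
  "smooth N \<phi> \<longleftrightarrow> depends_on N \<phi> \<and> (\<forall>k. Ck N k \<phi>)"

definition supp_in :: "nat \<Rightarrow> real \<Rightarrow> ((nat \<Rightarrow> real) \<Rightarrow> real) \<Rightarrow> bool" where
  "supp_in N R \<phi> \<longleftrightarrow> (\<forall>x. (\<exists>j<N. \<bar>x j\<bar> > R) \<longrightarrow> \<phi> x = 0)"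

lemma continuous_on_upd: "continuous_on S (\<lambda>x::nat \<Rightarrow> real. x(j := t))"
proof (rule continuous_on_coordinatewise_then_product)
  fix i show "continuous_on S (\<lambda>x. (x(j := t)) i)"
    by (cases "i = j") (auto intro: continuous_on_subset[OF continuous_on_product_coordinates])
qed

lemma continuous_on_upd2: "continuous_on S (\<lambda>t. (x::nat \<Rightarrow> real)(j := t))"
proof (rule continuous_on_coordinatewise_then_product)
  fix i show "continuous_on S (\<lambda>t. (x(j := t)) i)"
    by (cases "i = j") auto
qed

lemma continuous_on_restrict: "continuous_on S (\<lambda>x::nat \<Rightarrow> real. restrict x A)"
proof (rule continuous_on_coordinatewise_then_product)
  fix i show "continuous_on S (\<lambda>x. restrict x A i)"
    by (cases "i \<in> A") (auto intro: continuous_on_subset[OF continuous_on_product_coordinates])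
qed

text \<open>\<open>restrict\<close> is a continuous retraction onto the extensional functions;
  composing with it carries continuity from there, where \<open>test_fun\<close> asks for it, to the
  whole space.\<close>

lemma depends_on_cont:
  assumes "depends_on N \<phi>"
  shows "continuous_on (PiE {..<N} (\<lambda>_. UNIV)) \<phi> \<longleftrightarrow> continuous_on UNIV \<phi>"
proof
  assume c: "continuous_on (PiE {..<N} (\<lambda>_. UNIV)) \<phi>"
  have "continuous_on UNIV (\<lambda>x. \<phi> (restrict x {..<N}))"
    by (rule continuous_on_compose2[OF c continuous_on_restrict]) (simp add: image_subset_iff)
  then show "continuous_on UNIV \<phi>" using assms by (simp add: depends_on_def flip: assms[unfolded depends_on_def, rule_format])
qed (auto intro: continuous_on_subset)

lemma depends_on_cong:
  assumes "depends_on N \<phi>" "\<And>i. i < N \<Longrightarrow> x i = y i"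
  shows "\<phi> x = \<phi> y"
proof -
  have "restrict x {..<N} = restrict y {..<N}" using assms(2) by (auto simp: restrict_def)
  then show ?thesis using assms(1) unfolding depends_on_def by metis
qed

lemma depends_on_I:
  assumes "\<And>x y. (\<And>i. i < N \<Longrightarrow> x i = y i) \<Longrightarrow> \<phi> x = \<phi> y"
  shows "depends_on N \<phi>"
  unfolding depends_on_def by (intro allI assms) simp

lemma depends_on_pd:
  assumes "depends_on N \<phi>" "j < N"
  shows "depends_on N (pd j \<phi>)"
proof (rule depends_on_I)
  fix x y :: "nat \<Rightarrow> real" assume xy: "\<And>i. i < N \<Longrightarrow> x i = y i"
  have "(\<lambda>t. \<phi> (x(j := t))) = (\<lambda>t. \<phi> (y(j := t)))"
    by (intro ext depends_on_cong[OF assms(1)]) (use xy in auto)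
  then show "pd j \<phi> x = pd j \<phi> y" using xy[OF assms(2)] by (simp add: pd_def)
qed

lemma Ck_weaken: "Ck N (Suc k) \<phi> \<Longrightarrow> Ck N k \<phi>"
proof (induction k arbitrary: \<phi>)
  case (Suc k)
  then show ?case using Ck.simps(2) by metis
qed auto

lemma smooth_pd: "smooth N \<phi> \<Longrightarrow> j < N \<Longrightarrow> smooth N (pd j \<phi>)"
  unfolding smooth_def using depends_on_pd Ck.simps(2) by blast

lemma smooth_iter_pd: "smooth N \<phi> \<Longrightarrow> set js \<subseteq> {..<N} \<Longrightarrow> smooth N (iter_pd js \<phi>)"
  by (induction js) (auto simp: iter_pd_def smooth_pd)

lemma smooth_cont: "smooth N \<phi> \<Longrightarrow> continuous_on UNIV \<phi>"
  unfolding smooth_def using Ck.simps(1) by blast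

lemma smooth_depends_on: "smooth N \<phi> \<Longrightarrow> depends_on N \<phi>" by (simp add: smooth_def)

lemma smooth_DERIV:
  assumes "smooth N \<phi>" "j < N"
  shows "((\<lambda>t. \<phi> (x(j := t))) has_real_derivative pd j \<phi> (x(j := s))) (at s)"
proof -
  have "Ck N (Suc 0) \<phi>" using assms unfolding smooth_def by blast
  then have "(\<lambda>t. \<phi> ((x(j := s))(j := t))) differentiable (at ((x(j := s)) j))"
    using assms(2) unfolding Ck.simps by blast
  then have "(\<lambda>t. \<phi> (x(j := t))) differentiable (at s)" by simp
  then show ?thesis by (simp add: pd_def DERIV_deriv_iff_real_differentiable)
qed

lemma smooth_DERIV':
  assumes "smooth N \<phi>" "j < N"
  shows "((\<lambda>t. \<phi> (x(j := t))) has_real_derivative pd j \<phi> x) (at (x j))"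
  using smooth_DERIV[OF assms, of x "x j"] by simp

text \<open>In the forward direction the induction on \<open>k\<close> runs over all lists
  \<open>js\<close> simultaneously, since each further derivative lengthens the list.\<close>

lemma test_fun_iff: "test_fun N \<phi> \<longleftrightarrow> smooth N \<phi> \<and> (\<exists>R. supp_in N R \<phi>)"
proof
  assume t: "test_fun N \<phi>"
  then have depends_on: "depends_on N \<phi>" by (simp add: test_fun_def depends_on_def)
  have loc': "depends_on N (iter_pd js \<phi>)" if "set js \<subseteq> {..<N}" for js
    using that depends_on by (induction js) (auto simp: iter_pd_def depends_on_pd)
  have "Ck N k (iter_pd js \<phi>)" if "set js \<subseteq> {..<N}" for k js
    using that
  proof (induction k arbitrary: js)
    case 0
    then show ?case using t depends_on_cont[OF loc'[OF 0]] by (auto simp: test_fun_def)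
  next
    case (Suc k)
    have "Ck N k (pd j (iter_pd js \<phi>))" if "j < N" for j
      using Suc.IH[of "j # js"] Suc.prems that by (simp add: iter_pd_def)
    then show ?case using t depends_on_cont[OF loc'[OF Suc.prems]] Suc.prems by (auto simp: test_fun_def)
  qed
  from this[of "[]"] have "\<forall>k. Ck N k \<phi>" by (simp add: iter_pd_def)
  then show "smooth N \<phi> \<and> (\<exists>R. supp_in N R \<phi>)"
    using t depends_on by (auto simp: smooth_def supp_in_def test_fun_def)
next
  assume s: "smooth N \<phi> \<and> (\<exists>R. supp_in N R \<phi>)"
  have "continuous_on (PiE {..<N} (\<lambda>_. UNIV)) (iter_pd js \<phi>)
       \<and> (\<forall>j<N. \<forall>x. (\<lambda>t. iter_pd js \<phi> (x(j := t))) differentiable (at (x j)))"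
    if "set js \<subseteq> {..<N}" for js
  proof -
    have *: "smooth N (iter_pd js \<phi>)" using s that by (intro smooth_iter_pd) auto
    then show ?thesis
      using smooth_DERIV'[OF *] smooth_cont[OF *]
      by (auto intro: continuous_on_subset simp: real_differentiable_def)
  qed
  then show "test_fun N \<phi>" using s by (auto simp: test_fun_def smooth_def supp_in_def depends_on_def)
qed

lemma test_fun_smooth: "test_fun N \<phi> \<Longrightarrow> smooth N \<phi>" by (simp add: test_fun_iff)

lemma pd_eqI: "((\<lambda>t. \<phi> (x(j := t))) has_real_derivative d) (at (x j)) \<Longrightarrow> pd j \<phi> x = d"
  by (simp add: pd_def DERIV_imp_deriv)

lemma Ck_I:
  assumes "\<And>j. j < N \<Longrightarrow> Ck N k (\<phi>' j)" "continuous_on UNIV \<phi>"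
    and "\<And>j x. j < N \<Longrightarrow> ((\<lambda>t. \<phi> (x(j := t))) has_real_derivative \<phi>' j x) (at (x j))"
  shows "Ck N (Suc k) \<phi>"
proof -
  have "pd j \<phi> = \<phi>' j" if "j < N" for j
    using assms(3)[OF that] by (auto simp: fun_eq_iff intro: pd_eqI)
  then show ?thesis using assms unfolding Ck.simps real_differentiable_def by (metis (no_types, lifting))
qed

lemma Ck_DERIV:
  assumes "Ck N (Suc k) \<phi>" "j < N"
  shows "((\<lambda>t. \<phi> (x(j := t))) has_real_derivative pd j \<phi> x) (at (x j))"
  using assms by (auto simp: pd_def DERIV_deriv_iff_real_differentiable)

lemma Ck_add: "Ck N k \<phi> \<Longrightarrow> Ck N k \<psi> \<Longrightarrow> Ck N k (\<lambda>x. \<phi> x + \<psi> x)"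
proof (induction k arbitrary: \<phi> \<psi>)
  case (Suc k)
  show ?case
  proof (rule Ck_I[where \<phi>' = "\<lambda>j x. pd j \<phi> x + pd j \<psi> x"])
    show "continuous_on UNIV (\<lambda>x. \<phi> x + \<psi> x)" using Suc.prems by (auto intro: continuous_intros)
  next
    fix j assume "j < N"
    then show "Ck N k (\<lambda>x. pd j \<phi> x + pd j \<psi> x)" using Suc by auto
  next
    fix j x assume "j < N"
    then show "((\<lambda>t. \<phi> (x(j := t)) + \<psi> (x(j := t))) has_real_derivative pd j \<phi> x + pd j \<psi> x) (at (x j))"
      using Suc.prems by (intro DERIV_add Ck_DERIV)
  qed
qed (auto intro: continuous_intros)

lemma Ck_mult: "Ck N k \<phi> \<Longrightarrow> Ck N k \<psi> \<Longrightarrow> Ck N k (\<lambda>x. \<phi> x * \<psi> x)"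
proof (induction k arbitrary: \<phi> \<psi>)
  case (Suc k)
  show ?case
  proof (rule Ck_I[where \<phi>' = "\<lambda>j x. pd j \<phi> x * \<psi> x + pd j \<psi> x * \<phi> x"])
    show "continuous_on UNIV (\<lambda>x. \<phi> x * \<psi> x)" using Suc.prems by (auto intro: continuous_intros)
  next
    fix j assume j: "j < N"
    have "Ck N k \<phi>" "Ck N k \<psi>" using Suc.prems by (blast intro: Ck_weaken)+
    then show "Ck N k (\<lambda>x. pd j \<phi> x * \<psi> x + pd j \<psi> x * \<phi> x)" using Suc j by (intro Ck_add Suc.IH) auto
  next
    fix j x assume j: "j < N"
    show "((\<lambda>t. \<phi> (x(j := t)) * \<psi> (x(j := t))) has_real_derivative pd j \<phi> x * \<psi> x + pd j \<psi> x * \<phi> x) (at (x j))"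
      using DERIV_mult[OF Ck_DERIV[OF Suc.prems(1) j, of x] Ck_DERIV[OF Suc.prems(2) j, of x]] by (simp only: fun_upd_triv)
  qed
qed (auto intro: continuous_intros)

lemma Ck_const: "Ck N k (\<lambda>_. c)"
  by (induction k arbitrary: c) (auto intro!: Ck_I[where \<phi>' = "\<lambda>_ _. 0"] simp del: Ck.simps(2))

lemma smooth_const: "smooth N (\<lambda>_. c)"
  by (auto simp: smooth_def depends_on_def Ck_const)

lemma smooth_add: "smooth N \<phi> \<Longrightarrow> smooth N \<psi> \<Longrightarrow> smooth N (\<lambda>x. \<phi> x + \<psi> x)"
  by (auto simp: smooth_def Ck_add intro!: depends_on_I arg_cong2[where f = "(+)"] elim: depends_on_cong)

lemma smooth_mult: "smooth N \<phi> \<Longrightarrow> smooth N \<psi> \<Longrightarrow> smooth N (\<lambda>x. \<phi> x * \<psi> x)"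
  by (auto simp: smooth_def Ck_mult intro!: depends_on_I arg_cong2[where f = "(*)"] elim: depends_on_cong)

lemma smooth_cmult: "smooth N \<phi> \<Longrightarrow> smooth N (\<lambda>x. c * \<phi> x)"
  by (intro smooth_mult smooth_const)

lemma pd_add: "smooth N \<phi> \<Longrightarrow> smooth N \<psi> \<Longrightarrow> j < N \<Longrightarrow>
    pd j (\<lambda>x. \<phi> x + \<psi> x) = (\<lambda>x. pd j \<phi> x + pd j \<psi> x)"
  by (intro ext pd_eqI DERIV_add smooth_DERIV')

lemma pd_mult: "smooth N \<phi> \<Longrightarrow> smooth N \<psi> \<Longrightarrow> j < N \<Longrightarrow>
    pd j (\<lambda>x. \<phi> x * \<psi> x) = (\<lambda>x. pd j \<phi> x * \<psi> x + \<phi> x * pd j \<psi> x)"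
proof (intro ext pd_eqI)
  fix x assume *: "smooth N \<phi>" "smooth N \<psi>" "j < N"
  show "((\<lambda>t. \<phi> (x(j := t)) * \<psi> (x(j := t))) has_real_derivative
      pd j \<phi> x * \<psi> x + \<phi> x * pd j \<psi> x) (at (x j))"
    using DERIV_mult[OF smooth_DERIV'[OF *(1,3), of x] smooth_DERIV'[OF *(2,3), of x]]
    by (simp only: fun_upd_triv mult.commute)
qed

lemma pd_cmult: "smooth N \<phi> \<Longrightarrow> j < N \<Longrightarrow> pd j (\<lambda>x. c * \<phi> x) = (\<lambda>x. c * pd j \<phi> x)"
  by (intro ext pd_eqI DERIV_cmult smooth_DERIV')

text \<open>If the coordinate exceeding \<open>R\<close> is not the one differentiated, the section
  is identically 0; if it is, the section vanishes on the open set where that coordinate stays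
  beyond \<open>R\<close>.\<close>

lemma supp_in_pd:
  assumes "supp_in N R \<phi>"
  shows "supp_in N R (pd j \<phi>)"
  unfolding supp_in_def
proof (intro allI impI)
  fix x assume "\<exists>i<N. R < \<bar>x i\<bar>"
  then obtain i where i: "i < N" "R < \<bar>x i\<bar>" by auto
  have "((\<lambda>t. \<phi> (x(j := t))) has_real_derivative 0) (at (x j))"
  proof (cases "i = j")
    case False
    then have "\<phi> (x(j := t)) = 0" for t
      using assms i unfolding supp_in_def by (metis fun_upd_other)
    then show ?thesis by simp
  next
    case True
    have "((\<lambda>t. 0) has_real_derivative 0) (at (x j))" by simp
    then show ?thesis
    proof (rule has_field_derivative_transform_within_open)
      show "open {t::real. R < \<bar>t\<bar>}" by (intro open_Collect_less continuous_intros)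
      show "0 = \<phi> (x(j := t))" if "t \<in> {t. R < \<bar>t\<bar>}" for t
        using assms i True that unfolding supp_in_def by (metis fun_upd_same mem_Collect_eq)
    qed (use i True in auto)
  qed
  then show "pd j \<phi> x = 0" by (rule pd_eqI)
qed

lemma test_fun_pd: "test_fun N \<phi> \<Longrightarrow> j < N \<Longrightarrow> test_fun N (pd j \<phi>)"
  unfolding test_fun_iff using smooth_pd supp_in_pd by blast

lemma test_fun_mult: "test_fun N w \<Longrightarrow> smooth N u \<Longrightarrow> test_fun N (\<lambda>x. w x * u x)"
  by (auto simp: test_fun_iff smooth_mult supp_in_def)

lemma supp_in_mono: "supp_in N R \<phi> \<Longrightarrow> R \<le> R' \<Longrightarrow> supp_in N R' \<phi>"
  by (force simp: supp_in_def)

lemma test_fun_add: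
  assumes "test_fun N \<phi>" "test_fun N \<psi>"
  shows "test_fun N (\<lambda>x. \<phi> x + \<psi> x)"
proof -
  obtain R1 R2 where "supp_in N R1 \<phi>" "supp_in N R2 \<psi>" using assms by (auto simp: test_fun_iff)
  then have "supp_in N (max R1 R2) \<phi>" "supp_in N (max R1 R2) \<psi>" by (auto elim: supp_in_mono)
  then have "supp_in N (max R1 R2) (\<lambda>x. \<phi> x + \<psi> x)" by (auto simp: supp_in_def)
  then show ?thesis using assms by (auto simp: test_fun_iff smooth_add)
qed

lemma test_fun_cmult: "test_fun N \<phi> \<Longrightarrow> test_fun N (\<lambda>x. c * \<phi> x)"
  by (auto simp: test_fun_iff smooth_cmult supp_in_def)

lemma test_fun_zero: "test_fun N (\<lambda>_. 0)"
  by (auto simp: test_fun_iff smooth_const supp_in_def)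

subsection \<open>Tensor products\<close>

definition tensor :: "nat \<Rightarrow> (nat \<Rightarrow> real \<Rightarrow> real) \<Rightarrow> (nat \<Rightarrow> real) \<Rightarrow> real" where
  "tensor N a x = (\<Prod>i<N. a i (x i))"

lemma tensor_split: "j < N \<Longrightarrow> tensor N a x = a j (x j) * (\<Prod>i\<in>{..<N} - {j}. a i (x i))"
  by (simp add: tensor_def prod.remove)

lemma tensor_DERIV:
  assumes "j < N" "smooth1 (a j)"
  shows "((\<lambda>t. tensor N a (x(j := t))) has_real_derivative tensor N (a(j := deriv (a j))) x) (at (x j))"
proof -
  have "tensor N a (x(j := t)) = a j t * (\<Prod>i\<in>{..<N} - {j}. a i (x i))" for t
    using assms(1) by (simp add: tensor_split) 
  moreover have "tensor N (a(j := deriv (a j))) x = deriv (a j) (x j) * (\<Prod>i\<in>{..<N} - {j}. a i (x i))"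
    using assms(1) by (simp add: tensor_split)
  ultimately show ?thesis
    using smooth1_deriv(1)[OF assms(2)] by (auto intro!: derivative_eq_intros)
qed

lemma tensor_pd: "j < N \<Longrightarrow> smooth1 (a j) \<Longrightarrow> pd j (tensor N a) = tensor N (a(j := deriv (a j)))"
  by (intro ext pd_eqI tensor_DERIV)

lemma tensor_cont:
  assumes "\<And>i. i < N \<Longrightarrow> smooth1 (a i)"
  shows "continuous_on UNIV (tensor N a)"
  unfolding tensor_def[abs_def]
  by (intro continuous_on_prod continuous_on_compose2[OF smooth1_cont[OF assms]])
    (auto intro: continuous_on_product_coordinates)

lemma smooth_tensor:
  assumes "\<And>i. i < N \<Longrightarrow> smooth1 (a i)"
  shows "smooth N (tensor N a)"
proof -
  have "Ck N k (tensor N a)" for k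
    using assms
  proof (induction k arbitrary: a)
    case 0
    then show ?case by (simp add: tensor_cont)
  next
    case (Suc k)
    show ?case
    proof (rule Ck_I[where \<phi>' = "\<lambda>j. tensor N (a(j := deriv (a j)))"])
      show "Ck N k (tensor N (a(j := deriv (a j))))" if "j < N" for j
        by (rule Suc.IH) (use Suc.prems smooth1_deriv that in simp)
      show "((\<lambda>t. tensor N a (x(j := t))) has_real_derivative tensor N (a(j := deriv (a j))) x) (at (x j))"
        if "j < N" for j x
        using that Suc.prems by (intro tensor_DERIV)
    qed (use Suc.prems in \<open>simp add: tensor_cont\<close>)
  qed
  then show ?thesis by (auto simp: smooth_def tensor_def intro!: depends_on_I prod.cong)
qed

lemma supp_in_tensor:
  assumes "\<And>i t. i < N \<Longrightarrow> \<bar>t\<bar> > R \<Longrightarrow> a i t = 0"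
  shows "supp_in N R (tensor N a)"
  using assms by (force simp: supp_in_def tensor_def)

lemma test_fun_tensor:
  assumes "\<And>i. i < N \<Longrightarrow> smooth1 (a i)" "\<And>i t. i < N \<Longrightarrow> \<bar>t\<bar> > R \<Longrightarrow> a i t = 0"
  shows "test_fun N (tensor N a)"
  using smooth_tensor[of N a] supp_in_tensor[of N R a] assms by (auto simp: test_fun_iff)

subsection \<open>Measurability and boundedness\<close>

lemma space_configM: "space (configM N) = PiE {..<N} (\<lambda>_. UNIV)"
  by (simp add: configM_def space_PiM)

lemma measurable_configM_component[measurable]: "i < N \<Longrightarrow> (\<lambda>x. x i) \<in> borel_measurable (configM N)"
  unfolding configM_def by (rule measurable_component_singleton[of i _ "\<lambda>_. lborel", simplified]) simp

text \<open>On the space of \<open>configM N\<close> every coordinate from \<open>N\<close> on is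
  the constant \<open>undefined\<close>, so inclusion into the full sequence space is measurable,
  and functions continuous on the latter become measurable for \<open>configM\<close>.\<close>

lemma measurable_configM_id: "(\<lambda>x. x) \<in> measurable (configM N) borel"
proof (rule measurable_coordinatewise_then_product)
  fix i show "(\<lambda>x. x i) \<in> borel_measurable (configM N)"
  proof (cases "i < N")
    case False
    then have eq: "x i = undefined" if "x \<in> space (configM N)" for x
      using that by (simp add: space_configM PiE_def extensional_def)
    have "(\<lambda>x. undefined) \<in> borel_measurable (configM N)" by (rule measurable_const) simp
    then show ?thesis by (subst measurable_cong[where g = "\<lambda>x. undefined"]) (simp_all add: eq)
  qed measurable
qed

lemma cont_measurable_configM: "continuous_on UNIV \<phi> \<Longrightarrow> \<phi> \<in> borel_measurable (configM N)"
  for \<phi> :: "(nat \<Rightarrow> real) \<Rightarrow> 'a::topological_space"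
  using measurable_compose[OF measurable_configM_id borel_measurable_continuous_onI] by simp

lemma smooth_measurable: "smooth N \<phi> \<Longrightarrow> \<phi> \<in> borel_measurable (configM M)"
  by (intro cont_measurable_configM smooth_cont)

interpretation PS: product_sigma_finite "\<lambda>_::nat. lborel :: real measure"
  by standard

lemma sigma_finite_configM: "sigma_finite_measure (configM N)"
  unfolding configM_def by (rule PS.sigma_finite) simp

definition cube :: "nat \<Rightarrow> real \<Rightarrow> (nat \<Rightarrow> real) set" where
  "cube N R = PiE {..<N} (\<lambda>_. {-R..R})"

lemma cube_sets[measurable]: "cube N R \<in> sets (configM N)"
  unfolding cube_def configM_def by (rule sets_PiM_I_finite) auto

lemma emeasure_cube: "emeasure (configM N) (cube N R) < \<infinity>"
  unfolding cube_def configM_def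
  by (subst PS.emeasure_PiM) (simp_all add: less_top[symmetric] power_eq_top_ennreal emeasure_lborel_Icc_eq)

text \<open>Tychonoff, after rewriting the cube as a product over all indices whose factors from
  \<open>N\<close> on are the singleton of \<open>undefined\<close>.\<close>

lemma compact_cube: "compact (cube N R)"
proof -
  have *: "cube N R = PiE UNIV (\<lambda>i. if i < N then {-R..R} else {undefined})"
    by (auto simp: cube_def PiE_def extensional_def Pi_def split: if_splits)
  have "compactin (product_topology (\<lambda>_. euclidean) UNIV) (PiE UNIV (\<lambda>i::nat. if i < N then {-R..R} else {undefined::real}))"
    unfolding compactin_PiE by auto
  then show ?thesis unfolding * euclidean_product_topology by simp
qed

lemma cont_supp_bounded:
  assumes "continuous_on UNIV \<phi>" "depends_on N \<phi>" "supp_in N R \<phi>"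
  shows "\<exists>C\<ge>0. \<forall>x. \<bar>\<phi> x\<bar> \<le> C"
proof -
  have "compact (\<phi> ` cube N R)"
    by (intro compact_continuous_image compact_cube continuous_on_subset[OF assms(1)]) auto
  then obtain C where C: "\<forall>y\<in>\<phi> ` cube N R. norm y \<le> C"
    using compact_imp_bounded bounded_iff by metis
  show ?thesis
  proof (intro exI[of _ "\<bar>C\<bar>"] conjI allI)
    fix x
    show "\<bar>\<phi> x\<bar> \<le> \<bar>C\<bar>"
    proof (cases "\<exists>j<N. \<bar>x j\<bar> > R")
      case False
      then have "restrict x {..<N} \<in> cube N R" by (force simp: cube_def)
      then have "norm (\<phi> (restrict x {..<N})) \<le> C" using C by auto
      then show ?thesis using assms(2) unfolding depends_on_def by (metis abs_ge_self order_trans real_norm_def)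
    qed (use assms(3) in \<open>simp add: supp_in_def\<close>)
  qed simp
qed

lemma test_fun_bounded: "test_fun N \<phi> \<Longrightarrow> \<exists>C\<ge>0. \<forall>x. \<bar>\<phi> x\<bar> \<le> C"
  using cont_supp_bounded[OF smooth_cont smooth_depends_on] by (auto simp: test_fun_iff)

lemma bounded_supp_integrable:
  fixes \<phi> :: "(nat \<Rightarrow> real) \<Rightarrow> real"
  assumes [measurable]: "\<phi> \<in> borel_measurable (configM N)" and "supp_in N R \<phi>" "\<And>x. \<bar>\<phi> x\<bar> \<le> C"
  shows "integrable (configM N) \<phi>"
proof (rule Bochner_Integration.integrable_bound)
  show "integrable (configM N) (\<lambda>x. C * indicator (cube N R) x)"
    by (intro integrable_mult_right integrable_real_indicator emeasure_cube cube_sets)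
  show "AE x in configM N. norm (\<phi> x) \<le> norm (C * indicator (cube N R) x)"
  proof (rule AE_I2)
    fix x assume x: "x \<in> space (configM N)"
    show "norm (\<phi> x) \<le> norm (C * indicator (cube N R) x)"
    proof (cases "x \<in> cube N R")
      case False
      then have "\<exists>j<N. \<bar>x j\<bar> > R" using x by (force simp: cube_def space_configM PiE_def)
      then show ?thesis using assms(2) by (simp add: supp_in_def)
    qed (use assms(3)[of x] in auto)
  qed
qed measurable

lemma test_fun_measurable: "test_fun N \<phi> \<Longrightarrow> \<phi> \<in> borel_measurable (configM M)"
  by (intro smooth_measurable test_fun_smooth)

lemma test_fun_integrable: "test_fun N \<phi> \<Longrightarrow> integrable (configM N) \<phi>"
  using test_fun_bounded[of N \<phi>] bounded_supp_integrable[OF test_fun_measurable, of N \<phi> N]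
  by (auto simp: test_fun_iff)

lemma test_fun_sq_int: "test_fun N \<phi> \<Longrightarrow> sq_int (configM N) \<phi>"
  using test_fun_integrable[OF test_fun_mult[OF _ test_fun_smooth, of N \<phi> \<phi>]]
  by (simp add: sq_int_def power2_eq_square test_fun_measurable)

subsection \<open>The regularized Coulomb potential\<close>

text \<open>For \<open>a >= 0\<close> this is the integral of \<open>exp (- t^2)\<close> from
  \<open>a\<close> to infinity, written as the complement of a finite integral so that the
  fundamental theorem of calculus gives its derivative.\<close>

definition gauss_tail :: "real \<Rightarrow> real" where
  "gauss_tail a = sqrt pi / 2 - integral {0..a} (\<lambda>t. exp (- t\<^sup>2))"

lemma gauss_half: "has_bochner_integral lborel (\<lambda>t::real. indicator {0..} t * exp (- t\<^sup>2)) (sqrt pi / 2)"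
  using gaussian_moment_0 by simp

lemma gauss_Icc:
  assumes "0 \<le> a"
  shows "(\<integral>t. indicator {..a} t *\<^sub>R (indicator {0..} t * exp (- t\<^sup>2)) \<partial>lborel) = integral {0..a} (\<lambda>t::real. exp (- t\<^sup>2))"
proof -
  have "set_integrable lborel {0..a} (\<lambda>t::real. exp (- t\<^sup>2))"
    by (rule borel_integrable_compact[of "{0..a}" "\<lambda>t. exp (- t\<^sup>2)", folded set_integrable_def])
      (auto intro!: continuous_intros)
  then have "integral {0..a} (\<lambda>t::real. exp (- t\<^sup>2)) = (LBINT t:{0..a}. exp (- t\<^sup>2))"
    by (simp add: set_borel_integral_eq_integral)
  also have "\<dots> = (\<integral>t. indicator {..a} t *\<^sub>R (indicator {0..} t * exp (- t\<^sup>2)) \<partial>lborel)"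
    unfolding set_lebesgue_integral_def by (intro Bochner_Integration.integral_cong) (auto split: split_indicator)
  finally show ?thesis by simp
qed

lemma gauss_tail_tendsto: "(gauss_tail \<longlongrightarrow> 0) at_top"
proof -
  have "((\<lambda>y. \<integral>t. indicator {..y} t *\<^sub>R (indicator {0..} t * exp (- t\<^sup>2)) \<partial>lborel) \<longlongrightarrow>
     (\<integral>t. indicator {0..} t * exp (- t\<^sup>2) \<partial>(lborel :: real measure))) at_top"
    by (rule tendsto_integral_at_top) (use gauss_half in \<open>auto simp: has_bochner_integral_iff\<close>)
  moreover have "\<forall>\<^sub>F y in at_top. (\<integral>t. indicator {..y} t *\<^sub>R (indicator {0..} t * exp (- t\<^sup>2)) \<partial>lborel)
      = integral {0..y} (\<lambda>t::real. exp (- t\<^sup>2))"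
    using eventually_ge_at_top[of 0] by eventually_elim (rule gauss_Icc)
  ultimately have "((\<lambda>y. integral {0..y} (\<lambda>t. exp (- t\<^sup>2))) \<longlongrightarrow>
     (\<integral>t. indicator {0..} t * exp (- t\<^sup>2) \<partial>(lborel :: real measure))) at_top"
    by (rule Lim_transform_eventually)
  also have "(\<integral>t. indicator {0..} t * exp (- t\<^sup>2) \<partial>(lborel :: real measure)) = sqrt pi / 2"
    using gauss_half by (simp add: has_bochner_integral_iff)
  finally have "((\<lambda>y. integral {0..y} (\<lambda>t. exp (- t\<^sup>2))) \<longlongrightarrow> sqrt pi / 2) at_top" .
  from tendsto_diff[OF tendsto_const[of "sqrt pi / 2"] this] show ?thesis
    unfolding gauss_tail_def[abs_def] by simp
qed

lemma gauss_tail_0: "gauss_tail 0 = sqrt pi / 2"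
  by (simp add: gauss_tail_def)

lemma gauss_tail_deriv:
  assumes "x > 0"
  shows "(gauss_tail has_real_derivative - exp (- x\<^sup>2)) (at x)"
proof -
  have "((\<lambda>u. integral {0..u} (\<lambda>t. exp (- t\<^sup>2))) has_real_derivative exp (- x\<^sup>2)) (at x within {0..x+1})"
    by (rule integral_has_real_derivative) (use assms in \<open>auto intro!: continuous_intros\<close>)
  moreover have "at x within {0..x+1} = at x"
    using assms by (intro at_within_interior) auto
  ultimately show ?thesis unfolding gauss_tail_def[abs_def] by (auto intro!: derivative_eq_intros)
qed

lemma gauss_tail_cont: "continuous_on {0..} gauss_tail"
proof -
  have "continuous_on {0..b} gauss_tail" for b
    unfolding gauss_tail_def[abs_def]
    by (intro continuous_intros indefinite_integral_continuous_1 integrable_continuous_real)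
  then have "continuous (at x within {0..}) gauss_tail" if "x \<ge> 0" for x
  proof -
    have "continuous (at x within {0..x+1}) gauss_tail"
      using that \<open>continuous_on {0..x+1} gauss_tail\<close> by (auto simp: continuous_on_eq_continuous_within)
    moreover have "at x within {0..x+1} = at x within {0..}"
      by (rule at_within_nhd[where S = "{..<x+1}"]) (use that in auto)
    ultimately show ?thesis by (simp add: continuous_within)
  qed
  then show ?thesis by (auto simp: continuous_on_eq_continuous_within)
qed

text \<open>Substitution \<open>u = t^2 - a^2\<close> with \<open>a = |x|\<close>: the root becomes
  \<open>t\<close> and cancels against \<open>du = 2 t dt\<close>.\<close>

lemma V0_eq: "V0 x = 2 * exp (x\<^sup>2) * gauss_tail \<bar>x\<bar>"
proof -
  define a where "a = \<bar>x\<bar>"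
  have a: "a \<ge> 0" by (simp add: a_def)
  define f where "f u = exp (- u) / sqrt (a\<^sup>2 + u)" for u
  define g where "g t = t\<^sup>2 - a\<^sup>2" for t :: real
  have gi: "set_integrable lborel {a<..} (\<lambda>t::real. 2 * exp (a\<^sup>2) * exp (- t\<^sup>2))"
  proof -
    have "integrable lborel (\<lambda>t. indicator {a<..} t *\<^sub>R ((2 * exp (a\<^sup>2)) * (indicator {0..} t * exp (- t\<^sup>2))))"
      using gauss_half by (intro integrable_mult_indicator integrable_mult_right) (auto simp: has_bochner_integral_iff)
    also have "(\<lambda>t. indicator {a<..} t *\<^sub>R ((2 * exp (a\<^sup>2)) * (indicator {0..} t * exp (- t\<^sup>2))))
       = (\<lambda>t. indicator {a<..} t *\<^sub>R (2 * exp (a\<^sup>2) * exp (- t\<^sup>2)))"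
      using a by (auto simp: fun_eq_iff split: split_indicator)
    finally show ?thesis by (simp add: set_integrable_def)
  qed
  have fg: "f (g t) * (2 * t) = 2 * exp (a\<^sup>2) * exp (- t\<^sup>2)" if "t > a" for t
    using that a by (simp add: f_def g_def exp_diff exp_minus real_sqrt_abs field_simps)
  have "(LBINT u=0..\<infinity>. f u) = (LBINT t=ereal a..\<infinity>. f (g t) * (2 * t))"
  proof (rule interval_integral_substitution_nonneg(2))
    show "ereal a < \<infinity>" by simp
    show "(g has_real_derivative 2 * t) (at t)" for t
      unfolding g_def[abs_def] by (auto intro!: derivative_eq_intros)
    show "isCont f (g t)" if "ereal a < ereal t" for t
    proof -
      have "t\<^sup>2 > 0" using that a by simp
      then show ?thesis unfolding f_def[abs_def] g_def by (intro continuous_intros) auto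
    qed
    show "isCont (\<lambda>t. 2 * t) t" for t :: real by (intro continuous_intros)
    show "0 \<le> f (g t)" for t by (simp add: f_def g_def)
    show "0 \<le> 2 * t" if "ereal a \<le> ereal t" for t using that a by simp
    show "((ereal \<circ> g \<circ> real_of_ereal) \<longlongrightarrow> 0) (at_right (ereal a))"
    proof -
      have "(g \<longlongrightarrow> g a) (at_right a)" unfolding g_def[abs_def] by (intro tendsto_intros)
      then have "((ereal \<circ> g) \<longlongrightarrow> ereal 0) (at_right a)" by (simp add: ereal_tendsto_simps g_def)
      then show ?thesis by (simp add: ereal_tendsto_simps zero_ereal_def)
    qed
    show "((ereal \<circ> g \<circ> real_of_ereal) \<longlongrightarrow> \<infinity>) (at_left \<infinity>)"
    proof -
      have "filterlim g at_top at_top" unfolding g_def[abs_def] by real_asymp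
      then have "((ereal \<circ> g) \<longlongrightarrow> \<infinity>) at_top" by (simp add: o_def tendsto_PInfty_eq_at_top)
      then show ?thesis by (simp add: ereal_tendsto_simps)
    qed
    have "set_integrable lborel {a<..} (\<lambda>t. f (g t) * (2 * t))"
      using gi by (rule set_integrable_cong[THEN iffD1, rotated -1]) (use fg in auto)
    then show "set_integrable lborel (einterval (ereal a) \<infinity>) (\<lambda>t. f (g t) * (2 * t))"
      by simp
  qed
  then have "V0 x = (LBINT t:{a<..}. f (g t) * (2 * t))"
    by (simp add: V0_def f_def a_def interval_lebesgue_integral_def zero_ereal_def)
  also have "\<dots> = (LBINT t:{a<..}. 2 * exp (a\<^sup>2) * exp (- t\<^sup>2))"
    by (intro set_lebesgue_integral_cong) (use fg in auto)
  also have "\<dots> = 2 * exp (a\<^sup>2) * (LBINT t:{a<..}. exp (- t\<^sup>2))" by simp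
  also have "(LBINT t:{a<..}. exp (- t\<^sup>2)) = gauss_tail a"
  proof -
    have i: "integrable lborel (\<lambda>t::real. indicator {0..} t * exp (- t\<^sup>2))"
      using gauss_half by (simp add: has_bochner_integral_iff)
    have "(LBINT t:{a<..}. exp (- t\<^sup>2)) =
       (\<integral>t. indicator {0..} t * exp (- t\<^sup>2) - indicator {..a} t *\<^sub>R (indicator {0..} t * exp (- t\<^sup>2)) \<partial>lborel)"
      unfolding set_lebesgue_integral_def using a
      by (intro Bochner_Integration.integral_cong) (auto split: split_indicator)
    also have "\<dots> = (\<integral>t. indicator {0..} t * exp (- t\<^sup>2) \<partial>(lborel :: real measure))
        - (\<integral>t. indicator {..a} t *\<^sub>R (indicator {0..} t * exp (- t\<^sup>2)) \<partial>lborel)"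
      by (intro Bochner_Integration.integral_diff integrable_mult_indicator i) simp
    also have "\<dots> = gauss_tail a"
      unfolding gauss_Icc[OF a] gauss_tail_def using gauss_half by (simp add: has_bochner_integral_iff)
    finally show ?thesis .
  qed
  finally show ?thesis by (simp add: a_def)
qed

text \<open>The numerator \<open>x\<^sup>2 + b - 1 - x s\<close> has the sign of \<open>(b - 2) x\<^sup>2 + (b - 1)\<^sup>2\<close>: it is
  nonnegative for \<open>b = 2\<close> and changes sign once, from plus to minus, for \<open>1 < b < 2\<close>.\<close>

lemma gauss_tail_compare_deriv:
  fixes x b :: real
  assumes x: "x > 0" and b: "b > 0"
  defines "s \<equiv> sqrt (x\<^sup>2 + b)"
  shows "((\<lambda>x. exp (- x\<^sup>2) / (x + sqrt (x\<^sup>2 + b)) - gauss_tail x) has_real_derivative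
      exp (- x\<^sup>2) * (x\<^sup>2 + b - 1 - x * s) / (s * (x + s))) (at x)"
proof -
  have s: "s > 0" "s\<^sup>2 = x\<^sup>2 + b" using x b by (auto simp: s_def add_nonneg_pos)
  have pos: "x\<^sup>2 + b > 0" using b by (simp add: add_nonneg_pos)
  have ds: "((\<lambda>x. sqrt (x\<^sup>2 + b)) has_real_derivative x / s) (at x)"
    using pos by (auto intro!: derivative_eq_intros simp: s_def field_simps)
  have de: "((\<lambda>x. exp (- x\<^sup>2)) has_real_derivative - 2 * x * exp (- x\<^sup>2)) (at x)"
    by (auto intro!: derivative_eq_intros)
  have "((\<lambda>x. exp (- x\<^sup>2) / (x + sqrt (x\<^sup>2 + b)) - gauss_tail x) has_real_derivative
     ((- 2 * x * exp (- x\<^sup>2)) * (x + s) - exp (- x\<^sup>2) * (1 + x / s)) / ((x + s) * (x + s)) - - exp (- x\<^sup>2)) (at x)"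
    unfolding s_def
    by (intro DERIV_diff DERIV_divide DERIV_add DERIV_ident gauss_tail_deriv x de ds[unfolded s_def])
      (use x s in \<open>unfold s_def, linarith\<close>)
  moreover have "((- 2 * x * exp (- x\<^sup>2)) * (x + s) - exp (- x\<^sup>2) * (1 + x / s)) / ((x + s) * (x + s)) - - exp (- x\<^sup>2)
     = exp (- x\<^sup>2) * (x\<^sup>2 + b - 1 - x * s) / (s * (x + s))"
  proof -
    define E where "E = exp (- x\<^sup>2)"
    have "x + s > 0" using x s by simp
    have "1 + x / s = (x + s) * (1 / s)" using s by (simp add: field_simps)
    then have "(- 2 * x * E) * (x + s) - E * (1 + x / s) = (E * (- 2 * x - 1 / s)) * (x + s)"
      by (simp only:) (simp add: algebra_simps)
    then have "((- 2 * x * E) * (x + s) - E * (1 + x / s)) / ((x + s) * (x + s)) = E * (- 2 * x - 1 / s) / (x + s)"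
      using \<open>x + s > 0\<close> by simp
    moreover have "E * (- 2 * x - 1 / s) / (x + s) + E = E * (s * s - 1 - x * s) / (s * (x + s))"
    proof -
      have "E * (- 2 * x - 1 / s) / (x + s) + E = (E * (- 2 * x - 1 / s) + E * (x + s)) / (x + s)"
        using \<open>x + s > 0\<close> by (simp add: add_divide_distrib)
      also have "E * (- 2 * x - 1 / s) + E * (x + s) = (E * (s * s - 1 - x * s)) / s"
        using s(1) by (simp add: field_simps)
      finally show ?thesis by simp
    qed
    ultimately show ?thesis using s(2) unfolding E_def[symmetric] by (simp add: power2_eq_square)
  qed
  ultimately show ?thesis by simp
qed

lemma gauss_tail_compare_cont:
  assumes "b > 0"
  shows "continuous_on {0..} (\<lambda>x. exp (- x\<^sup>2) / (x + sqrt (x\<^sup>2 + b)) - gauss_tail x)"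
proof -
  have "x + sqrt (x\<^sup>2 + b) \<noteq> 0" if "x \<in> {0..}" for x
    using that assms by (smt (verit) atLeast_iff real_sqrt_gt_zero zero_le_power2)
  then show ?thesis by (intro continuous_intros gauss_tail_cont) auto
qed

lemma gauss_tail_compare_tendsto:
  assumes "b > 0"
  shows "((\<lambda>x. exp (- x\<^sup>2) / (x + sqrt (x\<^sup>2 + b)) - gauss_tail x) \<longlongrightarrow> 0) at_top"
proof -
  have "((\<lambda>x. exp (- x\<^sup>2) / (x + sqrt (x\<^sup>2 + b))) \<longlongrightarrow> 0) at_top" using assms by real_asymp
  from tendsto_diff[OF this gauss_tail_tendsto] show ?thesis by simp
qed

text \<open>A classical bound on the Mills ratio. The comparison function \<open>D\<close> is
  nondecreasing and tends to 0 at infinity, so it is nonpositive. The value 2 is the one that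
  matches the second term of the expansion of \<open>V0\<close> at infinity.\<close>

lemma V0_lower: "2 / (\<bar>x\<bar> + sqrt (x\<^sup>2 + 2)) \<le> V0 x"
proof -
  define D where "D y = exp (- y\<^sup>2) / (y + sqrt (y\<^sup>2 + 2)) - gauss_tail y" for y
  have deriv: "\<exists>d. (D has_real_derivative d) (at y) \<and> d \<ge> 0" if "y > 0" for y
  proof -
    define s where "s = sqrt (y\<^sup>2 + 2)"
    have s: "s > 0" "s\<^sup>2 = y\<^sup>2 + 2" by (auto simp: s_def add_nonneg_pos)
    have "y * s \<le> y\<^sup>2 + 1"
    proof (rule power2_le_imp_le)
      show "(y * s)\<^sup>2 \<le> (y\<^sup>2 + 1)\<^sup>2" by (simp add: power_mult_distrib s(2)) (simp add: power2_eq_square algebra_simps)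
    qed simp
    then show ?thesis using gauss_tail_compare_deriv[OF that, of 2] that s(1)
      unfolding D_def[abs_def] s_def[symmetric] by (intro exI conjI) auto
  qed
  have mono: "D y \<le> D z" if "0 \<le> y" "y \<le> z" for y z
  proof (rule DERIV_nonneg_imp_increasing_open[OF that(2)])
    show "continuous_on {y..z} D"
      using gauss_tail_compare_cont[of 2] that unfolding D_def[abs_def] by (auto intro: continuous_on_subset)
  qed (use deriv that in auto)
  have "D \<bar>x\<bar> \<le> 0"
  proof (rule tendsto_lowerbound)
    show "(D \<longlongrightarrow> 0) at_top" unfolding D_def[abs_def] by (rule gauss_tail_compare_tendsto) simp
    show "\<forall>\<^sub>F y in at_top. D \<bar>x\<bar> \<le> D y"
      using eventually_ge_at_top[of "\<bar>x\<bar>"] by eventually_elim (auto intro: mono)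
  qed simp
  then have "exp (x\<^sup>2) * (exp (- x\<^sup>2) / (\<bar>x\<bar> + sqrt (x\<^sup>2 + 2))) \<le> exp (x\<^sup>2) * gauss_tail \<bar>x\<bar>"
    by (intro mult_left_mono) (auto simp: D_def)
  then show ?thesis by (simp add: V0_eq exp_minus)
qed

text \<open>Any constant strictly between 1 and \<open>4/\<pi>\<close> would do in place of \<open>5/4\<close>.\<close>

lemma V0_upper: "V0 x \<le> 2 / (\<bar>x\<bar> + sqrt (x\<^sup>2 + 5 / 4))"
proof -
  define D where "D y = exp (- y\<^sup>2) / (y + sqrt (y\<^sup>2 + 5 / 4)) - gauss_tail y" for y
  \<comment> \<open>For \<open>b = 5/4\<close> the expression \<open>(b - 2) y^2 + (b - 1)^2\<close>
    is \<open>1/16 - (3/4) y^2\<close>, which changes sign at \<open>y^2 = 1/12\<close>.\<close>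
  have deriv: "\<exists>d. (D has_real_derivative d) (at y) \<and> (y\<^sup>2 \<le> 1 / 12 \<longrightarrow> d \<ge> 0) \<and> (y\<^sup>2 \<ge> 1 / 12 \<longrightarrow> d \<le> 0)"
    if "y > 0" for y
  proof -
    define s where "s = sqrt (y\<^sup>2 + 5 / 4)"
    have s: "s > 0" "s\<^sup>2 = y\<^sup>2 + 5 / 4" by (auto simp: s_def add_nonneg_pos)
    have e: "(y\<^sup>2 + 1 / 4)\<^sup>2 - (y * s)\<^sup>2 = (1 / 12 - y\<^sup>2) * (3 / 4)"
      by (simp add: power_mult_distrib s(2)) (simp add: power2_eq_square algebra_simps)
    have 1: "y * s \<le> y\<^sup>2 + 1 / 4" if "y\<^sup>2 \<le> 1 / 12"
      by (rule power2_le_imp_le) (use e that in auto)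
    have 2: "y\<^sup>2 + 1 / 4 \<le> y * s" if "y\<^sup>2 \<ge> 1 / 12"
    proof (rule power2_le_imp_le)
      have "(1 / 12 - y\<^sup>2) * (3 / 4) \<le> 0" using that by simp
      then show "(y\<^sup>2 + 1 / 4)\<^sup>2 \<le> (y * s)\<^sup>2" using e by linarith
    qed (use \<open>y > 0\<close> s in simp)
    define d where "d = exp (- y\<^sup>2) * (y\<^sup>2 + 5 / 4 - 1 - y * s) / (s * (y + s))"
    have "(D has_real_derivative d) (at y)"
      using gauss_tail_compare_deriv[OF that, of "5/4"] unfolding D_def[abs_def] s_def[symmetric] d_def by simp
    moreover have "d \<ge> 0" if "y\<^sup>2 \<le> 1 / 12"
      using 1[OF that] \<open>y > 0\<close> s(1) by (simp add: d_def)
    moreover have "d \<le> 0" if "y\<^sup>2 \<ge> 1 / 12"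
      unfolding d_def using 2[OF that] \<open>y > 0\<close> s(1) by (intro divide_nonpos_pos mult_nonneg_nonpos) auto
    ultimately show ?thesis by blast
  qed
  have cont: "continuous_on {y..z} D" if "0 \<le> y" for y z
    using gauss_tail_compare_cont[of "5/4"] that unfolding D_def[abs_def] by (auto intro: continuous_on_subset)
  define r where "r = sqrt (1 / 12)"
  have r0: "r \<ge> 0" by (simp add: r_def)
  \<comment> \<open>At 0 the claim is an upper bound on pi, here \<open>16/5\<close>.\<close>
  have D0: "D 0 \<ge> 0"
  proof -
    have "sqrt pi / 2 \<le> 1 / sqrt (5 / 4)"
    proof (rule power2_le_imp_le)
      have "pi \<le> 16 / 5" using pi_less_4 pi_approx by simp
      then show "(sqrt pi / 2)\<^sup>2 \<le> (1 / sqrt (5 / 4))\<^sup>2" by (simp add: power_divide)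
    qed simp
    then show ?thesis by (simp add: D_def gauss_tail_0)
  qed
  \<comment> \<open>Up to \<open>r\<close> the function \<open>D\<close> rises from a nonnegative
    value; beyond \<open>r\<close> it falls towards its limit 0. It is nonnegative on both
    ranges.\<close>
  have "D \<bar>x\<bar> \<ge> 0"
  proof (cases "\<bar>x\<bar> \<le> r")
    case True
    have "D 0 \<le> D \<bar>x\<bar>"
    proof (rule DERIV_nonneg_imp_increasing_open[OF abs_ge_zero])
      fix y assume y: "0 < y" "y < \<bar>x\<bar>"
      then have "y\<^sup>2 \<le> r\<^sup>2" using True by (intro power_mono) auto
      then show "\<exists>d. DERIV D y :> d \<and> 0 \<le> d" using deriv[OF y(1)] by (auto simp: r_def)
    qed (auto intro: cont)
    then show ?thesis using D0 by simp
  next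
    case False
    show ?thesis
    proof (rule tendsto_upperbound)
      show "(D \<longlongrightarrow> 0) at_top" unfolding D_def[abs_def] by (rule gauss_tail_compare_tendsto) simp
      show "\<forall>\<^sub>F z in at_top. D z \<le> D \<bar>x\<bar>"
        using eventually_ge_at_top[of "\<bar>x\<bar>"]
      proof eventually_elim
        case (elim z)
        show ?case
        proof (rule DERIV_nonpos_imp_decreasing_open[OF elim])
          fix y assume y: "\<bar>x\<bar> < y" "y < z"
          then have "r\<^sup>2 \<le> y\<^sup>2" using False r0 by (intro power_mono) auto
          then have "y\<^sup>2 \<ge> 1 / 12" by (simp add: r_def)
          moreover have "y > 0" using y(1) by linarith
          ultimately show "\<exists>d. DERIV D y :> d \<and> d \<le> 0" using deriv[of y] by blast
        qed (auto intro: cont)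
      qed
    qed simp
  qed
  then have "exp (x\<^sup>2) * gauss_tail \<bar>x\<bar> \<le> exp (x\<^sup>2) * (exp (- x\<^sup>2) / (\<bar>x\<bar> + sqrt (x\<^sup>2 + 5 / 4)))"
    by (intro mult_left_mono) (auto simp: D_def)
  then show ?thesis by (simp add: V0_eq exp_minus)
qed

lemma V0_cont: "continuous_on UNIV V0"
proof -
  have "continuous_on UNIV (\<lambda>x. 2 * exp (x\<^sup>2) * gauss_tail \<bar>x\<bar>)"
    by (intro continuous_intros continuous_on_compose2[OF gauss_tail_cont]) auto
  then show ?thesis by (simp add: V0_eq[abs_def])
qed

lemma V0_pos: "V0 x > 0"
  by (rule less_le_trans[OF _ V0_lower]) (auto intro!: divide_pos_pos add_nonneg_pos)

lemma V0_le_2: "V0 x \<le> 2"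
proof -
  have "1 \<le> \<bar>x\<bar> + sqrt (x\<^sup>2 + 5 / 4)"
  proof (rule add_increasing)
    have "1 \<le> x\<^sup>2 + 5 / 4" using zero_le_power2[of x] by linarith
    then show "1 \<le> sqrt (x\<^sup>2 + 5 / 4)" by simp
  qed simp
  then have "2 / (\<bar>x\<bar> + sqrt (x\<^sup>2 + 5 / 4)) \<le> 2" by (simp add: divide_le_eq)
  then show ?thesis using V0_upper[of x] by simp
qed

subsection \<open>The weight function\<close>

text \<open>A smooth convex function squeezed between \<open>1/(\<surd>2 V\<^sub>0(\<surd>2 x))\<close> and \<open>1/V\<^sub>0(x)\<close>. The latter
  would be the natural choice, but it has a kink at 0.\<close>

definition weight :: "real \<Rightarrow> real" where
  "weight x = (sqrt (x\<^sup>2 + 1 / 100) + sqrt (x\<^sup>2 + 1)) / 2"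

lemma weight_ge_half: "1 / 2 \<le> weight x"
proof -
  have "0 + 1 \<le> sqrt (x\<^sup>2 + 1 / 100) + sqrt (x\<^sup>2 + 1)" by (rule add_mono) auto
  then show ?thesis unfolding weight_def by simp
qed

lemma weight_le: "weight x \<le> \<bar>x\<bar> + 1"
proof -
  have "sqrt (x\<^sup>2 + 1) \<le> \<bar>x\<bar> + 1"
    by (rule real_le_lsqrt) (auto simp: power2_sum)
  moreover have "sqrt (x\<^sup>2 + 1 / 100) \<le> sqrt (x\<^sup>2 + 1)" by simp
  ultimately have "sqrt (x\<^sup>2 + 1 / 100) + sqrt (x\<^sup>2 + 1) \<le> (\<bar>x\<bar> + 1) + (\<bar>x\<bar> + 1)" by linarith
  then show ?thesis unfolding weight_def by simp
qed

text \<open>With \<open>a = |x|\<close> this reduces to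
  \<open>sqrt (a^2 + 1/100) - a <= sqrt (a^2 + 5/4) - sqrt (a^2 + 1)\<close>. By conjugates the
  sides are fractions with numerators 1/100 and 1/4, and the factor 25 between these beats the ratio
  of the denominators even at \<open>a = 0\<close>. The rounding by 1/100 is thus paid for by the
  gap between 1 and 5/4.\<close>

lemma weight_V0_le: "weight x * V0 x \<le> 1"
proof -
  define a where "a = \<bar>x\<bar>"
  have a: "a \<ge> 0" "x\<^sup>2 = a\<^sup>2" by (auto simp: a_def)
  define p q r where "p = sqrt (a\<^sup>2 + 1 / 100)" and "q = sqrt (a\<^sup>2 + 1)" and "r = sqrt (a\<^sup>2 + 5 / 4)"
  have pqr2: "p\<^sup>2 = a\<^sup>2 + 1 / 100" "q\<^sup>2 = a\<^sup>2 + 1" "r\<^sup>2 = a\<^sup>2 + 5 / 4"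
    by (simp_all add: p_def q_def r_def add_nonneg_nonneg)
  have p: "p \<ge> 1 / 10" "p \<ge> a" unfolding p_def by (rule real_le_rsqrt; simp add: power_divide)+
  have q: "q \<ge> 1" "q \<le> a + 1" unfolding q_def using a
    by (auto intro!: real_le_lsqrt simp: power2_sum)
  have r: "r > 0" "r \<le> a + 6 / 5" unfolding r_def using a
    by (auto intro!: real_le_lsqrt add_nonneg_pos simp: power2_sum power_divide)
  have "p - a \<le> r - q"
  proof -
    have "(p - a) * (p + a) = 1 / 100" using pqr2(1) by (simp add: power2_eq_square algebra_simps)
    then have 1: "p - a = (1 / 100) / (p + a)" using p a by (subst eq_divide_eq) auto
    have "(r - q) * (r + q) = 1 / 4" using pqr2 by (simp add: power2_eq_square algebra_simps)
    then have 2: "r - q = (1 / 4) / (r + q)" using q r by (subst eq_divide_eq) auto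
    have "r + q \<le> 25 * (p + a)" using p q r a by simp
    then have "(1 / 4) / (25 * (p + a)) \<le> (1 / 4) / (r + q)" using p q r a by (intro divide_left_mono) auto
    then show ?thesis unfolding 1 2 by simp
  qed
  then have "weight x \<le> (\<bar>x\<bar> + sqrt (x\<^sup>2 + 5 / 4)) / 2"
    unfolding weight_def by (simp add: p_def q_def r_def a(2)[symmetric] a_def[symmetric])
  then have "weight x * V0 x \<le> (\<bar>x\<bar> + sqrt (x\<^sup>2 + 5 / 4)) / 2 * (2 / (\<bar>x\<bar> + sqrt (x\<^sup>2 + 5 / 4)))"
    using V0_upper[of x] V0_pos[of x] weight_ge_half[of x] by (intro mult_mono) auto
  also have "\<dots> = 1"
  proof -
    have "\<bar>x\<bar> + sqrt (x\<^sup>2 + 5 / 4) > 0" by (intro add_nonneg_pos) (auto intro: add_nonneg_pos)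
    then show ?thesis by simp
  qed
  finally show ?thesis .
qed

text \<open>Triangle inequality in the plane for the vectors \<open>(x, c)\<close> and
  \<open>(- y, c)\<close>.\<close>

lemma sqrt_minkowski2: "sqrt ((x - y)\<^sup>2 + (2 * c)\<^sup>2) \<le> sqrt (x\<^sup>2 + c\<^sup>2) + sqrt (y\<^sup>2 + c\<^sup>2)"
  using real_sqrt_sum_squares_triangle_ineq[of x "- y" c c] by (simp only: diff_conv_add_uminus mult_2 power2_minus)

text \<open>For \<open>d = |x - y|\<close>, Minkowski's inequality bounds the two terms with
  constant 1 below by \<open>sqrt (d^2 + 4)\<close>, and the two terms with constant 1/100 by
  \<open>d\<close>. Together they match the lower bound of \<open>V0\<close> at
  \<open>d / sqrt 2\<close>, which after multiplication by \<open>1 / sqrt 2\<close> reads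
  \<open>2 / (d + sqrt (d^2 + 4))\<close>.\<close>

lemma weight_pair_ge: "1 \<le> (weight x + weight y) * ((1 / sqrt 2) * V0 (\<bar>x - y\<bar> / sqrt 2))"
proof -
  define d where "d = \<bar>x - y\<bar>"
  have "sqrt ((x - y)\<^sup>2 + (2 * (1 / 10))\<^sup>2) \<le> sqrt (x\<^sup>2 + (1 / 10)\<^sup>2) + sqrt (y\<^sup>2 + (1 / 10)\<^sup>2)"
    by (rule sqrt_minkowski2)
  moreover have "d \<le> sqrt ((x - y)\<^sup>2 + (2 * (1 / 10))\<^sup>2)" unfolding d_def
    by (intro real_le_rsqrt) auto
  moreover have "sqrt (d\<^sup>2 + 4) \<le> sqrt (x\<^sup>2 + 1) + sqrt (y\<^sup>2 + 1)"
    using sqrt_minkowski2[of x y 1] by (simp add: d_def)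
  moreover have "2 * (weight x + weight y) = ((sqrt (x\<^sup>2 + (1 / 10)\<^sup>2) + sqrt (y\<^sup>2 + (1 / 10)\<^sup>2)) + (sqrt (x\<^sup>2 + 1) + sqrt (y\<^sup>2 + 1)))"
    unfolding weight_def by (simp add: power_divide field_simps)
  ultimately have "d + sqrt (d\<^sup>2 + 4) \<le> 2 * (weight x + weight y)"
    by linarith
  then have 1: "(d + sqrt (d\<^sup>2 + 4)) / 2 \<le> weight x + weight y" by simp
  have "sqrt 2 * (d / sqrt 2 + sqrt ((d / sqrt 2)\<^sup>2 + 2)) = d + sqrt (d\<^sup>2 + 4)"
    by (simp add: distrib_left power_divide flip: real_sqrt_mult) 
  then have "2 / (d + sqrt (d\<^sup>2 + 4)) = (1 / sqrt 2) * (2 / (\<bar>d / sqrt 2\<bar> + sqrt ((d / sqrt 2)\<^sup>2 + 2)))"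
    by (simp add: d_def)
  also have "\<dots> \<le> (1 / sqrt 2) * V0 (d / sqrt 2)" by (intro mult_left_mono V0_lower) auto
  finally have 2: "2 / (d + sqrt (d\<^sup>2 + 4)) \<le> (1 / sqrt 2) * V0 (d / sqrt 2)" .
  have pos: "d + sqrt (d\<^sup>2 + 4) > 0" unfolding d_def by (intro add_nonneg_pos) (auto intro: add_nonneg_pos)
  have "1 = (d + sqrt (d\<^sup>2 + 4)) / 2 * (2 / (d + sqrt (d\<^sup>2 + 4)))" using pos by simp
  also have "\<dots> \<le> (weight x + weight y) * ((1 / sqrt 2) * V0 (d / sqrt 2))"
    using pos 1 2 weight_ge_half[of x] weight_ge_half[of y] by (intro mult_mono) auto
  finally show ?thesis by (simp add: d_def)
qed

text \<open>The IMS identity weights by a square, so the derivative that enters the final bound is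
  that of the square root. The form \<open>powr\<close> is the one covered by
  \<open>smooth1_powr\<close>.\<close>

definition sqrt_weight :: "real \<Rightarrow> real" where
  "sqrt_weight x = weight x powr (1 / 2)"

lemma smooth1_weight: "smooth1 weight"
proof -
  have p: "x\<^sup>2 + c > 0" if "c > 0" for x c :: real using that by (simp add: add_nonneg_pos)
  have "smooth1 (\<lambda>x. (1 / 2) * ((x\<^sup>2 + 1 / 100) powr (1 / 2) + (x\<^sup>2 + 1) powr (1 / 2)))"
    by (intro smooth1_intros smooth1_powr p) auto
  moreover have "(\<lambda>x. (1 / 2) * ((x\<^sup>2 + 1 / 100) powr (1 / 2) + (x\<^sup>2 + 1) powr (1 / 2))) = weight"
    by (rule ext) (simp add: weight_def powr_half_sqrt add_nonneg_nonneg)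
  ultimately show ?thesis by (simp only:)
qed

lemma smooth1_sqrt_weight: "smooth1 sqrt_weight"
  unfolding sqrt_weight_def[abs_def] by (intro smooth1_powr smooth1_weight) (use weight_ge_half in \<open>smt (verit) field_sum_of_halves\<close>)

lemma weight_pos: "weight x > 0" using weight_ge_half[of x] by simp

lemma sqrt_weight_sq: "(sqrt_weight x)\<^sup>2 = weight x"
  using weight_pos[of x] by (simp add: sqrt_weight_def powr_half_sqrt)

text \<open>The derivative of \<open>weight\<close> is an average of two terms
  \<open>x / sqrt (x^2 + c)\<close>, hence at most 1 in modulus, and it equals
  \<open>2 * sqrt_weight\<close> times the derivative of \<open>sqrt_weight\<close>. The lower bound
  1/2 on \<open>weight\<close> does the rest.\<close>

lemma sqrt_weight_deriv_sq: "(deriv sqrt_weight x)\<^sup>2 \<le> 1 / 2"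
proof -
  have p: "x\<^sup>2 + c > 0" if "c > 0" for c :: real using that by (simp add: add_nonneg_pos)
  define d where "d = (x / sqrt (x\<^sup>2 + 1 / 100) + x / sqrt (x\<^sup>2 + 1)) / 2"
  have dwt: "(weight has_real_derivative d) (at x)"
    unfolding weight_def[abs_def] d_def using p[of "1/100"] p[of 1]
    by (auto intro!: derivative_eq_intros simp: field_simps)
  have b: "\<bar>x / sqrt (x\<^sup>2 + c)\<bar> \<le> 1" if "c > 0" for c
  proof -
    have "\<bar>x\<bar> \<le> sqrt (x\<^sup>2 + c)" using that by (intro real_le_rsqrt) auto
    then show ?thesis using p[OF that] by (simp add: abs_divide)
  qed
  have d1: "\<bar>d\<bar> \<le> 1"
  proof -
    define p q where "p = x / sqrt (x\<^sup>2 + 1 / 100)" and "q = x / sqrt (x\<^sup>2 + 1)"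
    have "\<bar>p\<bar> \<le> 1" "\<bar>q\<bar> \<le> 1" unfolding p_def q_def by (rule b; simp)+
    then show ?thesis unfolding d_def p_def[symmetric] q_def[symmetric] by (auto simp: abs_le_iff)
  qed
  have "(sqrt_weight has_real_derivative deriv sqrt_weight x) (at x)" by (rule smooth1_deriv[OF smooth1_sqrt_weight])
  then have "((\<lambda>x. (sqrt_weight x)\<^sup>2) has_real_derivative 2 * sqrt_weight x * deriv sqrt_weight x) (at x)"
    by (auto intro!: derivative_eq_intros)
  then have "2 * sqrt_weight x * deriv sqrt_weight x = d" unfolding sqrt_weight_sq using dwt by (rule DERIV_unique)
  then have "(2 * sqrt_weight x * deriv sqrt_weight x)\<^sup>2 \<le> 1" using d1 by (simp add: abs_square_le_1)
  then have "4 * weight x * (deriv sqrt_weight x)\<^sup>2 \<le> 1" by (simp add: power_mult_distrib sqrt_weight_sq)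
  moreover have "2 * (deriv sqrt_weight x)\<^sup>2 \<le> 4 * weight x * (deriv sqrt_weight x)\<^sup>2"
    using weight_ge_half[of x] by (intro mult_right_mono) auto
  ultimately show ?thesis by simp
qed

subsection \<open>Integration by parts\<close>

lemma configM_insert:
  assumes "j < N"
  shows "configM N = PiM (insert j ({..<N} - {j})) (\<lambda>_. lborel)"
  using assms by (simp add: configM_def insert_absorb)

lemma integral_lborel_deriv_zero:
  fixes F F' :: "real \<Rightarrow> real"
  assumes D: "\<And>t. (F has_real_derivative F' t) (at t)" and c: "continuous_on UNIV F'"
    and F0: "\<And>t. \<bar>t\<bar> > R \<Longrightarrow> F t = 0" and F'0: "\<And>t. \<bar>t\<bar> > R \<Longrightarrow> F' t = 0"
  shows "(\<integral>t. F' t \<partial>lborel) = 0"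
proof -
  define r where "r = \<bar>R\<bar> + 1"
  have r: "r > 0" "\<And>t. \<bar>t\<bar> \<ge> r \<Longrightarrow> \<bar>t\<bar> > R" by (auto simp: r_def)
  have "F' t = indicator {- r..r} t *\<^sub>R F' t" for t
    using F'0[of t] r(2)[of t] by (auto split: split_indicator)
  then have "(\<integral>t. F' t \<partial>lborel) = (\<integral>t. indicator {- r..r} t *\<^sub>R F' t \<partial>lborel)" by metis
  also have "\<dots> = F r - F (- r)"
  proof (rule integral_FTC_atLeastAtMost)
    show "(F has_vector_derivative F' x) (at x within {- r..r})" for x
      using D[of x] by (simp add: has_real_derivative_iff_has_vector_derivative has_vector_derivative_at_within)
  qed (use r c in \<open>auto intro: continuous_on_subset\<close>)
  also have "\<dots> = 0"
  proof -
    have "\<bar>r\<bar> > R" "\<bar>- r\<bar> > R" by (simp_all add: r_def)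
    then show ?thesis by (simp only: F0 diff_self)
  qed
  finally show ?thesis .
qed

text \<open>Fubini with coordinate \<open>j\<close> innermost: the inner integral is that of the
  derivative of a compactly supported function of one variable.\<close>

lemma integral_pd_zero:
  assumes F: "test_fun N F" and j: "j < N"
  shows "(\<integral>x. pd j F x \<partial>configM N) = 0"
proof -
  obtain R where R: "supp_in N R F" using F by (auto simp: test_fun_iff)
  have s: "smooth N F" using F by (rule test_fun_smooth)
  have s': "smooth N (pd j F)" using s j by (rule smooth_pd)
  have i: "integrable (configM N) (pd j F)" by (intro test_fun_integrable test_fun_pd F j)
  have "(\<integral>x. pd j F x \<partial>configM N)
      = (\<integral>x. (\<integral>t. pd j F (x(j := t)) \<partial>lborel) \<partial>PiM ({..<N} - {j}) (\<lambda>_. lborel))"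
    unfolding configM_insert[OF j]
    by (rule PS.product_integral_insert) (use i in \<open>simp_all only: configM_insert[OF j], simp_all\<close>)
  also have "\<dots> = (\<integral>x. 0 \<partial>PiM ({..<N} - {j}) (\<lambda>_. lborel :: real measure))"
  proof (intro Bochner_Integration.integral_cong refl)
    fix x :: "nat \<Rightarrow> real"
    show "(\<integral>t. pd j F (x(j := t)) \<partial>lborel) = 0"
    proof (rule integral_lborel_deriv_zero)
      show "((\<lambda>t. F (x(j := t))) has_real_derivative pd j F (x(j := t))) (at t)" for t
        using s j by (rule smooth_DERIV)
      show "continuous_on UNIV (\<lambda>t. pd j F (x(j := t)))"
        using continuous_on_compose2[OF smooth_cont[OF s'] continuous_on_upd2] by simp
      show "F (x(j := t)) = 0" if "\<bar>t\<bar> > R" for t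
        using R j that unfolding supp_in_def by (metis fun_upd_same)
      show "pd j F (x(j := t)) = 0" if "\<bar>t\<bar> > R" for t
        using supp_in_pd[OF R, of j] j that unfolding supp_in_def by (metis fun_upd_same)
    qed
  qed
  finally show ?thesis by simp
qed

lemma integral_by_parts:
  assumes "test_fun N \<phi>" "smooth N \<psi>" "j < N"
  shows "(\<integral>x. pd j \<phi> x * \<psi> x \<partial>configM N) = - (\<integral>x. \<phi> x * pd j \<psi> x \<partial>configM N)"
proof -
  have "0 = (\<integral>x. pd j (\<lambda>x. \<phi> x * \<psi> x) x \<partial>configM N)"
    using integral_pd_zero[OF test_fun_mult] assms by simp
  also have "\<dots> = (\<integral>x. pd j \<phi> x * \<psi> x + \<phi> x * pd j \<psi> x \<partial>configM N)"
    using pd_mult[OF test_fun_smooth[OF assms(1)] assms(2,3)] by simp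
  also have "\<dots> = (\<integral>x. pd j \<phi> x * \<psi> x \<partial>configM N) + (\<integral>x. \<phi> x * pd j \<psi> x \<partial>configM N)"
    using assms by (intro Bochner_Integration.integral_add test_fun_integrable test_fun_mult test_fun_pd smooth_pd)
  finally show ?thesis by simp
qed

subsection \<open>The operator on test functions\<close>

definition laplacian :: "nat \<Rightarrow> ((nat \<Rightarrow> real) \<Rightarrow> real) \<Rightarrow> (nat \<Rightarrow> real) \<Rightarrow> real" where
  "laplacian N \<phi> x = (\<Sum>j<N. pd j (pd j \<phi>) x)"

definition hamiltonian :: "nat \<Rightarrow> real \<Rightarrow> real \<Rightarrow> ((nat \<Rightarrow> real) \<Rightarrow> real) \<Rightarrow> (nat \<Rightarrow> real) \<Rightarrow> real" where
  "hamiltonian N Z M \<phi> x = - (1 / M) * laplacian N \<phi> x + Wpot N Z x * \<phi> x"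

definition energy_form :: "nat \<Rightarrow> real \<Rightarrow> real \<Rightarrow> ((nat \<Rightarrow> real) \<Rightarrow> real) \<Rightarrow> real" where
  "energy_form N Z M \<phi> = (\<integral>x. \<phi> x * hamiltonian N Z M \<phi> x \<partial>configM N)"

lemma cont_comp: "continuous_on UNIV (\<lambda>x::nat \<Rightarrow> real. x i)"
  by (rule continuous_on_product_coordinates)

lemma Wpot_cont: "continuous_on UNIV (Wpot N Z)"
  unfolding Wpot_def[abs_def]
  by (intro continuous_intros continuous_on_compose2[OF V0_cont] cont_comp) auto

lemma Wpot_depends_on: "depends_on N (Wpot N Z)"
  unfolding Wpot_def[abs_def] by (rule depends_on_I) (auto intro!: sum.cong arg_cong2[where f = "(+)"])

lemma Wpot_measurable[measurable]: "Wpot N Z \<in> borel_measurable (configM M)"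
  by (intro cont_measurable_configM Wpot_cont)

lemma Wpot_bounded: "\<exists>C\<ge>0. \<forall>x. \<bar>Wpot N Z x\<bar> \<le> C"
proof (intro exI conjI allI)
  fix x
  have V: "\<bar>V0 y\<bar> \<le> 2" for y using V0_pos[of y] V0_le_2[of y] by simp
  have "\<bar>Wpot N Z x\<bar> \<le> \<bar>\<Sum>j<N. - Z * V0 (x j)\<bar> + \<bar>\<Sum>j<N. \<Sum>k\<in>{j<..<N}. (1 / sqrt 2) * V0 (\<bar>x j - x k\<bar> / sqrt 2)\<bar>"
    unfolding Wpot_def by (rule abs_triangle_ineq)
  also have "\<dots> \<le> (\<Sum>j<N. \<bar>- Z * V0 (x j)\<bar>) + (\<Sum>j<N. \<Sum>k\<in>{j<..<N}. \<bar>(1 / sqrt 2) * V0 (\<bar>x j - x k\<bar> / sqrt 2)\<bar>)"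
    by (intro add_mono order_trans[OF sum_abs sum_mono] sum_abs order_refl)
  also have "\<dots> \<le> (\<Sum>j<N. \<bar>Z\<bar> * 2) + (\<Sum>j<N. \<Sum>k\<in>{j<..<N}. (1 / sqrt 2) * 2)"
    unfolding abs_mult by (intro add_mono sum_mono mult_mono V) auto
  finally show "\<bar>Wpot N Z x\<bar> \<le> (\<Sum>j<N. \<bar>Z\<bar> * 2) + (\<Sum>j<N. \<Sum>k\<in>{j<..<N}. (1 / sqrt 2) * 2)" .
qed (auto intro!: sum_nonneg add_nonneg_nonneg)

lemma sq_int_Wpot_mult: "sq_int (configM N) f \<Longrightarrow> sq_int (configM N) (\<lambda>x. Wpot N Z x * f x)"
  using Wpot_bounded[of N Z] by (auto intro: sq_int_mult_bounded)

lemma test_fun_sum: "(\<And>i. i \<in> I \<Longrightarrow> test_fun N (f i)) \<Longrightarrow> test_fun N (\<lambda>x. \<Sum>i\<in>I. f i x)"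
  by (induction I rule: infinite_finite_induct) (auto intro: test_fun_zero test_fun_add)

lemma test_fun_laplacian: "test_fun N \<phi> \<Longrightarrow> test_fun N (laplacian N \<phi>)"
  unfolding laplacian_def[abs_def] by (intro test_fun_sum test_fun_pd) auto

lemma sq_int_hamiltonian: "test_fun N \<phi> \<Longrightarrow> sq_int (configM N) (hamiltonian N Z M \<phi>)"
  unfolding hamiltonian_def[abs_def] by (intro sq_int_intros sq_int_Wpot_mult test_fun_sq_int test_fun_laplacian)

lemma laplacian_add: "smooth N \<phi> \<Longrightarrow> smooth N \<psi> \<Longrightarrow> laplacian N (\<lambda>x. \<phi> x + \<psi> x) x = laplacian N \<phi> x + laplacian N \<psi> x"
  unfolding laplacian_def by (simp add: pd_add[of N] smooth_pd sum.distrib)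

lemma laplacian_cmult: "smooth N \<phi> \<Longrightarrow> laplacian N (\<lambda>x. c * \<phi> x) x = c * laplacian N \<phi> x"
  unfolding laplacian_def by (simp add: pd_cmult[of N] smooth_pd sum_distrib_left)

lemma hamiltonian_add: "smooth N \<phi> \<Longrightarrow> smooth N \<psi> \<Longrightarrow> hamiltonian N Z M (\<lambda>x. \<phi> x + \<psi> x) x = hamiltonian N Z M \<phi> x + hamiltonian N Z M \<psi> x"
  unfolding hamiltonian_def by (simp add: laplacian_add add_divide_distrib) (simp add: algebra_simps)

lemma hamiltonian_cmult: "smooth N \<phi> \<Longrightarrow> hamiltonian N Z M (\<lambda>x. c * \<phi> x) x = c * hamiltonian N Z M \<phi> x"
  unfolding hamiltonian_def by (simp add: laplacian_cmult) (simp add: algebra_simps)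

lemma laplacian_symmetric:
  assumes "test_fun N \<phi>" "test_fun N \<psi>"
  shows "(\<integral>x. laplacian N \<phi> x * \<psi> x \<partial>configM N) = (\<integral>x. \<phi> x * laplacian N \<psi> x \<partial>configM N)"
proof -
  have s: "smooth N \<phi>" "smooth N \<psi>" using assms by (auto intro: test_fun_smooth)
  have "(\<integral>x. laplacian N \<phi> x * \<psi> x \<partial>configM N) = (\<Sum>j<N. \<integral>x. pd j (pd j \<phi>) x * \<psi> x \<partial>configM N)"
    unfolding laplacian_def sum_distrib_right using assms s
    by (intro Bochner_Integration.integral_sum test_fun_integrable test_fun_mult test_fun_pd) auto
  also have "\<dots> = (\<Sum>j<N. \<integral>x. \<phi> x * pd j (pd j \<psi>) x \<partial>configM N)"
    using assms s by (intro sum.cong refl) (simp add: integral_by_parts test_fun_pd smooth_pd)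
  also have "\<dots> = (\<integral>x. \<phi> x * laplacian N \<psi> x \<partial>configM N)"
    unfolding laplacian_def sum_distrib_left using assms s
    by (intro Bochner_Integration.integral_sum[symmetric] test_fun_integrable test_fun_mult smooth_pd) auto
  finally show ?thesis .
qed

lemma hamiltonian_symmetric:
  assumes "test_fun N \<phi>" "test_fun N \<psi>"
  shows "l2_inner (configM N) (hamiltonian N Z M \<phi>) \<psi> = l2_inner (configM N) \<phi> (hamiltonian N Z M \<psi>)"
proof -
  have i: "integrable (configM N) (\<lambda>x. laplacian N \<phi> x * \<psi> x)" "integrable (configM N) (\<lambda>x. \<phi> x * laplacian N \<psi> x)"
    "integrable (configM N) (\<lambda>x. Wpot N Z x * \<phi> x * \<psi> x)"
    using assms by (auto intro!: sq_int_real_mult_integrable sq_int_Wpot_mult intro: test_fun_sq_int test_fun_laplacian)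
  have "l2_inner (configM N) (hamiltonian N Z M \<phi>) \<psi> = (\<integral>x. - (1 / M) * (laplacian N \<phi> x * \<psi> x) + Wpot N Z x * \<phi> x * \<psi> x \<partial>configM N)"
    unfolding l2_inner_def hamiltonian_def by (simp add: algebra_simps)
  also have "\<dots> = - (1 / M) * (\<integral>x. laplacian N \<phi> x * \<psi> x \<partial>configM N) + (\<integral>x. Wpot N Z x * \<phi> x * \<psi> x \<partial>configM N)"
    using i by (simp del: mult_minus_left)
  also have "\<dots> = (\<integral>x. - (1 / M) * (\<phi> x * laplacian N \<psi> x) + Wpot N Z x * \<phi> x * \<psi> x \<partial>configM N)"
    using i by (simp add: laplacian_symmetric[OF assms] del: mult_minus_left)
  also have "\<dots> = l2_inner (configM N) \<phi> (hamiltonian N Z M \<psi>)"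
    unfolding l2_inner_def hamiltonian_def by (simp add: algebra_simps)
  finally show ?thesis .
qed

lemma energy_form_l2_inner: "energy_form N Z M \<phi> = l2_inner (configM N) \<phi> (hamiltonian N Z M \<phi>)"
  by (simp add: energy_form_def l2_inner_def)

lemma integral_second_pd_le:
  assumes "test_fun N \<phi>" "j < N"
  shows "(\<integral>x. \<phi> x * pd j (pd j \<phi>) x \<partial>configM N) \<le> 0"
proof -
  have "(\<integral>x. \<phi> x * pd j (pd j \<phi>) x \<partial>configM N) = - (\<integral>x. pd j \<phi> x * pd j \<phi> x \<partial>configM N)"
    using integral_by_parts[of N \<phi> "pd j \<phi>" j] assms by (simp add: smooth_pd test_fun_smooth)
  also have "\<dots> \<le> 0" by simp
  finally show ?thesis .
qed

lemma energy_form_split: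
  assumes "test_fun N \<phi>"
  shows "energy_form N Z M \<phi> = - (1 / M) * (\<integral>x. \<phi> x * laplacian N \<phi> x \<partial>configM N) + (\<integral>x. Wpot N Z x * (\<phi> x)\<^sup>2 \<partial>configM N)"
proof -
  have i: "integrable (configM N) (\<lambda>x. \<phi> x * laplacian N \<phi> x)" "integrable (configM N) (\<lambda>x. Wpot N Z x * \<phi> x * \<phi> x)"
    using assms by (auto intro!: sq_int_real_mult_integrable sq_int_Wpot_mult intro: test_fun_sq_int test_fun_laplacian)
  have "energy_form N Z M \<phi> = (\<integral>x. - (1 / M) * (\<phi> x * laplacian N \<phi> x) + Wpot N Z x * \<phi> x * \<phi> x \<partial>configM N)"
    unfolding energy_form_def hamiltonian_def by (simp add: algebra_simps)
  then show ?thesis using i by (simp add: power2_eq_square mult.assoc del: mult_minus_left)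
qed

lemma integral_laplacian_le:
  assumes "test_fun N \<phi>"
  shows "(\<integral>x. \<phi> x * laplacian N \<phi> x \<partial>configM N) \<le> 0"
proof -
  have "(\<integral>x. \<phi> x * laplacian N \<phi> x \<partial>configM N) = (\<Sum>j<N. \<integral>x. \<phi> x * pd j (pd j \<phi>) x \<partial>configM N)"
    unfolding laplacian_def sum_distrib_left using assms
    by (intro Bochner_Integration.integral_sum test_fun_integrable test_fun_mult smooth_pd test_fun_smooth) auto
  also have "\<dots> \<le> 0" using assms by (intro sum_nonpos integral_second_pd_le) auto
  finally show ?thesis .
qed

text \<open>The kinetic term is nonnegative and the potential bounded. This later makes the set of
  form bounds nonempty.\<close>

lemma energy_form_lower_bound:
  assumes "M > 0"
  shows "\<exists>c. \<forall>\<phi>. test_fun N \<phi> \<longrightarrow> c * l2_inner (configM N) \<phi> \<phi> \<le> energy_form N Z M \<phi>"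
proof -
  obtain C where C: "\<forall>x. \<bar>Wpot N Z x\<bar> \<le> C" using Wpot_bounded by blast
  have "- C * l2_inner (configM N) \<phi> \<phi> \<le> energy_form N Z M \<phi>" if \<phi>: "test_fun N \<phi>" for \<phi>
  proof -
    have i: "integrable (configM N) (\<lambda>x. Wpot N Z x * \<phi> x * \<phi> x)" "integrable (configM N) (\<lambda>x. \<phi> x * \<phi> x)"
      using \<phi> by (auto intro!: sq_int_real_mult_integrable sq_int_Wpot_mult intro: test_fun_sq_int)
    have "- C * l2_inner (configM N) \<phi> \<phi> = (\<integral>x. - C * (\<phi> x)\<^sup>2 \<partial>configM N)"
      by (simp add: l2_inner_def power2_eq_square)
    also have "\<dots> \<le> (\<integral>x. Wpot N Z x * (\<phi> x)\<^sup>2 \<partial>configM N)"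
    proof (rule integral_mono)
      fix x show "- C * (\<phi> x)\<^sup>2 \<le> Wpot N Z x * (\<phi> x)\<^sup>2"
        using C[rule_format, of x] by (intro mult_right_mono) auto
    qed (use i in \<open>auto simp: power2_eq_square mult.assoc\<close>)
    also have "\<dots> \<le> energy_form N Z M \<phi>"
      using integral_laplacian_le[OF \<phi>] assms by (simp add: energy_form_split[OF \<phi>] mult_nonneg_nonpos divide_nonpos_pos)
    finally show ?thesis .
  qed
  then show ?thesis by blast
qed

section \<open>Localization of the kinetic energy\<close>

definition grad_sq :: "nat \<Rightarrow> ((nat \<Rightarrow> real) \<Rightarrow> real) \<Rightarrow> (nat \<Rightarrow> real) \<Rightarrow> real" where
  "grad_sq N w x = (\<Sum>j<N. (pd j w x)\<^sup>2)"

text \<open>The IMS localization identity: \<open>(w u) \<partial>\<^sup>2(w u)\<close> and \<open>w\<^sup>2 u \<partial>\<^sup>2u - (\<partial>w)\<^sup>2 u\<^sup>2\<close> differ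
  by the total derivative of \<open>u\<^sup>2 w \<partial>w\<close>.\<close>

lemma ims_laplacian:
  assumes w: "test_fun N w" and u: "smooth N u"
  shows "(\<integral>x. (w x * u x) * laplacian N (\<lambda>x. w x * u x) x \<partial>configM N)
    = (\<integral>x. (w x)\<^sup>2 * u x * laplacian N u x \<partial>configM N) - (\<integral>x. grad_sq N w x * (u x)\<^sup>2 \<partial>configM N)"
proof -
  have swap_coords: "smooth N w" using w by (rule test_fun_smooth)
  have wu: "test_fun N (\<lambda>x. w x * u x)" using w u by (rule test_fun_mult)
  have int1: "(\<integral>x. (w x * u x) * pd j (pd j (\<lambda>x. w x * u x)) x \<partial>configM N)
     = (\<integral>x. (w x)\<^sup>2 * u x * pd j (pd j u) x \<partial>configM N) - (\<integral>x. (pd j w x)\<^sup>2 * (u x)\<^sup>2 \<partial>configM N)"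
    if j: "j < N" for j
  proof -
    define F where "F x = w x * (u x * (u x * pd j w x))" for x
    have F: "test_fun N F" unfolding F_def[abs_def]
      by (intro test_fun_mult w smooth_mult u smooth_pd swap_coords j)
    have pdF: "pd j F x = pd j w x * (u x * (u x * pd j w x)) +
        w x * (pd j u x * (u x * pd j w x) + u x * (pd j u x * pd j w x + u x * pd j (pd j w) x))" for x
      unfolding F_def[abs_def] using w u swap_coords j by (simp add: pd_mult[of N] smooth_mult smooth_pd)
    have pd2: "pd j (pd j (\<lambda>x. w x * u x)) x = pd j (pd j w) x * u x + pd j w x * pd j u x
        + (pd j w x * pd j u x + w x * pd j (pd j u) x)" for x
      using u swap_coords j by (simp add: pd_mult[of N] pd_add[of N] smooth_mult smooth_pd)
    have i1: "integrable (configM N) (\<lambda>x. (w x)\<^sup>2 * u x * pd j (pd j u) x)"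
    proof -
      have "test_fun N (\<lambda>x. w x * (w x * (u x * pd j (pd j u) x)))"
        by (intro test_fun_mult w smooth_mult u smooth_pd swap_coords j)
      from test_fun_integrable[OF this] show ?thesis by (simp add: power2_eq_square mult.assoc)
    qed
    have i2: "integrable (configM N) (\<lambda>x. (pd j w x)\<^sup>2 * (u x)\<^sup>2)"
    proof -
      have "test_fun N (\<lambda>x. pd j w x * (pd j w x * (u x * u x)))"
        by (intro test_fun_mult test_fun_pd w smooth_mult u smooth_pd swap_coords j)
      from test_fun_integrable[OF this] show ?thesis by (simp add: power2_eq_square mult.assoc)
    qed
    have "(\<integral>x. (w x * u x) * pd j (pd j (\<lambda>x. w x * u x)) x \<partial>configM N)
      = (\<integral>x. (w x)\<^sup>2 * u x * pd j (pd j u) x + pd j F x - (pd j w x)\<^sup>2 * (u x)\<^sup>2 \<partial>configM N)"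
      unfolding pd2 pdF by (simp add: power2_eq_square algebra_simps)
    also have "\<dots> = (\<integral>x. (w x)\<^sup>2 * u x * pd j (pd j u) x \<partial>configM N) + (\<integral>x. pd j F x \<partial>configM N)
       - (\<integral>x. (pd j w x)\<^sup>2 * (u x)\<^sup>2 \<partial>configM N)"
      using i1 i2 test_fun_integrable[OF test_fun_pd[OF F j]] by simp
    finally show ?thesis using integral_pd_zero[OF F j] by simp
  qed
  have "(\<integral>x. (w x * u x) * laplacian N (\<lambda>x. w x * u x) x \<partial>configM N)
     = (\<Sum>j<N. \<integral>x. (w x * u x) * pd j (pd j (\<lambda>x. w x * u x)) x \<partial>configM N)"
    unfolding laplacian_def sum_distrib_left
    by (intro Bochner_Integration.integral_sum test_fun_integrable test_fun_mult[OF wu] smooth_pd test_fun_smooth[OF wu]) auto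
  also have "\<dots> = (\<Sum>j<N. (\<integral>x. (w x)\<^sup>2 * u x * pd j (pd j u) x \<partial>configM N))
      - (\<Sum>j<N. \<integral>x. (pd j w x)\<^sup>2 * (u x)\<^sup>2 \<partial>configM N)"
    by (simp add: int1 flip: sum_subtractf)
  also have "(\<Sum>j<N. (\<integral>x. (w x)\<^sup>2 * u x * pd j (pd j u) x \<partial>configM N)) = (\<integral>x. (w x)\<^sup>2 * u x * laplacian N u x \<partial>configM N)"
    unfolding laplacian_def sum_distrib_left
  proof (rule Bochner_Integration.integral_sum[symmetric])
    fix j assume "j \<in> {..<N}"
    then have "test_fun N (\<lambda>x. w x * (w x * (u x * pd j (pd j u) x)))"
      by (intro test_fun_mult w smooth_mult u smooth_pd swap_coords) auto
    from test_fun_integrable[OF this] show "integrable (configM N) (\<lambda>x. (w x)\<^sup>2 * u x * pd j (pd j u) x)"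
      by (simp add: power2_eq_square mult.assoc)
  qed
  also have "(\<Sum>j<N. \<integral>x. (pd j w x)\<^sup>2 * (u x)\<^sup>2 \<partial>configM N) = (\<integral>x. grad_sq N w x * (u x)\<^sup>2 \<partial>configM N)"
    unfolding grad_sq_def sum_distrib_right
  proof (rule Bochner_Integration.integral_sum[symmetric])
    fix j assume j: "j \<in> {..<N}"
    have "test_fun N (\<lambda>x. pd j w x * (pd j w x * (u x * u x)))"
      using j by (intro test_fun_mult test_fun_pd w smooth_mult u smooth_pd swap_coords) auto
    from test_fun_integrable[OF this] show "integrable (configM N) (\<lambda>x. (pd j w x)\<^sup>2 * (u x)\<^sup>2)"
      by (simp add: power2_eq_square mult.assoc)
  qed
  finally show ?thesis .
qed

subsection \<open>Density of test functions\<close>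

definition open_box :: "nat \<Rightarrow> (nat \<Rightarrow> real) \<Rightarrow> (nat \<Rightarrow> real) \<Rightarrow> (nat \<Rightarrow> real) set" where
  "open_box N a b = PiE {..<N} (\<lambda>i. {a i<..<b i})"

lemma open_box_sets[measurable]: "open_box N a b \<in> sets (configM N)"
  unfolding open_box_def configM_def by (rule sets_PiM_I_finite) auto

lemma emeasure_open_box: "emeasure (configM N) (open_box N a b) < \<infinity>"
  unfolding open_box_def configM_def
proof (subst PS.emeasure_PiM)
  have "emeasure lborel {a i<..<b i} \<noteq> top" for i
    using emeasure_lborel_box_finite[of "a i" "b i"] by (simp add: box_real less_top)
  then show "(\<Prod>i<N. emeasure lborel {a i<..<b i}) < \<infinity>"
    by (simp add: less_top[symmetric] ennreal_prod_eq_top)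
qed auto

lemma sq_int_indicator_open_box: "sq_int (configM N) (indicator (open_box N a b) :: _ \<Rightarrow> real)"
proof -
  have "(\<lambda>x. (norm (indicator (open_box N a b) x :: real))\<^sup>2) = indicator (open_box N a b)"
    by (auto simp: fun_eq_iff split: split_indicator)
  then show ?thesis unfolding sq_int_def
    by (auto intro!: integrable_real_indicator emeasure_open_box borel_measurable_indicator)
qed

lemma tensor_interval_bump_tendsto:
  assumes "x \<in> space (configM N)"
  shows "(\<lambda>k. tensor N (\<lambda>i. interval_bump (a i) (b i) k) x) \<longlonglongrightarrow> indicator (open_box N a b) x"
proof -
  have "(\<lambda>k. tensor N (\<lambda>i. interval_bump (a i) (b i) k) x) \<longlonglongrightarrow> (\<Prod>i<N. indicator {a i<..<b i} (x i))"
    unfolding tensor_def by (intro tendsto_prod interval_bump_tendsto)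
  also have "(\<Prod>i<N. indicator {a i<..<b i} (x i)) = (indicator (open_box N a b) x :: real)"
  proof (cases "x \<in> open_box N a b")
    case True
    then have "x i \<in> {a i<..<b i}" if "i < N" for i
      using that unfolding open_box_def PiE_def Pi_def by blast
    then have "(\<Prod>i<N. indicator {a i<..<b i} (x i)) = (1::real)"
      by (intro prod.neutral) (simp add: indicator_def)
    then show ?thesis using True by (simp only: indicator_simps)
  next
    case False
    then obtain i where i: "i < N" "x i \<notin> {a i<..<b i}"
      using assms unfolding open_box_def space_configM PiE_def Pi_def by blast
    then have "(\<Prod>i<N. indicator {a i<..<b i} (x i)) = (0::real)"
      by (intro prod_zero bexI[of _ i]) (simp_all add: indicator_def)
    then show ?thesis using False by (simp add: indicator_def)
  qed
  finally show ?thesis .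
qed

lemma test_fun_interval_bump: "test_fun N (tensor N (\<lambda>i. interval_bump (a i) (b i) k))"
proof (rule test_fun_tensor)
  define R where "R = (\<Sum>i<N. \<bar>a i\<bar> + \<bar>b i\<bar>)"
  fix i t assume i: "i < N" and t: "\<bar>t\<bar> > R"
  have "\<bar>a i\<bar> + \<bar>b i\<bar> \<le> R" unfolding R_def using i by (intro member_le_sum) auto
  then show "interval_bump (a i) (b i) k t = 0" using t by (intro interval_bump_eq_0) auto
qed (rule smooth1_interval_bump)

lemma open_box_Pow: "range (\<lambda>(a, b). open_box N a b) \<subseteq> Pow (PiE {..<N} (\<lambda>_. UNIV))"
  by (auto simp: open_box_def PiE_def)

text \<open>Open intervals generate the Borel sets, and in every factor countably many of them cover
  the line; so boxes alone generate the product sigma-algebra.\<close>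

lemma sets_configM_open_box: "sets (configM N) = sigma_sets (PiE {..<N} (\<lambda>_. UNIV)) (range (\<lambda>(a, b). open_box N a b))"
proof -
  define E :: "real set set" where "E = range (\<lambda>(a, b). {a<..<b})"
  have b: "sets (lborel :: real measure) = sets (sigma UNIV E)"
    unfolding E_def by (simp add: borel_eq_box box_real)
  have "sets (configM N) = sets (PiM {..<N} (\<lambda>_. sigma UNIV E))"
    unfolding configM_def by (intro sets_PiM_cong refl b)
  also have "\<dots> = sets (sigma (PiE {..<N} (\<lambda>_. UNIV))
      {{f\<in>PiE {..<N} (\<lambda>_. UNIV). \<forall>i\<in>j. f i \<in> A i} |A j. j \<in> {{..<N}} \<and> A \<in> Pi j (\<lambda>_. E)})"
  proof (rule sets_PiM_sigma)
    show "\<exists>S\<subseteq>E. countable S \<and> UNIV = \<Union>S" for i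
    proof (intro exI conjI)
      show "range (\<lambda>n::nat. {- real n<..<real n}) \<subseteq> E" by (auto simp: E_def)
      have "\<exists>n::nat. x \<in> {- real n<..<real n}" for x
      proof -
        obtain n :: nat where "\<bar>x\<bar> < real n" using reals_Archimedean2 by blast
        then have "- real n < x \<and> x < real n" by linarith
        then show ?thesis by auto
      qed
      then show "UNIV = \<Union> (range (\<lambda>n::nat. {- real n<..<real n}))" by blast
    qed auto
  qed auto
  also have "{{f\<in>PiE {..<N} (\<lambda>_. UNIV). \<forall>i\<in>j. f i \<in> A i} |A j. j \<in> {{..<N}} \<and> A \<in> Pi j (\<lambda>_. E)}
     = range (\<lambda>(a, b). open_box N a b)" (is "?L = ?R")
  proof (intro equalityI subsetI)
    fix X assume "X \<in> ?L"
    then obtain A where A: "X = {f\<in>PiE {..<N} (\<lambda>_. UNIV). \<forall>i\<in>{..<N}. f i \<in> A i}" "\<forall>i<N. A i \<in> E" by auto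
    have "\<exists>a b. i < N \<longrightarrow> A i = {a<..<b}" for i
    proof (cases "i < N")
      case True
      then have "A i \<in> E" using A(2) by blast
      then show ?thesis by (auto simp: E_def)
    qed simp
    then obtain a b where ab: "\<And>i. i < N \<Longrightarrow> A i = {a i<..<b i}" by metis
    have "X = open_box N a b" unfolding A(1) open_box_def using ab by (auto simp: PiE_def Pi_def)
    then show "X \<in> ?R" by auto
  next
    fix X assume "X \<in> ?R"
    then obtain a b where X: "X = open_box N a b" by auto
    have "X = {f\<in>PiE {..<N} (\<lambda>_. UNIV). \<forall>i\<in>{..<N}. f i \<in> {a i<..<b i}}"
      unfolding X open_box_def by (auto simp: PiE_def Pi_def)
    moreover have "(\<lambda>i. {a i<..<b i}) \<in> Pi {..<N} (\<lambda>_. E)" by (auto simp: E_def)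
    ultimately have "\<exists>A j. X = {f\<in>PiE {..<N} (\<lambda>_. UNIV). \<forall>i\<in>j. f i \<in> A i} \<and> j \<in> {{..<N}} \<and> A \<in> Pi j (\<lambda>_. E)"
      by (intro exI[of _ "\<lambda>i. {a i<..<b i}"] exI[of _ "{..<N}"] conjI) simp_all
    then show "X \<in> ?L" by (rule CollectI)
  qed
  finally show ?thesis by (simp only: sets_measure_of[OF open_box_Pow])
qed

text \<open>Tensor products of interval bumps are test functions that tend to the indicator of the
  box from below. The majorant \<open>|f|\<close> on the box is integrable because \<open>f\<close>
  is square integrable and the box has finite measure.\<close>

lemma integral_open_box_zero:
  assumes f: "sq_int (configM N) f" and z: "\<And>\<phi>. test_fun N \<phi> \<Longrightarrow> (\<integral>x. f x * \<phi> x \<partial>configM N) = 0"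
  shows "(\<integral>x. f x * indicator (open_box N a b) x \<partial>configM N) = 0"
proof -
  let ?t = "\<lambda>k. tensor N (\<lambda>i. interval_bump (a i) (b i) k)"
  have fi: "integrable (configM N) (\<lambda>x. \<bar>f x * indicator (open_box N a b) x\<bar>)"
    using sq_int_real_mult_integrable[OF f sq_int_indicator_open_box] by simp
  have [measurable]: "f \<in> borel_measurable (configM N)" "?t k \<in> borel_measurable (configM N)" for k
    using f test_fun_measurable[OF test_fun_interval_bump] by (auto simp: sq_int_def)
  have "(\<lambda>k. \<integral>x. f x * ?t k x \<partial>configM N) \<longlonglongrightarrow> (\<integral>x. f x * indicator (open_box N a b) x \<partial>configM N)"
  proof (rule integral_dominated_convergence[OF _ _ fi])
    show "AE x in configM N. (\<lambda>k. f x * ?t k x) \<longlonglongrightarrow> f x * indicator (open_box N a b) x"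
      by (intro AE_I2 tendsto_intros tensor_interval_bump_tendsto)
    fix k
    show "AE x in configM N. norm (f x * ?t k x) \<le> \<bar>f x * indicator (open_box N a b) x\<bar>"
    proof (rule AE_I2)
      fix x assume x: "x \<in> space (configM N)"
      have "\<bar>?t k x\<bar> \<le> indicator (open_box N a b) x"
      proof (cases "x \<in> open_box N a b")
        case True
        have "\<bar>?t k x\<bar> \<le> 1"
          unfolding tensor_def abs_prod using interval_bump_bounds by (intro prod_le_1) auto
        then show ?thesis using True by simp
      next
        case False
        then obtain i where i: "i < N" "x i \<notin> {a i<..<b i}"
          using x unfolding open_box_def space_configM PiE_def Pi_def by blast
        then have "?t k x = 0" unfolding tensor_def
          by (intro prod_zero bexI[of _ i]) (simp_all add: interval_bump_eq_0)
        then show ?thesis by simp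
      qed
      then show "norm (f x * ?t k x) \<le> \<bar>f x * indicator (open_box N a b) x\<bar>"
        by (simp add: abs_mult mult_left_mono)
    qed
  qed measurable
  moreover have "(\<integral>x. f x * ?t k x \<partial>configM N) = 0" for k by (rule z[OF test_fun_interval_bump])
  ultimately show ?thesis by (simp add: LIMSEQ_const_iff)
qed

text \<open>The positive and the negative part of \<open>f\<close> are densities of two measures
  that agree and are finite on boxes. Boxes are stable under intersection and exhaust the space, so
  the measures coincide, and with them the densities.\<close>

lemma fundamental_lemma:
  assumes f: "sq_int (configM N) f" and z: "\<And>\<phi>. test_fun N \<phi> \<Longrightarrow> (\<integral>x. f x * \<phi> x \<partial>configM N) = 0"
  shows "AE x in configM N. f x = 0"
proof -
  interpret S: sigma_finite_measure "configM N" by (rule sigma_finite_configM)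
  have [measurable]: "f \<in> borel_measurable (configM N)" using f by (simp add: sq_int_def)
  define P where "P = density (configM N) (\<lambda>x. ennreal (max 0 (f x)))"
  define Q where "Q = density (configM N) (\<lambda>x. ennreal (max 0 (- f x)))"
  let ?E = "range (\<lambda>(a, b). open_box N a b)"
  have fi: "integrable (configM N) (\<lambda>x. f x * indicator (open_box N a b) x)" for a b
    by (rule sq_int_real_mult_integrable[OF f sq_int_indicator_open_box])
  have pi: "integrable (configM N) (\<lambda>x. max 0 (f x) * indicator (open_box N a b) x)"
    "integrable (configM N) (\<lambda>x. max 0 (- f x) * indicator (open_box N a b) x)" for a b
    by (rule Bochner_Integration.integrable_bound[OF fi[of a b]]; auto split: split_indicator simp: max_def)+
  have eP: "emeasure P (open_box N a b) = ennreal (\<integral>x. max 0 (f x) * indicator (open_box N a b) x \<partial>configM N)" for a b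
    unfolding P_def using pi(1)
    by (subst emeasure_density) (auto simp: nn_integral_eq_integral[symmetric] ennreal_mult'' intro!: nn_integral_cong split: split_indicator)
  have eQ: "emeasure Q (open_box N a b) = ennreal (\<integral>x. max 0 (- f x) * indicator (open_box N a b) x \<partial>configM N)" for a b
    unfolding Q_def using pi(2)
    by (subst emeasure_density) (auto simp: nn_integral_eq_integral[symmetric] ennreal_mult'' intro!: nn_integral_cong split: split_indicator)
  have "P = Q"
  proof (rule measure_eqI_generator_eq[where E = ?E and \<Omega> = "PiE {..<N} (\<lambda>_. UNIV)" and A = "\<lambda>n::nat. open_box N (\<lambda>_. - real n) (\<lambda>_. real n)"])
    show "Int_stable ?E"
    proof (rule Int_stableI)
      fix A B assume "A \<in> ?E" "B \<in> ?E"
      then obtain a b c d where "A = open_box N a b" "B = open_box N c d" by auto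
      then have "A \<inter> B = open_box N (\<lambda>i. max (a i) (c i)) (\<lambda>i. min (b i) (d i))"
        by (auto simp: open_box_def PiE_def Pi_def)
      then show "A \<inter> B \<in> ?E" by auto
    qed
    show "?E \<subseteq> Pow (PiE {..<N} (\<lambda>_. UNIV))" by (rule open_box_Pow)
    show "emeasure P X = emeasure Q X" if X: "X \<in> ?E" for X
    proof -
      obtain a b where X: "X = open_box N a b" using X by auto
      have "f x = max 0 (f x) - max 0 (- f x)" for x by (simp add: max_def)
      then have "(\<integral>x. (max 0 (f x) * indicator (open_box N a b) x - max 0 (- f x) * indicator (open_box N a b) x) \<partial>configM N) = 0"
        using integral_open_box_zero[OF f z, of a b] by (simp add: left_diff_distrib[symmetric])
      then show ?thesis unfolding X eP eQ using pi by simp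
    qed
    show "sets P = sigma_sets (PiE {..<N} (\<lambda>_. UNIV)) ?E" "sets Q = sigma_sets (PiE {..<N} (\<lambda>_. UNIV)) ?E"
      by (simp_all add: P_def Q_def sets_configM_open_box)
    show "(\<Union>n. open_box N (\<lambda>_. - real n) (\<lambda>_. real n)) = PiE {..<N} (\<lambda>_. UNIV)"
    proof (intro equalityI subsetI)
      fix x :: "nat \<Rightarrow> real" assume x: "x \<in> PiE {..<N} (\<lambda>_. UNIV)"
      obtain n :: nat where n: "real n > (\<Sum>i<N. \<bar>x i\<bar>)" using reals_Archimedean2 by blast
      have "\<bar>x i\<bar> < real n" if "i < N" for i
        using member_le_sum[of i "{..<N}" "\<lambda>i. \<bar>x i\<bar>"] that n by auto
      then have "x \<in> open_box N (\<lambda>_. - real n) (\<lambda>_. real n)" using x by (auto simp: open_box_def PiE_def Pi_def abs_less_iff minus_less_iff)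
      then show "x \<in> (\<Union>n. open_box N (\<lambda>_. - real n) (\<lambda>_. real n))" by auto
    qed (auto simp: open_box_def PiE_def)
    show "range (\<lambda>n::nat. open_box N (\<lambda>_. - real n) (\<lambda>_. real n)) \<subseteq> ?E" by auto
    show "emeasure P (open_box N (\<lambda>_. - real n) (\<lambda>_. real n)) \<noteq> \<infinity>" for n by (simp add: eP)
  qed
  then have "AE x in configM N. ennreal (max 0 (f x)) = ennreal (max 0 (- f x))"
    unfolding P_def Q_def by (subst (asm) S.density_unique_iff) auto
  then show ?thesis by eventually_elim (auto simp: max_def split: if_splits)
qed

lemma l2_inner_cong_AE:
  assumes "AE x in M. f x = f' x" "AE x in M. g x = g' x"
    and "sq_int M f" "sq_int M f'" "sq_int M g" "sq_int M g'"
  shows "l2_inner M f g = l2_inner M f' g'"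
  unfolding l2_inner_def
  by (rule integral_cong_AE) (use assms in \<open>auto dest: sq_int_measurable\<close>)

lemma l2_conv_cong_AE:
  assumes "l2_conv M F f" "AE x in M. f x = g x" "\<And>k. sq_int M (F k)" "sq_int M f" "sq_int M g"
  shows "l2_conv M F g"
proof -
  have "l2_norm M (\<lambda>x. F k x - f x) = l2_norm M (\<lambda>x. F k x - g x)" for k
    unfolding l2_norm_def using assms by (intro arg_cong[where f = sqrt] l2_inner_cong_AE sq_int_diff) auto
  then show ?thesis using assms(1) by (simp add: l2_conv_def)
qed

text \<open>The projection of \<open>f\<close> onto the closed span of the test functions differs from \<open>f\<close> by a
  function orthogonal to all test functions.\<close>

lemma test_fun_dense:
  assumes f: "sq_int (configM N) f"
  shows "\<exists>F. (\<forall>k::nat. test_fun N (F k)) \<and> l2_conv (configM N) F f"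
proof -
  have "\<exists>f' F. sq_int (configM N) f' \<and> (\<forall>k::nat. F k \<in> Collect (test_fun N)) \<and> l2_conv (configM N) F f' \<and>
      (\<forall>v\<in>Collect (test_fun N). l2_inner (configM N) (\<lambda>x. f x - f' x) v = 0)"
    by (rule l2_projection) (use f test_fun_zero in \<open>auto intro: test_fun_sq_int test_fun_add test_fun_cmult\<close>)
  then obtain f' F where F: "sq_int (configM N) f'" "\<forall>k::nat. test_fun N (F k)" "l2_conv (configM N) F f'"
    "\<forall>v. test_fun N v \<longrightarrow> l2_inner (configM N) (\<lambda>x. f x - f' x) v = 0" by auto
  have "AE x in configM N. f x - f' x = 0"
    by (rule fundamental_lemma) (use F f in \<open>auto intro: sq_int_diff simp: l2_inner_def\<close>)
  then have "l2_conv (configM N) F f"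
    using F f by (intro l2_conv_cong_AE[OF F(3)]) (auto intro: test_fun_sq_int)
  with F show ?thesis by blast
qed

subsection \<open>Mollification\<close>

definition admissible :: "nat \<Rightarrow> real \<Rightarrow> (nat \<Rightarrow> real \<Rightarrow> real) \<Rightarrow> bool" where
  "admissible N R a \<longleftrightarrow> (\<forall>i<N. smooth1 (a i) \<and> (\<forall>t. \<bar>t\<bar> > R \<longrightarrow> a i t = 0))"

text \<open>The kernel is a product rather than a radial function so that a derivative in
  \<open>x j\<close> merely replaces the factor \<open>a j\<close> by \<open>deriv (a j)\<close>;
  smoothness of convolutions is then an induction within one class of kernels.\<close>

definition tensor_kernel :: "nat \<Rightarrow> (nat \<Rightarrow> real \<Rightarrow> real) \<Rightarrow> (nat \<Rightarrow> real) \<Rightarrow> (nat \<Rightarrow> real) \<Rightarrow> real" where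
  "tensor_kernel N a x = tensor N (\<lambda>i t. a i (x i - t))"

definition convolve :: "nat \<Rightarrow> (nat \<Rightarrow> real \<Rightarrow> real) \<Rightarrow> ((nat \<Rightarrow> real) \<Rightarrow> real) \<Rightarrow> (nat \<Rightarrow> real) \<Rightarrow> real" where
  "convolve N a \<psi> x = (\<integral>y. \<psi> y * tensor_kernel N a x y \<partial>configM N)"

lemma deriv_supp:
  assumes "smooth1 f" "\<And>t. \<bar>t\<bar> > R \<Longrightarrow> f t = 0" "\<bar>t\<bar> > R"
  shows "deriv f t = 0"
proof (rule DERIV_imp_deriv)
  have "((\<lambda>t. 0) has_real_derivative 0) (at t)" by simp
  then show "(f has_real_derivative 0) (at t)"
  proof (rule has_field_derivative_transform_within_open)
    show "open {t::real. R < \<bar>t\<bar>}" by (intro open_Collect_less continuous_intros)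
  qed (use assms in auto)
qed

lemma admissible_deriv: "admissible N R a \<Longrightarrow> j < N \<Longrightarrow> admissible N R (a(j := deriv (a j)))"
  unfolding admissible_def using deriv_supp smooth1_deriv(2) by (metis fun_upd_apply)

lemma smooth1_supp_bounded:
  assumes "smooth1 f" "\<And>t. \<bar>t\<bar> > R \<Longrightarrow> f t = 0"
  shows "\<exists>C. \<forall>t. \<bar>f t\<bar> \<le> C"
proof -
  have "compact (f ` {- R..R})"
    by (intro compact_continuous_image continuous_on_subset[OF smooth1_cont[OF assms(1)]]) auto
  then obtain C where C: "\<forall>y\<in>f ` {- R..R}. norm y \<le> C"
    using compact_imp_bounded bounded_iff by metis
  have "\<bar>f t\<bar> \<le> \<bar>C\<bar>" for t
  proof (cases "\<bar>t\<bar> > R")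
    case False
    then have "t \<in> {- R..R}" by auto
    then have "norm (f t) \<le> C" using C by blast
    then show ?thesis by simp
  qed (use assms(2) in auto)
  then show ?thesis by blast
qed

lemma admissible_bounded:
  assumes "admissible N R a"
  shows "\<exists>C\<ge>1. \<forall>i<N. \<forall>t. \<bar>a i t\<bar> \<le> C"
proof -
  have "\<forall>i. \<exists>C. i < N \<longrightarrow> (\<forall>t. \<bar>a i t\<bar> \<le> C)"
    using assms smooth1_supp_bounded unfolding admissible_def by metis
  then obtain C where C: "\<And>i t. i < N \<Longrightarrow> \<bar>a i t\<bar> \<le> C i" by metis
  have "\<bar>a i t\<bar> \<le> 1 + (\<Sum>i<N. \<bar>C i\<bar>)" if "i < N" for i t
    using C[OF that, of t] member_le_sum[of i "{..<N}" "\<lambda>i. \<bar>C i\<bar>"] that by auto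
  then show ?thesis by (intro exI[of _ "1 + (\<Sum>i<N. \<bar>C i\<bar>)"]) (auto intro: sum_nonneg)
qed

lemma smooth1_reflect: "smooth1 f \<Longrightarrow> smooth1 (\<lambda>t. f (c - t))"
  by (rule smooth1_compose) (auto intro: smooth1_intros)

lemma test_fun_tensor_kernel:
  assumes "admissible N R a"
  shows "test_fun N (tensor_kernel N a x)"
  unfolding tensor_kernel_def
proof (rule test_fun_tensor)
  fix i t assume i: "i < N" and t: "\<bar>t\<bar> > \<bar>R\<bar> + (\<Sum>i<N. \<bar>x i\<bar>)"
  have "\<bar>x i\<bar> \<le> (\<Sum>i<N. \<bar>x i\<bar>)" using member_le_sum[of i "{..<N}" "\<lambda>i. \<bar>x i\<bar>"] i by auto
  then have "\<bar>x i - t\<bar> > R" using t by linarith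
  then show "a i (x i - t) = 0" using assms i by (simp add: admissible_def)
qed (use assms in \<open>auto simp: admissible_def intro: smooth1_reflect\<close>)

lemma tensor_kernel_integrable: "admissible N R a \<Longrightarrow> sq_int (configM N) \<psi> \<Longrightarrow> integrable (configM N) (\<lambda>y. \<psi> y * tensor_kernel N a x y)"
  by (rule sq_int_real_mult_integrable[OF _ test_fun_sq_int[OF test_fun_tensor_kernel]])

lemma tensor_kernel_bound:
  assumes b: "\<And>i t. i < N \<Longrightarrow> \<bar>a i t\<bar> \<le> C" "\<And>i t. i < N \<Longrightarrow> \<bar>t\<bar> > R \<Longrightarrow> a i t = 0"
    and x: "\<And>i. i < N \<Longrightarrow> \<bar>x i\<bar> \<le> r" and y: "y \<in> space (configM N)"
  shows "\<bar>tensor_kernel N a x y\<bar> \<le> C ^ N * indicator (cube N (r + R)) y"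
proof (cases "y \<in> cube N (r + R)")
  case True
  have "\<bar>tensor_kernel N a x y\<bar> = (\<Prod>i<N. \<bar>a i (x i - y i)\<bar>)" by (simp add: tensor_kernel_def tensor_def abs_prod)
  also have "\<dots> \<le> (\<Prod>i<N. C)" by (intro prod_mono) (use b in auto)
  finally show ?thesis using True by simp
next
  case False
  then obtain i where i: "i < N" "y i \<notin> {- (r + R)..r + R}"
    using y unfolding cube_def space_configM PiE_def Pi_def by blast
  then have "\<bar>x i - y i\<bar> > R" using x[OF i(1)] by auto
  then have "tensor_kernel N a x y = 0" unfolding tensor_kernel_def tensor_def using b(2) i(1) by (intro prod_zero bexI[of _ i]) auto
  then show ?thesis using False by simp
qed

lemma sq_int_indicator_cube: "sq_int (configM N) (indicator (cube N R) :: _ \<Rightarrow> real)"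
proof -
  have "(\<lambda>x. (norm (indicator (cube N R) x :: real))\<^sup>2) = indicator (cube N R)"
    by (auto simp: fun_eq_iff split: split_indicator)
  then show ?thesis unfolding sq_int_def
    by (auto intro!: integrable_real_indicator emeasure_cube borel_measurable_indicator)
qed

text \<open>Both the profiles and the base point may move with \<open>n\<close>: continuity of a
  convolution uses fixed profiles and moving points, differentiability a fixed point and difference
  quotients as profiles. All kernels live on a common cube, where the square integrable \<psi> is
  integrable.\<close>

lemma tensor_kernel_dct:
  assumes \<psi>: "sq_int (configM N) \<psi>"
    and b: "\<And>n i t. i < N \<Longrightarrow> \<bar>a n i t\<bar> \<le> C" "\<And>n i t. i < N \<Longrightarrow> \<bar>t\<bar> > R \<Longrightarrow> a n i t = 0"
    and x: "\<And>n i. i < N \<Longrightarrow> \<bar>x n i\<bar> \<le> r"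
    and lim: "\<And>i t. i < N \<Longrightarrow> (\<lambda>n. a n i (x n i - t)) \<longlonglongrightarrow> a' i (x' i - t)"
    and meas: "\<And>n. (\<lambda>y. tensor_kernel N (a n) (x n) y) \<in> borel_measurable (configM N)"
      "(\<lambda>y. tensor_kernel N a' x' y) \<in> borel_measurable (configM N)"
  shows "(\<lambda>n. convolve N (a n) \<psi> (x n)) \<longlonglongrightarrow> convolve N a' \<psi> x'"
  unfolding convolve_def
proof (rule integral_dominated_convergence)
  have [measurable]: "\<psi> \<in> borel_measurable (configM N)" using \<psi> by (simp add: sq_int_def)
  note meas[measurable]
  show "integrable (configM N) (\<lambda>y. C ^ N * \<bar>\<psi> y * indicator (cube N (r + R)) y\<bar>)"
    using sq_int_real_mult_integrable[OF \<psi> sq_int_indicator_cube] by simp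
  show "(\<lambda>y. \<psi> y * tensor_kernel N a' x' y) \<in> borel_measurable (configM N)"
    "(\<lambda>y. \<psi> y * tensor_kernel N (a n) (x n) y) \<in> borel_measurable (configM N)" for n by measurable
  show "AE y in configM N. (\<lambda>n. \<psi> y * tensor_kernel N (a n) (x n) y) \<longlonglongrightarrow> \<psi> y * tensor_kernel N a' x' y"
    unfolding tensor_kernel_def tensor_def by (intro AE_I2 tendsto_intros lim) auto
  show "AE y in configM N. norm (\<psi> y * tensor_kernel N (a n) (x n) y) \<le> C ^ N * \<bar>\<psi> y * indicator (cube N (r + R)) y\<bar>" for n
  proof (rule AE_I2)
    fix y assume "y \<in> space (configM N)"
    then have "\<bar>\<psi> y\<bar> * \<bar>tensor_kernel N (a n) (x n) y\<bar> \<le> \<bar>\<psi> y\<bar> * (C ^ N * indicator (cube N (r + R)) y)"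
      by (intro mult_left_mono tensor_kernel_bound b x) auto
    then show "norm (\<psi> y * tensor_kernel N (a n) (x n) y) \<le> C ^ N * \<bar>\<psi> y * indicator (cube N (r + R)) y\<bar>"
      by (simp add: abs_mult mult_ac)
  qed
qed

lemma convolve_cont:
  assumes a: "admissible N R a" and \<psi>: "sq_int (configM N) \<psi>"
  shows "continuous_on UNIV (convolve N a \<psi>)"
  unfolding continuous_on_sequentially
proof (intro allI ballI impI)
  fix X :: "nat \<Rightarrow> nat \<Rightarrow> real" and x assume "x \<in> UNIV" "(\<forall>n. X n \<in> UNIV) \<and> X \<longlonglongrightarrow> x"
  then have "X \<longlonglongrightarrow> x" by simp
  then have lim: "(\<lambda>n. X n i) \<longlonglongrightarrow> x i" for i
    using continuous_on_tendsto_compose[OF cont_comp[of i], of X x sequentially] by simp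
  have "\<forall>i. \<exists>B. \<forall>n. \<bar>X n i\<bar> \<le> B"
    using convergent_imp_Bseq[OF convergentI[OF lim]] by (auto simp: Bseq_def)
  then obtain B where B: "\<And>i n. \<bar>X n i\<bar> \<le> B i" by metis
  have B0: "B i \<ge> 0" for i using B[of 0 i] by simp
  obtain C where C: "\<forall>i<N. \<forall>t. \<bar>a i t\<bar> \<le> C" using admissible_bounded[OF a] by blast
  have "(\<lambda>n. convolve N a \<psi> (X n)) \<longlonglongrightarrow> convolve N a \<psi> x"
  proof (rule tensor_kernel_dct[OF \<psi>, where C = C and R = R and r = "\<Sum>i<N. B i"])
    show "\<bar>X n i\<bar> \<le> (\<Sum>i<N. B i)" if "i < N" for n i
      using B[of n i] member_le_sum[of i "{..<N}" B] that B0 by auto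
    show "(\<lambda>n. a i (X n i - t)) \<longlonglongrightarrow> a i (x i - t)" if "i < N" for i t
    proof -
      have s: "smooth1 (a i)" using a that by (simp add: admissible_def)
      have "(\<lambda>n. X n i - t) \<longlonglongrightarrow> x i - t" by (intro tendsto_diff lim tendsto_const)
      from continuous_on_tendsto_compose[OF smooth1_cont[OF s] this] show ?thesis by simp
    qed
    show "a i t = 0" if "i < N" "\<bar>t\<bar> > R" for i t using a that by (simp add: admissible_def)
    show "\<bar>a i t\<bar> \<le> C" if "i < N" for i t using C that by blast
  qed (rule test_fun_measurable[OF test_fun_tensor_kernel[OF a]])+
  then show "(convolve N a \<psi> \<circ> X) \<longlonglongrightarrow> convolve N a \<psi> x" by (simp add: o_def)
qed

text \<open>The difference quotient of a convolution is itself a convolution, with the difference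
  quotient of the \<open>j\<close>-th profile as new factor. Along a sequence of increments
  dominated convergence yields the derivative.\<close>

lemma convolve_DERIV:
  assumes a: "admissible N R a" and \<psi>: "sq_int (configM N) \<psi>" and j: "j < N"
  shows "((\<lambda>t. convolve N a \<psi> (x(j := t))) has_real_derivative convolve N (a(j := deriv (a j))) \<psi> x) (at (x j))"
  unfolding has_field_derivative_iff tendsto_at_iff_sequentially
proof (intro allI impI)
  fix T :: "nat \<Rightarrow> real"
  assume T: "\<forall>n. T n \<in> UNIV - {x j}" and Tlim: "T \<longlonglongrightarrow> x j"
  let ?a' = "a(j := deriv (a j))"
  have a': "admissible N R ?a'" using a j by (rule admissible_deriv)
  have sj: "smooth1 (a j)" using a j by (simp add: admissible_def)
  define q where "q n \<tau> = (a j (\<tau> + (T n - x j)) - a j \<tau>) / (T n - x j)" for n \<tau>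
  have Tn: "T n - x j \<noteq> 0" for n using T by auto
  have hlim: "(\<lambda>n. T n - x j) \<longlonglongrightarrow> 0" using Tlim by (simp add: LIM_zero)
  obtain B where B: "\<And>n. \<bar>T n - x j\<bar> \<le> B"
    using convergent_imp_Bseq[OF convergentI[OF hlim]] by (auto simp: Bseq_def)
  have B0: "B \<ge> 0" using B[of 0] by simp
  obtain C where C: "C \<ge> 1" "\<forall>i<N. \<forall>t. \<bar>a i t\<bar> \<le> C" using admissible_bounded[OF a] by blast
  obtain C' where C': "\<forall>i<N. \<forall>t. \<bar>?a' i t\<bar> \<le> C'" using admissible_bounded[OF a'] by blast
  have qb: "\<bar>q n \<tau>\<bar> \<le> C'" for n \<tau>
  proof -
    have "norm (a j (\<tau> + (T n - x j)) - a j \<tau>) \<le> C' * norm ((\<tau> + (T n - x j)) - \<tau>)"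
    proof (rule field_differentiable_bound[where S = UNIV and f' = "deriv (a j)"])
      show "norm (deriv (a j) z) \<le> C'" for z using C' j by auto
    qed (use smooth1_deriv(1)[OF sj] in \<open>auto\<close>)
    then show ?thesis using Tn[of n] by (simp add: q_def abs_divide pos_divide_le_eq)
  qed
  have quot: "(convolve N a \<psi> (x(j := T n)) - convolve N a \<psi> x) / (T n - x j) = convolve N (a(j := q n)) \<psi> x" for n
  proof -
    have "tensor_kernel N (a(j := q n)) x y = (tensor_kernel N a (x(j := T n)) y - tensor_kernel N a x y) / (T n - x j)" for y
    proof -
      have "(\<Prod>i\<in>{..<N} - {j}. (a(j := q n)) i (x i - y i)) = (\<Prod>i\<in>{..<N} - {j}. a i (x i - y i))"
        "(\<Prod>i\<in>{..<N} - {j}. a i ((x(j := T n)) i - y i)) = (\<Prod>i\<in>{..<N} - {j}. a i (x i - y i))"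
        by (intro prod.cong; simp)+
      then show ?thesis unfolding tensor_kernel_def using j Tn[of n]
        by (simp add: tensor_split q_def left_diff_distrib diff_divide_distrib)
    qed
    moreover have "convolve N a \<psi> (x(j := T n)) - convolve N a \<psi> x
        = (\<integral>y. \<psi> y * tensor_kernel N a (x(j := T n)) y - \<psi> y * tensor_kernel N a x y \<partial>configM N)"
      unfolding convolve_def by (intro Bochner_Integration.integral_diff[symmetric] tensor_kernel_integrable[OF a \<psi>])
    ultimately show ?thesis
      unfolding convolve_def by (simp add: right_diff_distrib diff_divide_distrib flip: integral_divide_zero times_divide_eq_right)
  qed
  have "(\<lambda>n. convolve N (a(j := q n)) \<psi> x) \<longlonglongrightarrow> convolve N ?a' \<psi> x"
  \<comment> \<open>By the mean value theorem the quotients \<open>q n\<close> are bounded by the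
    bound \<open>C'\<close> of the derivative; shifts being at most \<open>B\<close>, they vanish
    beyond \<open>R + B\<close>.\<close>
  proof (rule tensor_kernel_dct[OF \<psi>, where C = "max C C'" and R = "R + B" and r = "\<Sum>i<N. \<bar>x i\<bar>"])
    show "\<bar>(a(j := q n)) i t\<bar> \<le> max C C'" if "i < N" for n i t
      using that C(2) qb[of n t] by (auto simp: le_max_iff_disj)
    show "(a(j := q n)) i t = 0" if "i < N" "\<bar>t\<bar> > R + B" for n i t
    proof (cases "i = j")
      case True
      have "\<bar>t\<bar> > R" "\<bar>t + (T n - x j)\<bar> > R" using that B[of n] B0 by linarith+
      then show ?thesis using True a j by (simp add: q_def admissible_def)
    next
      case False
      then show ?thesis using that a B0 by (simp add: admissible_def)
    qed
    show "\<bar>x i\<bar> \<le> (\<Sum>i<N. \<bar>x i\<bar>)" if "i < N" for i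
      using member_le_sum[of i "{..<N}" "\<lambda>i. \<bar>x i\<bar>"] that by auto
    show "(\<lambda>n. (a(j := q n)) i (x i - t)) \<longlonglongrightarrow> ?a' i (x i - t)" if "i < N" for i t
    proof (cases "i = j")
      case True
      have "((\<lambda>h. (a j (x j - t + h) - a j (x j - t)) / h) \<longlongrightarrow> deriv (a j) (x j - t)) (at 0)"
        using smooth1_deriv(1)[OF sj] by (simp add: DERIV_def)
      moreover have "filterlim (\<lambda>n. T n - x j) (at 0) sequentially"
        using hlim Tn by (auto simp: filterlim_at)
      ultimately have "(\<lambda>n. q n (x j - t)) \<longlonglongrightarrow> deriv (a j) (x j - t)"
        unfolding q_def by (rule filterlim_compose)
      then show ?thesis using True by simp
    qed simp
    show "(\<lambda>y. tensor_kernel N (a(j := q n)) x y) \<in> borel_measurable (configM N)" for n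
    proof (intro cont_measurable_configM)
      have c: "continuous_on UNIV (a i)" if "i < N" for i using a that by (auto simp: admissible_def intro: smooth1_cont)
      have "continuous_on UNIV (\<lambda>\<tau>. q n \<tau>)" unfolding q_def using Tn[of n]
        by (intro continuous_intros continuous_on_compose2[OF c[OF j]]) auto
      then have "continuous_on UNIV ((a(j := q n)) i)" if "i < N" for i using c[OF that] by simp
      then have "continuous_on UNIV (\<lambda>y. (a(j := q n)) i (x i - y i))" if "i < N" for i
        by (rule continuous_on_compose2[of UNIV _ UNIV "\<lambda>y. x i - y i"])
          (rule that, intro continuous_on_diff continuous_on_const cont_comp, simp)
      then show "continuous_on UNIV (\<lambda>y. tensor_kernel N (a(j := q n)) x y)"
        unfolding tensor_kernel_def tensor_def by (intro continuous_on_prod) simp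
    qed
    show "(\<lambda>y. tensor_kernel N ?a' x y) \<in> borel_measurable (configM N)"
      by (rule test_fun_measurable[OF test_fun_tensor_kernel[OF a']])
  qed
  then show "((\<lambda>y. (convolve N a \<psi> (x(j := y)) - convolve N a \<psi> (x(j := x j))) / (y - x j)) \<circ> T)
      \<longlonglongrightarrow> convolve N ?a' \<psi> x"
    by (simp add: o_def quot)
qed

lemma smooth_convolve:
  assumes a: "admissible N R a" and \<psi>: "sq_int (configM N) \<psi>"
  shows "smooth N (convolve N a \<psi>)"
proof -
  have "Ck N k (convolve N a \<psi>)" for k
    using a
  proof (induction k arbitrary: a)
    case 0
    then show ?case using convolve_cont[OF _ \<psi>] by simp
  next
    case (Suc k)
    show ?case
      by (rule Ck_I[where \<phi>' = "\<lambda>j. convolve N (a(j := deriv (a j))) \<psi>"])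
        (use Suc.IH admissible_deriv[OF Suc.prems] convolve_cont[OF Suc.prems \<psi>] convolve_DERIV[OF Suc.prems \<psi>] in blast)+
  qed
  moreover have "depends_on N (convolve N a \<psi>)"
    by (rule depends_on_I) (auto simp: convolve_def tensor_kernel_def tensor_def intro!: Bochner_Integration.integral_cong prod.cong)
  ultimately show ?thesis by (simp add: smooth_def)
qed

lemma pd_convolve: "admissible N R a \<Longrightarrow> sq_int (configM N) \<psi> \<Longrightarrow> j < N \<Longrightarrow> pd j (convolve N a \<psi>) = convolve N (a(j := deriv (a j))) \<psi>"
  by (intro ext pd_eqI convolve_DERIV)

lemma deriv_reflect: "smooth1 f \<Longrightarrow> deriv (\<lambda>t. f (c - t)) = (\<lambda>t. - deriv f (c - t))"
proof
  fix t assume f: "smooth1 f"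
  have "((\<lambda>t. c - t) has_real_derivative -1) (at t)" by (auto intro!: derivative_eq_intros)
  from DERIV_chain2[OF smooth1_deriv(1)[OF f] this] show "deriv (\<lambda>t. f (c - t)) t = - deriv f (c - t)"
    by (intro DERIV_imp_deriv) simp
qed

text \<open>Derivatives are in the integration variable; the kernel depends on the difference
  \<open>x - y\<close>, so the signs of the two differentiations cancel.\<close>

lemma laplacian_tensor_kernel:
  assumes a: "admissible N R a"
  shows "laplacian N (tensor_kernel N a x) y = (\<Sum>j<N. tensor_kernel N (a(j := deriv (deriv (a j)))) x y)"
  unfolding laplacian_def
proof (intro sum.cong refl)
  fix j assume "j \<in> {..<N}"
  then have j: "j < N" by simp
  have s: "smooth1 (a i)" if "i < N" for i using a that by (simp add: admissible_def)
  let ?b = "\<lambda>i t. a i (x i - t)"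
  have d1: "deriv (?b j) = (\<lambda>t. - deriv (a j) (x j - t))" by (rule deriv_reflect[OF s[OF j]])
  have sd: "smooth1 (deriv (a j))" using s[OF j] by (rule smooth1_deriv)
  have d2: "deriv (deriv (?b j)) = (\<lambda>t. deriv (deriv (a j)) (x j - t))"
  proof
    fix t
    have "((\<lambda>t. c - t) has_real_derivative -1) (at t)" for c :: real by (auto intro!: derivative_eq_intros)
    from DERIV_minus[OF DERIV_chain2[OF smooth1_deriv(1)[OF sd] this]]
    show "deriv (deriv (?b j)) t = deriv (deriv (a j)) (x j - t)"
      unfolding d1 by (intro DERIV_imp_deriv) simp
  qed
  have sb: "smooth1 (?b i)" if "i < N" for i using s[OF that] by (rule smooth1_reflect)
  have "pd j (pd j (tensor_kernel N a x)) = pd j (tensor N (?b(j := deriv (?b j))))"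
    unfolding tensor_kernel_def using j sb[OF j] by (subst tensor_pd) auto
  also have "\<dots> = tensor N ((?b(j := deriv (?b j)))(j := deriv ((?b(j := deriv (?b j))) j)))"
    using j smooth1_deriv(2)[OF sb[OF j]] by (intro tensor_pd) auto
  also have "\<dots> = tensor N (?b(j := deriv (deriv (?b j))))" by simp
  also have "?b(j := deriv (deriv (?b j))) = (\<lambda>i t. (a(j := deriv (deriv (a j)))) i (x i - t))"
    unfolding d2 by (auto simp: fun_eq_iff)
  finally show "pd j (pd j (tensor_kernel N a x)) y = tensor_kernel N (a(j := deriv (deriv (a j)))) x y" by (simp add: tensor_kernel_def)
qed

text \<open>The second derivatives of the kernel in its two arguments agree, so the Laplacian in
  \<open>x\<close> can be thrown onto the integration variable, where a weak equation can be
  tested.\<close>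

lemma laplacian_convolve:
  assumes a: "admissible N R a" and \<psi>: "sq_int (configM N) \<psi>"
  shows "laplacian N (convolve N a \<psi>) x = (\<integral>y. \<psi> y * laplacian N (tensor_kernel N a x) y \<partial>configM N)"
proof -
  have a2: "admissible N R (a(j := deriv (deriv (a j))))" if "j < N" for j
    using admissible_deriv[OF admissible_deriv[OF a that] that] by simp
  have "pd j (pd j (convolve N a \<psi>)) x = convolve N (a(j := deriv (deriv (a j)))) \<psi> x" if "j < N" for j
    using pd_convolve[OF a \<psi> that] pd_convolve[OF admissible_deriv[OF a that] \<psi> that] by simp
  then have "laplacian N (convolve N a \<psi>) x = (\<Sum>j<N. convolve N (a(j := deriv (deriv (a j)))) \<psi> x)" by (simp add: laplacian_def)
  also have "\<dots> = (\<integral>y. (\<Sum>j<N. \<psi> y * tensor_kernel N (a(j := deriv (deriv (a j)))) x y) \<partial>configM N)"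
    unfolding convolve_def by (intro Bochner_Integration.integral_sum[symmetric] tensor_kernel_integrable[OF a2 \<psi>]) auto
  finally show ?thesis by (simp add: laplacian_tensor_kernel[OF a] sum_distrib_left)
qed

subsection \<open>Approximate identities\<close>

definition bump_mass :: real where "bump_mass = (\<integral>t. bump t \<partial>lborel)"

definition mollifier :: "nat \<Rightarrow> real \<Rightarrow> real" where
  "mollifier k t = (real (Suc k) / bump_mass) * bump (real (Suc k) * t)"

lemma bump_integrable: "integrable lborel bump"
proof -
  have "set_integrable lborel {-1..1} bump"
    by (rule borel_integrable_compact[of "{-1..1}" bump, folded set_integrable_def])
      (auto intro: continuous_on_subset[OF smooth1_cont[OF smooth1_bump]])
  moreover have "indicator {-1..1} t *\<^sub>R bump t = bump t" for t
    using bump_eq_0[of t] by (auto split: split_indicator)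
  ultimately show ?thesis unfolding set_integrable_def by (simp only:)
qed

lemma bump_mass_pos: "bump_mass > 0"
proof -
  have "bump_mass \<noteq> 0"
  proof
    assume "bump_mass = 0"
    then have "AE t in lborel. bump t = 0"
      using integral_nonneg_eq_0_iff_AE[OF bump_integrable] bump_nonneg by (auto simp: bump_mass_def)
    then have "AE t in lborel. t \<notin> {-1<..<1::real}"
      by eventually_elim (auto simp: bump_def flat_exp_1 abs_square_less_1 power2_less_1_iff split: if_splits)
    then have "{-1<..<1::real} \<in> null_sets lborel"
      by (subst (asm) AE_iff_null_sets[symmetric]) auto
    then have "emeasure lborel {-1<..<1::real} = 0" by auto
    moreover have "emeasure lborel {-1<..<1::real} = 2" by (subst emeasure_lborel_Ioo) auto
    ultimately show False by (simp only:) simp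
  qed
  moreover have "bump_mass \<ge> 0" unfolding bump_mass_def by (intro Bochner_Integration.integral_nonneg bump_nonneg)
  ultimately show ?thesis by simp
qed

lemma mollifier_nonneg: "0 \<le> mollifier k t"
  using bump_mass_pos bump_nonneg by (simp add: mollifier_def)

lemma mollifier_integral: "(\<integral>t. mollifier k (c - t) \<partial>lborel) = 1" "integrable lborel (\<lambda>t. mollifier k (c - t))"
proof -
  have e: "mollifier k (c - t) = (real (Suc k) / bump_mass) * bump (real (Suc k) * c + (- real (Suc k)) * t)" for t
    by (simp add: mollifier_def algebra_simps)
  have n: "- real (Suc k) \<noteq> 0" by simp
  have i: "integrable lborel (\<lambda>t. bump (real (Suc k) * c + (- real (Suc k)) * t))"
    by (rule lborel_integrable_real_affine[OF bump_integrable n])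
  have "bump_mass = \<bar>- real (Suc k)\<bar> *\<^sub>R (\<integral>t. bump (real (Suc k) * c + (- real (Suc k)) * t) \<partial>lborel)"
    unfolding bump_mass_def by (rule lborel_integral_real_affine[OF n])
  then show "(\<integral>t. mollifier k (c - t) \<partial>lborel) = 1"
    unfolding e using bump_mass_pos by (simp del: of_nat_Suc)
  show "integrable lborel (\<lambda>t. mollifier k (c - t))" unfolding e using i by simp
qed

lemma mollifier_even: "mollifier k (- t) = mollifier k t"
  using bump_even[of "real (Suc k) * t"] by (simp add: mollifier_def)

lemma smooth1_mollifier: "smooth1 (mollifier k)"
  unfolding mollifier_def[abs_def] by (intro smooth1_cmult smooth1_compose[OF smooth1_bump] smooth1_ident)

lemma mollifier_supp: "\<bar>t\<bar> > 1 / real (Suc k) \<Longrightarrow> mollifier k t = 0"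
  by (simp add: mollifier_def bump_eq_0 abs_mult field_simps)

lemma admissible_mollifier: "admissible N (1 / real (Suc k)) (\<lambda>_. mollifier k)"
  using smooth1_mollifier mollifier_supp by (auto simp: admissible_def)

abbreviation "moll_kernel N k \<equiv> tensor_kernel N (\<lambda>_. mollifier k)"
abbreviation "mollify N k \<equiv> convolve N (\<lambda>_. mollifier k)"

lemma moll_kernel_nonneg: "0 \<le> moll_kernel N k x y"
  unfolding tensor_kernel_def tensor_def by (intro prod_nonneg) (auto simp: mollifier_nonneg)

lemma moll_kernel_sym: "moll_kernel N k x y = moll_kernel N k y x"
  unfolding tensor_kernel_def tensor_def
  by (intro prod.cong refl) (metis mollifier_even minus_diff_eq)

lemma moll_kernel_integral: "(\<integral>y. moll_kernel N k x y \<partial>configM N) = 1"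
proof -
  have "(\<integral>y. (\<Prod>i<N. mollifier k (x i - y i)) \<partial>PiM {..<N} (\<lambda>_. lborel)) = (\<Prod>i<N. \<integral>t. mollifier k (x i - t) \<partial>lborel)"
    by (rule PS.product_integral_prod) (auto intro: mollifier_integral)
  then show ?thesis by (simp add: tensor_kernel_def tensor_def[abs_def] configM_def mollifier_integral)
qed

lemma moll_kernel_integrable: "integrable (configM N) (moll_kernel N k x)"
  by (rule test_fun_integrable[OF test_fun_tensor_kernel[OF admissible_mollifier]])

text \<open>Jensen's inequality, read off from \<open>\<integral> (\<psi>(y) - m)\<^sup>2 k(x,y) dy \<ge> 0\<close> with \<open>m\<close> the mean.\<close>

lemma mollify_sq_le:
  assumes \<psi>: "sq_int (configM N) \<psi>"
  shows "(mollify N k \<psi> x)\<^sup>2 \<le> (\<integral>y. (\<psi> y)\<^sup>2 * moll_kernel N k x y \<partial>configM N)"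
    and "integrable (configM N) (\<lambda>y. (\<psi> y)\<^sup>2 * moll_kernel N k x y)"
proof -
  define m where "m = mollify N k \<psi> x"
  obtain C where C: "\<forall>y. \<bar>moll_kernel N k x y\<bar> \<le> C" using test_fun_bounded[OF test_fun_tensor_kernel[OF admissible_mollifier]] by blast
  have [measurable]: "\<psi> \<in> borel_measurable (configM N)" "moll_kernel N k x \<in> borel_measurable (configM N)"
    using \<psi> moll_kernel_integrable[of N k x] by (auto simp: sq_int_def)
  have i1: "integrable (configM N) (\<lambda>y. \<psi> y * moll_kernel N k x y)" by (rule tensor_kernel_integrable[OF admissible_mollifier \<psi>])
  have "sq_int (configM N) (\<lambda>y. moll_kernel N k x y * \<psi> y)" using \<psi> C by (intro sq_int_mult_bounded) auto
  from sq_int_real_mult_integrable[OF \<psi> this]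
  show i2: "integrable (configM N) (\<lambda>y. (\<psi> y)\<^sup>2 * moll_kernel N k x y)" by (simp add: power2_eq_square mult_ac)
  have "0 \<le> (\<integral>y. (\<psi> y - m)\<^sup>2 * moll_kernel N k x y \<partial>configM N)"
    using moll_kernel_nonneg by (intro Bochner_Integration.integral_nonneg) auto
  also have "\<dots> = (\<integral>y. (\<psi> y)\<^sup>2 * moll_kernel N k x y - 2 * m * (\<psi> y * moll_kernel N k x y) + m\<^sup>2 * moll_kernel N k x y \<partial>configM N)"
    by (simp add: power2_diff algebra_simps)
  also have "\<dots> = (\<integral>y. (\<psi> y)\<^sup>2 * moll_kernel N k x y \<partial>configM N) - 2 * m * m + m\<^sup>2 * 1"
    using i1 i2 moll_kernel_integrable[of N k x] by (simp add: moll_kernel_integral m_def convolve_def)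
  finally show "(mollify N k \<psi> x)\<^sup>2 \<le> (\<integral>y. (\<psi> y)\<^sup>2 * moll_kernel N k x y \<partial>configM N)"
    by (simp add: m_def power2_eq_square)
qed

lemma moll_kernel_pair_measurable: "(\<lambda>(x, y). moll_kernel N k x y) \<in> borel_measurable (configM N \<Otimes>\<^sub>M configM N)"
proof -
  have [measurable]: "mollifier k \<in> borel_measurable borel"
    by (rule borel_measurable_continuous_onI[OF smooth1_cont[OF smooth1_mollifier]])
  have [measurable]: "(\<lambda>z. fst z i) \<in> borel_measurable (configM N \<Otimes>\<^sub>M configM N)"
    "(\<lambda>z. snd z i) \<in> borel_measurable (configM N \<Otimes>\<^sub>M configM N)" if "i < N" for i
    using that measurable_compose[OF measurable_fst measurable_configM_component]
      measurable_compose[OF measurable_snd measurable_configM_component] by auto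
  show ?thesis unfolding tensor_kernel_def tensor_def case_prod_beta by measurable
qed

text \<open>Jensen's inequality is integrated in \<open>x\<close> and the order of integration
  exchanged; by symmetry the kernel has total mass 1 in either argument.\<close>

lemma mollify_young:
  assumes \<psi>: "sq_int (configM N) \<psi>"
  shows "sq_int (configM N) (mollify N k \<psi>)" "l2_norm (configM N) (mollify N k \<psi>) \<le> l2_norm (configM N) \<psi>"
proof -
  interpret S: sigma_finite_measure "configM N" by (rule sigma_finite_configM)
  interpret P: pair_sigma_finite "configM N" "configM N" ..
  note moll_kernel_pair_measurable[of N k, measurable]
  have [measurable]: "\<psi> \<in> borel_measurable (configM N)" using \<psi> by (simp add: sq_int_def)
  have [measurable]: "mollify N k \<psi> \<in> borel_measurable (configM N)"
    by (rule smooth_measurable[OF smooth_convolve[OF admissible_mollifier \<psi>]])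
  have "(\<integral>\<^sup>+x. ennreal ((norm (mollify N k \<psi> x))\<^sup>2) \<partial>configM N)
     \<le> (\<integral>\<^sup>+x. \<integral>\<^sup>+y. ennreal ((\<psi> y)\<^sup>2 * moll_kernel N k x y) \<partial>configM N \<partial>configM N)"
  proof (rule nn_integral_mono)
    fix x
    have "ennreal ((norm (mollify N k \<psi> x))\<^sup>2) \<le> ennreal (\<integral>y. (\<psi> y)\<^sup>2 * moll_kernel N k x y \<partial>configM N)"
      using mollify_sq_le(1)[OF \<psi>] by (intro ennreal_leI) simp
    also have "\<dots> = (\<integral>\<^sup>+y. ennreal ((\<psi> y)\<^sup>2 * moll_kernel N k x y) \<partial>configM N)"
      using mollify_sq_le(2)[OF \<psi>] moll_kernel_nonneg by (intro nn_integral_eq_integral[symmetric]) auto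
    finally show "ennreal ((norm (mollify N k \<psi> x))\<^sup>2) \<le> (\<integral>\<^sup>+y. ennreal ((\<psi> y)\<^sup>2 * moll_kernel N k x y) \<partial>configM N)" .
  qed
  also have "\<dots> = (\<integral>\<^sup>+y. \<integral>\<^sup>+x. ennreal ((\<psi> y)\<^sup>2 * moll_kernel N k x y) \<partial>configM N \<partial>configM N)"
    by (rule P.Fubini'[symmetric]) measurable
  also have "\<dots> = (\<integral>\<^sup>+y. ennreal ((norm (\<psi> y))\<^sup>2) \<partial>configM N)"
  proof (intro nn_integral_cong)
    fix y
    have "(\<integral>\<^sup>+x. ennreal ((\<psi> y)\<^sup>2 * moll_kernel N k x y) \<partial>configM N) = (\<integral>\<^sup>+x. ennreal ((\<psi> y)\<^sup>2) * ennreal (moll_kernel N k y x) \<partial>configM N)"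
      by (intro nn_integral_cong) (simp add: ennreal_mult moll_kernel_nonneg moll_kernel_sym[of N k y])
    also have "\<dots> = ennreal ((\<psi> y)\<^sup>2) * (\<integral>\<^sup>+x. ennreal (moll_kernel N k y x) \<partial>configM N)"
      using moll_kernel_integrable[of N k y] by (intro nn_integral_cmult) auto
    also have "(\<integral>\<^sup>+x. ennreal (moll_kernel N k y x) \<partial>configM N) = ennreal 1"
      unfolding moll_kernel_integral[of N k y, symmetric] using moll_kernel_integrable moll_kernel_nonneg by (intro nn_integral_eq_integral) auto
    finally show "(\<integral>\<^sup>+x. ennreal ((\<psi> y)\<^sup>2 * moll_kernel N k x y) \<partial>configM N) = ennreal ((norm (\<psi> y))\<^sup>2)" by simp
  qed
  finally have le: "(\<integral>\<^sup>+x. ennreal ((norm (mollify N k \<psi> x))\<^sup>2) \<partial>configM N) \<le> (\<integral>\<^sup>+y. ennreal ((norm (\<psi> y))\<^sup>2) \<partial>configM N)" .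
  show s: "sq_int (configM N) (mollify N k \<psi>)"
    using le \<psi> by (subst sq_int_nn_integral) (auto simp: sq_int_nn_integral sq_int_measurable intro: le_less_trans)
  have "ennreal ((l2_norm (configM N) (mollify N k \<psi>))\<^sup>2) \<le> ennreal ((l2_norm (configM N) \<psi>)\<^sup>2)"
    unfolding l2_norm_nn_integral[OF s] l2_norm_nn_integral[OF \<psi>] by (rule le)
  then have "(l2_norm (configM N) (mollify N k \<psi>))\<^sup>2 \<le> (l2_norm (configM N) \<psi>)\<^sup>2" by (simp only: ennreal_le_iff zero_le_power2)
  then show "l2_norm (configM N) (mollify N k \<psi>) \<le> l2_norm (configM N) \<psi>"
    by (rule power2_le_imp_le) (rule l2_norm_ge0)
qed

text \<open>The points \<open>z n\<close> lead from \<open>y\<close> to \<open>x\<close> by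
  replacing one coordinate at a time, and the mean value theorem is applied to each step.
  Coordinates from \<open>N\<close> on do not matter to \<phi>.\<close>

lemma test_fun_lipschitz:
  assumes \<phi>: "test_fun N \<phi>"
  shows "\<exists>L\<ge>0. \<forall>x y. \<bar>\<phi> x - \<phi> y\<bar> \<le> L * (\<Sum>i<N. \<bar>x i - y i\<bar>)"
proof -
  have "\<forall>j. \<exists>C\<ge>0. j < N \<longrightarrow> (\<forall>x. \<bar>pd j \<phi> x\<bar> \<le> C)"
    using test_fun_bounded[OF test_fun_pd[OF \<phi>]] by (metis order_refl)
  then obtain C where C: "\<And>j. C j \<ge> 0" "\<And>j x. j < N \<Longrightarrow> \<bar>pd j \<phi> x\<bar> \<le> C j" by metis
  define L where "L = (\<Sum>j<N. C j)"
  have L: "\<bar>pd j \<phi> x\<bar> \<le> L" if "j < N" for j x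
    using C(2)[OF that, of x] member_le_sum[of j "{..<N}" C] that C(1) by (auto simp: L_def)
  have s: "smooth N \<phi>" using \<phi> by (rule test_fun_smooth)
  have "\<bar>\<phi> x - \<phi> y\<bar> \<le> L * (\<Sum>i<N. \<bar>x i - y i\<bar>)" for x y
  proof -
    define z where "z n = (\<lambda>i. if i < n then x i else y i)" for n :: nat
    have step: "\<bar>\<phi> (z (Suc n)) - \<phi> (z n)\<bar> \<le> L * \<bar>x n - y n\<bar>" if n: "n < N" for n
    proof -
      have e: "z (Suc n) = (z n)(n := x n)" "z n = (z n)(n := y n)"
        by (auto simp: z_def fun_eq_iff less_Suc_eq)
      have "norm (\<phi> ((z n)(n := x n)) - \<phi> ((z n)(n := y n))) \<le> L * norm (x n - y n)"
      proof (rule field_differentiable_bound[where S = UNIV and f' = "\<lambda>t. pd n \<phi> ((z n)(n := t))"])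
        show "((\<lambda>t. \<phi> ((z n)(n := t))) has_field_derivative pd n \<phi> ((z n)(n := t))) (at t within UNIV)" for t
          using smooth_DERIV[OF s n] by simp
        show "norm (pd n \<phi> ((z n)(n := t))) \<le> L" for t using L[OF n] by simp
      qed auto
      then show ?thesis using e by (metis real_norm_def)
    qed
    have "\<phi> (z N) = \<phi> x" by (rule depends_on_cong[OF smooth_depends_on[OF s]]) (simp add: z_def)
    moreover have "z 0 = y" by (simp add: z_def)
    ultimately have "\<phi> x - \<phi> y = (\<Sum>n<N. \<phi> (z (Suc n)) - \<phi> (z n))"
      by (simp add: sum_lessThan_telescope[of "\<lambda>n. \<phi> (z n)"])
    also have "\<bar>\<dots>\<bar> \<le> (\<Sum>n<N. L * \<bar>x n - y n\<bar>)"
      by (intro order_trans[OF sum_abs] sum_mono step) auto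
    finally show ?thesis by (simp add: sum_distrib_left)
  qed
  moreover have "L \<ge> 0" unfolding L_def using C(1) by (intro sum_nonneg) auto
  ultimately show ?thesis by blast
qed

text \<open>The kernel is supported where coordinates differ by at most \<open>1 / Suc k\<close>, so
  the Lipschitz bound gives a uniform rate; a support common to all \<open>k\<close> turns uniform
  into L2 convergence.\<close>

lemma mollify_test_fun_bound:
  assumes \<phi>: "test_fun N \<phi>"
  shows "\<exists>K R. K \<ge> 0 \<and> (\<forall>k. \<forall>x\<in>space (configM N). \<bar>mollify N k \<phi> x - \<phi> x\<bar> \<le> K / real (Suc k) * indicator (cube N R) x)"
proof -
  obtain L where L: "L \<ge> 0" "\<And>x y. \<bar>\<phi> x - \<phi> y\<bar> \<le> L * (\<Sum>i<N. \<bar>x i - y i\<bar>)"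
    using test_fun_lipschitz[OF \<phi>] by blast
  obtain R where R: "supp_in N R \<phi>" using \<phi> by (auto simp: test_fun_iff)
  have i1: "integrable (configM N) (\<lambda>y. \<phi> y * moll_kernel N k x y)" for k x
    by (rule tensor_kernel_integrable[OF admissible_mollifier test_fun_sq_int[OF \<phi>]])
  have supp: "\<bar>x i - y i\<bar> \<le> 1 / real (Suc k)" if "moll_kernel N k x y \<noteq> 0" "i < N" for k x y i
  proof (rule ccontr)
    assume "\<not> \<bar>x i - y i\<bar> \<le> 1 / real (Suc k)"
    then have "mollifier k (x i - y i) = 0" by (intro mollifier_supp) simp
    then have "moll_kernel N k x y = 0" unfolding tensor_kernel_def tensor_def using that(2) by (intro prod_zero bexI[of _ i]) auto
    then show False using that(1) by simp
  qed
  have "\<bar>mollify N k \<phi> x - \<phi> x\<bar> \<le> (L * real N) / real (Suc k) * indicator (cube N (R + 1)) x"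
    if x: "x \<in> space (configM N)" for k x
  proof (cases "x \<in> cube N (R + 1)")
    case True
    have "mollify N k \<phi> x - \<phi> x = (\<integral>y. \<phi> y * moll_kernel N k x y \<partial>configM N) - \<phi> x * (\<integral>y. moll_kernel N k x y \<partial>configM N)"
      by (simp add: convolve_def moll_kernel_integral)
    also have "\<dots> = (\<integral>y. \<phi> y * moll_kernel N k x y - \<phi> x * moll_kernel N k x y \<partial>configM N)"
      using i1[of k x] moll_kernel_integrable[of N k x] by simp
    finally have eq: "mollify N k \<phi> x - \<phi> x = (\<integral>y. \<phi> y * moll_kernel N k x y - \<phi> x * moll_kernel N k x y \<partial>configM N)" .
    have "\<bar>mollify N k \<phi> x - \<phi> x\<bar> \<le> (\<integral>y. \<bar>\<phi> y * moll_kernel N k x y - \<phi> x * moll_kernel N k x y\<bar> \<partial>configM N)"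
      unfolding eq by (rule integral_abs_bound)
    also have "\<dots> \<le> (\<integral>y. (L * real N) / real (Suc k) * moll_kernel N k x y \<partial>configM N)"
    proof (rule integral_mono)
      show "integrable (configM N) (\<lambda>y. \<bar>\<phi> y * moll_kernel N k x y - \<phi> x * moll_kernel N k x y\<bar>)"
        using i1[of k x] moll_kernel_integrable[of N k x] by simp
      show "integrable (configM N) (\<lambda>y. (L * real N) / real (Suc k) * moll_kernel N k x y)"
        using moll_kernel_integrable[of N k x] by simp
      fix y
      show "\<bar>\<phi> y * moll_kernel N k x y - \<phi> x * moll_kernel N k x y\<bar> \<le> (L * real N) / real (Suc k) * moll_kernel N k x y"
      proof (cases "moll_kernel N k x y = 0")
        case False
        have "\<bar>\<phi> y - \<phi> x\<bar> = \<bar>\<phi> x - \<phi> y\<bar>" by simp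
        also have "\<dots> \<le> L * (\<Sum>i<N. \<bar>x i - y i\<bar>)" by (rule L)
        also have "\<dots> \<le> L * (\<Sum>i<N. 1 / real (Suc k))"
          using L(1) supp[OF False] by (intro mult_left_mono sum_mono) auto
        also have "\<dots> = (L * real N) / real (Suc k)" by simp
        finally have "\<bar>\<phi> y - \<phi> x\<bar> * moll_kernel N k x y \<le> (L * real N) / real (Suc k) * moll_kernel N k x y"
          using moll_kernel_nonneg by (intro mult_right_mono)
        then show ?thesis by (simp add: abs_mult moll_kernel_nonneg flip: left_diff_distrib)
      qed simp
    qed
    also have "\<dots> = (L * real N) / real (Suc k)" by (simp add: moll_kernel_integral)
    finally show ?thesis using True by simp
  next
    case False
    then obtain i where i: "i < N" "x i \<notin> {- (R + 1)..R + 1}"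
      using x unfolding cube_def space_configM PiE_def Pi_def by blast
    have z: "\<phi> y * moll_kernel N k x y = 0" for y
    proof (cases "moll_kernel N k x y = 0")
      case False
      have "1 / real (Suc k) \<le> 1" by simp
      moreover have "\<bar>x i\<bar> > R + 1" using i(2) by auto
      ultimately have "\<bar>y i\<bar> > R" using supp[OF False i(1)] by linarith
      then show ?thesis using R i(1) by (auto simp: supp_in_def)
    qed simp
    have "mollify N k \<phi> x = 0" by (simp only: convolve_def z Bochner_Integration.integral_zero)
    moreover have "\<phi> x = 0" using R i unfolding supp_in_def by force
    ultimately show ?thesis using False by simp
  qed
  then show ?thesis using L(1) by (intro exI[of _ "L * real N"] exI[of _ "R + 1"]) auto
qed

lemma mollify_test_fun_conv:
  assumes \<phi>: "test_fun N \<phi>"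
  shows "l2_conv (configM N) (\<lambda>k. mollify N k \<phi>) \<phi>"
proof -
  obtain K R where K: "K \<ge> 0" "\<And>k x. x \<in> space (configM N) \<Longrightarrow>
      \<bar>mollify N k \<phi> x - \<phi> x\<bar> \<le> K / real (Suc k) * indicator (cube N R) x"
    using mollify_test_fun_bound[OF \<phi>] by blast
  let ?c = "l2_norm (configM N) (indicator (cube N R) :: _ \<Rightarrow> real)"
  have le: "l2_norm (configM N) (\<lambda>x. mollify N k \<phi> x - \<phi> x) \<le> K / real (Suc k) * ?c" for k
    using K by (intro l2_norm_mono sq_int_indicator_cube sq_int_diff mollify_young test_fun_sq_int \<phi>) auto
  have lim: "(\<lambda>k. K / real (Suc k) * ?c) \<longlonglongrightarrow> 0"
    using tendsto_mult[OF tendsto_mult[OF tendsto_const[of K] LIMSEQ_inverse_real_of_nat] tendsto_const[of ?c]]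
    by (simp add: divide_inverse)
  show ?thesis unfolding l2_conv_def
  proof (rule Lim_null_comparison[OF always_eventually lim], rule allI)
    fix k
    show "norm (l2_norm (configM N) (\<lambda>x. mollify N k \<phi> x - \<phi> x)) \<le> K / real (Suc k) * ?c"
      using le[of k] by (simp only: real_norm_def abs_of_nonneg[OF l2_norm_ge0])
  qed
qed

lemma convolve_diff:
  assumes "admissible N R a" "sq_int (configM N) \<psi>" "sq_int (configM N) \<phi>"
  shows "convolve N a (\<lambda>x. \<psi> x - \<phi> x) x = convolve N a \<psi> x - convolve N a \<phi> x"
  unfolding convolve_def using tensor_kernel_integrable[OF assms(1)] assms(2,3) by (simp add: left_diff_distrib)

text \<open>Mollification is a contraction, so convergence on the dense set of test functions
  suffices; the error splits into three thirds.\<close>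

lemma mollify_conv:
  assumes \<psi>: "sq_int (configM N) \<psi>"
  shows "l2_conv (configM N) (\<lambda>k. mollify N k \<psi>) \<psi>"
  unfolding l2_conv_def
proof (rule LIMSEQ_I)
  fix e :: real assume e: "e > 0"
  obtain F where F: "\<And>k::nat. test_fun N (F k)" "l2_conv (configM N) F \<psi>" using test_fun_dense[OF \<psi>] by blast
  obtain n where "\<forall>m\<ge>n. norm (l2_norm (configM N) (\<lambda>x. F m x - \<psi> x) - 0) < e / 3"
    using LIMSEQ_D[OF F(2)[unfolded l2_conv_def], of "e / 3"] e by auto
  then have n: "l2_norm (configM N) (\<lambda>x. F n x - \<psi> x) < e / 3" by auto
  define \<phi> where "\<phi> = F n"
  have \<phi>: "test_fun N \<phi>" "sq_int (configM N) \<phi>" using F(1) by (auto simp: \<phi>_def intro: test_fun_sq_int)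
  obtain k0 where k0: "\<forall>k\<ge>k0. norm (l2_norm (configM N) (\<lambda>x. mollify N k \<phi> x - \<phi> x) - 0) < e / 3"
    using LIMSEQ_D[OF mollify_test_fun_conv[OF \<phi>(1), unfolded l2_conv_def], of "e / 3"] e by auto
  show "\<exists>no. \<forall>k\<ge>no. norm (l2_norm (configM N) (\<lambda>x. mollify N k \<psi> x - \<psi> x) - 0) < e"
  proof (intro exI[of _ k0] allI impI)
    fix k assume k: "k0 \<le> k"
    have "l2_norm (configM N) (\<lambda>x. mollify N k \<psi> x - mollify N k \<phi> x) \<le> l2_norm (configM N) (\<lambda>x. \<psi> x - \<phi> x)"
      using mollify_young(2)[OF sq_int_diff[OF \<psi> \<phi>(2)], of k] unfolding convolve_diff[OF admissible_mollifier \<psi> \<phi>(2), abs_def] .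
    also have "\<dots> < e / 3" using n by (simp add: \<phi>_def l2_norm_minus_commute)
    finally have 1: "l2_norm (configM N) (\<lambda>x. mollify N k \<psi> x - mollify N k \<phi> x) < e / 3" .
    have 2: "l2_norm (configM N) (\<lambda>x. mollify N k \<phi> x - \<phi> x) < e / 3" using k0 k by auto
    have 3: "l2_norm (configM N) (\<lambda>x. \<phi> x - \<psi> x) < e / 3" using n by (simp add: \<phi>_def)
    have t1: "l2_norm (configM N) (\<lambda>x. mollify N k \<psi> x - \<psi> x) \<le> l2_norm (configM N) (\<lambda>x. mollify N k \<psi> x - mollify N k \<phi> x) + l2_norm (configM N) (\<lambda>x. mollify N k \<phi> x - \<psi> x)"
      by (rule l2_norm_triangle_diff[OF mollify_young(1)[OF \<psi>] mollify_young(1)[OF \<phi>(2)] \<psi>])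
    have t2: "l2_norm (configM N) (\<lambda>x. mollify N k \<phi> x - \<psi> x) \<le> l2_norm (configM N) (\<lambda>x. mollify N k \<phi> x - \<phi> x) + l2_norm (configM N) (\<lambda>x. \<phi> x - \<psi> x)"
      by (rule l2_norm_triangle_diff[OF mollify_young(1)[OF \<phi>(2)] \<phi>(2) \<psi>])
    have "l2_norm (configM N) (\<lambda>x. mollify N k \<psi> x - \<psi> x) < e / 3 + (e / 3 + e / 3)"
      using 1 2 3 t1 t2 by linarith
    then show "norm (l2_norm (configM N) (\<lambda>x. mollify N k \<psi> x - \<psi> x) - 0) < e"
      by (simp add: l2_norm_ge0)
  qed
qed

subsection \<open>Weak solutions\<close>

definition weak_sol :: "nat \<Rightarrow> real \<Rightarrow> real \<Rightarrow> ((nat \<Rightarrow> real) \<Rightarrow> real) \<Rightarrow> ((nat \<Rightarrow> real) \<Rightarrow> real) \<Rightarrow> bool" where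
  "weak_sol N Z M \<psi> f \<longleftrightarrow> sq_int (configM N) \<psi> \<and> sq_int (configM N) f \<and>
     (\<forall>\<phi>. test_fun N \<phi> \<longrightarrow> l2_inner (configM N) \<psi> (hamiltonian N Z M \<phi>) = l2_inner (configM N) f \<phi>)"

text \<open>The equation is tested against the kernel centred at \<open>x\<close>. The potential
  does not commute with mollification, so it goes to the right-hand side, where its boundedness
  keeps \<open>f - Wpot \<psi>\<close> square integrable.\<close>

lemma laplacian_mollify:
  assumes w: "weak_sol N Z M \<psi> f"
  shows "- (1 / M) * laplacian N (mollify N k \<psi>) x = mollify N k (\<lambda>x. f x - Wpot N Z x * \<psi> x) x"
proof -
  have s: "sq_int (configM N) \<psi>" "sq_int (configM N) f" using w by (auto simp: weak_sol_def)
  let ?t = "moll_kernel N k x"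
  have t: "test_fun N ?t" by (rule test_fun_tensor_kernel[OF admissible_mollifier])
  have i: "integrable (configM N) (\<lambda>y. \<psi> y * laplacian N ?t y)" "integrable (configM N) (\<lambda>y. Wpot N Z y * \<psi> y * ?t y)"
    "integrable (configM N) (\<lambda>y. f y * ?t y)"
    by (intro sq_int_real_mult_integrable sq_int_Wpot_mult s test_fun_sq_int[OF t] test_fun_sq_int[OF test_fun_laplacian[OF t]])+
  have "l2_inner (configM N) \<psi> (hamiltonian N Z M ?t) = l2_inner (configM N) f ?t" using w t by (auto simp: weak_sol_def)
  moreover have "l2_inner (configM N) \<psi> (hamiltonian N Z M ?t)
     = (\<integral>y. - (1 / M) * (\<psi> y * laplacian N ?t y) + Wpot N Z y * \<psi> y * ?t y \<partial>configM N)"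
    unfolding l2_inner_def hamiltonian_def by (simp add: algebra_simps)
  moreover have "\<dots> = - (1 / M) * (\<integral>y. \<psi> y * laplacian N ?t y \<partial>configM N) + (\<integral>y. Wpot N Z y * \<psi> y * ?t y \<partial>configM N)"
    using i by (simp del: mult_minus_left)
  moreover have "mollify N k (\<lambda>x. f x - Wpot N Z x * \<psi> x) x = (\<integral>y. f y * ?t y \<partial>configM N) - (\<integral>y. Wpot N Z y * \<psi> y * ?t y \<partial>configM N)"
    unfolding convolve_def left_diff_distrib using i by simp
  ultimately show ?thesis unfolding laplacian_convolve[OF admissible_mollifier s(1)] by (simp add: l2_inner_def)
qed

lemma mollify_conv_mult:
  assumes "sq_int (configM N) \<psi>" "a \<in> borel_measurable (configM N)" "\<And>x. \<bar>a x\<bar> \<le> C"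
  shows "l2_conv (configM N) (\<lambda>k x. a x * mollify N k \<psi> x) (\<lambda>x. a x * \<psi> x)"
proof (rule l2_conv_mult_bounded[OF mollify_conv[OF assms(1)] mollify_young(1)[OF assms(1)] assms(1,2)])
  show "\<bar>a x\<bar> \<le> C" for x by (rule assms(3))
  show "C \<ge> 0" using assms(3)[of undefined] by linarith
qed

lemma grad_sq_measurable: "test_fun N w \<Longrightarrow> grad_sq N w \<in> borel_measurable (configM N)"
proof -
  assume w: "test_fun N w"
  have [measurable]: "pd j w \<in> borel_measurable (configM N)" if "j < N" for j
    by (rule test_fun_measurable[OF test_fun_pd[OF w that]])
  show ?thesis unfolding grad_sq_def[abs_def] by measurable
qed

lemma grad_sq_bounded: "test_fun N w \<Longrightarrow> \<exists>C. \<forall>x. \<bar>grad_sq N w x\<bar> \<le> C"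
proof -
  assume w: "test_fun N w"
  have "\<forall>j. \<exists>C. j < N \<longrightarrow> (\<forall>x. \<bar>pd j w x\<bar> \<le> C)"
    using test_fun_bounded[OF test_fun_pd[OF w]] by metis
  then obtain C where C: "\<And>j x. j < N \<Longrightarrow> \<bar>pd j w x\<bar> \<le> C j" by metis
  have "(pd j w x)\<^sup>2 \<le> (C j)\<^sup>2" if "j < N" for j x
    using power_mono[OF C[OF that, of x], of 2] by simp
  then have "\<bar>grad_sq N w x\<bar> \<le> (\<Sum>j<N. (C j)\<^sup>2)" for x
    unfolding grad_sq_def by (subst abs_of_nonneg) (auto intro: sum_mono sum_nonneg)
  then show ?thesis by blast
qed

lemma grad_sq_nonneg: "0 \<le> grad_sq N w x"
  unfolding grad_sq_def by (intro sum_nonneg) auto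

text \<open>Multiplication by \<theta> turns the mollified solution into a test function. The limit
  contains no derivative of \<psi>, since the only Laplacian left by the IMS identity falls on the
  mollification and is removed by the equation.\<close>

lemma energy_form_mollified_tendsto:
  assumes w: "weak_sol N Z M \<psi> f" and x: "test_fun N \<theta>"
  shows "(\<lambda>k. energy_form N Z M (\<lambda>x. \<theta> x * mollify N k \<psi> x)) \<longlonglongrightarrow>
    l2_inner (configM N) (\<lambda>x. (\<theta> x)\<^sup>2 * \<psi> x) f + (1 / M) * l2_inner (configM N) (\<lambda>x. grad_sq N \<theta> x * \<psi> x) \<psi>"
proof -
  have s: "sq_int (configM N) \<psi>" "sq_int (configM N) f" using w by (auto simp: weak_sol_def)
  obtain Cx where Cx: "\<forall>x. \<bar>\<theta> x\<bar> \<le> Cx" using test_fun_bounded[OF x] by blast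
  obtain Cg where Cg: "\<forall>y. \<bar>grad_sq N \<theta> y\<bar> \<le> Cg" using grad_sq_bounded[OF x] by blast
  obtain Cw where Cw: "Cw \<ge> 0" "\<forall>y. \<bar>Wpot N Z y\<bar> \<le> Cw" using Wpot_bounded by blast
  have [measurable]: "\<theta> \<in> borel_measurable (configM N)" "grad_sq N \<theta> \<in> borel_measurable (configM N)"
    using x by (auto intro: test_fun_measurable grad_sq_measurable)
  have C2: "\<bar>(\<theta> y)\<^sup>2\<bar> \<le> Cx\<^sup>2" for y using power_mono[OF Cx[rule_format, of y], of 2] by simp
  have C3: "\<bar>Wpot N Z y * (\<theta> y)\<^sup>2\<bar> \<le> Cw * Cx\<^sup>2" for y
    unfolding abs_mult using C2[of y] Cw by (intro mult_mono) auto
  define g where "g x = f x - Wpot N Z x * \<psi> x" for x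
  have sg: "sq_int (configM N) g" unfolding g_def[abs_def] by (intro sq_int_diff sq_int_Wpot_mult s)
  have sq: "sq_int (configM N) (\<lambda>x. (\<theta> x)\<^sup>2 * h x)" "sq_int (configM N) (\<lambda>x. grad_sq N \<theta> x * h x)"
    "sq_int (configM N) (\<lambda>x. Wpot N Z x * (\<theta> x)\<^sup>2 * h x)" if "sq_int (configM N) h" for h
    by (rule sq_int_mult_bounded[OF that _ C2] sq_int_mult_bounded[OF that _ C3]
        sq_int_mult_bounded[OF that _ Cg[rule_format]]; measurable)+
  let ?u = "\<lambda>k. mollify N k \<psi>"
  have su: "sq_int (configM N) (?u k)" for k by (rule mollify_young(1)[OF s(1)])
  \<comment> \<open>Each of the three terms is an inner product of factors that converge in L2 as
    \<open>k\<close> grows; \<open>g\<close> collects the right-hand side with the potential moved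
    over.\<close>
  have eq: "energy_form N Z M (\<lambda>x. \<theta> x * ?u k x) = l2_inner (configM N) (\<lambda>x. (\<theta> x)\<^sup>2 * ?u k x) (mollify N k g)
      + (1 / M) * l2_inner (configM N) (\<lambda>x. grad_sq N \<theta> x * ?u k x) (?u k)
      + l2_inner (configM N) (\<lambda>x. Wpot N Z x * (\<theta> x)\<^sup>2 * ?u k x) (?u k)" for k
  proof -
    have u: "smooth N (?u k)" by (rule smooth_convolve[OF admissible_mollifier s(1)])
    have "energy_form N Z M (\<lambda>x. \<theta> x * ?u k x) =
      - (1 / M) * ((\<integral>x. (\<theta> x)\<^sup>2 * ?u k x * laplacian N (?u k) x \<partial>configM N) - (\<integral>x. grad_sq N \<theta> x * (?u k x)\<^sup>2 \<partial>configM N))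
      + (\<integral>x. Wpot N Z x * (\<theta> x * ?u k x)\<^sup>2 \<partial>configM N)"
      unfolding energy_form_split[OF test_fun_mult[OF x u]] ims_laplacian[OF x u] ..
    also have "\<dots> = (\<integral>x. (\<theta> x)\<^sup>2 * ?u k x * (- (1 / M) * laplacian N (?u k) x) \<partial>configM N) + (1 / M) * (\<integral>x. grad_sq N \<theta> x * (?u k x)\<^sup>2 \<partial>configM N)
      + (\<integral>x. Wpot N Z x * (\<theta> x * ?u k x)\<^sup>2 \<partial>configM N)"
    proof -
      have "(\<integral>x. (\<theta> x)\<^sup>2 * ?u k x * (- (1 / M) * laplacian N (?u k) x) \<partial>configM N)
         = (\<integral>x. (- (1 / M)) * ((\<theta> x)\<^sup>2 * ?u k x * laplacian N (?u k) x) \<partial>configM N)"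
        by (intro Bochner_Integration.integral_cong refl) (simp only: mult.left_commute)
      also have "\<dots> = (- (1 / M)) * (\<integral>x. (\<theta> x)\<^sup>2 * ?u k x * laplacian N (?u k) x \<partial>configM N)" by (rule integral_mult_right_zero)
      finally show ?thesis by (simp add: right_diff_distrib)
    qed
    also have "(\<integral>x. (\<theta> x)\<^sup>2 * ?u k x * (- (1 / M) * laplacian N (?u k) x) \<partial>configM N) = l2_inner (configM N) (\<lambda>x. (\<theta> x)\<^sup>2 * ?u k x) (mollify N k g)"
      unfolding laplacian_mollify[OF w] by (simp add: l2_inner_def g_def[abs_def])
    finally show ?thesis by (simp add: l2_inner_def power2_eq_square mult_ac)
  qed
  have lim: "(\<lambda>k. energy_form N Z M (\<lambda>x. \<theta> x * ?u k x)) \<longlonglongrightarrow> l2_inner (configM N) (\<lambda>x. (\<theta> x)\<^sup>2 * \<psi> x) g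
      + (1 / M) * l2_inner (configM N) (\<lambda>x. grad_sq N \<theta> x * \<psi> x) \<psi>
      + l2_inner (configM N) (\<lambda>x. Wpot N Z x * (\<theta> x)\<^sup>2 * \<psi> x) \<psi>"
    unfolding eq
    by (intro tendsto_add tendsto_mult tendsto_const l2_conv_ip2 sq su s sg mollify_conv mollify_young
        mollify_conv_mult[OF s(1) _ C2] mollify_conv_mult[OF s(1) _ C3] mollify_conv_mult[OF s(1) _ Cg[rule_format]])
      measurable
  have "l2_inner (configM N) (\<lambda>x. (\<theta> x)\<^sup>2 * \<psi> x) g = l2_inner (configM N) (\<lambda>x. (\<theta> x)\<^sup>2 * \<psi> x) f
      - l2_inner (configM N) (\<lambda>x. (\<theta> x)\<^sup>2 * \<psi> x) (\<lambda>x. Wpot N Z x * \<psi> x)"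
    unfolding g_def[abs_def] by (intro l2_inner_diff_right s sq sq_int_Wpot_mult)
  moreover have "l2_inner (configM N) (\<lambda>x. (\<theta> x)\<^sup>2 * \<psi> x) (\<lambda>x. Wpot N Z x * \<psi> x) = l2_inner (configM N) (\<lambda>x. Wpot N Z x * (\<theta> x)\<^sup>2 * \<psi> x) \<psi>"
    by (simp add: l2_inner_def mult_ac)
  ultimately show ?thesis using lim by simp
qed

lemma localized_conv:
  assumes "sq_int (configM N) \<psi>" "test_fun N \<theta>"
  shows "l2_conv (configM N) (\<lambda>k x. \<theta> x * mollify N k \<psi> x) (\<lambda>x. \<theta> x * \<psi> x)"
    "test_fun N (\<lambda>x. \<theta> x * mollify N k \<psi> x)" "sq_int (configM N) (\<lambda>x. \<theta> x * \<psi> x)"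
proof -
  obtain C where C: "\<forall>x. \<bar>\<theta> x\<bar> \<le> C" using test_fun_bounded[OF assms(2)] by blast
  show "l2_conv (configM N) (\<lambda>k x. \<theta> x * mollify N k \<psi> x) (\<lambda>x. \<theta> x * \<psi> x)"
    by (rule mollify_conv_mult[OF assms(1) test_fun_measurable[OF assms(2)] C[rule_format]])
  show "test_fun N (\<lambda>x. \<theta> x * mollify N k \<psi> x)"
    by (rule test_fun_mult[OF assms(2) smooth_convolve[OF admissible_mollifier assms(1)]])
  show "sq_int (configM N) (\<lambda>x. \<theta> x * \<psi> x)"
    using C by (intro sq_int_mult_bounded[OF assms(1) test_fun_measurable[OF assms(2)]]) auto
qed

subsection \<open>Cutoff functions\<close>

definition cutoff :: "nat \<Rightarrow> nat \<Rightarrow> (nat \<Rightarrow> real) \<Rightarrow> real" where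
  "cutoff N n = tensor N (\<lambda>_ t. bump (t / real (Suc n)))"

lemma smooth1_bump_scale: "smooth1 (\<lambda>t. bump (t / c))"
  using smooth1_compose[OF smooth1_bump, of "\<lambda>t. (1 / c) * t"] smooth1_cmult[OF smooth1_ident, of "1 / c"] by simp

lemma bump_scale_supp: "\<bar>t\<bar> > real (Suc n) \<Longrightarrow> bump (t / real (Suc n)) = 0"
  by (rule bump_eq_0) (simp add: abs_divide)

lemma deriv_bump_scale: "c \<noteq> 0 \<Longrightarrow> deriv (\<lambda>t. bump (t / c)) t = deriv bump (t / c) / c"
proof -
  assume c: "c \<noteq> 0"
  have "((\<lambda>t. t / c) has_real_derivative 1 / c) (at t)" using c by (auto intro!: derivative_eq_intros)
  from DERIV_chain2[OF smooth1_deriv(1)[OF smooth1_bump] this] show ?thesis by (intro DERIV_imp_deriv) simp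
qed

lemma test_fun_cutoff: "test_fun N (cutoff N n)"
  unfolding cutoff_def by (rule test_fun_tensor, rule smooth1_bump_scale, rule bump_scale_supp)

lemma prod_bounds:
  assumes "\<And>i. i \<in> A \<Longrightarrow> 0 \<le> f i \<and> f i \<le> (1::real)"
  shows "0 \<le> prod f A" "prod f A \<le> 1"
  using assms by (auto intro: prod_nonneg prod_le_1)

lemma cutoff_bounds: "0 \<le> cutoff N n x" "cutoff N n x \<le> 1"
  unfolding cutoff_def tensor_def using bump_nonneg bump_le_1 by (auto intro: prod_bounds)

lemma cutoff_tendsto: "(\<lambda>n. cutoff N n x) \<longlonglongrightarrow> 1"
proof -
  have "(\<lambda>n. bump (x i / real (Suc n))) \<longlonglongrightarrow> bump 0" for i
  proof (rule continuous_on_tendsto_compose[OF smooth1_cont[OF smooth1_bump]])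
    show "(\<lambda>n. x i / real (Suc n)) \<longlonglongrightarrow> 0"
      using tendsto_mult[OF tendsto_const[of "x i"] LIMSEQ_inverse_real_of_nat] by (simp add: divide_inverse)
  qed auto
  then have "(\<lambda>n. cutoff N n x) \<longlonglongrightarrow> (\<Prod>i<N. bump 0)"
    unfolding cutoff_def tensor_def by (intro tendsto_prod)
  then show ?thesis by (simp add: bump_0)
qed

text \<open>Dilation by \<open>n + 1\<close> gains one inverse power per derivative, and the
  undifferentiated factors are at most 1.\<close>

lemma cutoff_grad: "\<exists>K\<ge>0. \<forall>n x. grad_sq N (cutoff N n) x \<le> K / (real (Suc n))\<^sup>2"
proof -
  obtain C where C: "C \<ge> 0" "\<And>t. \<bar>deriv bump t\<bar> \<le> C" using bump_deriv_bound by blast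
  have "(pd j (cutoff N n) x)\<^sup>2 \<le> C\<^sup>2 / (real (Suc n))\<^sup>2" if j: "j < N" for j n x
  proof -
    let ?P = "\<Prod>i\<in>{..<N} - {j}. bump (x i / real (Suc n))"
    have "pd j (cutoff N n) x = deriv bump (x j / real (Suc n)) / real (Suc n) * ?P"
      unfolding cutoff_def using j smooth1_bump_scale
      by (simp add: tensor_pd tensor_split deriv_bump_scale del: of_nat_Suc)
    then have "\<bar>pd j (cutoff N n) x\<bar> = \<bar>deriv bump (x j / real (Suc n))\<bar> / real (Suc n) * \<bar>?P\<bar>"
      by (simp add: abs_mult abs_divide)
    also have "\<dots> \<le> C / real (Suc n) * 1"
      using C prod_bounds[of "{..<N} - {j}" "\<lambda>i. bump (x i / real (Suc n))"] bump_nonneg bump_le_1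
      by (intro mult_mono divide_right_mono) auto
    finally have "\<bar>pd j (cutoff N n) x\<bar>\<^sup>2 \<le> (C / real (Suc n))\<^sup>2" by (intro power_mono) auto
    then show ?thesis by (simp add: power_divide)
  qed
  then have "grad_sq N (cutoff N n) x \<le> (\<Sum>j<N. C\<^sup>2 / (real (Suc n))\<^sup>2)" for n x
    unfolding grad_sq_def by (intro sum_mono) auto
  then show ?thesis by (intro exI[of _ "real N * C\<^sup>2"]) auto
qed

lemma cutoff_conv:
  assumes \<psi>: "sq_int (configM N) \<psi>"
  shows "l2_conv (configM N) (\<lambda>n x. cutoff N n x * \<psi> x) \<psi>"
proof -
  have [measurable]: "\<psi> \<in> borel_measurable (configM N)" "cutoff N n \<in> borel_measurable (configM N)" for n
    using \<psi> test_fun_measurable[OF test_fun_cutoff] by (auto simp: sq_int_def)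
  have "(\<lambda>n. \<integral>x. (cutoff N n x * \<psi> x - \<psi> x)\<^sup>2 \<partial>configM N) \<longlonglongrightarrow> (\<integral>x. 0 \<partial>configM N)"
  proof (rule integral_dominated_convergence)
    show "integrable (configM N) (\<lambda>x. (\<psi> x)\<^sup>2)" using \<psi> by (simp add: sq_int_def)
    show "AE x in configM N. (\<lambda>n. (cutoff N n x * \<psi> x - \<psi> x)\<^sup>2) \<longlonglongrightarrow> 0"
    proof (rule AE_I2)
      fix x
      have "(\<lambda>n. (cutoff N n x * \<psi> x - \<psi> x)\<^sup>2) \<longlonglongrightarrow> (1 * \<psi> x - \<psi> x)\<^sup>2" by (intro tendsto_intros cutoff_tendsto)
      then show "(\<lambda>n. (cutoff N n x * \<psi> x - \<psi> x)\<^sup>2) \<longlonglongrightarrow> 0" by simp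
    qed
    show "AE x in configM N. norm ((cutoff N n x * \<psi> x - \<psi> x)\<^sup>2) \<le> (\<psi> x)\<^sup>2" for n
    proof (rule AE_I2)
      fix x
      have "cutoff N n x * \<psi> x - \<psi> x = (cutoff N n x - 1) * \<psi> x" by (simp add: algebra_simps)
      then have "(cutoff N n x * \<psi> x - \<psi> x)\<^sup>2 = (cutoff N n x - 1)\<^sup>2 * (\<psi> x)\<^sup>2" by (simp add: power_mult_distrib)
      also have "\<dots> \<le> 1 * (\<psi> x)\<^sup>2"
        using cutoff_bounds[of N n x] by (intro mult_right_mono) (auto simp: abs_square_le_1)
      finally show "norm ((cutoff N n x * \<psi> x - \<psi> x)\<^sup>2) \<le> (\<psi> x)\<^sup>2" by simp
    qed
  qed measurable
  then have "(\<lambda>n. sqrt (\<integral>x. (cutoff N n x * \<psi> x - \<psi> x)\<^sup>2 \<partial>configM N)) \<longlonglongrightarrow> sqrt 0"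
    by (intro tendsto_real_sqrt) simp
  then show ?thesis by (simp add: l2_conv_def l2_norm_def l2_inner_def power2_eq_square)
qed

lemma sq_int_cutoff_mult: "sq_int (configM N) \<psi> \<Longrightarrow> sq_int (configM N) (\<lambda>x. cutoff N n x * \<psi> x)"
  by (rule localized_conv(3)[OF _ test_fun_cutoff])

lemma cutoff_grad_tendsto:
  assumes "sq_int (configM N) \<psi>"
  shows "(\<lambda>n. l2_inner (configM N) (\<lambda>x. grad_sq N (cutoff N n) x * \<psi> x) \<psi>) \<longlonglongrightarrow> 0"
proof -
  obtain K where K: "K \<ge> 0" "\<And>n x. grad_sq N (cutoff N n) x \<le> K / (real (Suc n))\<^sup>2" using cutoff_grad by blast
  have i: "integrable (configM N) (\<lambda>x. \<psi> x * \<psi> x)" by (rule sq_int_real_mult_integrable[OF assms assms])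
  have le: "l2_inner (configM N) (\<lambda>x. grad_sq N (cutoff N n) x * \<psi> x) \<psi> \<le> K / (real (Suc n))\<^sup>2 * l2_inner (configM N) \<psi> \<psi>" for n
  proof -
    obtain C where C: "\<forall>x. \<bar>grad_sq N (cutoff N n) x\<bar> \<le> C" using grad_sq_bounded[OF test_fun_cutoff] by blast
    have "sq_int (configM N) (\<lambda>x. grad_sq N (cutoff N n) x * \<psi> x)"
      using C by (intro sq_int_mult_bounded[OF assms grad_sq_measurable[OF test_fun_cutoff]]) auto
    from sq_int_real_mult_integrable[OF this assms]
    have "(\<integral>x. grad_sq N (cutoff N n) x * \<psi> x * \<psi> x \<partial>configM N) \<le> (\<integral>x. K / (real (Suc n))\<^sup>2 * (\<psi> x * \<psi> x) \<partial>configM N)"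
    proof (rule integral_mono)
      show "grad_sq N (cutoff N n) x * \<psi> x * \<psi> x \<le> K / (real (Suc n))\<^sup>2 * (\<psi> x * \<psi> x)" for x
        unfolding mult.assoc by (intro mult_right_mono K) auto
    qed (use i in simp)
    then show ?thesis by (simp add: l2_inner_def)
  qed
  have ge: "0 \<le> l2_inner (configM N) (\<lambda>x. grad_sq N (cutoff N n) x * \<psi> x) \<psi>" for n
    unfolding l2_inner_def using grad_sq_nonneg by (intro Bochner_Integration.integral_nonneg) (simp add: mult.assoc)
  have "(\<lambda>n. K / (real (Suc n))\<^sup>2 * l2_inner (configM N) \<psi> \<psi>) \<longlonglongrightarrow> K * 0\<^sup>2 * l2_inner (configM N) \<psi> \<psi>"
    unfolding divide_inverse power_inverse[symmetric] by (intro tendsto_intros LIMSEQ_inverse_real_of_nat)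
  then have lim: "(\<lambda>n. K / (real (Suc n))\<^sup>2 * l2_inner (configM N) \<psi> \<psi>) \<longlonglongrightarrow> 0" by simp
  show ?thesis
    by (rule tendsto_sandwich[OF always_eventually always_eventually tendsto_const lim]) (use le ge in auto)
qed

lemma cutoff_sq_ip_tendsto:
  assumes "sq_int (configM N) \<psi>" "sq_int (configM N) f"
  shows "(\<lambda>n. l2_inner (configM N) (\<lambda>x. (cutoff N n x)\<^sup>2 * \<psi> x) f) \<longlonglongrightarrow> l2_inner (configM N) \<psi> f"
proof -
  have "l2_inner (configM N) (\<lambda>x. (cutoff N n x)\<^sup>2 * \<psi> x) f = l2_inner (configM N) (\<lambda>x. cutoff N n x * \<psi> x) (\<lambda>x. cutoff N n x * f x)" for n
    by (simp add: l2_inner_def power2_eq_square mult_ac)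
  then show ?thesis using assms
    by (simp add: l2_conv_ip2 cutoff_conv sq_int_cutoff_mult)
qed

subsection \<open>Semibounded forms\<close>

definition form_bound :: "nat \<Rightarrow> real \<Rightarrow> real \<Rightarrow> real \<Rightarrow> bool" where
  "form_bound N Z M q \<longleftrightarrow> (\<forall>\<phi>. test_fun N \<phi> \<longrightarrow> q * l2_inner (configM N) \<phi> \<phi> \<le> energy_form N Z M \<phi>)"

text \<open>Carries a form inequality from test functions to weak solutions through two limits:
  mollification at a fixed cutoff, then removal of the cutoff, whose gradient term tends to
  0.\<close>

lemma weak_sol_lower_bound:
  assumes w: "weak_sol N Z M \<psi> f" and q: "form_bound N Z M q"
  shows "q * l2_inner (configM N) \<psi> \<psi> \<le> l2_inner (configM N) \<psi> f"
proof -
  have s: "sq_int (configM N) \<psi>" "sq_int (configM N) f" using w by (auto simp: weak_sol_def)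
  have cut: "q * l2_inner (configM N) (\<lambda>x. \<theta> x * \<psi> x) (\<lambda>x. \<theta> x * \<psi> x) \<le>
     l2_inner (configM N) (\<lambda>x. (\<theta> x)\<^sup>2 * \<psi> x) f + (1 / M) * l2_inner (configM N) (\<lambda>x. grad_sq N \<theta> x * \<psi> x) \<psi>"
    if x: "test_fun N \<theta>" for \<theta>
  proof (rule LIMSEQ_le)
    note c = localized_conv[OF s(1) x]
    show "(\<lambda>k. q * l2_inner (configM N) (\<lambda>x. \<theta> x * mollify N k \<psi> x) (\<lambda>x. \<theta> x * mollify N k \<psi> x)) \<longlonglongrightarrow>
        q * l2_inner (configM N) (\<lambda>x. \<theta> x * \<psi> x) (\<lambda>x. \<theta> x * \<psi> x)"
      by (intro tendsto_mult tendsto_const l2_conv_ip2 c test_fun_sq_int)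
    show "(\<lambda>k. energy_form N Z M (\<lambda>x. \<theta> x * mollify N k \<psi> x)) \<longlonglongrightarrow>
      l2_inner (configM N) (\<lambda>x. (\<theta> x)\<^sup>2 * \<psi> x) f + (1 / M) * l2_inner (configM N) (\<lambda>x. grad_sq N \<theta> x * \<psi> x) \<psi>"
      by (rule energy_form_mollified_tendsto[OF w x])
    show "\<exists>N0. \<forall>k\<ge>N0. q * l2_inner (configM N) (\<lambda>x. \<theta> x * mollify N k \<psi> x) (\<lambda>x. \<theta> x * mollify N k \<psi> x) \<le> energy_form N Z M (\<lambda>x. \<theta> x * mollify N k \<psi> x)"
      using q c(2) unfolding form_bound_def by blast
  qed
  have "q * l2_inner (configM N) \<psi> \<psi> \<le> l2_inner (configM N) \<psi> f + (1 / M) * 0"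
  proof (rule LIMSEQ_le)
    show "(\<lambda>n. q * l2_inner (configM N) (\<lambda>x. cutoff N n x * \<psi> x) (\<lambda>x. cutoff N n x * \<psi> x)) \<longlonglongrightarrow> q * l2_inner (configM N) \<psi> \<psi>"
      by (intro tendsto_mult tendsto_const l2_conv_ip2 cutoff_conv sq_int_cutoff_mult s)
    show "(\<lambda>n. l2_inner (configM N) (\<lambda>x. (cutoff N n x)\<^sup>2 * \<psi> x) f + (1 / M) * l2_inner (configM N) (\<lambda>x. grad_sq N (cutoff N n) x * \<psi> x) \<psi>)
       \<longlonglongrightarrow> l2_inner (configM N) \<psi> f + (1 / M) * 0"
      by (intro tendsto_add tendsto_mult tendsto_const cutoff_sq_ip_tendsto cutoff_grad_tendsto s)
  qed (use cut[OF test_fun_cutoff] in blast)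
  then show ?thesis by simp
qed

lemma l2_inner_zero_AE:
  fixes \<psi> :: "_ \<Rightarrow> real"
  assumes "sq_int M \<psi>" "l2_inner M \<psi> \<psi> \<le> 0"
  shows "AE x in M. \<psi> x = 0"
proof -
  have i: "integrable M (\<lambda>x. \<psi> x * \<psi> x)" by (rule sq_int_real_mult_integrable[OF assms(1,1)])
  have "l2_inner M \<psi> \<psi> = 0" using assms(2) l2_inner_ge0[of M \<psi>] by (rule antisym)
  then have "(\<integral>x. \<psi> x * \<psi> x \<partial>M) = 0" by (simp add: l2_inner_def)
  then have "AE x in M. \<psi> x * \<psi> x = 0"
    using integral_nonneg_eq_0_iff_AE[OF i] by simp
  then show ?thesis by simp
qed

text \<open>Real form of the homogeneous equation with parameter \<open>a - i b\<close> for
  \<open>\<eta>1 + i \<eta>2\<close>. Adding the two lower bounds cancels the cross terms in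
  \<open>b\<close> and leaves \<open>q - a\<close> times a sum of squared norms at most 0.\<close>

lemma weak_sol_unique:
  assumes w: "weak_sol N Z M \<eta>1 (\<lambda>x. a * \<eta>1 x + b * \<eta>2 x)" "weak_sol N Z M \<eta>2 (\<lambda>x. a * \<eta>2 x - b * \<eta>1 x)"
    and q: "form_bound N Z M q" "a < q"
  shows "(AE x in configM N. \<eta>1 x = 0) \<and> (AE x in configM N. \<eta>2 x = 0)"
proof -
  let ?M = "configM N"
  have s: "sq_int ?M \<eta>1" "sq_int ?M \<eta>2" using w by (auto simp: weak_sol_def)
  have i: "integrable ?M (\<lambda>x. \<eta>1 x * \<eta>1 x)" "integrable ?M (\<lambda>x. \<eta>1 x * \<eta>2 x)" "integrable ?M (\<lambda>x. \<eta>2 x * \<eta>2 x)"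
    using s by (auto intro: sq_int_real_mult_integrable)
  have 1: "l2_inner ?M \<eta>1 (\<lambda>x. a * \<eta>1 x + b * \<eta>2 x) = a * l2_inner ?M \<eta>1 \<eta>1 + b * l2_inner ?M \<eta>1 \<eta>2"
    using l2_inner_add_right[OF sq_int_cmult[OF s(1)] sq_int_cmult[OF s(2)] s(1)] l2_inner_scale_right[of ?M \<eta>1]
    by simp
  have 2: "l2_inner ?M \<eta>2 (\<lambda>x. a * \<eta>2 x - b * \<eta>1 x) = a * l2_inner ?M \<eta>2 \<eta>2 - b * l2_inner ?M \<eta>1 \<eta>2"
    using l2_inner_diff_right[OF sq_int_cmult[OF s(2)] sq_int_cmult[OF s(1)] s(2)] l2_inner_scale_right[of ?M \<eta>2]
    by (simp add: l2_inner_commute[of ?M \<eta>2 \<eta>1])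
  have "q * l2_inner ?M \<eta>1 \<eta>1 + q * l2_inner ?M \<eta>2 \<eta>2 \<le> a * l2_inner ?M \<eta>1 \<eta>1 + a * l2_inner ?M \<eta>2 \<eta>2"
    using weak_sol_lower_bound[OF w(1) q(1)] weak_sol_lower_bound[OF w(2) q(1)] unfolding 1 2 by linarith
  then have "(q - a) * (l2_inner ?M \<eta>1 \<eta>1 + l2_inner ?M \<eta>2 \<eta>2) \<le> 0" by (simp add: algebra_simps)
  then have "l2_inner ?M \<eta>1 \<eta>1 + l2_inner ?M \<eta>2 \<eta>2 \<le> 0" using q(2) by (simp add: mult_le_0_iff)
  then have "l2_inner ?M \<eta>1 \<eta>1 \<le> 0" "l2_inner ?M \<eta>2 \<eta>2 \<le> 0"
    using l2_inner_ge0[of ?M \<eta>1] l2_inner_ge0[of ?M \<eta>2] by linarith+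
  then show ?thesis using l2_inner_zero_AE s by blast
qed

subsection \<open>Complex-valued functions\<close>

lemma sq_int_complex_iff: "sq_int M F \<longleftrightarrow> sq_int M (\<lambda>x. Re (F x)) \<and> sq_int M (\<lambda>x. Im (F x))"
proof
  assume F: "sq_int M F"
  then have [measurable]: "F \<in> borel_measurable M" by (simp add: sq_int_def)
  show "sq_int M (\<lambda>x. Re (F x)) \<and> sq_int M (\<lambda>x. Im (F x))"
    using sq_int_bound[OF F, of "\<lambda>x. Re (F x)" 1] sq_int_bound[OF F, of "\<lambda>x. Im (F x)" 1]
    by (auto simp: abs_Re_le_cmod abs_Im_le_cmod)
next
  assume F: "sq_int M (\<lambda>x. Re (F x)) \<and> sq_int M (\<lambda>x. Im (F x))"
  then have "F \<in> borel_measurable M" by (subst borel_measurable_complex_iff) (auto simp: sq_int_def)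
  moreover have "integrable M (\<lambda>x. (Re (F x))\<^sup>2 + (Im (F x))\<^sup>2)"
    using F by (intro Bochner_Integration.integrable_add) (auto simp: sq_int_def)
  ultimately show "sq_int M F" by (simp add: sq_int_def cmod_power2)
qed

lemma l2_inner_complex:
  assumes "sq_int M F" "sq_int M G"
  shows "l2_inner M F G = l2_inner M (\<lambda>x. Re (F x)) (\<lambda>x. Re (G x)) + l2_inner M (\<lambda>x. Im (F x)) (\<lambda>x. Im (G x))"
proof -
  have "sq_int M (\<lambda>x. Re (F x))" "sq_int M (\<lambda>x. Im (F x))" "sq_int M (\<lambda>x. Re (G x))" "sq_int M (\<lambda>x. Im (G x))"
    using assms by (auto simp: sq_int_complex_iff)
  then show ?thesis unfolding l2_inner_def inner_complex_def
    by (simp add: sq_int_real_mult_integrable)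
qed

lemma l2_conv_Re_Im:
  assumes "l2_conv M F f" "\<And>k. sq_int M (F k)" "sq_int M f"
  shows "l2_conv M (\<lambda>k x. Re (F k x)) (\<lambda>x. Re (f x))" "l2_conv M (\<lambda>k x. Im (F k x)) (\<lambda>x. Im (f x))"
proof -
  have s: "sq_int M (\<lambda>x. F k x - f x)" for k by (intro sq_int_diff assms)
  have s': "sq_int M (\<lambda>x. Re (F k x) - Re (f x))" "sq_int M (\<lambda>x. Im (F k x) - Im (f x))" for k
    using s[of k] by (simp_all add: sq_int_complex_iff)
  have R: "l2_norm M (\<lambda>x. Re (F k x) - Re (f x)) \<le> 1 * l2_norm M (\<lambda>x. F k x - f x)" for k
    by (rule l2_norm_mono[OF s s'(1)]) (auto simp: abs_Re_le_cmod simp flip: minus_complex.sel)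
  have I: "l2_norm M (\<lambda>x. Im (F k x) - Im (f x)) \<le> 1 * l2_norm M (\<lambda>x. F k x - f x)" for k
    by (rule l2_norm_mono[OF s s'(2)]) (auto simp: abs_Im_le_cmod simp flip: minus_complex.sel)
  show "l2_conv M (\<lambda>k x. Re (F k x)) (\<lambda>x. Re (f x))" unfolding l2_conv_def
    by (rule Lim_null_comparison[OF always_eventually assms(1)[unfolded l2_conv_def]])
      (use R in \<open>simp add: l2_norm_ge0\<close>)
  show "l2_conv M (\<lambda>k x. Im (F k x)) (\<lambda>x. Im (f x))" unfolding l2_conv_def
    by (rule Lim_null_comparison[OF always_eventually assms(1)[unfolded l2_conv_def]])
      (use I in \<open>simp add: l2_norm_ge0\<close>)
qed

lemma l2_conv_Cauchy:
  assumes "l2_conv M F f" "\<And>k. sq_int M (F k)" "sq_int M f" "e > 0"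
  shows "\<exists>n0. \<forall>m\<ge>n0. \<forall>n\<ge>n0. l2_norm M (\<lambda>x. F m x - F n x) < e"
proof -
  obtain n0 where n0: "\<forall>n\<ge>n0. norm (l2_norm M (\<lambda>x. F n x - f x) - 0) < e / 2"
    using LIMSEQ_D[OF assms(1)[unfolded l2_conv_def], of "e / 2"] assms(4) by auto
  have "l2_norm M (\<lambda>x. F m x - F n x) < e" if "m \<ge> n0" "n \<ge> n0" for m n
  proof -
    have "l2_norm M (\<lambda>x. F m x - F n x) \<le> l2_norm M (\<lambda>x. F m x - f x) + l2_norm M (\<lambda>x. f x - F n x)"
      by (rule l2_norm_triangle_diff[OF assms(2,3,2)])
    moreover have "l2_norm M (\<lambda>x. F m x - f x) < e / 2" "l2_norm M (\<lambda>x. f x - F n x) < e / 2"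
      using n0 that by (auto simp: l2_norm_minus_commute[of M f])
    ultimately show ?thesis by linarith
  qed
  then show ?thesis by blast
qed

lemma L2_iff: "f \<in> L2 N \<longleftrightarrow> sq_int (configM N) f"
  by (simp add: L2_def sq_int_def)

lemma integral_mult_real_complex:
  fixes \<psi> :: "_ \<Rightarrow> complex"
  assumes "sq_int M \<psi>" "sq_int M g"
  shows "(\<integral>x. \<psi> x * complex_of_real (g x) \<partial>M)
    = Complex (l2_inner M (\<lambda>x. Re (\<psi> x)) g) (l2_inner M (\<lambda>x. Im (\<psi> x)) g)"
proof -
  have s: "sq_int M (\<lambda>x. Re (\<psi> x))" "sq_int M (\<lambda>x. Im (\<psi> x))" using assms by (auto simp: sq_int_complex_iff)
  have i: "integrable M (\<lambda>x. Re (\<psi> x) * g x)" "integrable M (\<lambda>x. Im (\<psi> x) * g x)"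
    using s assms(2) by (auto intro: sq_int_real_mult_integrable)
  have eq: "\<psi> x * complex_of_real (g x) = complex_of_real (Re (\<psi> x) * g x) + \<i> * complex_of_real (Im (\<psi> x) * g x)" for x
    by (simp add: complex_eq_iff)
  have "(\<integral>x. \<psi> x * complex_of_real (g x) \<partial>M)
      = complex_of_real (\<integral>x. Re (\<psi> x) * g x \<partial>M) + \<i> * complex_of_real (\<integral>x. Im (\<psi> x) * g x \<partial>M)"
    unfolding eq using i
    by (subst Bochner_Integration.integral_add) (auto intro!: integrable_of_real simp del: of_real_mult)
  then show ?thesis by (simp add: l2_inner_def complex_eq_iff)
qed

text \<open>The coefficients of the operator and the test functions are real, so the complex
  identity is a pair of real ones. If one of the two functions is not square integrable, both sides
  are false.\<close>

lemma h_op_iff: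
  "h_op N Z M \<psi> f \<longleftrightarrow> weak_sol N Z M (\<lambda>x. Re (\<psi> x)) (\<lambda>x. Re (f x)) \<and> weak_sol N Z M (\<lambda>x. Im (\<psi> x)) (\<lambda>x. Im (f x))"
proof (cases "sq_int (configM N) \<psi> \<and> sq_int (configM N) f")
  case True
  have "(\<integral>x. \<psi> x * complex_of_real (- (1 / M) * (\<Sum>j<N. iter_pd [j, j] \<phi> x) + Wpot N Z x * \<phi> x) \<partial>configM N)
        = (\<integral>x. f x * complex_of_real (\<phi> x) \<partial>configM N)
     \<longleftrightarrow> l2_inner (configM N) (\<lambda>x. Re (\<psi> x)) (hamiltonian N Z M \<phi>) = l2_inner (configM N) (\<lambda>x. Re (f x)) \<phi>
       \<and> l2_inner (configM N) (\<lambda>x. Im (\<psi> x)) (hamiltonian N Z M \<phi>) = l2_inner (configM N) (\<lambda>x. Im (f x)) \<phi>"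
    if \<phi>: "test_fun N \<phi>" for \<phi>
  proof -
    have "- (1 / M) * (\<Sum>j<N. iter_pd [j, j] \<phi> x) + Wpot N Z x * \<phi> x = hamiltonian N Z M \<phi> x" for x
      by (simp add: hamiltonian_def laplacian_def iter_pd_def)
    then show ?thesis
      using integral_mult_real_complex[of "configM N" \<psi> "hamiltonian N Z M \<phi>"] integral_mult_real_complex[of "configM N" f \<phi>]
        True sq_int_hamiltonian[OF \<phi>] test_fun_sq_int[OF \<phi>] by simp
  qed
  then show ?thesis using True by (auto simp: h_op_def L2_iff weak_sol_def sq_int_complex_iff)
next
  case False
  then show ?thesis by (auto simp: h_op_def L2_iff weak_sol_def sq_int_complex_iff)
qed

lemma weak_sol_cong:
  assumes "weak_sol N Z M \<psi> f" "AE x in configM N. f x = g x" "sq_int (configM N) g"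
  shows "weak_sol N Z M \<psi> g"
  unfolding weak_sol_def
proof (intro conjI allI impI)
  fix \<phi> assume \<phi>: "test_fun N \<phi>"
  have "l2_inner (configM N) f \<phi> = l2_inner (configM N) g \<phi>"
    using assms test_fun_sq_int[OF \<phi>] by (intro l2_inner_cong_AE) (auto simp: weak_sol_def)
  then show "l2_inner (configM N) \<psi> (hamiltonian N Z M \<phi>) = l2_inner (configM N) g \<phi>" using assms(1) \<phi> by (auto simp: weak_sol_def)
qed (use assms in \<open>auto simp: weak_sol_def\<close>)

subsection \<open>Half-plane below the form bound\<close>

text \<open>Least squares: \<open>(f1, f2)\<close> is projected onto the closure of the range of \<open>h - (a + i b)\<close> on test
  functions. The defect solves the homogeneous equation for \<open>a - i b\<close> and hence vanishes, and
  coercivity turns convergence in the range into convergence of the preimages.\<close>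

lemma weak_sol_exists:
  assumes f: "sq_int (configM N) f1" "sq_int (configM N) f2" and q: "form_bound N Z M q" "a < q"
  shows "\<exists>\<psi>1 \<psi>2. weak_sol N Z M \<psi>1 (\<lambda>x. f1 x + (a * \<psi>1 x - b * \<psi>2 x)) \<and> weak_sol N Z M \<psi>2 (\<lambda>x. f2 x + (a * \<psi>2 x + b * \<psi>1 x))"
proof -
  let ?M = "configM N" and ?H = "hamiltonian N Z M"
  \<comment> \<open>\<open>T1\<close> and \<open>T2\<close> are the real and imaginary part of
    \<open>(h - (a + i b)) (u + i v)\<close> for \<open>p = (u, v)\<close>. Packing the pairs into
    complex values lets projection and completeness apply with the real inner product.\<close>
  define T1 where "T1 p x = ?H (fst p) x - a * fst p x + b * snd p x" for p :: "((nat \<Rightarrow> real) \<Rightarrow> real) \<times> ((nat \<Rightarrow> real) \<Rightarrow> real)" and x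
  define T2 where "T2 p x = ?H (snd p) x - a * snd p x - b * fst p x" for p :: "((nat \<Rightarrow> real) \<Rightarrow> real) \<times> ((nat \<Rightarrow> real) \<Rightarrow> real)" and x
  define T where "T p x = Complex (T1 p x) (T2 p x)" for p x
  define P where "P p x = Complex (fst p x) (snd p x)" for p :: "((nat \<Rightarrow> real) \<Rightarrow> real) \<times> ((nat \<Rightarrow> real) \<Rightarrow> real)" and x
  define TF where "TF = {p. test_fun N (fst p) \<and> test_fun N (snd p)}"
  have sT12: "sq_int ?M (T1 p)" "sq_int ?M (T2 p)" if "p \<in> TF" for p
    using that unfolding T1_def[abs_def] T2_def[abs_def] TF_def
    by (auto intro!: sq_int_add sq_int_diff sq_int_cmult sq_int_hamiltonian intro: test_fun_sq_int)
  have sT: "sq_int ?M (T p)" if "p \<in> TF" for p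
    using sT12[OF that] by (simp add: sq_int_complex_iff T_def)
  have sP: "sq_int ?M (P p)" if "p \<in> TF" for p
    using that by (auto simp: sq_int_complex_iff P_def TF_def intro: test_fun_sq_int)
  \<comment> \<open>One combination \<open>p + c r\<close> covers all uses: sums for
    \<open>c = 1\<close>, multiples for \<open>p = 0\<close>, differences for
    \<open>c = -1\<close>.\<close>
  define lin where "lin c p r = (\<lambda>x. fst p x + c * fst r x, \<lambda>x. snd p x + c * snd r x)"
    for c :: real and p r :: "((nat \<Rightarrow> real) \<Rightarrow> real) \<times> ((nat \<Rightarrow> real) \<Rightarrow> real)"
  have lin: "lin c p r \<in> TF" "T (lin c p r) = (\<lambda>x. T p x + c *\<^sub>R T r x)" "P (lin c p r) = (\<lambda>x. P p x + c *\<^sub>R P r x)"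
    if "p \<in> TF" "r \<in> TF" for c p r
  proof -
    show "lin c p r \<in> TF" using that by (auto simp: lin_def TF_def intro: test_fun_add test_fun_cmult)
    have "?H (fst (lin c p r)) x = ?H (fst p) x + c * ?H (fst r) x" "?H (snd (lin c p r)) x = ?H (snd p) x + c * ?H (snd r) x" for x
      using that by (simp_all add: lin_def TF_def hamiltonian_add hamiltonian_cmult smooth_cmult test_fun_smooth)
    then show "T (lin c p r) = (\<lambda>x. T p x + c *\<^sub>R T r x)"
      by (auto simp: T_def T1_def T2_def lin_def fun_eq_iff complex_eq_iff algebra_simps)
    show "P (lin c p r) = (\<lambda>x. P p x + c *\<^sub>R P r x)"
      by (auto simp: P_def lin_def fun_eq_iff complex_eq_iff)
  qed
  have zero: "(\<lambda>_. 0, \<lambda>_. 0) \<in> TF" by (simp add: TF_def test_fun_zero)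
  have Tzero: "T (\<lambda>_. 0, \<lambda>_. 0) = (\<lambda>_. 0)"
    using lin(2)[OF zero zero, of "-1"] by (simp add: lin_def)
  define f where "f x = Complex (f1 x) (f2 x)" for x
  have sf: "sq_int ?M f" using f by (simp add: sq_int_complex_iff f_def)
  have "\<exists>f' F. sq_int ?M f' \<and> (\<forall>k::nat. F k \<in> T ` TF) \<and> l2_conv ?M F f' \<and> (\<forall>v\<in>T ` TF. l2_inner ?M (\<lambda>x. f x - f' x) v = 0)"
  proof (rule l2_projection)
    show "(\<lambda>x. u x + v x) \<in> T ` TF" if "u \<in> T ` TF" "v \<in> T ` TF" for u v
    proof -
      obtain p r where pr: "p \<in> TF" "r \<in> TF" "u = T p" "v = T r" using \<open>u \<in> T ` TF\<close> \<open>v \<in> T ` TF\<close> by blast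
      have "(\<lambda>x. u x + v x) = T (lin 1 p r)" using lin(2)[OF pr(1,2), of 1] pr by simp
      then show ?thesis using lin(1)[OF pr(1,2)] by blast
    qed
    show "(\<lambda>x. c *\<^sub>R v x) \<in> T ` TF" if "v \<in> T ` TF" for c v
    proof -
      obtain p where p: "p \<in> TF" "v = T p" using \<open>v \<in> T ` TF\<close> by blast
      have "(\<lambda>x. c *\<^sub>R v x) = T (lin c (\<lambda>_. 0, \<lambda>_. 0) p)" using lin(2)[OF zero p(1), of c] p Tzero by simp
      then show ?thesis using lin(1)[OF zero p(1)] by blast
    qed
  qed (use sT sf zero in auto)
  then obtain f' F where f': "sq_int ?M f'" "\<And>k::nat. F k \<in> T ` TF" "l2_conv ?M F f'"
    and orth: "\<And>v. v \<in> T ` TF \<Longrightarrow> l2_inner ?M (\<lambda>x. f x - f' x) v = 0" by blast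
  have "\<forall>k. \<exists>p. p \<in> TF \<and> F k = T p" using f'(2) by blast
  then obtain p where p: "\<And>k. p k \<in> TF" "\<And>k. F k = T (p k)" by metis
  have sF: "sq_int ?M (F k)" for k using sT[OF p(1)] p(2) by simp
  define \<eta>1 where "\<eta>1 x = f1 x - Re (f' x)" for x
  define \<eta>2 where "\<eta>2 x = f2 x - Im (f' x)" for x
  have sf': "sq_int ?M (\<lambda>x. Re (f' x))" "sq_int ?M (\<lambda>x. Im (f' x))" using f'(1) by (auto simp: sq_int_complex_iff)
  have s\<eta>: "sq_int ?M \<eta>1" "sq_int ?M \<eta>2" unfolding \<eta>1_def[abs_def] \<eta>2_def[abs_def] by (intro sq_int_diff f sf')+
  have orth': "l2_inner ?M \<eta>1 (T1 r) + l2_inner ?M \<eta>2 (T2 r) = 0" if r: "r \<in> TF" for r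
    using orth[of "T r"] r l2_inner_complex[OF sq_int_diff[OF sf f'(1)] sT[OF r]]
    by (simp add: f_def T_def \<eta>1_def[abs_def] \<eta>2_def[abs_def])
  \<comment> \<open>Orthogonality is tested on \<open>(\<phi>, 0)\<close> here and on
    \<open>(0, \<phi>)\<close> for \<open>w2\<close>. Passing to the adjoint flips the sign of
    \<open>b\<close>, whence the conjugate parameter.\<close>
  have w1: "weak_sol N Z M \<eta>1 (\<lambda>x. a * \<eta>1 x + b * \<eta>2 x)"
    unfolding weak_sol_def
  proof (intro conjI allI impI sq_int_add sq_int_cmult s\<eta>)
    fix \<phi> assume \<phi>: "test_fun N \<phi>"
    have H0: "?H (\<lambda>_. 0) x = 0" for x using hamiltonian_cmult[OF smooth_const[of N 0], of Z M 0 x] by simp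
    have r: "(\<phi>, \<lambda>_. 0) \<in> TF" using \<phi> by (simp add: TF_def test_fun_zero)
    have "T1 (\<phi>, \<lambda>_. 0) = (\<lambda>x. ?H \<phi> x - a *\<^sub>R \<phi> x)" "T2 (\<phi>, \<lambda>_. 0) = (\<lambda>x. (- b) *\<^sub>R \<phi> x)"
      by (simp_all add: T1_def[abs_def] T2_def[abs_def] H0)
    then have "l2_inner ?M \<eta>1 (?H \<phi>) - a * l2_inner ?M \<eta>1 \<phi> - b * l2_inner ?M \<eta>2 \<phi> = 0"
      using orth'[OF r] l2_inner_diff_right[OF sq_int_hamiltonian[OF \<phi>] sq_int_scaleR[OF test_fun_sq_int[OF \<phi>]] s\<eta>(1), of Z M a]
        l2_inner_scale_right[of ?M \<eta>1 a \<phi>] l2_inner_scale_right[of ?M \<eta>2 "- b" \<phi>] by simp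
    moreover have "l2_inner ?M (\<lambda>x. a * \<eta>1 x + b * \<eta>2 x) \<phi> = a * l2_inner ?M \<eta>1 \<phi> + b * l2_inner ?M \<eta>2 \<phi>"
      using l2_inner_add_left[OF sq_int_cmult[OF s\<eta>(1)] sq_int_cmult[OF s\<eta>(2)] test_fun_sq_int[OF \<phi>], of a b]
        l2_inner_scale_left[of ?M a \<eta>1 \<phi>] l2_inner_scale_left[of ?M b \<eta>2 \<phi>] by simp
    ultimately show "l2_inner ?M \<eta>1 (?H \<phi>) = l2_inner ?M (\<lambda>x. a * \<eta>1 x + b * \<eta>2 x) \<phi>" by linarith
  qed
  have w2: "weak_sol N Z M \<eta>2 (\<lambda>x. a * \<eta>2 x - b * \<eta>1 x)"
    unfolding weak_sol_def
  proof (intro conjI allI impI sq_int_diff sq_int_cmult s\<eta>)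
    fix \<phi> assume \<phi>: "test_fun N \<phi>"
    have H0: "?H (\<lambda>_. 0) x = 0" for x using hamiltonian_cmult[OF smooth_const[of N 0], of Z M 0 x] by simp
    have r: "(\<lambda>_. 0, \<phi>) \<in> TF" using \<phi> by (simp add: TF_def test_fun_zero)
    have "T2 (\<lambda>_. 0, \<phi>) = (\<lambda>x. ?H \<phi> x - a *\<^sub>R \<phi> x)" "T1 (\<lambda>_. 0, \<phi>) = (\<lambda>x. b *\<^sub>R \<phi> x)"
      by (simp_all add: T1_def[abs_def] T2_def[abs_def] H0)
    then have "l2_inner ?M \<eta>2 (?H \<phi>) - a * l2_inner ?M \<eta>2 \<phi> + b * l2_inner ?M \<eta>1 \<phi> = 0"
      using orth'[OF r] l2_inner_diff_right[OF sq_int_hamiltonian[OF \<phi>] sq_int_scaleR[OF test_fun_sq_int[OF \<phi>]] s\<eta>(2), of Z M a]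
        l2_inner_scale_right[of ?M \<eta>2 a \<phi>] l2_inner_scale_right[of ?M \<eta>1 b \<phi>] by simp
    moreover have "l2_inner ?M (\<lambda>x. a * \<eta>2 x - b * \<eta>1 x) \<phi> = a * l2_inner ?M \<eta>2 \<phi> - b * l2_inner ?M \<eta>1 \<phi>"
      using l2_inner_diff_left[OF sq_int_cmult[OF s\<eta>(2)] sq_int_cmult[OF s\<eta>(1)] test_fun_sq_int[OF \<phi>], of a b]
        l2_inner_scale_left[of ?M a \<eta>2 \<phi>] l2_inner_scale_left[of ?M b \<eta>1 \<phi>] by simp
    ultimately show "l2_inner ?M \<eta>2 (?H \<phi>) = l2_inner ?M (\<lambda>x. a * \<eta>2 x - b * \<eta>1 x) \<phi>" by linarith
  qed
  have ff': "AE x in ?M. Re (f' x) = f1 x" "AE x in ?M. Im (f' x) = f2 x"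
  proof -
    have "AE x in ?M. \<eta>1 x = 0" "AE x in ?M. \<eta>2 x = 0" using weak_sol_unique[OF w1 w2 q] by auto
    then show "AE x in ?M. Re (f' x) = f1 x" "AE x in ?M. Im (f' x) = f2 x"
      by (auto simp: \<eta>1_def \<eta>2_def elim: eventually_mono)
  qed
  \<comment> \<open>Pairing \<open>T r\<close> with \<open>P r\<close> leaves the two energies minus
    \<open>a\<close> times the squared norms, since the terms in \<open>b\<close> cancel; after
    Cauchy-Schwarz one factor \<open>l2_norm ?M (P r)\<close> is divided out.\<close>
  have coer: "(q - a) * l2_norm ?M (P r) \<le> l2_norm ?M (T r)" if r: "r \<in> TF" for r
  proof -
    obtain u v where uv: "r = (u, v)" "test_fun N u" "test_fun N v" using r by (cases r) (auto simp: TF_def)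
    have s: "sq_int ?M u" "sq_int ?M v" "sq_int ?M (?H u)" "sq_int ?M (?H v)"
      using uv by (auto intro: test_fun_sq_int sq_int_hamiltonian)
    have t1: "T1 r = (\<lambda>x. (?H u x - a *\<^sub>R u x) + b *\<^sub>R v x)" and t2: "T2 r = (\<lambda>x. (?H v x - a *\<^sub>R v x) - b *\<^sub>R u x)"
      by (simp_all add: T1_def[abs_def] T2_def[abs_def] uv(1))
    have e1: "l2_inner ?M (T1 r) u = energy_form N Z M u - a * l2_inner ?M u u + b * l2_inner ?M v u"
      unfolding t1 using s by (simp add: l2_inner_add_left l2_inner_diff_left l2_inner_scale_left sq_int_diff sq_int_scaleR energy_form_l2_inner l2_inner_commute[of ?M u "?H u"] del: real_scaleR_def)
    have e2: "l2_inner ?M (T2 r) v = energy_form N Z M v - a * l2_inner ?M v v - b * l2_inner ?M u v"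
      unfolding t2 using s by (simp add: l2_inner_diff_left l2_inner_scale_left sq_int_diff sq_int_scaleR energy_form_l2_inner l2_inner_commute[of ?M v "?H v"] del: real_scaleR_def)
    have PP: "l2_inner ?M (P r) (P r) = l2_inner ?M u u + l2_inner ?M v v"
      using l2_inner_complex[OF sP[OF r] sP[OF r]] by (simp add: P_def uv(1))
    have "l2_inner ?M (T r) (P r) = l2_inner ?M (T1 r) u + l2_inner ?M (T2 r) v"
      using l2_inner_complex[OF sT[OF r] sP[OF r]] by (simp add: P_def T_def uv(1))
    then have "l2_inner ?M (T r) (P r) = (energy_form N Z M u - a * l2_inner ?M u u) + (energy_form N Z M v - a * l2_inner ?M v v)"
      unfolding e1 e2 by (simp add: l2_inner_commute[of ?M v u])
    moreover have "q * l2_inner ?M u u \<le> energy_form N Z M u" "q * l2_inner ?M v v \<le> energy_form N Z M v"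
      using q(1) uv by (auto simp: form_bound_def)
    ultimately have "(q - a) * l2_inner ?M (P r) (P r) \<le> l2_inner ?M (T r) (P r)"
      unfolding PP by (simp add: algebra_simps)
    also have "\<dots> \<le> l2_norm ?M (T r) * l2_norm ?M (P r)" using l2_inner_CS[OF sT[OF r] sP[OF r]] by simp
    finally have "((q - a) * l2_norm ?M (P r)) * l2_norm ?M (P r) \<le> l2_norm ?M (T r) * l2_norm ?M (P r)"
      by (simp add: l2_norm_sq[symmetric] power2_eq_square mult.assoc)
    then show ?thesis
      using l2_norm_ge0[of ?M "P r"] l2_norm_ge0[of ?M "T r"] by (cases "l2_norm ?M (P r) = 0") auto
  qed
  have "\<exists>\<Psi>. sq_int ?M \<Psi> \<and> l2_conv ?M (\<lambda>k. P (p k)) \<Psi>"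
  proof (rule l2_complete[OF sP[OF p(1)]])
    fix e :: real assume "e > 0"
    then have "(q - a) * e > 0" using q(2) by simp
    from l2_conv_Cauchy[OF f'(3) sF f'(1) this]
    obtain n0 where n0: "\<forall>m\<ge>n0. \<forall>n\<ge>n0. l2_norm ?M (\<lambda>x. F m x - F n x) < (q - a) * e" by blast
    have "l2_norm ?M (\<lambda>x. P (p m) x - P (p n) x) < e" if "m \<ge> n0" "n \<ge> n0" for m n
    proof -
      have "(q - a) * l2_norm ?M (P (lin (-1) (p m) (p n))) \<le> l2_norm ?M (T (lin (-1) (p m) (p n)))"
        by (rule coer[OF lin(1)[OF p(1) p(1)]])
      then have "(q - a) * l2_norm ?M (\<lambda>x. P (p m) x - P (p n) x) \<le> l2_norm ?M (\<lambda>x. F m x - F n x)"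
        by (simp add: lin(2)[OF p(1) p(1)] lin(3)[OF p(1) p(1)] p(2))
      also have "\<dots> < (q - a) * e" using n0 that by blast
      finally show ?thesis using q(2) by simp
    qed
    then show "\<exists>n0. \<forall>m\<ge>n0. \<forall>n\<ge>n0. l2_norm ?M (\<lambda>x. P (p m) x - P (p n) x) < e" by blast
  qed
  then obtain \<Psi> where \<Psi>: "sq_int ?M \<Psi>" "l2_conv ?M (\<lambda>k. P (p k)) \<Psi>" by blast
  define \<psi>1 where "\<psi>1 x = Re (\<Psi> x)" for x
  define \<psi>2 where "\<psi>2 x = Im (\<Psi> x)" for x
  have s\<psi>: "sq_int ?M \<psi>1" "sq_int ?M \<psi>2" using \<Psi>(1) by (auto simp: sq_int_complex_iff \<psi>1_def[abs_def] \<psi>2_def[abs_def])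
  have tp: "test_fun N (fst (p k))" "test_fun N (snd (p k))" for k using p(1)[of k] by (auto simp: TF_def)
  have c: "l2_conv ?M (\<lambda>k. fst (p k)) \<psi>1" "l2_conv ?M (\<lambda>k. snd (p k)) \<psi>2"
    using l2_conv_Re_Im[OF \<Psi>(2) sP[OF p(1)] \<Psi>(1)] by (simp_all add: P_def \<psi>1_def[abs_def] \<psi>2_def[abs_def])
  have cT: "l2_conv ?M (\<lambda>k. T1 (p k)) (\<lambda>x. Re (f' x))" "l2_conv ?M (\<lambda>k. T2 (p k)) (\<lambda>x. Im (f' x))"
    using l2_conv_Re_Im[OF f'(3) sF f'(1)] by (simp_all add: p(2) T_def)
  have sTp: "sq_int ?M (T1 (p k))" "sq_int ?M (T2 (p k))" for k using sT12[OF p(1)] by auto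
  have sp: "sq_int ?M (fst (p k))" "sq_int ?M (snd (p k))" for k using tp by (auto intro: test_fun_sq_int)
  \<comment> \<open>Each approximant satisfies its equation by symmetry of
    \<open>hamiltonian\<close> on test functions, and the equation survives the limit because only
    inner products with fixed functions occur in it.\<close>
  have W1: "weak_sol N Z M \<psi>1 (\<lambda>x. Re (f' x) + (a * \<psi>1 x - b * \<psi>2 x))"
    unfolding weak_sol_def
  proof (intro conjI allI impI sq_int_add sq_int_diff sq_int_cmult s\<psi> sf')
    fix \<phi> assume \<phi>: "test_fun N \<phi>"
    have s\<phi>: "sq_int ?M \<phi>" using \<phi> by (rule test_fun_sq_int)
    have "l2_inner ?M (fst (p k)) (?H \<phi>) = l2_inner ?M (T1 (p k)) \<phi> + (a * l2_inner ?M (fst (p k)) \<phi> - b * l2_inner ?M (snd (p k)) \<phi>)" for k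
    proof -
      have "?H (fst (p k)) = (\<lambda>x. T1 (p k) x + (a *\<^sub>R fst (p k) x - b *\<^sub>R snd (p k) x))"
        by (auto simp: T1_def fun_eq_iff)
      then show ?thesis unfolding hamiltonian_symmetric[OF tp(1) \<phi>, symmetric] using sTp[of k] sp[of k] s\<phi>
        by (simp add: l2_inner_add_left l2_inner_diff_left l2_inner_scale_left sq_int_diff sq_int_scaleR del: real_scaleR_def)
    qed
    then have "(\<lambda>k. l2_inner ?M (fst (p k)) (?H \<phi>)) \<longlonglongrightarrow> l2_inner ?M (\<lambda>x. Re (f' x)) \<phi> + (a * l2_inner ?M \<psi>1 \<phi> - b * l2_inner ?M \<psi>2 \<phi>)"
      by (simp only:) (intro tendsto_intros l2_conv_ip c cT sTp sp s\<phi> s\<psi> sf')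
    moreover have "(\<lambda>k. l2_inner ?M (fst (p k)) (?H \<phi>)) \<longlonglongrightarrow> l2_inner ?M \<psi>1 (?H \<phi>)"
      by (intro l2_conv_ip c sp s\<psi> sq_int_hamiltonian \<phi>)
    ultimately have "l2_inner ?M \<psi>1 (?H \<phi>) = l2_inner ?M (\<lambda>x. Re (f' x)) \<phi> + (a * l2_inner ?M \<psi>1 \<phi> - b * l2_inner ?M \<psi>2 \<phi>)"
      by (rule LIMSEQ_unique[rotated])
    also have "\<dots> = l2_inner ?M (\<lambda>x. Re (f' x) + (a *\<^sub>R \<psi>1 x - b *\<^sub>R \<psi>2 x)) \<phi>"
      using s\<psi> sf' s\<phi> by (simp add: l2_inner_add_left l2_inner_diff_left l2_inner_scale_left sq_int_diff sq_int_scaleR del: real_scaleR_def)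
    finally show "l2_inner ?M \<psi>1 (?H \<phi>) = l2_inner ?M (\<lambda>x. Re (f' x) + (a * \<psi>1 x - b * \<psi>2 x)) \<phi>" by simp
  qed
  have W2: "weak_sol N Z M \<psi>2 (\<lambda>x. Im (f' x) + (a * \<psi>2 x + b * \<psi>1 x))"
    unfolding weak_sol_def
  proof (intro conjI allI impI sq_int_add sq_int_cmult s\<psi> sf')
    fix \<phi> assume \<phi>: "test_fun N \<phi>"
    have s\<phi>: "sq_int ?M \<phi>" using \<phi> by (rule test_fun_sq_int)
    have "l2_inner ?M (snd (p k)) (?H \<phi>) = l2_inner ?M (T2 (p k)) \<phi> + (a * l2_inner ?M (snd (p k)) \<phi> + b * l2_inner ?M (fst (p k)) \<phi>)" for k
    proof -
      have "?H (snd (p k)) = (\<lambda>x. T2 (p k) x + (a *\<^sub>R snd (p k) x + b *\<^sub>R fst (p k) x))"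
        by (auto simp: T2_def fun_eq_iff)
      then show ?thesis unfolding hamiltonian_symmetric[OF tp(2) \<phi>, symmetric] using sTp[of k] sp[of k] s\<phi>
        by (simp add: l2_inner_add_left l2_inner_scale_left sq_int_add sq_int_scaleR del: real_scaleR_def)
    qed
    then have "(\<lambda>k. l2_inner ?M (snd (p k)) (?H \<phi>)) \<longlonglongrightarrow> l2_inner ?M (\<lambda>x. Im (f' x)) \<phi> + (a * l2_inner ?M \<psi>2 \<phi> + b * l2_inner ?M \<psi>1 \<phi>)"
      by (simp only:) (intro tendsto_intros l2_conv_ip c cT sTp sp s\<phi> s\<psi> sf')
    moreover have "(\<lambda>k. l2_inner ?M (snd (p k)) (?H \<phi>)) \<longlonglongrightarrow> l2_inner ?M \<psi>2 (?H \<phi>)"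
      by (intro l2_conv_ip c sp s\<psi> sq_int_hamiltonian \<phi>)
    ultimately have "l2_inner ?M \<psi>2 (?H \<phi>) = l2_inner ?M (\<lambda>x. Im (f' x)) \<phi> + (a * l2_inner ?M \<psi>2 \<phi> + b * l2_inner ?M \<psi>1 \<phi>)"
      by (rule LIMSEQ_unique[rotated])
    also have "\<dots> = l2_inner ?M (\<lambda>x. Im (f' x) + (a *\<^sub>R \<psi>2 x + b *\<^sub>R \<psi>1 x)) \<phi>"
      using s\<psi> sf' s\<phi> by (simp add: l2_inner_add_left l2_inner_scale_left sq_int_add sq_int_scaleR del: real_scaleR_def)
    finally show "l2_inner ?M \<psi>2 (?H \<phi>) = l2_inner ?M (\<lambda>x. Im (f' x) + (a * \<psi>2 x + b * \<psi>1 x)) \<phi>" by simp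
  qed
  have "weak_sol N Z M \<psi>1 (\<lambda>x. f1 x + (a * \<psi>1 x - b * \<psi>2 x))"
    by (rule weak_sol_cong[OF W1]) (use ff' s\<psi> f in \<open>auto intro!: sq_int_add sq_int_diff sq_int_cmult\<close>)
  moreover have "weak_sol N Z M \<psi>2 (\<lambda>x. f2 x + (a * \<psi>2 x + b * \<psi>1 x))"
    by (rule weak_sol_cong[OF W2]) (use ff' s\<psi> f in \<open>auto intro!: sq_int_add sq_int_cmult\<close>)
  ultimately show ?thesis by blast
qed

text \<open>\<open>E0\<close> takes real parts of all spectral points, so a whole complex half-plane
  is excluded and not just a half-line. Surjectivity is solved with \<open>b = Im z\<close>,
  injectivity with \<open>b = - Im z\<close>.\<close>

lemma below_bound_not_in_spectrum:
  assumes q: "form_bound N Z M q" "Re z < q"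
  shows "z \<notin> spectrum_h N Z M"
proof -
  have "\<exists>\<psi>. h_op N Z M \<psi> (\<lambda>x. f x + z * \<psi> x)" if f: "f \<in> L2 N" for f
  proof -
    have "sq_int (configM N) (\<lambda>x. Re (f x))" "sq_int (configM N) (\<lambda>x. Im (f x))"
      using f by (auto simp: L2_iff sq_int_complex_iff)
    from weak_sol_exists[OF this q, of "Im z"] obtain \<psi>1 \<psi>2 where
      "weak_sol N Z M \<psi>1 (\<lambda>x. Re (f x) + (Re z * \<psi>1 x - Im z * \<psi>2 x))"
      "weak_sol N Z M \<psi>2 (\<lambda>x. Im (f x) + (Re z * \<psi>2 x + Im z * \<psi>1 x))" by blast
    then have "h_op N Z M (\<lambda>x. Complex (\<psi>1 x) (\<psi>2 x)) (\<lambda>x. f x + z * Complex (\<psi>1 x) (\<psi>2 x))"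
      by (simp add: h_op_iff)
    then show ?thesis by blast
  qed
  moreover have "ae_zero N \<psi>" if h: "h_op N Z M \<psi> (\<lambda>x. z * \<psi> x)" for \<psi>
  proof -
    have "weak_sol N Z M (\<lambda>x. Re (\<psi> x)) (\<lambda>x. Re z * Re (\<psi> x) + (- Im z) * Im (\<psi> x))"
      "weak_sol N Z M (\<lambda>x. Im (\<psi> x)) (\<lambda>x. Re z * Im (\<psi> x) - (- Im z) * Re (\<psi> x))"
      using h by (simp_all add: h_op_iff algebra_simps)
    from weak_sol_unique[OF this q] have "AE x in configM N. Re (\<psi> x) = 0" "AE x in configM N. Im (\<psi> x) = 0" by auto
    then show ?thesis unfolding ae_zero_def by eventually_elim (simp add: complex_eq_iff)
  qed
  ultimately show ?thesis by (auto simp: spectrum_h_def)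
qed

subsection \<open>The form bound belongs to the spectrum\<close>

text \<open>Discriminant of the nonnegative form \<open>h - q\<close> along the line
  \<open>u + t v\<close>; symmetry of \<open>hamiltonian\<close> merges the two mixed terms.\<close>

lemma form_CS:
  assumes q: "form_bound N Z M q" and uv: "test_fun N u" "test_fun N v"
  shows "(l2_inner (configM N) u (hamiltonian N Z M v) - q * l2_inner (configM N) u v)\<^sup>2
    \<le> (energy_form N Z M u - q * l2_inner (configM N) u u) * (energy_form N Z M v - q * l2_inner (configM N) v v)"
proof (rule quadratic_nonneg_imp_discr)
  fix t
  let ?M = "configM N" and ?H = "hamiltonian N Z M"
  have s: "sq_int ?M u" "sq_int ?M v" "sq_int ?M (?H u)" "sq_int ?M (?H v)" using uv by (auto intro: test_fun_sq_int sq_int_hamiltonian)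
  let ?w = "\<lambda>x. u x + t *\<^sub>R v x"
  have w: "test_fun N ?w" using test_fun_add[OF uv(1) test_fun_cmult[OF uv(2), of t]] by simp
  have H: "?H ?w = (\<lambda>x. ?H u x + t *\<^sub>R ?H v x)"
    using uv by (simp add: hamiltonian_add hamiltonian_cmult smooth_cmult test_fun_smooth fun_eq_iff)
  have "l2_inner ?M v (?H u) = l2_inner ?M u (?H v)"
    using hamiltonian_symmetric[OF uv, of Z M] by (simp add: l2_inner_commute)
  then have "energy_form N Z M ?w = energy_form N Z M u + 2 * l2_inner ?M u (?H v) * t + energy_form N Z M v * t\<^sup>2"
    unfolding energy_form_l2_inner H using s
    by (simp add: l2_inner_simps sq_int_add sq_int_scaleR power2_eq_square del: real_scaleR_def) (simp add: algebra_simps)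
  moreover have "q * l2_inner ?M ?w ?w \<le> energy_form N Z M ?w" using q w by (auto simp: form_bound_def)
  ultimately show "0 \<le> (energy_form N Z M u - q * l2_inner ?M u u) + 2 * (l2_inner ?M u (?H v) - q * l2_inner ?M u v) * t
      + (energy_form N Z M v - q * l2_inner ?M v v) * t\<^sup>2"
    unfolding l2_inner_square_add[OF s(1,2)] by (simp add: algebra_simps)
qed

text \<open>Cauchy--Schwarz for the nonnegative form \<open>h - q\<close>, applied to cut off mollifications of \<open>\<psi>\<close>.\<close>

lemma solvable_imp_form_bounded:
  assumes q: "form_bound N Z M q" and w: "weak_sol N Z M \<psi> (\<lambda>x. f x + q * \<psi> x)" and f: "sq_int (configM N) f" and \<phi>: "test_fun N \<phi>"
  shows "(l2_inner (configM N) f \<phi>)\<^sup>2 \<le> l2_inner (configM N) \<psi> f * (energy_form N Z M \<phi> - q * l2_inner (configM N) \<phi> \<phi>)"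
proof -
  let ?M = "configM N" and ?H = "hamiltonian N Z M"
  let ?g = "\<lambda>x. f x + q * \<psi> x" and ?q\<phi> = "energy_form N Z M \<phi> - q * l2_inner ?M \<phi> \<phi>"
  have s: "sq_int ?M \<psi>" "sq_int ?M ?g" using w by (auto simp: weak_sol_def)
  have s\<phi>: "sq_int ?M \<phi>" "sq_int ?M (?H \<phi>)" using \<phi> by (auto intro: test_fun_sq_int sq_int_hamiltonian)
  have cut: "(l2_inner ?M (\<lambda>x. \<theta> x * \<psi> x) (?H \<phi>) - q * l2_inner ?M (\<lambda>x. \<theta> x * \<psi> x) \<phi>)\<^sup>2 \<le>
     ((l2_inner ?M (\<lambda>x. (\<theta> x)\<^sup>2 * \<psi> x) ?g + (1 / M) * l2_inner ?M (\<lambda>x. grad_sq N \<theta> x * \<psi> x) \<psi>)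
      - q * l2_inner ?M (\<lambda>x. \<theta> x * \<psi> x) (\<lambda>x. \<theta> x * \<psi> x)) * ?q\<phi>"
    if x: "test_fun N \<theta>" for \<theta>
  proof (rule LIMSEQ_le)
    note c = localized_conv[OF s(1) x]
    let ?v = "\<lambda>k x. \<theta> x * mollify N k \<psi> x"
    show "(\<lambda>k. (l2_inner ?M (?v k) (?H \<phi>) - q * l2_inner ?M (?v k) \<phi>)\<^sup>2) \<longlonglongrightarrow>
        (l2_inner ?M (\<lambda>x. \<theta> x * \<psi> x) (?H \<phi>) - q * l2_inner ?M (\<lambda>x. \<theta> x * \<psi> x) \<phi>)\<^sup>2"
      by (intro tendsto_intros l2_conv_ip c test_fun_sq_int s\<phi>)
    show "(\<lambda>k. (energy_form N Z M (?v k) - q * l2_inner ?M (?v k) (?v k)) * ?q\<phi>) \<longlonglongrightarrow>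
       ((l2_inner ?M (\<lambda>x. (\<theta> x)\<^sup>2 * \<psi> x) ?g + (1 / M) * l2_inner ?M (\<lambda>x. grad_sq N \<theta> x * \<psi> x) \<psi>)
      - q * l2_inner ?M (\<lambda>x. \<theta> x * \<psi> x) (\<lambda>x. \<theta> x * \<psi> x)) * ?q\<phi>"
      by (intro tendsto_mult tendsto_diff tendsto_const energy_form_mollified_tendsto[OF w x] l2_conv_ip2 c test_fun_sq_int)
    show "\<exists>N0. \<forall>k\<ge>N0. (l2_inner ?M (?v k) (?H \<phi>) - q * l2_inner ?M (?v k) \<phi>)\<^sup>2 \<le> (energy_form N Z M (?v k) - q * l2_inner ?M (?v k) (?v k)) * ?q\<phi>"
      using form_CS[OF q c(2) \<phi>] by blast
  qed
  have "(l2_inner ?M \<psi> (?H \<phi>) - q * l2_inner ?M \<psi> \<phi>)\<^sup>2 \<le> ((l2_inner ?M \<psi> ?g + (1 / M) * 0) - q * l2_inner ?M \<psi> \<psi>) * ?q\<phi>"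
  proof (rule LIMSEQ_le)
    show "(\<lambda>n. (l2_inner ?M (\<lambda>x. cutoff N n x * \<psi> x) (?H \<phi>) - q * l2_inner ?M (\<lambda>x. cutoff N n x * \<psi> x) \<phi>)\<^sup>2) \<longlonglongrightarrow>
        (l2_inner ?M \<psi> (?H \<phi>) - q * l2_inner ?M \<psi> \<phi>)\<^sup>2"
      by (intro tendsto_intros l2_conv_ip cutoff_conv sq_int_cutoff_mult s s\<phi>)
    show "(\<lambda>n. ((l2_inner ?M (\<lambda>x. (cutoff N n x)\<^sup>2 * \<psi> x) ?g + (1 / M) * l2_inner ?M (\<lambda>x. grad_sq N (cutoff N n) x * \<psi> x) \<psi>)
      - q * l2_inner ?M (\<lambda>x. cutoff N n x * \<psi> x) (\<lambda>x. cutoff N n x * \<psi> x)) * ?q\<phi>) \<longlonglongrightarrow>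
      ((l2_inner ?M \<psi> ?g + (1 / M) * 0) - q * l2_inner ?M \<psi> \<psi>) * ?q\<phi>"
      by (intro tendsto_mult tendsto_diff tendsto_add tendsto_const cutoff_sq_ip_tendsto cutoff_grad_tendsto
          l2_conv_ip2 cutoff_conv sq_int_cutoff_mult s)
  qed (use cut[OF test_fun_cutoff] in blast)
  moreover have "l2_inner ?M \<psi> (?H \<phi>) - q * l2_inner ?M \<psi> \<phi> = l2_inner ?M f \<phi>"
  proof -
    have "l2_inner ?M \<psi> (?H \<phi>) = l2_inner ?M (\<lambda>x. f x + q *\<^sub>R \<psi> x) \<phi>" using w \<phi> by (simp add: weak_sol_def)
    then show ?thesis using f s s\<phi> by (simp add: l2_inner_add_left l2_inner_scale_left sq_int_scaleR del: real_scaleR_def)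
  qed
  moreover have "l2_inner ?M \<psi> ?g - q * l2_inner ?M \<psi> \<psi> = l2_inner ?M \<psi> f"
  proof -
    have "l2_inner ?M \<psi> ?g = l2_inner ?M \<psi> (\<lambda>x. f x + q *\<^sub>R \<psi> x)" by simp
    then show ?thesis using f s by (simp add: l2_inner_add_right l2_inner_scale_right sq_int_scaleR del: real_scaleR_def)
  qed
  ultimately show ?thesis by simp
qed

text \<open>A gliding hump: along unit vectors \<open>v n\<close>, the signs in \<open>f = \<Sum> \<plusminus>3\<^sup>-\<^sup>n v n\<close> are chosen
  so that the partial sums up to \<open>n\<close> never cancel the \<open>n\<close>-th term.\<close>

lemma gliding_hump:
  fixes v :: "nat \<Rightarrow> 'a \<Rightarrow> real"
  assumes v: "\<And>n. sq_int M (v n)" "\<And>n. l2_inner M (v n) (v n) = 1"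
  shows "\<exists>f. sq_int M f \<and> (\<forall>n. (1 / 2) * (1 / 3) ^ n \<le> \<bar>l2_inner M f (v n)\<bar>)"
proof -
  define S where "S = rec_nat (\<lambda>_. 0) (\<lambda>n s x. s x + ((if l2_inner M s (v n) \<ge> 0 then 1 else -1) * (1 / 3) ^ n) *\<^sub>R v n x)"
  have S0: "S 0 = (\<lambda>_. 0)" by (simp add: S_def)
  have SS: "S (Suc n) = (\<lambda>x. S n x + ((if l2_inner M (S n) (v n) \<ge> 0 then 1 else -1) * (1 / 3) ^ n) *\<^sub>R v n x)" for n
    by (simp add: S_def)
  have sS: "sq_int M (S n)" for n
  proof (induction n)
    case (Suc n)
    then show ?case unfolding SS by (intro sq_int_add sq_int_scaleR v)
  qed (simp add: S0 sq_int_zero)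
  have nv: "l2_norm M (v n) = 1" for n using v(2) by (simp add: l2_norm_def)
  have step: "l2_norm M (\<lambda>x. S (Suc n) x - S n x) = (1 / 3) ^ n" for n
  proof -
    have "(\<lambda>x. S (Suc n) x - S n x) = (\<lambda>x. ((if l2_inner M (S n) (v n) \<ge> 0 then 1 else -1) * (1 / 3) ^ n) *\<^sub>R v n x)"
      by (simp add: SS)
    then show ?thesis by (simp only: l2_norm_scale nv) (simp add: abs_mult)
  qed
  have tail: "l2_norm M (\<lambda>x. S (m + d) x - S m x) \<le> (3 / 2) * ((1 / 3) ^ m - (1 / 3) ^ (m + d))" for m d
  proof (induction d)
    case 0
    then show ?case by (simp add: l2_norm_def l2_inner_def)
  next
    case (Suc d)
    have "l2_norm M (\<lambda>x. S (m + Suc d) x - S m x) \<le> l2_norm M (\<lambda>x. S (Suc (m + d)) x - S (m + d) x) + l2_norm M (\<lambda>x. S (m + d) x - S m x)"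
      using l2_norm_triangle_diff[OF sS sS sS] by simp
    also have "\<dots> \<le> (1 / 3) ^ (m + d) + (3 / 2) * ((1 / 3) ^ m - (1 / 3) ^ (m + d))"
      using Suc step by simp
    also have "\<dots> = (3 / 2) * ((1 / 3) ^ m - (1 / 3) ^ (m + Suc d))" by (simp add: field_simps)
    finally show ?case .
  qed
  have tail': "l2_norm M (\<lambda>x. S n x - S m x) \<le> (3 / 2) * (1 / 3) ^ m" if "m \<le> n" for m n
  proof -
    have "l2_norm M (\<lambda>x. S n x - S m x) \<le> (3 / 2) * ((1 / 3) ^ m - (1 / 3) ^ n)" using tail[of m "n - m"] that by simp
    also have "\<dots> \<le> (3 / 2) * (1 / 3) ^ m" by simp
    finally show ?thesis .
  qed
  have "\<exists>f. sq_int M f \<and> l2_conv M S f"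
  proof (rule l2_complete[OF sS])
    fix e :: real assume e: "e > 0"
    have "(\<lambda>n. (3 / 2) * (1 / 3 :: real) ^ n) \<longlonglongrightarrow> (3 / 2) * 0" by (intro tendsto_intros LIMSEQ_power_zero) simp
    then obtain n0 where n0: "\<forall>n\<ge>n0. norm ((3 / 2) * (1 / 3 :: real) ^ n - 0) < e / 2"
      using LIMSEQ_D[of "\<lambda>n. (3 / 2) * (1 / 3 :: real) ^ n" 0 "e / 2"] e by auto
    have "l2_norm M (\<lambda>x. S m x - S n x) < e" if "m \<ge> n0" "n \<ge> n0" for m n
    proof -
      have "l2_norm M (\<lambda>x. S m x - S n x) \<le> l2_norm M (\<lambda>x. S m x - S n0 x) + l2_norm M (\<lambda>x. S n0 x - S n x)"
        by (rule l2_norm_triangle_diff[OF sS sS sS])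
      moreover have "l2_norm M (\<lambda>x. S m x - S n0 x) \<le> (3 / 2) * (1 / 3) ^ n0" "l2_norm M (\<lambda>x. S n0 x - S n x) \<le> (3 / 2) * (1 / 3) ^ n0"
        using tail' that by (auto simp: l2_norm_minus_commute[of M "S n0"])
      moreover have "(3 / 2) * (1 / 3 :: real) ^ n0 < e / 2" using n0 by auto
      ultimately show ?thesis by linarith
    qed
    then show "\<exists>n0. \<forall>m\<ge>n0. \<forall>n\<ge>n0. l2_norm M (\<lambda>x. S m x - S n x) < e" by blast
  qed
  then obtain f where f: "sq_int M f" "l2_conv M S f" by blast
  have fS: "l2_norm M (\<lambda>x. f x - S m x) \<le> (3 / 2) * (1 / 3) ^ m" for m
  proof (rule LIMSEQ_le_const)
    show "(\<lambda>n. l2_norm M (\<lambda>x. S n x - f x) + (3 / 2) * (1 / 3) ^ m) \<longlonglongrightarrow> (3 / 2) * (1 / 3) ^ m"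
      using tendsto_add[OF f(2)[unfolded l2_conv_def] tendsto_const[of "(3 / 2) * (1 / 3) ^ m"]] by simp
    show "\<exists>N0. \<forall>n\<ge>N0. l2_norm M (\<lambda>x. f x - S m x) \<le> l2_norm M (\<lambda>x. S n x - f x) + (3 / 2) * (1 / 3) ^ m"
    proof (intro exI[of _ m] allI impI)
      fix n assume "m \<le> n"
      have "l2_norm M (\<lambda>x. f x - S m x) \<le> l2_norm M (\<lambda>x. f x - S n x) + l2_norm M (\<lambda>x. S n x - S m x)"
        by (rule l2_norm_triangle_diff[OF f(1) sS sS])
      then show "l2_norm M (\<lambda>x. f x - S m x) \<le> l2_norm M (\<lambda>x. S n x - f x) + (3 / 2) * (1 / 3) ^ m"
        using tail'[OF \<open>m \<le> n\<close>] by (simp add: l2_norm_minus_commute[of M f])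
    qed
  qed
  have "(1 / 2) * (1 / 3) ^ n \<le> \<bar>l2_inner M f (v n)\<bar>" for n
  proof -
    have "l2_inner M (S (Suc n)) (v n) = l2_inner M (S n) (v n) + (if l2_inner M (S n) (v n) \<ge> 0 then 1 else -1) * (1 / 3) ^ n"
      unfolding SS by (simp add: l2_inner_add_left l2_inner_scale_left sq_int_scaleR sS v del: real_scaleR_def)
    then have 1: "\<bar>l2_inner M (S (Suc n)) (v n)\<bar> \<ge> (1 / 3) ^ n"
      using zero_le_power[of "1 / 3 :: real" n] by (simp split: if_splits)
    have "\<bar>l2_inner M (\<lambda>x. f x - S (Suc n) x) (v n)\<bar> \<le> l2_norm M (\<lambda>x. f x - S (Suc n) x) * l2_norm M (v n)"
      by (rule l2_inner_CS[OF sq_int_diff[OF f(1) sS] v(1)])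
    \<comment> \<open>The tail after the \<open>n\<close>-th term is at most
      \<open>(3/2) * 3^-(n+1)\<close>, which is half of \<open>3^-n\<close>: with ratio 1/3 the
      later terms can undo at most half of the overlap secured by the sign.\<close>
    then have 2: "\<bar>l2_inner M (\<lambda>x. f x - S (Suc n) x) (v n)\<bar> \<le> (1 / 2) * (1 / 3) ^ n"
      using fS[of "Suc n"] nv[of n] by simp
    have "l2_inner M f (v n) = l2_inner M (S (Suc n)) (v n) + l2_inner M (\<lambda>x. f x - S (Suc n) x) (v n)"
      using l2_inner_diff_left[OF f(1) sS v(1)] by simp
    then show ?thesis using 1 2 by linarith
  qed
  then show ?thesis using f(1) by blast
qed

text \<open>Since no larger form bound exists, there are unit vectors \<open>v n\<close> on which
  \<open>h - q\<close> is as small as desired. A solution with right-hand side \<open>f\<close>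
  would bound the squared overlap of \<open>f\<close> with \<open>v n\<close> by a constant times
  this smallness, whereas a gliding hump has overlaps of order \<open>3^-n\<close>. Exhibiting one
  unsolvable \<open>f\<close> takes the place of a bounded-inverse argument.\<close>

lemma sup_bound_in_spectrum:
  assumes q: "form_bound N Z M q" and max: "\<And>q'. form_bound N Z M q' \<Longrightarrow> q' \<le> q"
  shows "complex_of_real q \<in> spectrum_h N Z M"
proof (rule ccontr)
  let ?M = "configM N"
  assume "complex_of_real q \<notin> spectrum_h N Z M"
  then have surj: "\<And>f. f \<in> L2 N \<Longrightarrow> \<exists>\<psi>. h_op N Z M \<psi> (\<lambda>x. f x + complex_of_real q * \<psi> x)"
    by (simp add: spectrum_h_def)
  define Q where "Q \<phi> = energy_form N Z M \<phi> - q * l2_inner ?M \<phi> \<phi>" for \<phi>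
  have Q0: "0 \<le> Q \<phi>" if "test_fun N \<phi>" for \<phi> using q that by (auto simp: form_bound_def Q_def)
  \<comment> \<open>The rate 1/100 has to lie below \<open>(1/3)^2 = 1/9\<close>, the rate of the
    squared overlaps.\<close>
  have "\<exists>v. test_fun N v \<and> l2_inner ?M v v = 1 \<and> Q v < (1 / 100) ^ n" for n :: nat
  proof -
    have "(1 / 100 :: real) ^ n > 0" by simp
    then have "\<not> form_bound N Z M (q + (1 / 100) ^ n)" using max[of "q + (1 / 100) ^ n"] by linarith
    then obtain u where u: "test_fun N u" "energy_form N Z M u < (q + (1 / 100) ^ n) * l2_inner ?M u u"
      by (auto simp: form_bound_def not_le)
    then have lt: "Q u < (1 / 100) ^ n * l2_inner ?M u u" by (simp add: Q_def algebra_simps)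
    have pos: "l2_inner ?M u u > 0"
      using lt Q0[OF u(1)] l2_inner_ge0[of ?M u] by (cases "l2_inner ?M u u = 0") auto
    define c where "c = 1 / sqrt (l2_inner ?M u u)"
    have c: "c * (c * l2_inner ?M u u) = 1" using pos by (simp add: c_def)
    have H: "hamiltonian N Z M (\<lambda>x. c * u x) = (\<lambda>x. c *\<^sub>R hamiltonian N Z M u x)"
      using u(1) by (simp add: hamiltonian_cmult test_fun_smooth fun_eq_iff)
    have Qc: "energy_form N Z M (\<lambda>x. c * u x) = c * (c * energy_form N Z M u)"
      unfolding energy_form_l2_inner H using l2_inner_scale_left[of ?M c u] l2_inner_scale_right[of ?M u c "hamiltonian N Z M u"]
      by (simp add: l2_inner_scale_right)
    have lc: "l2_inner ?M (\<lambda>x. c * u x) (\<lambda>x. c * u x) = c * (c * l2_inner ?M u u)"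
      using l2_inner_scale_left[of ?M c u "\<lambda>x. c *\<^sub>R u x"] l2_inner_scale_right[of ?M u c u] by simp
    have cc: "c * c > 0" using pos by (simp add: c_def)
    have "Q (\<lambda>x. c * u x) = (c * c) * Q u" unfolding Q_def Qc lc by (simp add: algebra_simps)
    also have "\<dots> < (c * c) * ((1 / 100) ^ n * l2_inner ?M u u)" using lt cc by (rule mult_strict_left_mono)
    also have "\<dots> = (1 / 100) ^ n * (c * (c * l2_inner ?M u u))" by (simp only: mult_ac)
    finally have "Q (\<lambda>x. c * u x) < (1 / 100) ^ n" by (simp only: c mult_1_right)
    then show ?thesis using test_fun_cmult[OF u(1), of c] lc c by auto
  qed
  then obtain v where v: "\<And>n. test_fun N (v n)" "\<And>n. l2_inner ?M (v n) (v n) = 1" "\<And>n. Q (v n) < (1 / 100) ^ n" by metis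
  obtain f where f: "sq_int ?M f" "\<And>n. (1 / 2) * (1 / 3) ^ n \<le> \<bar>l2_inner ?M f (v n)\<bar>"
    using gliding_hump[of ?M v] v test_fun_sq_int by metis
  have "(\<lambda>x. complex_of_real (f x)) \<in> L2 N" using f(1) by (simp add: L2_iff sq_int_complex_iff sq_int_zero)
  from surj[OF this] obtain \<Psi> where "h_op N Z M \<Psi> (\<lambda>x. complex_of_real (f x) + complex_of_real q * \<Psi> x)" by blast
  then have w: "weak_sol N Z M (\<lambda>x. Re (\<Psi> x)) (\<lambda>x. f x + q * Re (\<Psi> x))" by (simp add: h_op_iff)
  define K where "K = l2_inner ?M (\<lambda>x. Re (\<Psi> x)) f"
  have bd: "(l2_inner ?M f (v n))\<^sup>2 \<le> K * Q (v n)" for n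
    using solvable_imp_form_bounded[OF q w f(1) v(1)] by (simp add: K_def Q_def)
  have "(100 / 9) ^ n \<le> 4 * \<bar>K\<bar>" for n :: nat
  proof -
    have "((1 / 2) * (1 / 3) ^ n)\<^sup>2 \<le> (l2_inner ?M f (v n))\<^sup>2"
      using power_mono[OF f(2)[of n], of 2] by simp
    also have "\<dots> \<le> K * Q (v n)" by (rule bd)
    also have "\<dots> \<le> \<bar>K\<bar> * (1 / 100) ^ n"
      using v(3)[of n] Q0[OF v(1)[of n]] by (intro mult_mono) auto
    finally have "(1 / 4) * (1 / 9) ^ n \<le> \<bar>K\<bar> * (1 / 100 :: real) ^ n"
      by (simp add: power_mult_distrib power2_eq_square flip: power_mult_distrib)
    then have "((1 / 4) * (1 / 9) ^ n) * 100 ^ n \<le> (\<bar>K\<bar> * (1 / 100) ^ n) * 100 ^ n"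
      by (rule mult_right_mono) simp
    then show ?thesis by (simp add: power_divide)
  qed
  moreover obtain n :: nat where "4 * \<bar>K\<bar> < (100 / 9) ^ n" using real_arch_pow[of "100 / 9"] by auto
  ultimately show False by (meson not_less)
qed

text \<open>The cutoff does not vanish on an open box of positive measure. Its energy quotient will
  bound the set of form bounds from above.\<close>

lemma exists_nonzero_test_fun: "\<exists>\<phi>. test_fun N \<phi> \<and> 0 < l2_inner (configM N) \<phi> \<phi>"
proof (rule ccontr)
  assume "\<nexists>\<phi>. test_fun N \<phi> \<and> 0 < l2_inner (configM N) \<phi> \<phi>"
  then have "l2_inner (configM N) (cutoff N 0) (cutoff N 0) \<le> 0" using test_fun_cutoff by (meson not_less)
  then have AE: "AE x in configM N. cutoff N 0 x = 0" by (intro l2_inner_zero_AE test_fun_sq_int test_fun_cutoff)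
  have "cutoff N 0 x \<noteq> 0" if "x \<in> open_box N (\<lambda>_. -1) (\<lambda>_. 1)" for x
  proof -
    have "bump (x i / real (Suc 0)) \<noteq> 0" if "i < N" for i
    proof -
      have "x i \<in> {-1<..<1}" using \<open>x \<in> open_box N _ _\<close> that unfolding open_box_def PiE_def Pi_def by blast
      then have "\<bar>x i\<bar> < 1" by (simp add: abs_less_iff)
      then show ?thesis by (simp add: bump_def flat_exp_1 abs_square_less_1)
    qed
    then show ?thesis unfolding cutoff_def tensor_def by simp
  qed
  then have "AE x in configM N. x \<notin> open_box N (\<lambda>_. -1) (\<lambda>_. 1)" using AE by (auto elim: eventually_mono)
  then have "emeasure (configM N) (open_box N (\<lambda>_. -1) (\<lambda>_. 1)) = 0"
    using AE_iff_null_sets[OF open_box_sets] by auto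
  moreover have "emeasure (configM N) (open_box N (\<lambda>_. -1) (\<lambda>_. 1)) = (\<Prod>i<N. emeasure lborel {-1<..<1::real})"
    unfolding open_box_def configM_def by (subst PS.emeasure_PiM) auto
  ultimately show False by simp
qed

text \<open>Only \<open>E0 <= Q0\<close> is required, with \<open>Q0\<close> the largest form bound.
  An \<open>Inf\<close> of reals lies below the members of its set only if the set is bounded below,
  so the excluded half-plane is needed besides membership of \<open>Q0\<close>.\<close>

lemma E0_form_bound:
  assumes "N \<ge> 1" "M > 0"
  shows "form_bound N Z M (E0 N Z M)"
proof -
  let ?M = "configM N"
  define A where "A = {q. form_bound N Z M q}"
  obtain q0 where q0: "q0 \<in> A" using energy_form_lower_bound[OF assms(2), of N Z] by (auto simp: A_def form_bound_def)
  obtain \<phi>0 where \<phi>0: "test_fun N \<phi>0" "0 < l2_inner ?M \<phi>0 \<phi>0" using exists_nonzero_test_fun by blast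
  have bdd: "bdd_above A"
  proof (rule bdd_aboveI)
    fix q assume "q \<in> A"
    then show "q \<le> energy_form N Z M \<phi>0 / l2_inner ?M \<phi>0 \<phi>0" using \<phi>0 by (simp add: A_def form_bound_def pos_le_divide_eq)
  qed
  define Q0 where "Q0 = Sup A"
  have max: "q \<le> Q0" if "form_bound N Z M q" for q
    unfolding Q0_def using that bdd by (intro cSup_upper) (simp add: A_def)
  have lb: "form_bound N Z M Q0"
    unfolding form_bound_def
  proof (intro allI impI)
    fix \<phi> assume \<phi>: "test_fun N \<phi>"
    show "Q0 * l2_inner ?M \<phi> \<phi> \<le> energy_form N Z M \<phi>"
    \<comment> \<open>With vanishing norm there is no energy quotient to compare with, and
      nonnegativity of the energy is read off from some form bound \<open>q0\<close>.\<close>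
    proof (cases "l2_inner ?M \<phi> \<phi> = 0")
      case True
      have "q0 * l2_inner ?M \<phi> \<phi> \<le> energy_form N Z M \<phi>" using q0 \<phi> unfolding A_def form_bound_def by blast
      then show ?thesis using True by simp
    next
      case False
      then have pos: "l2_inner ?M \<phi> \<phi> > 0" using l2_inner_ge0[of ?M \<phi>] by simp
      have "Q0 \<le> energy_form N Z M \<phi> / l2_inner ?M \<phi> \<phi>" unfolding Q0_def
        using q0 pos \<phi> by (intro cSup_least) (auto simp: A_def form_bound_def pos_le_divide_eq)
      then show ?thesis using pos by (simp add: pos_le_divide_eq)
    qed
  qed
  have "E0 N Z M = Inf (Re ` spectrum_h N Z M)" using assms(1) by (simp add: E0_def)
  also have "\<dots> \<le> Q0"
  proof (rule cInf_lower)
    show "Q0 \<in> Re ` spectrum_h N Z M" using sup_bound_in_spectrum[OF lb max] by force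
    show "bdd_below (Re ` spectrum_h N Z M)"
      by (rule bdd_belowI[of _ Q0]) (use below_bound_not_in_spectrum[OF lb] in \<open>force simp: not_less[symmetric]\<close>)
  qed
  finally have le: "E0 N Z M \<le> Q0" .
  show ?thesis unfolding form_bound_def
  proof (intro allI impI)
    fix \<phi> assume \<phi>: "test_fun N \<phi>"
    have "E0 N Z M * l2_inner ?M \<phi> \<phi> \<le> Q0 * l2_inner ?M \<phi> \<phi>" by (rule mult_right_mono[OF le l2_inner_ge0])
    also have "\<dots> \<le> energy_form N Z M \<phi>" using lb \<phi> by (auto simp: form_bound_def)
    finally show "E0 N Z M * l2_inner ?M \<phi> \<phi> \<le> energy_form N Z M \<phi>" .
  qed
qed

subsection \<open>Slicing off one coordinate\<close>

definition slice :: "nat \<Rightarrow> real \<Rightarrow> ((nat \<Rightarrow> real) \<Rightarrow> real) \<Rightarrow> (nat \<Rightarrow> real) \<Rightarrow> real" where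
  "slice n t v y = v (y(n := t))"

text \<open>Fubini with the last coordinate outermost. \<open>merge\<close> and the update at
  \<open>n\<close> agree on the first \<open>Suc n\<close> coordinates, the only ones that
  \<open>F\<close> sees.\<close>

lemma slice_integral:
  assumes i: "integrable (configM (Suc n)) F" and l: "depends_on (Suc n) F"
  shows "(\<integral>x. F x \<partial>configM (Suc n))
    = (\<integral>x. (\<integral>y. slice n (x n) F y \<partial>configM n) \<partial>PiM {n} (\<lambda>_. lborel :: real measure))"
proof -
  have un: "{n} \<union> {..<n} = {..<Suc n}" by auto
  have "(\<integral>x. F x \<partial>PiM ({n} \<union> {..<n}) (\<lambda>_. lborel))
     = (\<integral>x. (\<integral>y. F (merge {n} {..<n} (x, y)) \<partial>PiM {..<n} (\<lambda>_. lborel)) \<partial>PiM {n} (\<lambda>_. lborel))"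
    by (rule PS.product_integral_fold) (use i in \<open>simp_all only: un configM_def, simp_all\<close>)
  moreover have "F (merge {n} {..<n} (x, y)) = slice n (x n) F y" for x y
    unfolding slice_def by (rule depends_on_cong[OF l]) (auto simp: merge_def)
  ultimately show ?thesis by (simp only: un configM_def)
qed

lemma smooth_slice:
  assumes v: "smooth (Suc n) v"
  shows "smooth n (slice n t v)" "\<And>j y. j < n \<Longrightarrow> pd j (slice n t v) y = slice n t (pd j v) y"
proof -
  have D: "((\<lambda>s. slice n t u (y(j := s))) has_real_derivative slice n t (pd j u) y) (at (y j))"
    if u: "smooth (Suc n) u" and j: "j < n" for u j y
    using smooth_DERIV'[OF u, of j "y(n := t)"] j by (simp add: slice_def fun_upd_twist)
  show "pd j (slice n t v) y = slice n t (pd j v) y" if "j < n" for j y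
    by (rule pd_eqI[OF D[OF v that]])
  have c: "continuous_on UNIV (slice n t u)" if "smooth (Suc n) u" for u
    unfolding slice_def by (rule continuous_on_compose2[OF smooth_cont[OF that] continuous_on_upd]) simp
  have "Ck n k (slice n t v)" for k
    using v
  proof (induction k arbitrary: v)
    case 0
    then show ?case using c by simp
  next
    case (Suc k)
    show ?case
    proof (rule Ck_I[where \<phi>' = "\<lambda>j. slice n t (pd j v)"])
      show "Ck n k (slice n t (pd j v))" if "j < n" for j
        using that by (intro Suc.IH smooth_pd[OF Suc.prems]) simp
    qed (rule c[OF Suc.prems], rule D[OF Suc.prems])
  qed
  moreover have "depends_on n (slice n t v)"
    unfolding slice_def by (rule depends_on_I, rule depends_on_cong[OF smooth_depends_on[OF v]]) auto
  ultimately show "smooth n (slice n t v)" by (simp add: smooth_def)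
qed

lemma test_fun_slice:
  assumes v: "test_fun (Suc n) v"
  shows "test_fun n (slice n t v)"
proof -
  obtain R where R: "supp_in (Suc n) R v" using v by (auto simp: test_fun_iff)
  have "supp_in n R (slice n t v)"
    unfolding supp_in_def slice_def
  proof (intro allI impI)
    fix y assume "\<exists>j<n. R < \<bar>y j\<bar>"
    then obtain j where "j < n" "R < \<bar>y j\<bar>" by blast
    then have "j < Suc n" "R < \<bar>(y(n := t)) j\<bar>" by simp_all
    then show "v (y(n := t)) = 0" using R unfolding supp_in_def by blast
  qed
  then show ?thesis using smooth_slice(1)[OF test_fun_smooth[OF v]] by (auto simp: test_fun_iff)
qed

section \<open>The potential felt by a single electron\<close>

definition pair_pot :: "real \<Rightarrow> real \<Rightarrow> real" where
  "pair_pot a b = (1 / sqrt 2) * V0 (\<bar>a - b\<bar> / sqrt 2)"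

text \<open>Potential energy of electron \<open>j\<close> in the field of the nucleus and of all
  other electrons; every pair repulsion enters in full for both of its members.\<close>

definition coord_pot :: "nat \<Rightarrow> real \<Rightarrow> nat \<Rightarrow> (nat \<Rightarrow> real) \<Rightarrow> real" where
  "coord_pot N Z j x = - Z * V0 (x j) + (\<Sum>k\<in>{..<N} - {j}. pair_pot (x k) (x j))"

lemma pair_pot_commute: "pair_pot a b = pair_pot b a"
  by (simp add: pair_pot_def abs_minus_commute)

lemma Wpot_pair_pot: "Wpot N Z x = (\<Sum>j<N. - Z * V0 (x j)) + (\<Sum>j<N. \<Sum>k\<in>{j<..<N}. pair_pot (x j) (x k))"
  by (simp add: Wpot_def pair_pot_def)

lemma Wpot_Suc: "Wpot (Suc n) Z x = Wpot n Z x + coord_pot (Suc n) Z n x"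
proof -
  have "(\<Sum>k\<in>{j<..<Suc n}. pair_pot (x j) (x k)) = (\<Sum>k\<in>{j<..<n}. pair_pot (x j) (x k)) + pair_pot (x j) (x n)" if "j < n" for j
  proof -
    have "{j<..<Suc n} = insert n {j<..<n}" using that by auto
    then show ?thesis by simp
  qed
  then have "(\<Sum>j<n. \<Sum>k\<in>{j<..<Suc n}. pair_pot (x j) (x k)) = (\<Sum>j<n. (\<Sum>k\<in>{j<..<n}. pair_pot (x j) (x k)) + pair_pot (x j) (x n))"
    by (intro sum.cong) auto
  moreover have "{..<Suc n} - {n} = {..<n}" "{n<..<Suc n} = {}" by auto
  ultimately show ?thesis by (simp add: Wpot_pair_pot coord_pot_def sum.distrib)
qed

lemma coord_pot_measurable: "j < N \<Longrightarrow> coord_pot N Z j \<in> borel_measurable (configM N)"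
  unfolding coord_pot_def[abs_def] pair_pot_def
  by (intro cont_measurable_configM continuous_intros continuous_on_compose2[OF V0_cont] cont_comp) auto

lemma coord_pot_bounded: "\<bar>coord_pot N Z j x\<bar> \<le> \<bar>Z\<bar> * 2 + (\<Sum>k\<in>{..<N} - {j}. (1 / sqrt 2) * 2)"
proof -
  have V: "\<bar>V0 y\<bar> \<le> 2" for y using V0_pos[of y] V0_le_2[of y] by simp
  have "\<bar>coord_pot N Z j x\<bar> \<le> \<bar>- Z * V0 (x j)\<bar> + (\<Sum>k\<in>{..<N} - {j}. \<bar>pair_pot (x k) (x j)\<bar>)"
    unfolding coord_pot_def by (intro order_trans[OF abs_triangle_ineq] add_mono sum_abs order_refl)
  also have "\<dots> \<le> \<bar>Z\<bar> * 2 + (\<Sum>k\<in>{..<N} - {j}. (1 / sqrt 2) * 2)"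
    unfolding abs_mult pair_pot_def by (intro add_mono sum_mono mult_mono V) auto
  finally show ?thesis .
qed

lemma sq_int_coord_pot_mult: "j < N \<Longrightarrow> sq_int (configM N) f \<Longrightarrow> sq_int (configM N) (\<lambda>x. coord_pot N Z j x * f x)"
  by (rule sq_int_mult_bounded[OF _ coord_pot_measurable coord_pot_bounded])

text \<open>For each frozen value of the last coordinate the slice is a test function of
  \<open>n\<close> variables, to which the form bound applies; integrating over that value recovers
  the inequality. The kinetic energy of the last coordinate is nonnegative and is dropped.\<close>

lemma slice_form_bound:
  assumes M: "M > 0" and v: "test_fun (Suc n) v" and e: "form_bound n Z M e"
  shows "e * l2_inner (configM (Suc n)) v v + l2_inner (configM (Suc n)) (\<lambda>x. coord_pot (Suc n) Z n x * v x) v \<le> energy_form (Suc n) Z M v"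
proof -
  let ?M = "configM (Suc n)"
  have sv: "smooth (Suc n) v" using v by (rule test_fun_smooth)
  have lv: "depends_on (Suc n) v" using sv by (rule smooth_depends_on)
  have sqv: "sq_int ?M v" using v by (rule test_fun_sq_int)
  define K where "K x = (\<Sum>j<n. pd j (pd j v) x)" for x
  have tK: "test_fun (Suc n) K" unfolding K_def[abs_def] by (intro test_fun_sum test_fun_pd v) auto
  have tn: "test_fun (Suc n) (pd n (pd n v))" by (intro test_fun_pd v) auto
  have Wn: "\<exists>C. \<forall>x. \<bar>Wpot n Z x\<bar> \<le> C" using Wpot_bounded by blast
  have sW: "sq_int ?M (\<lambda>x. Wpot n Z x * v x)" using Wn by (auto intro: sq_int_mult_bounded[OF sqv Wpot_measurable])
  have i: "integrable ?M (\<lambda>x. v x * K x)" "integrable ?M (\<lambda>x. Wpot n Z x * v x * v x)"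
    "integrable ?M (\<lambda>x. v x * v x)" "integrable ?M (\<lambda>x. v x * pd n (pd n v) x)"
    "integrable ?M (\<lambda>x. coord_pot (Suc n) Z n x * v x * v x)"
    by (rule sq_int_real_mult_integrable[OF sqv test_fun_sq_int[OF tK]] sq_int_real_mult_integrable[OF sW sqv]
        sq_int_real_mult_integrable[OF sqv sqv] sq_int_real_mult_integrable[OF sqv test_fun_sq_int[OF tn]]
        sq_int_real_mult_integrable[OF sq_int_coord_pot_mult[OF _ sqv] sqv]; simp)+
  \<comment> \<open>The density of \<open>h(n) - e\<close> acting on the first \<open>n\<close>
    coordinates, with the last coordinate as a parameter.\<close>
  define F where "F x = - (1 / M) * (v x * K x) + Wpot n Z x * v x * v x - e * (v x * v x)" for x
  have iF: "integrable ?M F" unfolding F_def[abs_def]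
    by (intro Bochner_Integration.integrable_diff Bochner_Integration.integrable_add integrable_mult_right i)
  have lF: "depends_on (Suc n) F"
  proof (rule depends_on_I)
    fix x y :: "nat \<Rightarrow> real" assume xy: "\<And>i. i < Suc n \<Longrightarrow> x i = y i"
    have "v x = v y" "K x = K y" "Wpot n Z x = Wpot n Z y"
      using depends_on_cong[OF lv xy] depends_on_cong[OF smooth_depends_on[OF test_fun_smooth[OF tK]] xy] depends_on_cong[OF Wpot_depends_on, of n x y Z] xy
      by auto
    then show "F x = F y" by (simp add: F_def)
  qed
  have "0 \<le> (\<integral>x. F x \<partial>?M)"
    unfolding slice_integral[OF iF lF]
  proof (rule Bochner_Integration.integral_nonneg)
    fix z :: "nat \<Rightarrow> real"
    define t where "t = z n"
    let ?s = "slice n t v"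
    have ts: "test_fun n ?s" using v by (rule test_fun_slice)
    have laplacian: "laplacian n ?s y = slice n t K y" for y
    proof -
      have "pd j (pd j ?s) y = slice n t (pd j (pd j v)) y" if j: "j < n" for j
      proof -
        have "pd j ?s = slice n t (pd j v)" using smooth_slice(2)[OF sv j] by auto
        then show ?thesis using smooth_slice(2)[OF smooth_pd[OF sv] j, of j] j by simp
      qed
      then show ?thesis by (simp add: laplacian_def K_def slice_def)
    qed
    have W: "Wpot n Z (y(n := t)) = Wpot n Z y" for y by (rule depends_on_cong[OF Wpot_depends_on]) auto
    have s: "sq_int (configM n) ?s" "sq_int (configM n) (hamiltonian n Z M ?s)" using ts by (auto intro: test_fun_sq_int sq_int_hamiltonian)
    have "(\<integral>y. slice n t F y \<partial>configM n) = (\<integral>y. ?s y * hamiltonian n Z M ?s y - e * (?s y * ?s y) \<partial>configM n)"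
      by (intro Bochner_Integration.integral_cong refl)
        (simp add: F_def hamiltonian_def laplacian slice_def W algebra_simps)
    also have "\<dots> = energy_form n Z M ?s - e * l2_inner (configM n) ?s ?s"
      using s by (simp add: energy_form_def l2_inner_def sq_int_real_mult_integrable)
    also have "\<dots> \<ge> 0" using e ts by (auto simp: form_bound_def)
    finally show "0 \<le> (\<integral>y. slice n (z n) F y \<partial>configM n)" by (simp add: t_def)
  qed
  also have "(\<integral>x. F x \<partial>?M) = - (1 / M) * (\<integral>x. v x * K x \<partial>?M) + (\<integral>x. Wpot n Z x * v x * v x \<partial>?M) - e * (\<integral>x. v x * v x \<partial>?M)"
    unfolding F_def[abs_def] using i by (simp del: mult_minus_left)
  finally have 1: "0 \<le> - (1 / M) * (\<integral>x. v x * K x \<partial>?M) + (\<integral>x. Wpot n Z x * v x * v x \<partial>?M) - e * (\<integral>x. v x * v x \<partial>?M)" .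
  have 2: "0 \<le> - (1 / M) * (\<integral>x. v x * pd n (pd n v) x \<partial>?M)"
    using integral_second_pd_le[OF v, of n] M by (intro mult_nonpos_nonpos) auto
  have "energy_form (Suc n) Z M v = (\<integral>x. - (1 / M) * (v x * K x) + - (1 / M) * (v x * pd n (pd n v) x)
      + (Wpot n Z x * v x * v x + coord_pot (Suc n) Z n x * v x * v x) \<partial>?M)"
    unfolding energy_form_def hamiltonian_def laplacian_def Wpot_Suc by (simp add: K_def algebra_simps)
  also have "\<dots> = - (1 / M) * (\<integral>x. v x * K x \<partial>?M) + - (1 / M) * (\<integral>x. v x * pd n (pd n v) x \<partial>?M)
     + ((\<integral>x. Wpot n Z x * v x * v x \<partial>?M) + (\<integral>x. coord_pot (Suc n) Z n x * v x * v x \<partial>?M))"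
    using i by (simp del: mult_minus_left)
  finally show ?thesis using 1 2 by (simp add: l2_inner_def)
qed

subsection \<open>Exchanging coordinates\<close>

definition swap_coords :: "nat \<Rightarrow> nat \<Rightarrow> (nat \<Rightarrow> real) \<Rightarrow> nat \<Rightarrow> real" where
  "swap_coords a b x = (\<lambda>i. x (Transposition.transpose a b i))"

lemma transpose_less: "a < N \<Longrightarrow> b < N \<Longrightarrow> Transposition.transpose a b i < N \<longleftrightarrow> i < (N::nat)"
  by (auto simp: Transposition.transpose_def)

lemma swap_coords_upd: "swap_coords a b (x(i := t)) = (swap_coords a b x)(Transposition.transpose a b i := t)"
proof (rule ext)
  fix k
  have "Transposition.transpose a b k = i \<longleftrightarrow> k = Transposition.transpose a b i"
    by (metis transpose_involutory)
  then show "swap_coords a b (x(i := t)) k = ((swap_coords a b x)(Transposition.transpose a b i := t)) k"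
    by (simp add: swap_coords_def)
qed

lemma transpose_bij: "a < N \<Longrightarrow> b < N \<Longrightarrow> bij_betw (Transposition.transpose a b) {..<N} {..<(N::nat)}"
  by (rule bij_betw_byWitness[where f' = "Transposition.transpose a b"]) (auto simp: transpose_less)

lemma swap_coords_cont: "continuous_on S (swap_coords a b)"
  unfolding swap_coords_def
  by (rule continuous_on_coordinatewise_then_product)
    (auto intro: continuous_on_subset[OF continuous_on_product_coordinates])

lemma smooth_swap_coords:
  assumes ab: "a < N" "b < N" and v: "smooth N v"
  shows "smooth N (\<lambda>x. v (swap_coords a b x))"
    "\<And>j x. j < N \<Longrightarrow> pd j (\<lambda>x. v (swap_coords a b x)) x = pd (Transposition.transpose a b j) v (swap_coords a b x)"
proof -
  let ?p = "Transposition.transpose a b"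
  have D: "((\<lambda>s. u (swap_coords a b (x(j := s)))) has_real_derivative pd (?p j) u (swap_coords a b x)) (at (x j))"
    if u: "smooth N u" and j: "j < N" for u j x
    using smooth_DERIV'[OF u, of "?p j" "swap_coords a b x"] j ab by (simp add: swap_coords_upd transpose_less) (simp add: swap_coords_def)
  show "pd j (\<lambda>x. v (swap_coords a b x)) x = pd (?p j) v (swap_coords a b x)" if "j < N" for j x
    by (rule pd_eqI[OF D[OF v that]])
  have c: "continuous_on UNIV (\<lambda>x. u (swap_coords a b x))" if "smooth N u" for u
    by (rule continuous_on_compose2[OF smooth_cont[OF that] swap_coords_cont]) simp
  have "Ck N k (\<lambda>x. v (swap_coords a b x))" for k
    using v
  proof (induction k arbitrary: v)
    case 0
    then show ?case using c by simp
  next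
    case (Suc k)
    show ?case
    proof (rule Ck_I[where \<phi>' = "\<lambda>j x. pd (?p j) v (swap_coords a b x)"])
      show "Ck N k (\<lambda>x. pd (?p j) v (swap_coords a b x))" if "j < N" for j
        using that ab by (intro Suc.IH smooth_pd[OF Suc.prems]) (simp add: transpose_less)
    qed (rule c[OF Suc.prems], rule D[OF Suc.prems])
  qed
  moreover have "depends_on N (\<lambda>x. v (swap_coords a b x))"
    by (rule depends_on_I, rule depends_on_cong[OF smooth_depends_on[OF v]]) (use ab in \<open>auto simp: swap_coords_def transpose_less\<close>)
  ultimately show "smooth N (\<lambda>x. v (swap_coords a b x))" by (simp add: smooth_def)
qed

lemma test_fun_swap_coords:
  assumes ab: "a < N" "b < N" and v: "test_fun N v"
  shows "test_fun N (\<lambda>x. v (swap_coords a b x))"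
proof -
  obtain R where R: "supp_in N R v" using v by (auto simp: test_fun_iff)
  have "supp_in N R (\<lambda>x. v (swap_coords a b x))"
    unfolding supp_in_def
  proof (intro allI impI)
    fix x assume "\<exists>j<N. R < \<bar>x j\<bar>"
    then obtain j where j: "j < N" "R < \<bar>x j\<bar>" by auto
    then have "Transposition.transpose a b j < N" "R < \<bar>swap_coords a b x (Transposition.transpose a b j)\<bar>"
      using ab by (auto simp: swap_coords_def transpose_less)
    then show "v (swap_coords a b x) = 0" using R unfolding supp_in_def by blast
  qed
  then show ?thesis using smooth_swap_coords(1)[OF ab test_fun_smooth[OF v]] by (auto simp: test_fun_iff)
qed

lemma swap_coords_measurable:
  assumes ab: "a < N" "b < N"
  shows "swap_coords a b \<in> measurable (configM N) (configM N)"
  unfolding configM_def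
proof (rule measurable_PiM_single')
  fix i assume "i \<in> {..<N}"
  then show "(\<lambda>x. swap_coords a b x i) \<in> measurable (PiM {..<N} (\<lambda>_. lborel)) lborel"
    unfolding swap_coords_def using ab by (intro measurable_component_singleton) (simp add: transpose_less)
next
  show "swap_coords a b \<in> space (PiM {..<N} (\<lambda>_. lborel)) \<rightarrow> {..<N} \<rightarrow>\<^sub>E space lborel"
    using ab by (auto simp: space_PiM swap_coords_def PiE_def extensional_def transpose_less)
qed

text \<open>It suffices to compare on rectangles, where exchanging coordinates only permutes the
  factors of a product of lengths.\<close>

lemma distr_swap_coords:
  assumes ab: "a < N" "b < N"
  shows "distr (configM N) (configM N) (swap_coords a b) = configM N"
proof -
  let ?p = "Transposition.transpose a b"
  have "distr (configM N) (configM N) (swap_coords a b) = PiM {..<N} (\<lambda>_. lborel)"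
  proof (rule PS.PiM_eqI)
    fix A :: "nat \<Rightarrow> real set" assume A: "\<And>i. i \<in> {..<N} \<Longrightarrow> A i \<in> sets lborel"
    have AP: "PiE {..<N} A \<in> sets (configM N)" unfolding configM_def by (rule sets_PiM_I_finite) (use A in auto)
    have "swap_coords a b -` PiE {..<N} A \<inter> space (configM N) = PiE {..<N} (\<lambda>i. A (?p i))"
    proof (intro equalityI subsetI)
      fix x assume x: "x \<in> swap_coords a b -` PiE {..<N} A \<inter> space (configM N)"
      have "x i \<in> A (?p i)" if "i < N" for i
      proof -
        have "swap_coords a b x (?p i) \<in> A (?p i)" using x that ab transpose_less[OF ab, of i] unfolding PiE_def Pi_def by blast
        then show ?thesis by (simp add: swap_coords_def)
      qed
      then show "x \<in> PiE {..<N} (\<lambda>i. A (?p i))" using x by (simp add: space_configM PiE_def Pi_def)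
    next
      fix x assume x: "x \<in> PiE {..<N} (\<lambda>i. A (?p i))"
      have "swap_coords a b x i \<in> A i" if "i < N" for i
      proof -
        have "x (?p i) \<in> A (?p (?p i))" using x that transpose_less[OF ab, of i] unfolding PiE_def Pi_def by blast
        then show ?thesis by (simp add: swap_coords_def)
      qed
      moreover have "swap_coords a b x i = undefined" if "\<not> i < N" for i
        using x that transpose_less[OF ab, of i] by (simp add: swap_coords_def PiE_def extensional_def)
      ultimately have "swap_coords a b x \<in> PiE {..<N} A" by (simp add: PiE_def Pi_def extensional_def)
      then show "x \<in> swap_coords a b -` PiE {..<N} A \<inter> space (configM N)" using x by (simp add: space_configM PiE_def)
    qed
    then have "emeasure (distr (configM N) (configM N) (swap_coords a b)) (PiE {..<N} A) = emeasure (configM N) (PiE {..<N} (\<lambda>i. A (?p i)))"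
      by (simp add: emeasure_distr[OF swap_coords_measurable[OF ab] AP])
    also have "\<dots> = (\<Prod>i<N. emeasure lborel (A (?p i)))"
      unfolding configM_def by (rule PS.emeasure_PiM) (use A ab in \<open>auto simp: transpose_less\<close>)
    also have "\<dots> = (\<Prod>i<N. emeasure lborel (A i))"
      using prod.reindex_bij_betw[OF transpose_bij[OF ab], of "\<lambda>i. emeasure lborel (A i)"] by simp
    finally show "emeasure (distr (configM N) (configM N) (swap_coords a b)) (PiE {..<N} A) = (\<Prod>i\<in>{..<N}. emeasure lborel (A i))" .
  qed (simp_all add: configM_def)
  then show ?thesis by (simp add: configM_def)
qed

lemma integral_swap_coords:
  assumes ab: "a < N" "b < N" and F: "F \<in> borel_measurable (configM N)"
  shows "(\<integral>x. F (swap_coords a b x) \<partial>configM N) = (\<integral>x. (F x :: real) \<partial>configM N)"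
  using integral_distr[OF swap_coords_measurable[OF ab] F] by (simp add: distr_swap_coords[OF ab])

section \<open>Invariance of the operator under exchange of electrons\<close>

lemma pair_sum_symmetric:
  fixes F :: "nat \<Rightarrow> nat \<Rightarrow> real"
  assumes "\<And>j k. F j k = F k j"
  shows "(\<Sum>j<N. \<Sum>k\<in>{j<..<N}. F j k) = (\<Sum>j<N. \<Sum>k\<in>{..<N} - {j}. F j k) / 2"
proof (induction N)
  case (Suc n)
  have a: "(\<Sum>k\<in>{j<..<Suc n}. F j k) = (\<Sum>k\<in>{j<..<n}. F j k) + F j n" if "j < n" for j
  proof -
    have "{j<..<Suc n} = insert n {j<..<n}" using that by auto
    then show ?thesis by simp
  qed
  have b: "(\<Sum>k\<in>{..<Suc n} - {j}. F j k) = (\<Sum>k\<in>{..<n} - {j}. F j k) + F j n" if "j < n" for j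
  proof -
    have "{..<Suc n} - {j} = insert n ({..<n} - {j})" using that by auto
    then show ?thesis by simp
  qed
  have c: "{..<Suc n} - {n} = {..<n}" "{n<..<Suc n} = {}" by auto
  have "(\<Sum>j<Suc n. \<Sum>k\<in>{j<..<Suc n}. F j k) = (\<Sum>j<n. (\<Sum>k\<in>{j<..<n}. F j k) + F j n)"
    by (simp add: c) (intro sum.cong refl, simp add: a)
  moreover have "(\<Sum>j<Suc n. \<Sum>k\<in>{..<Suc n} - {j}. F j k) = (\<Sum>j<n. (\<Sum>k\<in>{..<n} - {j}. F j k) + F j n) + (\<Sum>k<n. F n k)"
    by (simp add: c) (intro sum.cong refl, simp add: b)
  moreover have "(\<Sum>k<n. F n k) = (\<Sum>j<n. F j n)" by (intro sum.cong refl assms)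
  ultimately show ?case using Suc by (simp add: sum.distrib add_divide_distrib)
qed simp

lemma Wpot_symmetric: "Wpot N Z x = (\<Sum>j<N. - Z * V0 (x j)) + (\<Sum>j<N. \<Sum>k\<in>{..<N} - {j}. pair_pot (x k) (x j)) / 2"
proof -
  have "(\<Sum>j<N. \<Sum>k\<in>{j<..<N}. pair_pot (x j) (x k)) = (\<Sum>j<N. \<Sum>k\<in>{j<..<N}. pair_pot (x k) (x j))"
    by (intro sum.cong refl pair_pot_commute)
  also have "\<dots> = (\<Sum>j<N. \<Sum>k\<in>{..<N} - {j}. pair_pot (x k) (x j)) / 2"
    by (rule pair_sum_symmetric) (rule pair_pot_commute)
  finally show ?thesis unfolding Wpot_pair_pot by (simp only:)
qed

lemma coord_pot_swap_coords:
  assumes ab: "a < N" "b < N" and j: "j < N"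
  shows "coord_pot N Z j (swap_coords a b x) = coord_pot N Z (Transposition.transpose a b j) x"
proof -
  let ?p = "Transposition.transpose a b"
  have "bij_betw ?p ({..<N} - {j}) ({..<N} - {?p j})"
  proof (rule bij_betw_byWitness[where f' = ?p])
    have "?p k = ?p l \<longleftrightarrow> k = l" for k l by (metis transpose_involutory)
    then show "?p ` ({..<N} - {j}) \<subseteq> {..<N} - {?p j}" using ab by (auto simp: transpose_less)
    have "?p k \<noteq> j" if "k \<noteq> ?p j" for k using that by (metis transpose_involutory)
    then show "?p ` ({..<N} - {?p j}) \<subseteq> {..<N} - {j}" using ab
      by (auto simp: transpose_less image_subset_iff)
  qed auto
  from sum.reindex_bij_betw[OF this, of "\<lambda>k. pair_pot (x k) (x (?p j))"] show ?thesis
    by (simp add: coord_pot_def swap_coords_def)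
qed

text \<open>Each repulsion occurs in two of the \<open>coord_pot\<close> and each attraction in one;
  a second copy of the attraction before halving restores the counts. In this form an exchange of
  coordinates is a mere reindexing of the sum.\<close>

lemma Wpot_coord_pot: "Wpot N Z x = (\<Sum>j<N. (coord_pot N Z j x - Z * V0 (x j)) / 2)"
  unfolding Wpot_symmetric coord_pot_def by (simp add: sum.distrib add_divide_distrib diff_divide_distrib sum_divide_distrib sum_subtractf sum_negf)

lemma Wpot_swap_coords:
  assumes ab: "a < N" "b < N"
  shows "Wpot N Z (swap_coords a b x) = Wpot N Z x"
proof -
  let ?p = "Transposition.transpose a b"
  have "Wpot N Z (swap_coords a b x) = (\<Sum>j<N. (coord_pot N Z (?p j) x - Z * V0 (x (?p j))) / 2)"
    unfolding Wpot_coord_pot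
  proof (intro sum.cong refl)
    fix j assume "j \<in> {..<N}"
    then have "coord_pot N Z j (swap_coords a b x) = coord_pot N Z (?p j) x" using ab by (intro coord_pot_swap_coords) auto
    moreover have "swap_coords a b x j = x (?p j)" by (simp add: swap_coords_def)
    ultimately show "(coord_pot N Z j (swap_coords a b x) - Z * V0 (swap_coords a b x j)) / 2 = (coord_pot N Z (?p j) x - Z * V0 (x (?p j))) / 2"
      by (simp only:)
  qed
  also have "\<dots> = Wpot N Z x"
    unfolding Wpot_coord_pot using sum.reindex_bij_betw[OF transpose_bij[OF ab], of "\<lambda>j. (coord_pot N Z j x - Z * V0 (x j)) / 2"] by simp
  finally show ?thesis .
qed

lemma hamiltonian_swap_coords:
  assumes ab: "a < N" "b < N" and v: "smooth N v"
  shows "hamiltonian N Z M (\<lambda>x. v (swap_coords a b x)) x = hamiltonian N Z M v (swap_coords a b x)"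
proof -
  let ?p = "Transposition.transpose a b"
  have "pd j (pd j (\<lambda>x. v (swap_coords a b x))) x = pd (?p j) (pd (?p j) v) (swap_coords a b x)" if j: "j < N" for j
  proof -
    have "pd j (\<lambda>x. v (swap_coords a b x)) = (\<lambda>x. pd (?p j) v (swap_coords a b x))" using smooth_swap_coords(2)[OF ab v j] by auto
    then show ?thesis using smooth_swap_coords(2)[OF ab smooth_pd[OF v] j, of "?p j" x] j ab by (simp add: transpose_less)
  qed
  then have "laplacian N (\<lambda>x. v (swap_coords a b x)) x = (\<Sum>j<N. pd (?p j) (pd (?p j) v) (swap_coords a b x))" by (simp add: laplacian_def)
  also have "\<dots> = laplacian N v (swap_coords a b x)"
    unfolding laplacian_def using sum.reindex_bij_betw[OF transpose_bij[OF ab], of "\<lambda>j. pd j (pd j v) (swap_coords a b x)"] by simp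
  finally show ?thesis by (simp add: hamiltonian_def Wpot_swap_coords[OF ab])
qed

text \<open>Electron \<open>j\<close> is exchanged with the last one, where slicing applies;
  measure, potential and Laplacian are invariant, and \<open>coord_pot\<close> of the last electron
  becomes that of \<open>j\<close>.\<close>

lemma coordinate_form_bound:
  assumes M: "M > 0" and v: "test_fun N v" and e: "form_bound (N - 1) Z M e" and j: "j < N"
  shows "e * l2_inner (configM N) v v + l2_inner (configM N) (\<lambda>x. coord_pot N Z j x * v x) v \<le> energy_form N Z M v"
proof -
  define n where "n = N - 1"
  have N: "N = Suc n" using j by (simp add: n_def)
  have jn: "j < N" "n < N" using j N by auto
  let ?v = "\<lambda>x. v (swap_coords j n x)"
  have tv: "test_fun N ?v" by (rule test_fun_swap_coords[OF jn v])
  have sv: "sq_int (configM N) v" "sq_int (configM N) (hamiltonian N Z M v)" using v by (auto intro: test_fun_sq_int sq_int_hamiltonian)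
  have mP: "coord_pot N Z j \<in> borel_measurable (configM N)" by (rule coord_pot_measurable[OF j])
  have meas: "v \<in> borel_measurable (configM N)" "hamiltonian N Z M v \<in> borel_measurable (configM N)"
    using sv by (auto simp: sq_int_def)
  have "e * l2_inner (configM N) ?v ?v + l2_inner (configM N) (\<lambda>x. coord_pot N Z n x * ?v x) ?v \<le> energy_form N Z M ?v"
    using slice_form_bound[OF M tv[unfolded N] e[folded n_def]] by (simp add: N)
  moreover have "l2_inner (configM N) ?v ?v = l2_inner (configM N) v v"
    unfolding l2_inner_def using integral_swap_coords[OF jn, of "\<lambda>x. v x \<bullet> v x"] meas by simp
  moreover have "l2_inner (configM N) (\<lambda>x. coord_pot N Z n x * ?v x) ?v = l2_inner (configM N) (\<lambda>x. coord_pot N Z j x * v x) v"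
  proof -
    have "coord_pot N Z n x = coord_pot N Z j (swap_coords j n x)" for x using coord_pot_swap_coords[OF jn j, of Z x] by simp
    then show ?thesis
      unfolding l2_inner_def using integral_swap_coords[OF jn, of "\<lambda>x. (coord_pot N Z j x * v x) \<bullet> v x"] meas mP by simp
  qed
  moreover have "energy_form N Z M ?v = energy_form N Z M v"
    unfolding energy_form_def hamiltonian_swap_coords[OF jn test_fun_smooth[OF v]]
    using integral_swap_coords[OF jn, of "\<lambda>x. v x * hamiltonian N Z M v x"] meas by simp
  ultimately show ?thesis by simp
qed

text \<open>This is the eigenvalue equation multiplied by \<open>\<theta>\<^sup>2 \<psi>\<close>:
  the localized energy is \<open>E\<close> times the squared norm of \<open>\<theta> \<psi>\<close>
  plus the gradient term. It is compared with the bound for electron \<open>j\<close> on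
  mollifications, which are test functions, and then in the limit.\<close>

lemma localized_energy_bound:
  assumes M: "M > 0" and w: "weak_sol N Z M \<psi> (\<lambda>x. E * \<psi> x)" and e: "form_bound (N - 1) Z M e" and j: "j < N"
    and x: "test_fun N \<theta>"
  shows "(e - E) * l2_inner (configM N) (\<lambda>x. \<theta> x * \<psi> x) (\<lambda>x. \<theta> x * \<psi> x)
      + l2_inner (configM N) (\<lambda>x. coord_pot N Z j x * (\<theta> x * \<psi> x)) (\<lambda>x. \<theta> x * \<psi> x)
    \<le> (1 / M) * l2_inner (configM N) (\<lambda>x. grad_sq N \<theta> x * \<psi> x) \<psi>"
proof -
  let ?M = "configM N"
  have s: "sq_int ?M \<psi>" using w by (auto simp: weak_sol_def)
  note c = localized_conv[OF s x]
  let ?v = "\<lambda>k x. \<theta> x * mollify N k \<psi> x"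
  have sv: "sq_int ?M (?v k)" for k by (rule test_fun_sq_int[OF c(2)])
  have B: "0 \<le> \<bar>Z\<bar> * 2 + (\<Sum>k\<in>{..<N} - {j}. (1 / sqrt 2) * 2)" by (intro add_nonneg_nonneg sum_nonneg) auto
  have "e * l2_inner ?M (\<lambda>x. \<theta> x * \<psi> x) (\<lambda>x. \<theta> x * \<psi> x) + l2_inner ?M (\<lambda>x. coord_pot N Z j x * (\<theta> x * \<psi> x)) (\<lambda>x. \<theta> x * \<psi> x)
     \<le> l2_inner ?M (\<lambda>x. (\<theta> x)\<^sup>2 * \<psi> x) (\<lambda>x. E * \<psi> x) + (1 / M) * l2_inner ?M (\<lambda>x. grad_sq N \<theta> x * \<psi> x) \<psi>"
  proof (rule LIMSEQ_le)
    show "(\<lambda>k. e * l2_inner ?M (?v k) (?v k) + l2_inner ?M (\<lambda>x. coord_pot N Z j x * ?v k x) (?v k)) \<longlonglongrightarrow>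
       e * l2_inner ?M (\<lambda>x. \<theta> x * \<psi> x) (\<lambda>x. \<theta> x * \<psi> x) + l2_inner ?M (\<lambda>x. coord_pot N Z j x * (\<theta> x * \<psi> x)) (\<lambda>x. \<theta> x * \<psi> x)"
      by (intro tendsto_add tendsto_mult tendsto_const l2_conv_ip2 c(1) c(3) sv sq_int_coord_pot_mult[OF j]
          l2_conv_mult_bounded[OF c(1) sv c(3) coord_pot_measurable[OF j] coord_pot_bounded B])
    show "(\<lambda>k. energy_form N Z M (?v k)) \<longlonglongrightarrow> l2_inner ?M (\<lambda>x. (\<theta> x)\<^sup>2 * \<psi> x) (\<lambda>x. E * \<psi> x) + (1 / M) * l2_inner ?M (\<lambda>x. grad_sq N \<theta> x * \<psi> x) \<psi>"
      by (rule energy_form_mollified_tendsto[OF w x])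
    show "\<exists>N0. \<forall>k\<ge>N0. e * l2_inner ?M (?v k) (?v k) + l2_inner ?M (\<lambda>x. coord_pot N Z j x * ?v k x) (?v k) \<le> energy_form N Z M (?v k)"
      using coordinate_form_bound[OF M c(2) e j] by blast
  qed
  moreover have "l2_inner ?M (\<lambda>x. (\<theta> x)\<^sup>2 * \<psi> x) (\<lambda>x. E * \<psi> x) = E * l2_inner ?M (\<lambda>x. \<theta> x * \<psi> x) (\<lambda>x. \<theta> x * \<psi> x)"
  proof -
    have "l2_inner ?M (\<lambda>x. (\<theta> x)\<^sup>2 * \<psi> x) (\<lambda>x. E * \<psi> x) = (\<integral>x. E * ((\<theta> x * \<psi> x) * (\<theta> x * \<psi> x)) \<partial>?M)"
      by (simp add: l2_inner_def power2_eq_square mult_ac)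
    then show ?thesis by (simp add: l2_inner_def)
  qed
  ultimately show ?thesis by (simp add: algebra_simps)
qed

subsection \<open>The weighted cutoff\<close>

lemma smooth_sqrt_weight_comp:
  assumes j: "j < N"
  shows "smooth N (\<lambda>x. sqrt_weight (x j))" "\<And>i x. pd i (\<lambda>x. sqrt_weight (x j)) x = (if i = j then deriv sqrt_weight (x j) else 0)"
proof -
  have "smooth N (tensor N (\<lambda>i. if i = j then sqrt_weight else (\<lambda>_. 1)))"
    by (rule smooth_tensor) (auto intro: smooth1_sqrt_weight smooth1_const)
  moreover have "tensor N (\<lambda>i. if i = j then sqrt_weight else (\<lambda>_. 1)) = (\<lambda>x. sqrt_weight (x j))"
    using j by (simp add: tensor_split fun_eq_iff)
  ultimately show "smooth N (\<lambda>x. sqrt_weight (x j))" by (simp only:)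
  show "pd i (\<lambda>x. sqrt_weight (x j)) x = (if i = j then deriv sqrt_weight (x j) else 0)" for i x
    by (rule pd_eqI) (use smooth1_deriv(1)[OF smooth1_sqrt_weight] in auto)
qed

text \<open>The weight is unbounded and not compactly supported, so its root becomes a test function
  only after a cutoff, to be removed at the end.\<close>

definition weighted_cutoff :: "nat \<Rightarrow> nat \<Rightarrow> nat \<Rightarrow> (nat \<Rightarrow> real) \<Rightarrow> real" where
  "weighted_cutoff N j n x = cutoff N n x * sqrt_weight (x j)"

lemma test_fun_weighted_cutoff: "j < N \<Longrightarrow> test_fun N (weighted_cutoff N j n)"
  unfolding weighted_cutoff_def[abs_def] by (intro test_fun_mult test_fun_cutoff smooth_sqrt_weight_comp)

lemma weighted_cutoff_sq: "(weighted_cutoff N j n x)\<^sup>2 = weight (x j) * (cutoff N n x)\<^sup>2"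
  by (simp add: weighted_cutoff_def power_mult_distrib sqrt_weight_sq)

text \<open>The cutoff gradient has to beat the linear growth of the weight: on the support
  \<open>weight\<close> is at most \<open>2 (n + 1)\<close>, against a squared gradient of order
  \<open>(n + 1)^-2\<close>. The leading 1 is twice the bound 1/2 on the squared derivative of
  \<open>sqrt_weight\<close>.\<close>

lemma weighted_cutoff_grad: "\<exists>K\<ge>0. \<forall>j<N. \<forall>n x. grad_sq N (weighted_cutoff N j n) x \<le> 1 + K / real (Suc n)"
proof -
  obtain K where K: "K \<ge> 0" "\<And>n x. grad_sq N (cutoff N n) x \<le> K / (real (Suc n))\<^sup>2" using cutoff_grad by blast
  have "grad_sq N (weighted_cutoff N j n) x \<le> 1 + (4 * K) / real (Suc n)" if j: "j < N" for j n x
  proof -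
    have pd: "(pd i (weighted_cutoff N j n) x)\<^sup>2 \<le> 2 * ((pd i (cutoff N n) x)\<^sup>2 * weight (x j)) + (if i = j then 1 else 0)"
      if i: "i < N" for i
    proof -
      have "pd i (weighted_cutoff N j n) x = pd i (cutoff N n) x * sqrt_weight (x j) + cutoff N n x * (if i = j then deriv sqrt_weight (x j) else 0)"
        unfolding weighted_cutoff_def[abs_def] using pd_mult[OF test_fun_smooth[OF test_fun_cutoff] smooth_sqrt_weight_comp(1)[OF j] i]
        by (simp add: smooth_sqrt_weight_comp(2)[OF j])
      \<comment> \<open>Estimating the square of a sum by twice the sum of squares avoids the mixed
        term at the cost of a factor 2, which is felt in the final constant.\<close>
      also have "(\<dots>)\<^sup>2 \<le> 2 * (pd i (cutoff N n) x * sqrt_weight (x j))\<^sup>2 + 2 * (cutoff N n x * (if i = j then deriv sqrt_weight (x j) else 0))\<^sup>2"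
        using sum_squares_bound[of "pd i (cutoff N n) x * sqrt_weight (x j)" "cutoff N n x * (if i = j then deriv sqrt_weight (x j) else 0)"]
        by (simp add: power2_sum)
      also have "2 * (cutoff N n x * (if i = j then deriv sqrt_weight (x j) else 0))\<^sup>2 \<le> (if i = j then 1 else 0)"
      proof (cases "i = j")
        case True
        have "(cutoff N n x)\<^sup>2 * (deriv sqrt_weight (x j))\<^sup>2 \<le> 1 * (1 / 2)"
          using sqrt_weight_deriv_sq cutoff_bounds[of N n x] by (intro mult_mono) (auto simp: abs_square_le_1)
        then show ?thesis using True by (simp add: power_mult_distrib)
      qed simp
      finally show ?thesis by (simp add: power_mult_distrib sqrt_weight_sq)
    qed
    have "grad_sq N (weighted_cutoff N j n) x \<le> (\<Sum>i<N. 2 * ((pd i (cutoff N n) x)\<^sup>2 * weight (x j)) + (if i = j then 1 else 0))"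
      unfolding grad_sq_def by (intro sum_mono pd) auto
    also have "\<dots> = 2 * (grad_sq N (cutoff N n) x * weight (x j)) + 1"
      using j by (simp add: sum.distrib grad_sq_def sum_distrib_left sum_distrib_right)
    also have "grad_sq N (cutoff N n) x * weight (x j) \<le> (2 * K) / real (Suc n)"
    \<comment> \<open>Outside the support of the cutoff the gradient vanishes and the size of the
      weight is irrelevant.\<close>
    proof (cases "\<bar>x j\<bar> > real (Suc n)")
      case True
      have "supp_in N (real (Suc n)) (cutoff N n)" unfolding cutoff_def by (rule supp_in_tensor) (rule bump_scale_supp)
      then have "pd i (cutoff N n) x = 0" for i using supp_in_pd True j unfolding supp_in_def by blast
      then have "grad_sq N (cutoff N n) x = 0" by (simp add: grad_sq_def)
      then show ?thesis using K(1) by simp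
    next
      case False
      have "weight (x j) \<le> 2 * real (Suc n)" using weight_le[of "x j"] False by simp
      then have "grad_sq N (cutoff N n) x * weight (x j) \<le> (K / (real (Suc n))\<^sup>2) * (2 * real (Suc n))"
        using K weight_pos[of "x j"] by (intro mult_mono) auto
      also have "\<dots> = (2 * K) / real (Suc n)" by (simp add: power2_eq_square del: of_nat_Suc)
      finally show ?thesis .
    qed
    finally show ?thesis by simp
  qed
  then show ?thesis using K(1) by (intro exI[of _ "4 * K"]) auto
qed

text \<open>Each attraction contributes at least \<open>- Z\<close>. In the sum over ordered pairs
  the terms of \<open>(j, k)\<close> and \<open>(k, j)\<close> combine to two weights on one pair
  potential, at least 1 in total, and there are \<open>N (N - 1) / 2\<close> unordered
  pairs.\<close>

lemma weighted_potential_ge: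
  assumes "Z > 0"
  shows "real N * (real N - 1) / 2 - Z * real N \<le> (\<Sum>j<N. coord_pot N Z j x * weight (x j))"
proof -
  have 1: "(\<Sum>j<N. - Z * (weight (x j) * V0 (x j))) \<ge> (\<Sum>j<N. - Z)"
    using weight_V0_le assms by (intro sum_mono) auto
  define F where "F j k = weight (x j) * pair_pot (x k) (x j)" for j k
  have swap_coords: "(\<Sum>j<N. \<Sum>k\<in>{..<N} - {j}. F k j) = (\<Sum>j<N. \<Sum>k\<in>{..<N} - {j}. F j k)"
  proof -
    have "(\<Sum>j<N. \<Sum>k\<in>{..<N} - {j}. G j k) = (\<Sum>j<N. \<Sum>k<N. if k = j then 0 else G j k)" for G :: "nat \<Rightarrow> nat \<Rightarrow> real"
      by (intro sum.cong refl sum.mono_neutral_cong_left) auto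
    then have "(\<Sum>j<N. \<Sum>k\<in>{..<N} - {j}. F k j) = (\<Sum>j<N. \<Sum>k<N. if k = j then 0 else F k j)" .
    also have "\<dots> = (\<Sum>k<N. \<Sum>j<N. if k = j then 0 else F k j)" by (rule sum.swap)
    also have "\<dots> = (\<Sum>k<N. \<Sum>j\<in>{..<N} - {k}. F k j)"
      by (intro sum.cong refl sum.mono_neutral_cong_right) auto
    finally show ?thesis .
  qed
  have "1 \<le> F j k + F k j" for j k
  proof -
    have "1 \<le> (weight (x j) + weight (x k)) * pair_pot (x j) (x k)" unfolding pair_pot_def by (rule weight_pair_ge)
    then show ?thesis unfolding F_def pair_pot_commute[of "x k" "x j"] by (simp only: distrib_right)
  qed
  then have "(\<Sum>j<N. \<Sum>k\<in>{..<N} - {j}. 1) \<le> (\<Sum>j<N. \<Sum>k\<in>{..<N} - {j}. F j k + F k j)"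
    by (intro sum_mono) auto
  also have "\<dots> = 2 * (\<Sum>j<N. \<Sum>k\<in>{..<N} - {j}. F j k)" by (simp add: sum.distrib swap_coords)
  finally have 2: "(\<Sum>j<N. \<Sum>k\<in>{..<N} - {j}. 1) / 2 \<le> (\<Sum>j<N. \<Sum>k\<in>{..<N} - {j}. F j k)" by simp
  have card: "(\<Sum>j<N. \<Sum>k\<in>{..<N} - {j}. 1 :: real) = real N * (real N - 1)"
    by (cases N) auto
  have "(\<Sum>j<N. coord_pot N Z j x * weight (x j)) = (\<Sum>j<N. - Z * (weight (x j) * V0 (x j))) + (\<Sum>j<N. \<Sum>k\<in>{..<N} - {j}. F j k)"
    unfolding coord_pot_def F_def by (simp add: sum.distrib[symmetric] algebra_simps sum_distrib_left)
  then show ?thesis using 1 2 card by (simp add: mult.commute)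
qed

text \<open>Without coordinates there is neither kinetic nor potential energy, in accordance with
  the convention for \<open>E0\<close> at \<open>N = 0\<close>.\<close>

lemma form_bound_0: "form_bound 0 Z M 0"
  by (auto simp: form_bound_def energy_form_def hamiltonian_def laplacian_def Wpot_def)

subsection \<open>The ionization bound\<close>

text \<open>Summed over \<open>j\<close>, the localized inequalities bound a constant
  \<open>D\<close> times the squared norm by \<open>N / M\<close> times the squared norm, up to the
  cutoff error. As \<open>D\<close> is \<open>N\<close> times an affine expression in
  \<open>N\<close>, a factor \<open>N\<close> cancels.\<close>

lemma bound_state_inequality:
  assumes Z: "Z > 0" and M: "M > 0" and w: "weak_sol N Z M \<psi> (\<lambda>x. E * \<psi> x)" and e: "form_bound (N - 1) Z M e" "E < e"
    and nz: "0 < l2_inner (configM N) \<psi> \<psi>" and N: "N \<ge> 1"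
  shows "real N < 2 * Z + 1 + 2 * (1 / M)"
proof -
  let ?M = "configM N"
  have s: "sq_int ?M \<psi>" using w by (simp add: weak_sol_def)
  have i\<psi>: "integrable ?M (\<lambda>x. \<psi> x * \<psi> x)" by (rule sq_int_real_mult_integrable[OF s s])
  obtain K where K': "\<forall>j<N. \<forall>n x. grad_sq N (weighted_cutoff N j n) x \<le> 1 + K / real (Suc n)"
    using weighted_cutoff_grad[of N] by blast
  have K: "grad_sq N (weighted_cutoff N j n) x \<le> 1 + K / real (Suc n)" if "j < N" for j n x
    using K'[rule_format, OF that] .
  \<comment> \<open>The first summand uses \<open>weight >= 1/2\<close> for each of the
    \<open>N\<close> electrons and is positive, which makes the final inequality strict; the second
    is the lower bound of the weighted potential.\<close>
  define D where "D = (e - E) * (real N / 2) + (real N * (real N - 1) / 2 - Z * real N)"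
  let ?c = "\<lambda>n x. cutoff N n x * \<psi> x"
  have step: "D * l2_inner ?M (?c n) (?c n) \<le> (1 / M) * (real N * (1 + K / real (Suc n)) * l2_inner ?M \<psi> \<psi>)" for n
  proof -
    let ?w = "\<lambda>j x. weighted_cutoff N j n x * \<psi> x"
    have tw: "test_fun N (weighted_cutoff N j n)" if "j < N" for j by (rule test_fun_weighted_cutoff[OF that])
    have swap_coords: "sq_int ?M (?w j)" if "j < N" for j by (rule localized_conv(3)[OF s tw[OF that]])
    have sc: "sq_int ?M (?c n)" by (rule sq_int_cutoff_mult[OF s])
    have iw: "integrable ?M (\<lambda>x. ?w j x * ?w j x)" "integrable ?M (\<lambda>x. coord_pot N Z j x * ?w j x * ?w j x)" if "j < N" for j
      using sq_int_real_mult_integrable[OF swap_coords swap_coords] sq_int_real_mult_integrable[OF sq_int_coord_pot_mult[OF _ swap_coords] swap_coords] that by auto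
    have depends_on: "(\<integral>x. (e - E) * (?w j x * ?w j x) + coord_pot N Z j x * ?w j x * ?w j x \<partial>?M)
        \<le> (1 / M) * ((1 + K / real (Suc n)) * l2_inner ?M \<psi> \<psi>)" if j: "j < N" for j
    proof -
      have "(\<integral>x. (e - E) * (?w j x * ?w j x) + coord_pot N Z j x * ?w j x * ?w j x \<partial>?M)
         = (e - E) * l2_inner ?M (?w j) (?w j) + l2_inner ?M (\<lambda>x. coord_pot N Z j x * ?w j x) (?w j)"
        using iw[OF j] by (simp add: l2_inner_def)
      also have "\<dots> \<le> (1 / M) * l2_inner ?M (\<lambda>x. grad_sq N (weighted_cutoff N j n) x * \<psi> x) \<psi>"
        by (rule localized_energy_bound[OF M w e(1) j tw[OF j]])
      also have "\<dots> \<le> (1 / M) * ((1 + K / real (Suc n)) * l2_inner ?M \<psi> \<psi>)"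
      proof (rule mult_left_mono)
        obtain C where C: "\<forall>x. \<bar>grad_sq N (weighted_cutoff N j n) x\<bar> \<le> C" using grad_sq_bounded[OF tw[OF j]] by blast
        have "sq_int ?M (\<lambda>x. grad_sq N (weighted_cutoff N j n) x * \<psi> x)"
          using C by (intro sq_int_mult_bounded[OF s grad_sq_measurable[OF tw[OF j]]]) auto
        from sq_int_real_mult_integrable[OF this s]
        have "(\<integral>x. grad_sq N (weighted_cutoff N j n) x * \<psi> x * \<psi> x \<partial>?M) \<le> (\<integral>x. (1 + K / real (Suc n)) * (\<psi> x * \<psi> x) \<partial>?M)"
        proof (rule integral_mono)
          show "grad_sq N (weighted_cutoff N j n) x * \<psi> x * \<psi> x \<le> (1 + K / real (Suc n)) * (\<psi> x * \<psi> x)" for x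
            unfolding mult.assoc by (intro mult_right_mono K j) auto
        qed (use i\<psi> in simp)
        then show "l2_inner ?M (\<lambda>x. grad_sq N (weighted_cutoff N j n) x * \<psi> x) \<psi> \<le> (1 + K / real (Suc n)) * l2_inner ?M \<psi> \<psi>"
          by (simp add: l2_inner_def)
      qed (use M in simp)
      finally show ?thesis .
    qed
    have "D * l2_inner ?M (?c n) (?c n) = (\<integral>x. D * (?c n x * ?c n x) \<partial>?M)" by (simp add: l2_inner_def)
    also have "\<dots> \<le> (\<integral>x. (\<Sum>j<N. (e - E) * (?w j x * ?w j x) + coord_pot N Z j x * ?w j x * ?w j x) \<partial>?M)"
    proof (rule integral_mono)
      show "integrable ?M (\<lambda>x. D * (?c n x * ?c n x))"
        by (intro integrable_mult_right sq_int_real_mult_integrable[OF sc sc])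
      show "integrable ?M (\<lambda>x. \<Sum>j<N. (e - E) * (?w j x * ?w j x) + coord_pot N Z j x * ?w j x * ?w j x)"
        using iw by (intro Bochner_Integration.integrable_sum Bochner_Integration.integrable_add integrable_mult_right) auto
      fix x
      have ww: "?w j x * ?w j x = weight (x j) * (?c n x * ?c n x)" for j
        using weighted_cutoff_sq[of N j n x] by (simp add: power2_eq_square algebra_simps)
      have "(\<Sum>j<N. (e - E) * (?w j x * ?w j x) + coord_pot N Z j x * ?w j x * ?w j x)
         = (\<Sum>j<N. (e - E) * weight (x j) + coord_pot N Z j x * weight (x j)) * (?c n x * ?c n x)"
        unfolding sum_distrib_right
      proof (intro sum.cong refl)
        fix j
        have "coord_pot N Z j x * ?w j x * ?w j x = coord_pot N Z j x * (?w j x * ?w j x)" by (rule mult.assoc)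
        then show "(e - E) * (?w j x * ?w j x) + coord_pot N Z j x * ?w j x * ?w j x
            = ((e - E) * weight (x j) + coord_pot N Z j x * weight (x j)) * (?c n x * ?c n x)"
          unfolding ww by (simp only: distrib_right mult.assoc)
      qed
      moreover have "D \<le> (\<Sum>j<N. (e - E) * weight (x j) + coord_pot N Z j x * weight (x j))"
      proof -
        have "(e - E) * (real N / 2) = (\<Sum>j<N. (e - E) * (1 / 2))" by simp
        also have "\<dots> \<le> (\<Sum>j<N. (e - E) * weight (x j))"
          using e(2) weight_ge_half by (intro sum_mono mult_left_mono) auto
        finally show ?thesis using weighted_potential_ge[OF Z, of N x] by (simp add: D_def sum.distrib)
      qed
      ultimately show "D * (?c n x * ?c n x) \<le> (\<Sum>j<N. (e - E) * (?w j x * ?w j x) + coord_pot N Z j x * ?w j x * ?w j x)"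
        by (simp only:) (intro mult_right_mono, auto)
    qed
    also have "\<dots> = (\<Sum>j<N. \<integral>x. (e - E) * (?w j x * ?w j x) + coord_pot N Z j x * ?w j x * ?w j x \<partial>?M)"
      using iw by (intro Bochner_Integration.integral_sum Bochner_Integration.integrable_add integrable_mult_right) auto
    also have "\<dots> \<le> (\<Sum>j<N. (1 / M) * ((1 + K / real (Suc n)) * l2_inner ?M \<psi> \<psi>))"
      by (intro sum_mono depends_on) auto
    also have "\<dots> = (1 / M) * (real N * (1 + K / real (Suc n)) * l2_inner ?M \<psi> \<psi>)" by simp
    finally show ?thesis .
  qed
  \<comment> \<open>The cutoff is removed: its gradient error \<open>K / Suc n\<close> tends to 0
    and the cut off solution tends to \<psi>.\<close>
  have "D * l2_inner ?M \<psi> \<psi> \<le> (1 / M) * (real N * (1 + K * 0) * l2_inner ?M \<psi> \<psi>)"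
  proof (rule LIMSEQ_le)
    show "(\<lambda>n. D * l2_inner ?M (?c n) (?c n)) \<longlonglongrightarrow> D * l2_inner ?M \<psi> \<psi>"
      by (intro tendsto_mult tendsto_const l2_conv_ip2 cutoff_conv sq_int_cutoff_mult s)
    show "(\<lambda>n. (1 / M) * (real N * (1 + K / real (Suc n)) * l2_inner ?M \<psi> \<psi>)) \<longlonglongrightarrow> (1 / M) * (real N * (1 + K * 0) * l2_inner ?M \<psi> \<psi>)"
      unfolding divide_inverse[of K]
      by (intro tendsto_mult tendsto_add tendsto_const LIMSEQ_inverse_real_of_nat)
  qed (use step in blast)
  then have "D * l2_inner ?M \<psi> \<psi> \<le> ((1 / M) * real N) * l2_inner ?M \<psi> \<psi>" by simp
  then have "D \<le> (1 / M) * real N" using nz by (rule mult_right_le_imp_le)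
  then have "real N * ((e - E) / 2 + ((real N - 1) / 2 - Z)) \<le> real N * (1 / M)"
    by (simp add: D_def algebra_simps diff_divide_distrib)
  then have "(e - E) / 2 + ((real N - 1) / 2 - Z) \<le> 1 / M"
    by (rule mult_left_le_imp_le) (use N in simp)
  then have "(e - E) + (real N - 1) - 2 * Z \<le> 2 * (1 / M)" by (simp add: field_simps)
  then show ?thesis using e(2) by simp
qed

theorem theorem1:
  "\<exists>c>0. \<forall>Z>0. \<forall>B>0. \<forall>N::nat. N \<ge> 1 \<longrightarrow>
     has_bound_state N Z (1 / sqrt B) \<longrightarrow> real N < 2 * Z + 1 + c * sqrt B"
\<comment> \<open>The kinetic prefactor \<open>1 / M\<close> equals \<open>sqrt B\<close> and enters
  \<open>bound_state_inequality\<close> with the factor 2.\<close>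
proof (intro exI[of _ 2] conjI allI impI)
  fix Z B :: real and N :: nat
  assume Z: "Z > 0" and B: "B > 0" and N: "N \<ge> 1" and bs: "has_bound_state N Z (1 / sqrt B)"
  let ?M = "1 / sqrt B"
  have M: "?M > 0" using B by simp
  obtain E where E: "is_eigenvalue N Z ?M E" "E < E0 (N - 1) Z ?M" using bs by (auto simp: has_bound_state_def)
  obtain \<psi> where \<psi>: "\<not> ae_zero N \<psi>" "h_op N Z ?M \<psi> (\<lambda>x. complex_of_real E * \<psi> x)"
    using E(1) by (auto simp: is_eigenvalue_def)
  have w: "weak_sol N Z ?M (\<lambda>x. Re (\<psi> x)) (\<lambda>x. E * Re (\<psi> x))" "weak_sol N Z ?M (\<lambda>x. Im (\<psi> x)) (\<lambda>x. E * Im (\<psi> x))"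
    using \<psi>(2) by (simp_all add: h_op_iff)
  have e: "form_bound (N - 1) Z ?M (E0 (N - 1) Z ?M)"
  \<comment> \<open>For a single electron the comparison value is the convention 0 and not the
    infimum of a spectrum.\<close>
  proof (cases "N - 1 = 0")
    case True
    then show ?thesis using form_bound_0 by (simp add: E0_def)
  next
    case False
    then show ?thesis using M by (intro E0_form_bound) auto
  qed
  \<comment> \<open>The eigenfunction is complex; its real or its imaginary part is nonzero and
    solves the same real equation.\<close>
  have "\<exists>\<phi>. weak_sol N Z ?M \<phi> (\<lambda>x. E * \<phi> x) \<and> 0 < l2_inner (configM N) \<phi> \<phi>"
  proof (rule ccontr)
    assume no: "\<nexists>\<phi>. weak_sol N Z ?M \<phi> (\<lambda>x. E * \<phi> x) \<and> 0 < l2_inner (configM N) \<phi> \<phi>"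
    have z: "AE x in configM N. \<phi> x = 0" if w': "weak_sol N Z ?M \<phi> (\<lambda>x. E * \<phi> x)" for \<phi>
    proof (rule l2_inner_zero_AE)
      show "sq_int (configM N) \<phi>" using w' by (simp add: weak_sol_def)
      show "l2_inner (configM N) \<phi> \<phi> \<le> 0" using no w' by (meson not_less)
    qed
    have "AE x in configM N. \<psi> x = 0"
      using z[OF w(1)] z[OF w(2)] by eventually_elim (simp add: complex_eq_iff)
    then show False using \<psi>(1) by (simp add: ae_zero_def)
  qed
  then obtain \<phi> where "weak_sol N Z ?M \<phi> (\<lambda>x. E * \<phi> x)" "0 < l2_inner (configM N) \<phi> \<phi>" by blast
  from bound_state_inequality[OF Z M this(1) e E(2) this(2) N]
  show "real N < 2 * Z + 1 + 2 * sqrt B" by simp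
qed simp

end
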